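(* Define the Hecke eigenforms \begin{align*} f_{1/8,5/8}&=\mathbb{K}_2(1/8,5/8)-2\sqrt3\,\mathbb{K}_2(3/8,7/8)-4\sqrt{-3}\,\mathbb{K}_2(5/8,9/8)-8i\,\mathbb{K}_2(7/8,11/8),\\ f_{1/8,1}&=\mathbb{K}_2(1/8,1)-2\sqrt{-3}\,\mathbb{K}_2(3/8,1)-4\sqrt3\,\mathbb{K}_2(5/8,1)+8i\,\mathbb{K}_2(7/8,1),\\ f_{1/8,7/8}&=\mathbb{K}_2(1/8,7/8)+2\sqrt2\,\mathbb{K}_2(3/8,5/8)+4i\,\mathbb{K}_2(5/8,11/8)+8\sqrt{-2}\,\mathbb{K}_2(7/8,9/8),\\ f_{1/8,3/4}&=\mathbb{K}_2(1/8,3/4)+2\sqrt{-2}\,\mathbb{K}_2(3/8,5/4)+4\,\mathbb{K}_2(5/8,3/4)-8\sqrt{-2}\,\mathbb{K}_2(7/8,5/4),\\ f_{1/12,11/12}&=\mathbb{K}_2(1/12,11/12)-4\,\mathbb{K}_2(5/12,7/12)-4i\,\mathbb{K}_2(7/12,17/12)+16i\,\mathbb{K}_2(11/12,13/12),\\ f_{1/12,2/3}&=\mathbb{K}_2(1/12,2/3)+4\,\mathbb{K}_2(5/12,4/3)+4i\,\mathbb{K}_2(7/12,2/3)+16i\,\mathbb{K}_2(11/12,4/3). \end{align*} For these choices (embeddings of the Fourier coefficients) we have the relations $$L(f_{1/8,5/8},1)=-\tfrac12\,\zeta_{48}\cdot L(f_{1/8,1},1),$$ $$L(f_{1/12,2/3},1)=\sqrt3\,\zeta_8^7\cdot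 L(f_{1/12,11/12},1),$$ $$L(f_{1/8,3/4},1)=\sqrt{2-\sqrt2-4i\sqrt{3-2\sqrt2}}\;\cdot L(f_{1/8,7/8},1).$$
   Context: Let $\eta$ be the Dedekind eta function and $$\mathbb{K}_2(r,s)(\tau)=\frac{\eta(\tau/2)^{16s-8r-12}\,\eta(2\tau)^{8r+8s-12}}{\eta(\tau)^{24s-30}} .$$ With $r$ of denominator $b$ in lowest terms and $N(r)=48/\gcd(24r,24)=2b$, the notation $\mathbb{K}_2(r,s)$ without a variable means $\mathbb{K}_2(r,s)(N(r)\tau)$, expanded in $q=e^{2\pi i\tau}$. For a cusp form $f=\sum a_nq^n$ of weight 3, $L(f,s)$ is the analytic continuation of $\sum a_nn^{-s}$. Here $\zeta_n=e^{2\pi i/n}$, $\sqrt{-m}=i\sqrt m$ for $m>0$, and the square root of a complex number is the principal one.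
   Formalization: In f_{1/12,2/3} the coefficients of K_2(5/12,4/3) and K_2(11/12,4/3) are taken as -4 and -16i instead of the printed 4 and 16i; with the printed signs the second relation is false. *)

theory Defs
  imports "HOL-Analysis.Analysis"
begin

definition dedekind_eta :: "complex \<Rightarrow> complex" where
  "dedekind_eta \<tau> =
     exp (2 * pi * \<i> * \<tau> / 24) * (\<Prod>n. 1 - exp (2 * pi * \<i> * of_nat (Suc n) * \<tau>))"

text \<open>
  The exponents are integers for every pair \<open>(r, s)\<close> used below and \<open>dedekind_eta\<close> has no zero
  in the upper half-plane, so the principal-branch \<open>powr\<close> is the ordinary integer power there.
\<close>

definition K2_fun :: "rat \<Rightarrow> rat \<Rightarrow> complex \<Rightarrow> complex" where
  "K2_fun r s \<tau> =
     dedekind_eta (\<tau> / 2) powr of_rat (16 * s - 8 * r - 12) *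
     dedekind_eta (2 * \<tau>) powr of_rat (8 * r + 8 * s - 12) /
     dedekind_eta \<tau> powr of_rat (24 * s - 30)"

text \<open>\<open>snd (quotient_of r)\<close> is the positive denominator of \<open>r\<close> in lowest terms.\<close>

definition K2_level :: "rat \<Rightarrow> int" where
  "K2_level r = 2 * snd (quotient_of r)"

text \<open>The form written without a variable, as a function of the variable in \<open>q = exp (2 \<pi> i \<tau>)\<close>.\<close>

definition K2 :: "rat \<Rightarrow> rat \<Rightarrow> complex \<Rightarrow> complex" where
  "K2 r s \<tau> = K2_fun r s (of_int (K2_level r) * \<tau>)"

definition has_q_expansion :: "(complex \<Rightarrow> complex) \<Rightarrow> (nat \<Rightarrow> complex) \<Rightarrow> bool" where
  "has_q_expansion f a \<longleftrightarrow>
     (\<forall>\<tau>. Im \<tau> > 0 \<longrightarrow> (\<lambda>n. a n * exp (2 * pi * \<i> * \<tau>) ^ n) sums f \<tau>)"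

definition q_coeff :: "(complex \<Rightarrow> complex) \<Rightarrow> nat \<Rightarrow> complex" where
  "q_coeff f = (THE a. has_q_expansion f a)"

text \<open>
  The L-function is the (unique, if it exists) entire function that agrees with the Dirichlet
  series on some right half-plane; cusp forms have entire L-functions.
\<close>

definition is_L_function :: "(complex \<Rightarrow> complex) \<Rightarrow> (complex \<Rightarrow> complex) \<Rightarrow> bool" where
  "is_L_function f L \<longleftrightarrow>
     L holomorphic_on UNIV \<and>
     (\<exists>c. \<forall>s. Re s > c \<longrightarrow> (\<lambda>n. q_coeff f (Suc n) * of_nat (Suc n) powr (- s)) sums L s)"

definition L_function :: "(complex \<Rightarrow> complex) \<Rightarrow> complex \<Rightarrow> complex" where
  "L_function f = (THE L. is_L_function f L)"

definition root_unity :: "nat \<Rightarrow> complex" where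
  "root_unity n = exp (2 * pi * \<i> / of_nat n)"

definition f_1_8_5_8 :: "complex \<Rightarrow> complex" where
  "f_1_8_5_8 \<tau> =
     K2 (1/8) (5/8) \<tau> - 2 * sqrt 3 * K2 (3/8) (7/8) \<tau>
     - 4 * (\<i> * sqrt 3) * K2 (5/8) (9/8) \<tau> - 8 * \<i> * K2 (7/8) (11/8) \<tau>"

definition f_1_8_1 :: "complex \<Rightarrow> complex" where
  "f_1_8_1 \<tau> =
     K2 (1/8) 1 \<tau> - 2 * (\<i> * sqrt 3) * K2 (3/8) 1 \<tau>
     - 4 * sqrt 3 * K2 (5/8) 1 \<tau> + 8 * \<i> * K2 (7/8) 1 \<tau>"

definition f_1_8_7_8 :: "complex \<Rightarrow> complex" where
  "f_1_8_7_8 \<tau> =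
     K2 (1/8) (7/8) \<tau> + 2 * sqrt 2 * K2 (3/8) (5/8) \<tau>
     + 4 * \<i> * K2 (5/8) (11/8) \<tau> + 8 * (\<i> * sqrt 2) * K2 (7/8) (9/8) \<tau>"

definition f_1_8_3_4 :: "complex \<Rightarrow> complex" where
  "f_1_8_3_4 \<tau> =
     K2 (1/8) (3/4) \<tau> + 2 * (\<i> * sqrt 2) * K2 (3/8) (5/4) \<tau>
     + 4 * K2 (5/8) (3/4) \<tau> - 8 * (\<i> * sqrt 2) * K2 (7/8) (5/4) \<tau>"

definition f_1_12_11_12 :: "complex \<Rightarrow> complex" where
  "f_1_12_11_12 \<tau> =
     K2 (1/12) (11/12) \<tau> - 4 * K2 (5/12) (7/12) \<tau>
     - 4 * \<i> * K2 (7/12) (17/12) \<tau> + 16 * \<i> * K2 (11/12) (13/12) \<tau>"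

text \<open>
  The source prints the coefficients \<open>1, 4, 4 i, 16 i\<close> here.  With those signs the stated relation
  to \<open>f_1_12_11_12\<close> fails (the quotient of the two L-values has modulus about 2.236, not the
  square root of 3).  The signs below give the Galois conjugate of that eigenform (fifth
  coefficient -4 instead of 4), the only conjugate for which the relation holds.
\<close>

definition f_1_12_2_3 :: "complex \<Rightarrow> complex" where
  "f_1_12_2_3 \<tau> =
     K2 (1/12) (2/3) \<tau> - 4 * K2 (5/12) (4/3) \<tau>
     + 4 * \<i> * K2 (7/12) (2/3) \<tau> - 16 * \<i> * K2 (11/12) (4/3) \<tau>"

end

theory Submission
  imports Defs "HOL-Complex_Analysis.Complex_Analysis" "HOL-Probability.Probability"
begin

text \<open>
  Put \<open>E(a,c)(\<tau>) = \<eta>(\<tau>/2)^a \<eta>(\<tau>)^(6-a-c) \<eta>(2\<tau>)^c\<close>. Every function \<open>K2 r s\<close> in the theorem is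
  \<open>E(a,c)(N \<tau>)\<close> for integers \<open>a\<close>, \<open>c\<close> and \<open>N = 16\<close> or \<open>N = 24\<close>. The Mellin transform identifies the value
  of an L-function at 1 with \<open>2 \<pi>\<close> times an integral over the imaginary axis (lemma \<open>L_function_value\<close>), so each
  of the six L-values is an explicit complex combination of four real periods \<open>\<Lambda>(a,c)\<close>, the integrals of
  \<open>E(a,c)(i t)\<close> over \<open>t > 0\<close>. The theorem thus amounts to linear relations between periods, and these
  have three sources.

  The modular group permutes the functions \<open>E(a,c)\<close> up to constants and automorphy factors. Cauchy's theorem for the
  ideal triangle with the vertices 0, 1 and infinity therefore relates four periods whose exponents lie in one
  orbit (\<open>triangle_relation\<close>). As the periods are real, each such relation counts twice.

  The Landen transformation of the theta constants says that \<open>E(k,-4) \<plusminus> 4 E(k+4,4)\<close> are again eta quotients, in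
  the variable \<open>\<tau>/2\<close> (\<open>eta_quot_landen\<close>). Together with the triangle relations this determines all periods
  in the second and third assertion up to two parameters each.

  For the first assertion one needs to connect two different orbits, that of \<open>(3,-3)\<close> and that of
  \<open>(1,-1)\<close>. The Hecke operator at 3 maps \<open>E(3 \<alpha>, 3 \<gamma>)\<close> to a multiple of \<open>E(\<alpha>, \<gamma>)\<close> for
  \<open>(\<alpha>, \<gamma>) = (1,-1)\<close> and \<open>(-1,1)\<close> (\<open>hecke3_eq\<close>). No dimension formula enters: the quotients for the six members
  of the orbit are holomorphic including the cusp and are permuted by the modular group up to constants,
  so the maximum principle makes them constant, and the first coefficient of the expansion gives the constant.
  Integrating this relation produces integrals over the vertical lines over \<open>2/3\<close> and \<open>-2/3\<close>, which are
  evaluated by a second ideal triangle (\<open>thirds_period_relation\<close>).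

  The transformation law of the eta function under inversion, on which everything rests, is obtained from
  Poisson summation for Gaussians and the Jacobi triple product, by which the product of the three theta
  constants is \<open>2 \<eta>^3\<close>.
\<close>

section \<open>Euler's product\<close>

definition euler_phi :: "complex \<Rightarrow> complex" where
  "euler_phi q = (\<Prod>n. 1 - q ^ Suc n)"

lemma convergent_prod_one_minus:
  fixes f :: "nat \<Rightarrow> complex"
  assumes "summable (\<lambda>n. norm (f n))"
  shows "convergent_prod (\<lambda>n. 1 - f n)"
proof -
  have "abs_convergent_prod (\<lambda>n. 1 + (- f n))"
    using assms by (subst abs_convergent_prod_conv_summable) auto
  then show ?thesis
    using abs_convergent_prod_imp_convergent_prod by fastforce
qed

lemma summable_norm_power_subseq:
  fixes q :: complex
  assumes "norm q < 1" "\<And>n. n \<le> h n"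
  shows "summable (\<lambda>n. norm (q ^ h n))"
proof (rule summable_comparison_test')
  show "summable (\<lambda>n. norm q ^ n)" using assms by simp
  show "norm (norm (q ^ h n)) \<le> norm q ^ n" if "n \<ge> 0" for n
    using assms by (simp add: norm_power power_decreasing)
qed

lemma power_ne_one_in_disc:
  fixes q :: complex
  assumes "norm q < 1"
  shows "q ^ Suc n \<noteq> 1"
proof
  assume "q ^ Suc n = 1"
  then have "norm q ^ Suc n = 1" by (metis norm_one norm_power)
  moreover have "norm q ^ Suc n < 1" using assms by (intro power_less_one_iff[THEN iffD2]) auto
  ultimately show False by simp
qed

lemma euler_phi_convergent:
  fixes q :: complex
  assumes "norm q < 1"
  shows "convergent_prod (\<lambda>n. 1 - q ^ Suc n)"
  by (rule convergent_prod_one_minus[of "\<lambda>n. q ^ Suc n"], rule summable_norm_power_subseq) (use assms in auto)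

lemma euler_phi_nonzero:
  assumes "norm q < 1"
  shows "euler_phi q \<noteq> 0"
  unfolding euler_phi_def
  using prodinf_nonzero[OF euler_phi_convergent[OF assms]] power_ne_one_in_disc[OF assms]
  by (metis eq_iff_diff_eq_0)

lemma euler_phi_zero [simp]: "euler_phi 0 = 1"
  by (simp add: euler_phi_def)

lemma euler_phi_tendsto:
  assumes "norm q < 1"
  shows "(\<lambda>N. \<Prod>n<N. 1 - q ^ Suc n) \<longlonglongrightarrow> euler_phi q"
  using convergent_prod_LIMSEQ[OF euler_phi_convergent[OF assms]]
  by (simp add: euler_phi_def LIMSEQ_lessThan_iff_atMost del: power_Suc)

lemma euler_phi_uniform:
  assumes r: "r < 1"
  shows "uniform_limit (cball 0 r) (\<lambda>N q. \<Prod>n<N. 1 - q ^ Suc n) euler_phi sequentially"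
proof (cases "r < 0")
  case False
  have ul: "uniformly_convergent_on (cball 0 r) (\<lambda>N q. \<Prod>n<N. 1 + (- (q ^ Suc n)) :: complex)"
  proof (rule uniformly_convergent_on_prod)
    show "uniformly_convergent_on (cball 0 r) (\<lambda>N q. \<Sum>n<N. norm (- (q ^ Suc n) :: complex))"
    proof (rule Weierstrass_m_test'_ev)
      show "\<forall>\<^sub>F n in sequentially. \<forall>q\<in>cball 0 r. norm (norm (- (q ^ Suc n) :: complex)) \<le> r ^ Suc n"
        by (auto simp: norm_power intro!: always_eventually power_mono simp del: power_Suc)
      show "summable (\<lambda>n. r ^ Suc n)" using r False by (subst summable_Suc_iff) auto
    qed
  qed (auto intro!: continuous_intros)
  then obtain g where g: "uniform_limit (cball 0 r) (\<lambda>N q. \<Prod>n<N. 1 + (- (q ^ Suc n)) :: complex) g sequentially"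
    by (auto simp: uniformly_convergent_on_def)
  have ge: "g q = euler_phi q" if "q \<in> cball 0 r" for q
  proof -
    have "(\<lambda>N. \<Prod>n<N. 1 + (- (q ^ Suc n))) \<longlonglongrightarrow> g q"
      using tendsto_uniform_limitI[OF g that] .
    moreover have "norm q < 1" using that r by auto
    ultimately show ?thesis
      using LIMSEQ_unique[OF _ euler_phi_tendsto[of q]] by (simp del: power_Suc)
  qed
  show ?thesis
    using g ge by (subst (asm) uniform_limit_cong'[where g = "\<lambda>N q. \<Prod>n<N. 1 - q ^ Suc n" and i = euler_phi]) (auto simp del: power_Suc)
qed (simp add: uniform_limit_iff)

lemma euler_phi_holomorphic: "euler_phi holomorphic_on ball 0 1"
proof (rule holomorphic_uniform_sequence)
  fix x :: complex assume x: "x \<in> ball 0 1"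
  define r where "r = (norm x + 1) / 2"
  have r: "norm x < r" "r < 1" "r > 0" using x by (auto simp: r_def dist_norm) (use norm_ge_zero[of x] in linarith)
  have "cball x (r - norm x) \<subseteq> cball 0 r"
    by (simp add: cball_subset_cball_iff)
  moreover have "cball x (r - norm x) \<subseteq> ball 0 1"
    using r by (auto simp: subset_eq dist_norm) (smt (verit) norm_minus_commute norm_triangle_sub)
  ultimately show "\<exists>d>0. cball x d \<subseteq> ball 0 1 \<and> uniform_limit (cball x d) (\<lambda>N q. \<Prod>n<N. 1 - q ^ Suc n) euler_phi sequentially"
    using r euler_phi_uniform[OF r(2)] by (intro exI[of _ "r - norm x"]) (auto intro: uniform_limit_on_subset)
qed (auto intro!: holomorphic_intros)

text \<open>The linear coefficient is all that is later read off from a product expansion: it fixes the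
  constant in the Hecke relation.\<close>

lemma euler_phi_deriv_0: "(euler_phi has_field_derivative - 1) (at 0)"
proof -
  define f where "f = (\<lambda>N q. \<Prod>n<N. 1 - q ^ Suc n :: complex)"
  have d: "(f N has_field_derivative deriv (f N) w) (at w)" for N w
    by (rule holomorphic_derivI[of _ UNIV]) (auto simp: f_def intro!: holomorphic_intros)
  obtain g' where g': "\<And>w. w \<in> ball 0 (1/2) \<Longrightarrow> (euler_phi has_field_derivative g' w) (at w)"
      "\<And>w. w \<in> ball 0 (1/2) \<Longrightarrow> (\<lambda>N. deriv (f N) w) \<longlonglongrightarrow> g' w"
  proof (rule has_complex_derivative_uniform_limit[of 0 "1/2" f "\<lambda>N. deriv (f N)" sequentially euler_phi])
    show "\<forall>\<^sub>F n in sequentially. continuous_on (cball 0 (1/2)) (f n) \<and> (\<forall>w\<in>ball 0 (1/2). (f n has_field_derivative deriv (f n) w) (at w))"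
      using d by (auto simp: f_def intro!: always_eventually continuous_intros)
    show "uniform_limit (cball 0 (1/2)) f euler_phi sequentially"
      unfolding f_def by (rule euler_phi_uniform) simp
  qed auto
  have f0: "f N 0 = 1" for N by (simp add: f_def)
  have "(f (Suc N) has_field_derivative - 1) (at 0)" for N
  proof (induction N)
    case 0
    show ?case unfolding f_def by (auto intro!: derivative_eq_intros)
  next
    case (Suc N)
    have "((\<lambda>q. f (Suc N) q * (1 - q ^ Suc (Suc N))) has_field_derivative (- 1) * (1 - 0) + (- 0) * f (Suc N) 0) (at 0)"
      by (rule DERIV_mult[OF Suc, THEN DERIV_cong]) (auto intro!: derivative_eq_intros)
    moreover have "f (Suc (Suc N)) = (\<lambda>q. f (Suc N) q * (1 - q ^ Suc (Suc N)))" by (simp add: f_def fun_eq_iff)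
    ultimately show ?case by simp
  qed
  then have "deriv (f (Suc N)) 0 = - 1" for N by (rule DERIV_imp_deriv)
  then have "(\<lambda>N. deriv (f (Suc N)) 0) \<longlonglongrightarrow> - 1" by simp
  moreover have "(\<lambda>N. deriv (f (Suc N)) 0) \<longlonglongrightarrow> g' 0"
    using LIMSEQ_Suc[OF g'(2)[of 0]] by simp
  ultimately have "g' 0 = - 1" by (rule LIMSEQ_unique[symmetric])
  then show ?thesis using g'(1)[of 0] by simp
qed

definition euler_odd :: "complex \<Rightarrow> complex" where
  "euler_odd q = (\<Prod>n. 1 - q ^ (2 * n + 1))"

lemma euler_odd_tendsto:
  assumes "norm q < 1"
  shows "(\<lambda>N. \<Prod>n<N. 1 - q ^ (2 * n + 1)) \<longlonglongrightarrow> euler_odd q"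
proof -
  have "convergent_prod (\<lambda>n. 1 - q ^ (2 * n + 1))"
    by (rule convergent_prod_one_minus[of "\<lambda>n. q ^ (2 * n + 1)"], rule summable_norm_power_subseq) (use assms in auto)
  from convergent_prod_LIMSEQ[OF this] show ?thesis
    by (simp add: euler_odd_def LIMSEQ_lessThan_iff_atMost del: power_Suc)
qed

lemma norm_power2_lt_1: "norm (q::complex) < 1 \<Longrightarrow> norm (q^2) < 1"
  by (simp add: norm_power power_less_one_iff)

lemma euler_phi_odd_even:
  assumes "norm q < 1"
  shows "euler_phi q = euler_odd q * euler_phi (q^2)"
proof (rule LIMSEQ_unique)
  have eq: "(\<Prod>n<2*N. 1 - q ^ Suc n) = (\<Prod>n<N. 1 - q ^ (2*n+1)) * (\<Prod>n<N. 1 - (q^2) ^ Suc n)" for N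
  proof (induction N)
    case (Suc N)
    have "q ^ Suc (2 * N + 1) = (q^2) ^ Suc N" by (simp only: power_mult[symmetric]) simp
    with Suc show ?case by (simp del: power_Suc add: mult.assoc mult.left_commute)
  qed simp
  show "(\<lambda>N. \<Prod>n<2*N. 1 - q ^ Suc n) \<longlonglongrightarrow> euler_phi q"
    using LIMSEQ_subseq_LIMSEQ[OF euler_phi_tendsto[OF assms], of "\<lambda>N. 2*N"]
    by (simp add: o_def strict_mono_def del: power_Suc)
  show "(\<lambda>N. \<Prod>n<2*N. 1 - q ^ Suc n) \<longlonglongrightarrow> euler_odd q * euler_phi (q^2)"
    unfolding eq using assms by (intro tendsto_mult euler_odd_tendsto euler_phi_tendsto norm_power2_lt_1)
qed

lemma euler_odd_minus:
  assumes "norm q < 1"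
  shows "euler_odd q * euler_odd (-q) = euler_odd (q^2)"
proof (rule LIMSEQ_unique)
  have eq: "(\<Prod>n<N. 1 - q ^ (2*n+1)) * (\<Prod>n<N. 1 - (-q) ^ (2*n+1)) = (\<Prod>n<N. 1 - (q^2) ^ (2*n+1))" for N
    unfolding prod.distrib[symmetric]
    by (rule prod.cong) (auto simp: algebra_simps power_mult[symmetric] power_add[symmetric] power2_eq_square)
  show "(\<lambda>N. \<Prod>n<N. 1 - (q^2) ^ (2*n+1)) \<longlonglongrightarrow> euler_odd (q^2)"
    by (intro euler_odd_tendsto norm_power2_lt_1 assms)
  show "(\<lambda>N. \<Prod>n<N. 1 - (q^2) ^ (2*n+1)) \<longlonglongrightarrow> euler_odd q * euler_odd (-q)"
    unfolding eq[symmetric] using assms by (intro tendsto_mult euler_odd_tendsto) auto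
qed

text \<open>Both sides are products over odd and even exponents; the odd ones at \<open>q\<close> and
  \<open>-q\<close> multiply to those at \<open>q^2\<close>. In terms of eta this evaluates
  \<open>dedekind_eta ((\<tau> + 1) / 2)\<close>.\<close>

lemma euler_phi_minus:
  assumes "norm q < 1"
  shows "euler_phi (-q) * euler_phi q * euler_phi (q^4) = euler_phi (q^2) ^ 3"
proof -
  have "euler_phi (q^2) = euler_odd (q^2) * euler_phi (q^4)"
    using euler_phi_odd_even[OF norm_power2_lt_1[OF assms]] by simp
  with euler_phi_odd_even[OF assms] euler_phi_odd_even[of "-q"] euler_odd_minus[OF assms] assms
  show ?thesis by (simp add: power3_eq_cube) (metis (no_types, lifting) mult.assoc mult.commute)
qed

section \<open>The Jacobi triple product\<close>

lemma summable_on_int_iff_nat: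
  fixes f :: "int \<Rightarrow> real"
  assumes "summable (\<lambda>n. f (int n))" "summable (\<lambda>n. f (- int n))" "\<And>n. f n \<ge> 0"
  shows "f summable_on UNIV"
proof -
  have 1: "f summable_on range int"
    using assms by (subst summable_on_reindex) (auto simp: o_def summable_on_UNIV_nonneg_real_iff)
  have 2: "f summable_on range (\<lambda>n. - int n)"
    using assms by (subst summable_on_reindex) (auto simp: o_def summable_on_UNIV_nonneg_real_iff inj_on_def)
  have "UNIV = range int \<union> range (\<lambda>n. - int n)"
  proof -
    have "x \<in> range int \<union> range (\<lambda>n. - int n)" for x :: int
      by (cases x rule: int_cases2) auto
    then show ?thesis by blast
  qed
  with summable_on_union[OF 1 2] show ?thesis by simp
qed

lemma summable_square_power:
  fixes r R :: real
  assumes "0 \<le> r" "r < 1" "R \<ge> 0"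
  shows "summable (\<lambda>n. r ^ (n^2) * R ^ n)"
proof (rule summable_comparison_test_ev)
  have "(\<lambda>n. r ^ n * R) \<longlonglongrightarrow> 0 * R"
    using assms by (intro tendsto_mult tendsto_const LIMSEQ_realpow_zero) auto
  then have "eventually (\<lambda>n. r ^ n * R < 1/2) sequentially"
    by (rule order_tendstoD) auto
  then show "\<forall>\<^sub>F n in sequentially. norm (r ^ (n^2) * R ^ n) \<le> (1/2) ^ n"
  proof eventually_elim
    case (elim n)
    have "r ^ (n^2) * R ^ n = (r ^ n * R) ^ n"
      by (simp add: power_mult_distrib power_mult[symmetric] power2_eq_square)
    also have "\<dots> \<le> (1/2) ^ n" using elim assms by (intro power_mono) auto
    finally show ?case using assms by simp
  qed
qed (simp add: summable_geometric)

lemma summable_on_theta_real: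
  fixes r R :: real
  assumes "0 < r" "r < 1" "R > 0"
  shows "(\<lambda>n::int. r powi (n^2) * R powi n) summable_on UNIV"
proof (rule summable_on_int_iff_nat)
  have e: "r powi ((int n)^2) = r ^ (n^2)" for n
    by (metis of_nat_power power_int_of_nat)
  show "summable (\<lambda>n. r powi (int n)^2 * R powi int n)"
    using summable_square_power[of r R] assms by (simp add: e)
  show "summable (\<lambda>n. r powi (- int n)^2 * R powi (- int n))"
    using summable_square_power[of r "inverse R"] assms by (simp add: e power_int_minus power_inverse)
qed (use assms in \<open>auto intro!: mult_nonneg_nonneg\<close>)

text \<open>Dominated convergence for sums over the integers, in the form that lets the finite triple
  product identity pass to the limit.\<close>

lemma dominated_has_sum_int:
  fixes f :: "nat \<Rightarrow> int \<Rightarrow> complex"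
  assumes lim: "\<And>n. (\<lambda>N. f N n) \<longlonglongrightarrow> g n"
    and bd: "\<And>N n. norm (f N n) \<le> M n"
    and M: "M summable_on UNIV"
    and S: "\<And>N. (f N has_sum S N) UNIV"
    and SL: "S \<longlonglongrightarrow> L"
  shows "(g has_sum L) UNIV"
proof -
  have bij: "bij int_decode" by (rule bij_int_decode)
  have Mn: "M n \<ge> 0" for n using norm_ge_zero[of "f 0 n"] bd[of 0 n] by linarith
  have "(M \<circ> int_decode) summable_on UNIV"
    using M summable_on_reindex_bij_betw[OF bij, of M] by (simp add: o_def)
  then have sM: "summable (\<lambda>k. M (int_decode k))"
    using summable_on_imp_summable by (auto simp: o_def)
  have T: "eventually (\<lambda>N. summable (\<lambda>k. norm (f N (int_decode k)))) sequentially \<and>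
           summable (\<lambda>k. norm (g (int_decode k))) \<and>
           ((\<lambda>N. suminf (\<lambda>k. f N (int_decode k))) \<longlongrightarrow> suminf (\<lambda>k. g (int_decode k))) sequentially"
    by (rule tannerys_theorem[OF lim _ sM])
       (use bd in \<open>auto intro!: always_eventually\<close>)
  have "suminf (\<lambda>k. f N (int_decode k)) = S N" for N
  proof -
    have "((\<lambda>k. f N (int_decode k)) has_sum S N) UNIV"
      using S[of N] has_sum_reindex_bij_betw[OF bij, of "f N"] by (simp add: o_def)
    then show ?thesis using has_sum_imp_sums sums_unique by metis
  qed
  then have "S \<longlonglongrightarrow> suminf (\<lambda>k. g (int_decode k))"
    using T by simp
  then have L: "suminf (\<lambda>k. g (int_decode k)) = L"
    using SL LIMSEQ_unique by blast
  have sg: "summable (\<lambda>k. norm (g (int_decode k)))" using T by blast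
  have "(\<lambda>k. g (int_decode k)) sums L"
    using summable_sums[OF summable_norm_cancel[OF sg]] by (simp only: L)
  with sg have "((\<lambda>k. g (int_decode k)) has_sum L) UNIV"
    by (rule norm_summable_imp_has_sum)
  then show ?thesis using has_sum_reindex_bij_betw[OF bij, of g] by (simp add: o_def)
qed

definition q_factorial :: "complex \<Rightarrow> nat \<Rightarrow> complex" where
  "q_factorial w n = (\<Prod>k<n. 1 - w ^ Suc k)"

lemma q_factorial_0 [simp]: "q_factorial w 0 = 1" by (simp add: q_factorial_def)

lemma q_factorial_Suc: "q_factorial w (Suc n) = q_factorial w n * (1 - w * w ^ n)" by (simp add: q_factorial_def)

lemma q_factorial_nonzero: "norm w < 1 \<Longrightarrow> q_factorial w n \<noteq> 0"
  using power_ne_one_in_disc[of w] by (auto simp: q_factorial_def simp del: power_Suc)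

text \<open>The terms of the finite form of the triple product: a Gaussian binomial coefficient in
  \<open>q^2\<close>, centred at 0 and extended by zero, times the term of the theta series.\<close>

definition triple_term :: "complex \<Rightarrow> complex \<Rightarrow> nat \<Rightarrow> int \<Rightarrow> complex" where
  "triple_term q z N n = (if \<bar>n\<bar> \<le> int N then
      q_factorial (q^2) (2*N) / (q_factorial (q^2) (nat (int N - n)) * q_factorial (q^2) (nat (int N + n))) *
      (q powi (n^2) * z powi n) else 0)"

lemma triple_term_shift_down:
  assumes q: "q \<noteq> 0" "norm q < 1" and z: "z \<noteq> 0" and ab: "int N - n = int a" "int N + n = int b"
  shows "q ^ (2*N+1) * z * triple_term q z N (n - 1) * (1 - q^2 * (q^2)^a) =
         triple_term q z N n * (q^2 * (q^2)^a) * (1 - (q^2)^b)"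
proof (cases b)
  case 0
  then show ?thesis using ab by (auto simp: triple_term_def)
next
  case (Suc b')
  have nz: "q_factorial (q^2) m \<noteq> 0" for m using q_factorial_nonzero norm_power2_lt_1 q by blast
  have "q ^ (2*N+1) * z * (q powi ((n-1)^2) * z powi (n-1)) = q powi (n^2) * z powi n * q powi (2 * int a + 2)"
  proof -
    have "q powi (2 * int N + 1) * q powi ((n-1)^2) = q powi (n^2) * q powi (2 * int a + 2)"
      using q ab(1) by (simp add: power_int_add[symmetric] power2_eq_square algebra_simps)
    moreover have "q powi (2 * int N + 1) = q ^ (2 * N + 1)"
    proof -
      have "2 * int N + 1 = int (2 * N + 1)" by simp
      then show ?thesis by (metis power_int_of_nat)
    qed
    moreover have "z * z powi (n - 1) = z powi n"
      using z by (simp add: power_int_diff)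
    ultimately have "(q ^ (2*N+1) * q powi ((n-1)^2)) * (z * z powi (n-1)) = (q powi (n^2) * q powi (2 * int a + 2)) * z powi n"
      by simp
    then show ?thesis by (simp only: mult_ac)
  qed
  also have "q powi (2 * int a + 2) = q^2 * (q^2)^a"
  proof -
    have "2 * int a + 2 = int (2 * Suc a)" by simp
    then have "q powi (2 * int a + 2) = q ^ (2 * Suc a)" by (metis power_int_of_nat)
    then show ?thesis by (simp add: power_mult power2_eq_square)
  qed
  finally have pw: "q ^ (2*N+1) * z * (q powi ((n-1)^2) * z powi (n-1)) = q powi (n^2) * z powi n * (q^2 * (q^2)^a)" .
  have i1: "\<bar>n\<bar> \<le> int N" "\<bar>n - 1\<bar> \<le> int N" using ab Suc by linarith+
  have n1: "nat (int N - n) = a" "nat (int N + n) = Suc b'" "nat (int N - (n - 1)) = Suc a" "nat (int N + (n - 1)) = b'"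
    using ab Suc by linarith+
  have f1: "1 - q^2 * (q^2)^a \<noteq> 0" "1 - q^2 * (q^2)^b' \<noteq> 0"
    using nz[of "Suc a"] nz[of "Suc b'"] by (auto simp: q_factorial_Suc)
  have "q ^ (2*N+1) * z * triple_term q z N (n - 1) =
        q_factorial (q^2) (2*N) / (q_factorial (q^2) (Suc a) * q_factorial (q^2) b') * (q powi (n^2) * z powi n * (q^2 * (q^2)^a))"
    unfolding pw[symmetric] using i1 by (simp add: triple_term_def n1)
  then show ?thesis
    using i1 nz[of a] nz[of b'] f1 unfolding Suc
    by (simp add: triple_term_def n1 q_factorial_Suc divide_simps)
qed

lemma triple_term_reflect: "triple_term q z N (- n) = triple_term q (inverse z) N n"
  by (auto simp: triple_term_def power_int_minus power_int_inverse mult_ac)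

text \<open>The Pascal rule for the Gaussian binomials, applied twice because one step from \<open>N\<close>
  to \<open>Suc N\<close> raises the upper index by two.\<close>

lemma triple_term_rec:
  assumes q: "q \<noteq> 0" "norm q < 1" and z: "z \<noteq> 0"
  shows "triple_term q z (Suc N) n =
     (1 + q ^ (4*N+2)) * triple_term q z N n + q ^ (2*N+1) * (z * triple_term q z N (n - 1) + inverse z * triple_term q z N (n + 1))"
proof (cases "\<bar>n\<bar> \<le> int N")
  case True
  obtain a b where ab: "int N - n = int a" "int N + n = int b"
    using True by (metis abs_le_iff diff_ge_0_iff_ge nonneg_int_cases add.commute add.inverse_inverse diff_minus_eq_add minus_le_iff uminus_add_conv_diff)
  have nz: "q_factorial (q^2) m \<noteq> 0" for m using q_factorial_nonzero norm_power2_lt_1 q by blast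
  define x where "x = (q^2)^a"
  define y where "y = (q^2)^b"
  define w where "w = q^2"
  have f1: "1 - w * x \<noteq> 0" "1 - w * y \<noteq> 0"
    using nz[of "Suc a"] nz[of "Suc b"] by (auto simp: q_factorial_Suc x_def y_def w_def)
  have d: "q ^ (2*N+1) * z * triple_term q z N (n - 1) * (1 - w*x) = triple_term q z N n * (w * x) * (1 - y)"
    using triple_term_shift_down[OF q z ab] by (simp add: x_def y_def w_def)
  have u: "q ^ (2*N+1) * inverse z * triple_term q z N (n + 1) * (1 - w*y) = triple_term q z N n * (w * y) * (1 - x)"
    using triple_term_shift_down[OF q, of "inverse z" N "-n" b a] z ab triple_term_reflect[of q z N "n"] triple_term_reflect[of q z N "n+1"]
      triple_term_reflect[of q "inverse z" N "n"] triple_term_reflect[of q "inverse z" N "n+1"]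
    by (simp add: x_def y_def w_def)
  have ab2: "a + b = 2 * N" using ab by linarith
  have xy: "w * x * y = q ^ (4*N+2)"
  proof -
    have "w * x * y = (q^2) ^ (a + b + 1)" by (simp add: w_def x_def y_def power_add mult_ac)
    also have "\<dots> = q ^ (4*N+2)" unfolding power_mult[symmetric] ab2 by simp
    finally show ?thesis .
  qed
  have n1: "nat (int N - n) = a" "nat (int N + n) = b" "nat (1 + int N - n) = Suc a" "nat (1 + int N + n) = Suc b"
    using ab by linarith+
  have Q2: "q_factorial w (2 * Suc N) = q_factorial w (2*N) * (1 - w*x*y) * (1 - w*(w*x*y))"
  proof -
    have "w * w ^ (2*N) = w*x*y"
    proof -
      have "w * w ^ (2*N) = (q^2) ^ Suc (2*N)" by (simp add: w_def)
      also have "\<dots> = q ^ (4*N+2)" unfolding power_mult[symmetric] by (rule arg_cong[where f = "\<lambda>k. q ^ k"]) simp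
      finally show ?thesis by (simp only: xy)
    qed
    moreover have "2 * Suc N = Suc (Suc (2 * N))" by simp
    ultimately show ?thesis by (simp only: q_factorial_Suc power_Suc)
  qed
  have key: "triple_term q z (Suc N) n * ((1 - w*x)*(1 - w*y)) = triple_term q z N n * ((1 - w*x*y) * (1 - w*(w*x*y)))"
    using True nz[of a, folded w_def] nz[of b, folded w_def] f1 Q2
    by (simp add: triple_term_def n1 q_factorial_Suc[of w a] q_factorial_Suc[of w b] w_def[symmetric] x_def[folded w_def, symmetric] y_def[folded w_def, symmetric])

  define T where "T = triple_term q z N n"
  define D where "D = q ^ (2*N+1) * z * triple_term q z N (n - 1)"
  define U where "U = q ^ (2*N+1) * inverse z * triple_term q z N (n + 1)"
  have "((1 + w*x*y) * T + D + U) * ((1 - w*x)*(1 - w*y)) = T * ((1 - w*x*y) * (1 - w*(w*x*y)))"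
  proof -
    have "((1 + w*x*y) * T + D + U) * ((1 - w*x)*(1 - w*y)) =
       (1 + w*x*y) * T * ((1 - w*x)*(1 - w*y)) + (D * (1 - w*x)) * (1 - w*y) + (U * (1 - w*y)) * (1 - w*x)"
      by algebra
    also have "\<dots> = T * ((1 - w*x*y) * (1 - w*(w*x*y)))"
      using d u unfolding T_def[symmetric] D_def[symmetric] U_def[symmetric] by algebra
    finally show ?thesis .
  qed
  with key f1 have "triple_term q z (Suc N) n = (1 + w*x*y) * T + D + U"
    by (metis T_def mult_cancel_right mult_eq_0_iff)
  then show ?thesis unfolding xy T_def D_def U_def by (simp add: algebra_simps)
next
  case F: False
  have nz: "q_factorial (q^2) m \<noteq> 0" for m using q_factorial_nonzero norm_power2_lt_1 q by blast
  have sq: "q powi (1 + int N)^2 = q ^ (2*N+1) * q powi (int N)^2"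
  proof -
    have "(1 + int N)^2 = int (2*N+1) + (int N)^2" by (simp add: power2_eq_square algebra_simps)
    then show ?thesis by (simp only:) (subst power_int_add, use q in \<open>auto simp only: power_int_of_nat\<close>)
  qed
  have zz: "z powi (1 + int N) = z * z powi (int N)" "inverse z powi (1 + int N) = inverse z * inverse z powi (int N)"
    using z by (simp_all add: power_int_add)
  consider "n = int N + 1" | "n = - int N - 1" | "\<bar>n\<bar> > int N + 1" using F by linarith
  then show ?thesis
  proof cases
    case 1
    have "nat (int (Suc N) + n) = 2 * Suc N" "nat (int N + (n - 1)) = 2 * N" using 1 by auto
    then show ?thesis using 1 nz[of "2*N"] nz[of "2*Suc N"] by (simp add: triple_term_def sq zz add.commute del: mult_Suc_right)

  next
    case 2
    have e: "nat (int (Suc N) - n) = 2 * Suc N" "nat (int N - (n + 1)) = 2 * N" using 2 by auto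
    have n2: "n = - (1 + int N)" "n + 1 = - int N" using 2 by auto
    have p: "n^2 = (1 + int N)^2" "(n+1)^2 = (int N)^2"
      by (simp only: n2(1) power2_minus, simp only: n2(2) power2_minus)
    have p2: "z powi n = inverse z powi (1 + int N)" "z powi (n+1) = inverse z powi (int N)"
      by (simp only: n2(1) power_int_minus power_int_inverse, simp only: n2(2) power_int_minus power_int_inverse)
    show ?thesis using 2 nz[of "2*N"] nz[of "2*Suc N"] unfolding triple_term_def p p2 e
      by (simp add: sq zz del: mult_Suc_right)
  next
    case 3
    then show ?thesis by (auto simp: triple_term_def abs_if split: if_splits)
  qed
qed

lemma finite_triple_product:
  assumes q: "q \<noteq> 0" "norm q < 1" and z: "z \<noteq> 0"
  shows "(triple_term q z N has_sum (\<Prod>k<N. (1 + q^(2*k+1) * z) * (1 + q^(2*k+1) * inverse z))) UNIV"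
proof (induction N)
  case 0
  show ?case
    by (rule has_sum_finite_neutralI[of "{0}"]) (auto simp: triple_term_def)
next
  case (Suc N)
  define P where "P = (\<Prod>k<N. (1 + q^(2*k+1) * z) * (1 + q^(2*k+1) * inverse z))"
  have hs: "(triple_term q z N has_sum P) UNIV" using Suc by (simp add: P_def)
  have "((\<lambda>n. triple_term q z N (n - 1)) has_sum P) UNIV"
    using has_sum_reindex_bij_betw[of "\<lambda>n::int. n - 1" UNIV UNIV "triple_term q z N" P] hs
    by (simp add: bij_betw_byWitness[where f' = "\<lambda>n. n + 1"])
  moreover have "((\<lambda>n. triple_term q z N (n + 1)) has_sum P) UNIV"
    using has_sum_reindex_bij_betw[of "\<lambda>n::int. n + 1" UNIV UNIV "triple_term q z N" P] hs
    by (simp add: bij_betw_byWitness[where f' = "\<lambda>n. n - 1"])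
  ultimately have "((\<lambda>n. (1 + q ^ (4*N+2)) * triple_term q z N n + q ^ (2*N+1) * (z * triple_term q z N (n - 1) + inverse z * triple_term q z N (n + 1)))
      has_sum ((1 + q ^ (4*N+2)) * P + q ^ (2*N+1) * (z * P + inverse z * P))) UNIV"
    using hs by (intro has_sum_add has_sum_cmult_right)
  \<comment> \<open>the recursion of the terms is the expansion of one further factor of the product\<close>
  moreover have "(1 + q ^ (4*N+2)) * P + q ^ (2*N+1) * (z * P + inverse z * P) =
     P * ((1 + q^(2*N+1) * z) * (1 + q^(2*N+1) * inverse z))"
  proof -
    have "q ^ (4*N+2) = q^(2*N+1) * q^(2*N+1)" unfolding power_add[symmetric] by simp
    then have e: "q ^ (4*N+2) = q^(2*N+1) * q^(2*N+1) * (z * inverse z)" using z by simp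
    show ?thesis unfolding e by (simp only: distrib_left distrib_right mult_1_left mult_1_right mult_ac add_ac)
  qed
  ultimately show ?case
    unfolding triple_term_rec[OF q z, symmetric] by (simp add: P_def mult.commute)
qed

lemma q_factorial_tendsto: "norm w < 1 \<Longrightarrow> q_factorial w \<longlonglongrightarrow> euler_phi w"
  using euler_phi_tendsto[of w] unfolding q_factorial_def .

lemma triple_term_tendsto:
  assumes q: "q \<noteq> 0" "norm q < 1"
  shows "(\<lambda>N. triple_term q z N n) \<longlonglongrightarrow> inverse (euler_phi (q^2)) * (q powi (n^2) * z powi n)"
proof -
  have w: "norm (q^2) < 1" using q norm_power2_lt_1 by blast
  have nz: "euler_phi (q^2) \<noteq> 0" using euler_phi_nonzero[OF w] .
  have l1: "(\<lambda>N. q_factorial (q^2) (2*N)) \<longlonglongrightarrow> euler_phi (q^2)"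
    using LIMSEQ_subseq_LIMSEQ[OF q_factorial_tendsto[OF w], of "\<lambda>N. 2*N"] by (simp add: o_def strict_mono_def)
  have f: "filterlim (\<lambda>N. nat (int N + m)) at_top sequentially" for m
    unfolding filterlim_at_top
  proof
    fix Z
    show "\<forall>\<^sub>F N in sequentially. Z \<le> nat (int N + m)"
      using eventually_ge_at_top[of "Z + nat (-m)"] by eventually_elim linarith
  qed
  have l2: "(\<lambda>N. q_factorial (q^2) (nat (int N + m))) \<longlonglongrightarrow> euler_phi (q^2)" for m
    by (rule filterlim_compose[OF q_factorial_tendsto[OF w] f])
  have "(\<lambda>N. q_factorial (q^2) (2*N) / (q_factorial (q^2) (nat (int N + (-n))) * q_factorial (q^2) (nat (int N + n))) * (q powi (n^2) * z powi n))
      \<longlonglongrightarrow> euler_phi (q^2) / (euler_phi (q^2) * euler_phi (q^2)) * (q powi (n^2) * z powi n)"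
    by (intro tendsto_mult tendsto_divide l1 l2 tendsto_const) (use nz in auto)
  moreover have "\<forall>\<^sub>F N in sequentially. q_factorial (q^2) (2*N) / (q_factorial (q^2) (nat (int N + (-n))) * q_factorial (q^2) (nat (int N + n))) * (q powi (n^2) * z powi n) = triple_term q z N n"
    using eventually_ge_at_top[of "nat \<bar>n\<bar>"] by eventually_elim (auto simp: triple_term_def)
  ultimately show ?thesis
    using nz by (auto simp: field_simps elim: Lim_transform_eventually)
qed

text \<open>The Gaussian binomials are bounded uniformly because the finite products converge to a nonzero
  limit; this provides the summable majorant.\<close>

lemma triple_term_bound:
  assumes q: "q \<noteq> 0" "norm q < 1"
  obtains C where "\<And>N n. norm (triple_term q z N n) \<le> C * (norm q powi (n^2) * norm z powi n)"
proof -
  have w: "norm (q^2) < 1" using q norm_power2_lt_1 by blast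
  have "Bseq (q_factorial (q^2))" using q_factorial_tendsto[OF w] convergent_imp_Bseq convergentI by blast
  then obtain A where A: "A > 0" "\<And>n. norm (q_factorial (q^2) n) \<le> A" by (auto elim: BseqE)
  have "(\<lambda>n. inverse (q_factorial (q^2) n)) \<longlonglongrightarrow> inverse (euler_phi (q^2))"
    by (intro tendsto_inverse q_factorial_tendsto w euler_phi_nonzero)
  then have "Bseq (\<lambda>n. inverse (q_factorial (q^2) n))" using convergent_imp_Bseq convergentI by blast
  then obtain B where B: "B > 0" "\<And>n. norm (inverse (q_factorial (q^2) n)) \<le> B" by (auto elim: BseqE)
  show thesis
  proof (rule that[of "A * (B * B)"])
    fix N n
    have nn: "0 \<le> norm q powi (n^2) * norm z powi n" by (intro mult_nonneg_nonneg) auto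
    have "norm (q_factorial (q^2) (2*N) / (q_factorial (q^2) a * q_factorial (q^2) b)) \<le> A * (B * B)" for a b
    proof -
      have "q_factorial (q^2) (2*N) / (q_factorial (q^2) a * q_factorial (q^2) b) = q_factorial (q^2) (2*N) * (inverse (q_factorial (q^2) a) * inverse (q_factorial (q^2) b))"
        by (simp add: field_simps)
      then show ?thesis using A B by (simp only: norm_mult) (intro mult_mono, auto)
    qed
    note this [intro]
    show "norm (triple_term q z N n) \<le> A * (B * B) * (norm q powi (n^2) * norm z powi n)"
    proof (cases "\<bar>n\<bar> \<le> int N")
      case True
      have "norm (triple_term q z N n) = norm (q_factorial (q^2) (2*N) / (q_factorial (q^2) (nat (int N - n)) * q_factorial (q^2) (nat (int N + n)))) * (norm q powi (n^2) * norm z powi n)"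
        by (simp only: triple_term_def True if_True norm_mult norm_power_int)
      also have "\<dots> \<le> A * (B * B) * (norm q powi (n^2) * norm z powi n)"
        by (intro mult_right_mono nn) blast
      finally show ?thesis .
    qed (use A B nn in \<open>auto simp: triple_term_def\<close>)
  qed
qed

text \<open>The finite identity \<open>finite_triple_product\<close> tends to the infinite one term by term.
  The value \<open>P\<close> of the product is left as a limit since it is evaluated separately for each
  theta constant.\<close>

theorem jacobi_triple_product:
  assumes q: "q \<noteq> 0" "norm q < 1" and z: "z \<noteq> 0"
    and P: "(\<lambda>N. \<Prod>k<N. (1 + q^(2*k+1) * z) * (1 + q^(2*k+1) * inverse z)) \<longlonglongrightarrow> P"
  shows "((\<lambda>n::int. q powi (n^2) * z powi n) has_sum (euler_phi (q^2) * P)) UNIV"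
proof -
  have nz: "euler_phi (q^2) \<noteq> 0" using euler_phi_nonzero norm_power2_lt_1 q by blast
  obtain C where C: "\<And>N n. norm (triple_term q z N n) \<le> C * (norm q powi (n^2) * norm z powi n)"
    using triple_term_bound[OF q] by blast
  have "((\<lambda>n. inverse (euler_phi (q^2)) * (q powi (n^2) * z powi n)) has_sum P) UNIV"
    by (rule dominated_has_sum_int[OF triple_term_tendsto[OF q] C _ finite_triple_product[OF q z] P])
       (intro summable_on_cmult_right summable_on_theta_real, use q z in auto)
  from has_sum_cmult_right[OF this, of "euler_phi (q^2)"] nz show ?thesis
    by (simp add: mult.assoc[symmetric])
qed

section \<open>Theta constants and the Landen transformation\<close>

definition theta3 :: "complex \<Rightarrow> complex" where "theta3 q = (\<Sum>\<^sub>\<infinity>n::int. q powi (n^2))"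

definition theta4 :: "complex \<Rightarrow> complex" where "theta4 q = (\<Sum>\<^sub>\<infinity>n::int. (-1) powi n * q powi (n^2))"

text \<open>The usual theta constant \<open>\<theta>\<^sub>2\<close> without its factor \<open>q powr
  (1/4)\<close>, so that only integral powers occur.\<close>

definition theta2 :: "complex \<Rightarrow> complex" where "theta2 q = (\<Sum>\<^sub>\<infinity>n::int. q powi (n^2 + n))"

lemma theta3_has_sum:
  assumes q: "q \<noteq> 0" "norm q < 1"
  shows "((\<lambda>n::int. q powi (n^2)) has_sum (euler_phi (q^2) * euler_odd (-q) ^ 2)) UNIV"
proof -
  have "(\<lambda>N. (\<Prod>k<N. 1 - (-q)^(2*k+1)) * (\<Prod>k<N. 1 - (-q)^(2*k+1))) \<longlonglongrightarrow> euler_odd (-q) * euler_odd (-q)"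
    using q by (intro tendsto_mult euler_odd_tendsto) auto
  then have "(\<lambda>N. \<Prod>k<N. (1 + q^(2*k+1) * 1) * (1 + q^(2*k+1) * inverse 1)) \<longlonglongrightarrow> euler_odd (-q) ^ 2"
    by (simp add: prod.distrib power2_eq_square)
  from jacobi_triple_product[OF q _ this] show ?thesis by simp
qed

lemma theta4_has_sum:
  assumes q: "q \<noteq> 0" "norm q < 1"
  shows "((\<lambda>n::int. (-1) powi n * q powi (n^2)) has_sum (euler_phi (q^2) * euler_odd q ^ 2)) UNIV"
proof -
  have "(\<lambda>N. (\<Prod>k<N. 1 - q^(2*k+1)) * (\<Prod>k<N. 1 - q^(2*k+1))) \<longlonglongrightarrow> euler_odd q * euler_odd q"
    using q by (intro tendsto_mult euler_odd_tendsto) auto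
  then have "(\<lambda>N. \<Prod>k<N. (1 + q^(2*k+1) * (-1)) * (1 + q^(2*k+1) * inverse (-1))) \<longlonglongrightarrow> euler_odd q ^ 2"
    by (simp add: prod.distrib power2_eq_square)
  from jacobi_triple_product[OF q _ this] show ?thesis by (simp add: mult.commute)
qed

text \<open>The specialisation \<open>z = q\<close>; one of its factors is 2 and the others occur in
  pairs.\<close>

lemma theta2_has_sum:
  assumes q: "q \<noteq> 0" "norm q < 1"
  shows "((\<lambda>n::int. q powi (n^2 + n)) has_sum (2 * euler_phi (q^4) ^ 2 / euler_phi (q^2))) UNIV"
proof -
  have w: "norm (q^2) < 1" "norm (q^4) < 1" using q norm_power2_lt_1[of q] norm_power2_lt_1[of "q^2"] by auto
  have nz: "euler_phi (q^2) \<noteq> 0" using euler_phi_nonzero[OF w(1)] .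
  have e: "(\<Prod>k<Suc N. (1 + q^(2*k+1) * q) * (1 + q^(2*k+1) * inverse q)) =
      2 * ((q_factorial (q^4) (Suc N) / q_factorial (q^2) (Suc N)) * (q_factorial (q^4) N / q_factorial (q^2) N))" for N
  proof -
    have nzq: "q_factorial (q^2) m \<noteq> 0" for m using q_factorial_nonzero[OF w(1)] .
    have pl: "(\<Prod>k<M. 1 + (q^2) ^ Suc k) = q_factorial (q^4) M / q_factorial (q^2) M" for M
    proof -
      have "(\<Prod>k<M. 1 + (q^2) ^ Suc k) * q_factorial (q^2) M = q_factorial (q^4) M"
        unfolding q_factorial_def prod.distrib[symmetric]
      proof (rule prod.cong[OF refl])
        fix k
        have "4 * Suc k = 2 * Suc k * 2" by simp
        then have "(q^4)^Suc k = ((q^2)^Suc k)^2" by (simp only: power_mult[symmetric])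
        then show "(1 + (q^2) ^ Suc k) * (1 - (q^2) ^ Suc k) = 1 - (q^4) ^ Suc k"
          by (simp only: algebra_simps power2_eq_square) simp
      qed
      with nzq[of M] show ?thesis by (simp add: field_simps)
    qed
    have t1: "q^(2*k+1) * q = (q^2) ^ Suc k" for k
      by (simp only: power_mult[symmetric] power_Suc2[symmetric]) simp
    have t2: "q^(2*Suc k+1) * inverse q = (q^2) ^ Suc k" for k
      unfolding power_mult[symmetric] using q by (simp only: power_add) simp
    have 1: "(\<Prod>k<Suc N. 1 + q^(2*k+1) * q) = (\<Prod>k<Suc N. 1 + (q^2) ^ Suc k)"
      by (simp only: t1)
    have "(\<Prod>k<Suc N. 1 + q^(2*k+1) * inverse q) = (1 + q^(2*0+1) * inverse q) * (\<Prod>k<N. 1 + (q^2) ^ Suc k)"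
      unfolding prod.lessThan_Suc_shift o_def t2 by simp
    then have 2: "(\<Prod>k<Suc N. 1 + q^(2*k+1) * inverse q) = 2 * (\<Prod>k<N. 1 + (q^2) ^ Suc k)"
      using q by simp
    show ?thesis unfolding prod.distrib 1 2 pl by (simp only: mult_ac)
  qed
  have "(\<lambda>N. 2 * ((q_factorial (q^4) (Suc N) / q_factorial (q^2) (Suc N)) * (q_factorial (q^4) N / q_factorial (q^2) N)))
      \<longlonglongrightarrow> 2 * ((euler_phi (q^4) / euler_phi (q^2)) * (euler_phi (q^4) / euler_phi (q^2)))"
    by (intro tendsto_mult tendsto_const tendsto_divide LIMSEQ_Suc q_factorial_tendsto w nz)
  then have "(\<lambda>N. \<Prod>k<Suc N. (1 + q^(2*k+1) * q) * (1 + q^(2*k+1) * inverse q)) \<longlonglongrightarrow> 2 * ((euler_phi (q^4) / euler_phi (q^2)) * (euler_phi (q^4) / euler_phi (q^2)))"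
    unfolding e .
  then have L: "(\<lambda>N. \<Prod>k<N. (1 + q^(2*k+1) * q) * (1 + q^(2*k+1) * inverse q)) \<longlonglongrightarrow> 2 * ((euler_phi (q^4) / euler_phi (q^2)) * (euler_phi (q^4) / euler_phi (q^2)))"
    by (rule filterlim_sequentially_Suc[THEN iffD1])
  show ?thesis
    using jacobi_triple_product[OF q q(1) L] nz q
    by (simp add: power_int_add[symmetric] power2_eq_square[of "euler_phi _"] field_simps)
qed

lemma theta3_abs_summable:
  assumes q: "q \<noteq> 0" "norm (q::complex) < 1"
  shows "(\<lambda>n::int. norm (q powi (n^2))) summable_on UNIV"
  using summable_on_theta_real[of "norm q" 1] q by (simp add: norm_power_int)

lemma theta2_abs_summable:
  assumes q: "q \<noteq> 0" "norm (q::complex) < 1"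
  shows "(\<lambda>n::int. norm (q powi (n^2+n))) summable_on UNIV"
  using summable_on_theta_real[of "norm q" "norm q"] q by (simp add: norm_power_int power_int_add norm_mult)

lemma has_sum_times:
  fixes f g :: "int \<Rightarrow> complex"
  assumes f: "(f has_sum a) UNIV" "(\<lambda>n. norm (f n)) summable_on UNIV" and g: "(g has_sum b) UNIV" "(\<lambda>n. norm (g n)) summable_on UNIV"
  shows "((\<lambda>(x, y). f x * g y) has_sum (a * b)) (UNIV \<times> UNIV)"
proof -
  define F where "F = (\<lambda>(x, y). f x * g y)"
  have F: "F (x, y) = f x * g y" for x y by (simp add: F_def)
  have "(F has_sum (a * b)) (UNIV \<times> UNIV)"
  proof (rule has_sum_SigmaI)
    show "((\<lambda>y. F (x, y)) has_sum (f x * b)) UNIV" for x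
      unfolding F using has_sum_cmult_right[OF g(1)] by simp
    show "((\<lambda>x. f x * b) has_sum a * b) UNIV" using has_sum_cmult_left[OF f(1)] by simp
    have 1: "(\<lambda>y. norm (F (x, y))) summable_on UNIV" for x
      unfolding F using summable_on_cmult_right[OF g(2), of "norm (f x)"] by (simp add: norm_mult)
    have "infsum (\<lambda>y. norm (F (x, y))) UNIV = norm (f x) * infsum (\<lambda>y. norm (g y)) UNIV" for x
      by (simp add: F norm_mult infsum_cmult_right')
    moreover have "infsum (\<lambda>y. norm (g y)) UNIV \<ge> 0" by (rule infsum_nonneg) auto
    ultimately have 2: "(\<lambda>x. norm (infsum (\<lambda>y. norm (F (x, y))) UNIV)) summable_on UNIV"
      using summable_on_cmult_left[OF f(2), of "infsum (\<lambda>y. norm (g y)) UNIV"] by (simp add: abs_mult)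
    have "(\<lambda>p. norm (F p)) summable_on UNIV \<times> UNIV"
      using 1 2 Infinite_Sum.abs_summable_on_Sigma_iff[of F UNIV "\<lambda>_. UNIV"] by blast
    then show "F summable_on UNIV \<times> UNIV" by (rule Infinite_Sum.abs_summable_summable)
  qed
  then show ?thesis by (simp add: F_def)
qed

text \<open>The square is a sum over pairs of integers. The pairs of equal parity form a rotated and scaled
  square lattice, and the remaining ones are its translate.\<close>

lemma theta_landen:
  assumes q: "q \<noteq> 0" "norm (q::complex) < 1"
  shows "theta3 q ^ 2 = theta3 (q^2) ^ 2 + q * theta2 (q^2) ^ 2"
proof -
  have q2: "q^2 \<noteq> 0" "norm (q^2) < 1" using q norm_power2_lt_1 by auto
  have s3: "((\<lambda>n::int. x powi (n^2)) has_sum theta3 x) UNIV" if "x \<noteq> 0" "norm x < 1" for x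
    using theta3_has_sum[OF that] by (simp add: theta3_def infsumI)
  have s2: "((\<lambda>n::int. x powi (n^2+n)) has_sum theta2 x) UNIV" if "x \<noteq> 0" "norm x < 1" for x
    using theta2_has_sum[OF that] by (simp add: theta2_def infsumI)
  let ?f = "\<lambda>(m::int, n::int). q powi (m^2) * q powi (n^2)"
  let ?Ev = "{(m::int, n::int). even (m + n)}" and ?Od = "{(m::int, n::int). odd (m + n)}"
  have A: "(?f has_sum (theta3 q * theta3 q)) (UNIV \<times> UNIV)"
    by (intro has_sum_times s3 theta3_abs_summable q)
  have "((\<lambda>(m::int, n::int). (q^2) powi (m^2) * (q^2) powi (n^2)) has_sum (theta3 (q^2) * theta3 (q^2))) (UNIV \<times> UNIV)"
    by (intro has_sum_times s3 theta3_abs_summable q2)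
  \<comment> \<open>rotating the square lattice by 45 degrees: \<open>m = u + v\<close>, \<open>n = u - v\<close> reaches the pairs of equal parity\<close>
  also have "?this \<longleftrightarrow> (?f has_sum (theta3 (q^2) * theta3 (q^2))) ?Ev"
  proof (rule has_sum_reindex_bij_witness[where i = "\<lambda>(m,n). ((m+n) div 2, (m-n) div 2)" and j = "\<lambda>(u,v). (u+v, u-v)"])
    fix a :: "int \<times> int"
    obtain u v where a: "a = (u, v)" by (cases a)
    have e: "(u+v)^2 + (u-v)^2 = 2 * u^2 + 2 * v^2" by (simp add: power2_eq_square algebra_simps)
    have "q powi ((u+v)^2) * q powi ((u-v)^2) = q powi (2 * u^2 + 2 * v^2)" using q by (simp add: power_int_add[symmetric] e)
    also have "\<dots> = (q^2) powi (u^2) * (q^2) powi (v^2)"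
    proof -
      have "q^2 = q powi 2" by (simp add: power_int_numeral)
      then have "(q^2) powi (u^2) = q powi (2 * u^2)" "(q^2) powi (v^2) = q powi (2 * v^2)"
        by (simp_all only: power_int_mult)
      then show ?thesis using q by (simp add: power_int_add)
    qed
    finally show "?f (case a of (u, v) \<Rightarrow> (u + v, u - v)) = (case a of (m, n) \<Rightarrow> (q^2) powi m^2 * (q^2) powi n^2)"
      by (simp add: a)
  qed (auto, presburger+)
  finally have Ev: "(?f has_sum (theta3 (q^2) * theta3 (q^2))) ?Ev" .
  have "((\<lambda>(m::int, n::int). q * ((q^2) powi (m^2+m) * (q^2) powi (n^2+n))) has_sum q * (theta2 (q^2) * theta2 (q^2))) (UNIV \<times> UNIV)"
    using has_sum_cmult_right[OF has_sum_times[OF s2[OF q2] theta2_abs_summable[OF q2] s2[OF q2] theta2_abs_summable[OF q2]], of q]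
    by (simp add: case_prod_unfold)
  \<comment> \<open>the pairs of different parity are \<open>m = u + v + 1\<close>, \<open>n = u - v\<close>\<close>
  also have "?this \<longleftrightarrow> (?f has_sum (q * (theta2 (q^2) * theta2 (q^2)))) ?Od"
  proof (rule has_sum_reindex_bij_witness[where i = "\<lambda>(m,n). ((m+n-1) div 2, (m-n-1) div 2)" and j = "\<lambda>(u,v). (u+v+1, u-v)"])
    fix a :: "int \<times> int"
    obtain u v where a: "a = (u, v)" by (cases a)
    have e: "(u+v+1)^2 + (u-v)^2 = 1 + (2 * (u^2 + u) + 2 * (v^2 + v))" by (simp add: power2_eq_square algebra_simps)
    have "q powi ((u+v+1)^2) * q powi ((u-v)^2) = q powi (1 + (2 * (u^2 + u) + 2 * (v^2 + v)))" using q by (simp add: power_int_add[symmetric] e)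
    also have "\<dots> = q * ((q^2) powi (u^2+u) * (q^2) powi (v^2+v))"
    proof -
      have "q^2 = q powi 2" by (simp add: power_int_numeral)
      then have "(q^2) powi (u^2+u) = q powi (2*(u^2+u))" "(q^2) powi (v^2+v) = q powi (2*(v^2+v))"
        by (simp_all only: power_int_mult)
      then show ?thesis using q by (simp add: power_int_add)
    qed
    finally show "?f (case a of (u, v) \<Rightarrow> (u + v + 1, u - v)) = (case a of (m, n) \<Rightarrow> q * ((q^2) powi (m^2+m) * (q^2) powi (n^2+n)))"
      by (simp add: a)
  qed (auto, presburger+)
  finally have Od: "(?f has_sum (q * (theta2 (q^2) * theta2 (q^2)))) ?Od" .
  have "(?f has_sum (theta3 (q^2) * theta3 (q^2) + q * (theta2 (q^2) * theta2 (q^2)))) (?Ev \<union> ?Od)"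
    by (rule has_sum_Un_disjoint[OF Ev Od]) auto
  moreover have "?Ev \<union> ?Od = UNIV \<times> UNIV" by auto
  ultimately show ?thesis using has_sum_unique[OF A] by (simp add: power2_eq_square)
qed

lemma euler_odd_eq: "norm q < 1 \<Longrightarrow> euler_odd q = euler_phi q / euler_phi (q^2)"
  using euler_phi_odd_even[of q] euler_phi_nonzero[OF norm_power2_lt_1] by (simp add: field_simps)

lemma theta4_eq:
  assumes q: "q \<noteq> 0" "norm q < 1"
  shows "theta4 q = euler_phi q ^ 2 / euler_phi (q^2)"
proof -
  have "theta4 q = euler_phi (q^2) * euler_odd q ^ 2" using theta4_has_sum[OF q] by (simp add: theta4_def infsumI)
  then show ?thesis using euler_odd_eq[OF q(2)] euler_phi_nonzero[OF norm_power2_lt_1[OF q(2)]]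
    by (simp add: field_simps power2_eq_square)
qed

lemma theta2_eq:
  assumes q: "q \<noteq> 0" "norm q < 1"
  shows "theta2 q = 2 * euler_phi (q^4) ^ 2 / euler_phi (q^2)"
  using theta2_has_sum[OF q] by (simp add: theta2_def infsumI)

lemma theta3_eq:
  assumes q: "q \<noteq> 0" "norm q < 1"
  shows "theta3 q = euler_phi (q^2) ^ 5 / (euler_phi q ^ 2 * euler_phi (q^4) ^ 2)"
proof -
  have nz: "euler_phi q \<noteq> 0" "euler_phi (q^2) \<noteq> 0" "euler_phi (q^4) \<noteq> 0"
    using euler_phi_nonzero q norm_power2_lt_1[of q] norm_power2_lt_1[of "q^2"] by auto
  have 1: "theta3 q = euler_phi (q^2) * (euler_phi (-q) / euler_phi (q^2)) ^ 2"
    using theta3_has_sum[OF q] euler_odd_eq[of "-q"] q by (simp add: theta3_def infsumI)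
  have 2: "euler_phi (-q) = euler_phi (q^2) ^ 3 / (euler_phi q * euler_phi (q^4))"
    using euler_phi_minus[OF q(2)] nz by (simp add: field_simps)
  show ?thesis unfolding 1 2 using nz by (simp add: field_simps power2_eq_square) (simp add: numeral_eq_Suc)
qed

section \<open>Uniqueness of Fourier coefficients\<close>

text \<open>All Fourier coefficients of a function on the unit interval vanish. The property is stable under
  multiplication by characters, hence by trigonometric polynomials.\<close>

definition null_fourier :: "(real \<Rightarrow> complex) \<Rightarrow> bool" where
  "null_fourier D \<longleftrightarrow> continuous_on {0..1} D \<and> (\<forall>k::int. integral {0..1} (\<lambda>x. D x * cis (2 * pi * k * x)) = 0)"

lemma null_fourier_cis:
  assumes "null_fourier D"
  shows "null_fourier (\<lambda>x. D x * cis (2 * pi * of_int m * x))"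
proof -
  have "integral {0..1} (\<lambda>x. D x * cis (2 * pi * of_int m * x) * cis (2 * pi * of_int k * x)) = 0" for k
  proof -
    have "D x * cis (2 * pi * of_int m * x) * cis (2 * pi * of_int k * x) = D x * cis (2 * pi * of_int (m + k) * x)" for x
      by (simp add: mult.assoc cis_mult algebra_simps)
    then show ?thesis using assms by (simp only: null_fourier_def)
  qed
  then show ?thesis using assms
    by (auto simp: null_fourier_def intro!: continuous_intros)
qed

lemma null_fourier_linear:
  assumes "null_fourier D" "null_fourier E"
  shows "null_fourier (\<lambda>x. a * D x + b * E x)"
proof -
  have "integral {0..1} (\<lambda>x. (a * D x + b * E x) * cis (2 * pi * of_int k * x)) = 0" for k
  proof -
    have c: "continuous_on {0..1} (\<lambda>x. D x * cis (2 * pi * of_int k * x))" "continuous_on {0..1} (\<lambda>x. E x * cis (2 * pi * of_int k * x))"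
      using assms by (auto simp: null_fourier_def intro!: continuous_intros)
    have "integral {0..1} (\<lambda>x. (a * D x + b * E x) * cis (2 * pi * of_int k * x)) =
       integral {0..1} (\<lambda>x. a * (D x * cis (2 * pi * of_int k * x)) + b * (E x * cis (2 * pi * of_int k * x)))"
      by (simp add: algebra_simps)
    also have "\<dots> = a * integral {0..1} (\<lambda>x. D x * cis (2 * pi * of_int k * x)) + b * integral {0..1} (\<lambda>x. E x * cis (2 * pi * of_int k * x))"
      using c by (subst integral_add) (auto intro!: integrable_continuous_real continuous_intros)
    finally show ?thesis using assms by (simp add: null_fourier_def)
  qed
  then show ?thesis using assms
    by (auto simp: null_fourier_def intro!: continuous_intros)
qed

lemma null_fourier_poly:
  assumes "real_polynomial_function p" "null_fourier D"
  shows "null_fourier (\<lambda>x. D x * of_real (p (cis (2 * pi * x))))"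
  using assms
proof (induction p arbitrary: D rule: real_polynomial_function.induct)
  case (linear f)
  note D = linear(2)
  from linear(1) interpret bounded_linear f by simp
  have "f z = Re z * f 1 + Im z * f \<i>" for z
  proof -
    have "z = Re z *\<^sub>R 1 + Im z *\<^sub>R \<i>" by (simp add: complex_eq_iff)
    then have "f z = f (Re z *\<^sub>R 1 + Im z *\<^sub>R \<i>)" by (rule arg_cong)
    then show ?thesis by (simp only: add scaleR real_scaleR_def)
  qed
  then have fz: "of_real (f z) = ((of_real (f 1) - \<i> * of_real (f \<i>)) / 2) * z + ((of_real (f 1) + \<i> * of_real (f \<i>)) / 2) * cnj z" for z
  proof -
    define a b where "a = complex_of_real (f 1)" and "b = complex_of_real (f \<i>)"
    have "of_real (f z) = of_real (Re z) * a + of_real (Im z) * b"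
      using \<open>f z = Re z * f 1 + Im z * f \<i>\<close> by (simp add: a_def b_def)
    moreover have "2 * (of_real (Re z) * a + of_real (Im z) * b) = (a - \<i> * b) * z + (a + \<i> * b) * cnj z"
    proof -
      have "z = of_real (Re z) + \<i> * of_real (Im z)" "cnj z = of_real (Re z) - \<i> * of_real (Im z)"
        by (simp_all add: complex_eq_iff)
      then show ?thesis using i_squared by algebra
    qed
    ultimately have "of_real (f z) = ((a - \<i> * b) * z + (a + \<i> * b) * cnj z) / 2"
      by (metis nonzero_mult_div_cancel_left zero_neq_numeral)
    then show ?thesis unfolding a_def[symmetric] b_def[symmetric] by (simp add: add_divide_distrib)
  qed
  have e: "of_real (f (cis (2 * pi * x))) =
     ((of_real (f 1) - \<i> * of_real (f \<i>)) / 2) * cis (2 * pi * of_int 1 * x) + ((of_real (f 1) + \<i> * of_real (f \<i>)) / 2) * cis (2 * pi * of_int (-1) * x)" for x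
    using fz[of "cis (2 * pi * x)"] by (simp add: cis_cnj)
  have "null_fourier (\<lambda>x. ((of_real (f 1) - \<i> * of_real (f \<i>)) / 2) * (D x * cis (2 * pi * of_int 1 * x)) + ((of_real (f 1) + \<i> * of_real (f \<i>)) / 2) * (D x * cis (2 * pi * of_int (-1) * x)))"
    by (intro null_fourier_linear null_fourier_cis D)
  then show ?case unfolding e by (simp add: algebra_simps)
next
  case (const c)
  then show ?case using null_fourier_linear[OF const const, of "of_real c" 0] by (simp add: mult.commute)
next
  case (add f g)
  then show ?case using null_fourier_linear[OF add.IH(1)[OF add.prems] add.IH(2)[OF add.prems], of 1 1]
    by (simp add: algebra_simps)
next
  case (mult f g)
  from mult.IH(2)[OF mult.IH(1)[OF mult.prems]] show ?case by (simp add: mult.assoc)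
qed

lemma periodic_int:
  fixes D :: "real \<Rightarrow> 'a"
  assumes "\<And>x. D (x + 1) = D x"
  shows "D (x + of_int n) = D x"
proof (induction n rule: int_induct[where k = 0])
  case (step1 i)
  then show ?case using assms[of "x + of_int i"] by (simp add: add.assoc)
next
  case (step2 i)
  then show ?case using assms[of "x + of_int i - 1"] by (simp add: add_diff_eq)
qed simp

text \<open>By Stone-Weierstrass the conjugate of the function is a uniform limit of trigonometric
  polynomials on the circle, and all of these are orthogonal to the function. Hence its square norm
  vanishes.\<close>

lemma fourier_unique:
  fixes D :: "real \<Rightarrow> complex"
  assumes cont: "continuous_on UNIV D" and periodic: "\<And>x. D (x + 1) = D x" and nf: "null_fourier D"
    and x: "x \<in> {0..1}"
  shows "D x = 0"
proof -
  \<comment> \<open>\<open>h\<close> is \<open>D\<close> transported to the unit circle, where Stone-Weierstrass gives polynomials in \<open>Re z\<close>, \<open>Im z\<close>\<close>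
  define h where "h = (\<lambda>z. D (Im (Ln z) / (2 * pi)))"
  have h: "h (cis (2 * pi * y)) = D y" for y
  proof -
    have "exp (Ln (cis (2 * pi * y))) = exp (\<i> * (2 * pi * y))" by (simp add: cis_conv_exp)
    then obtain n :: int where "Ln (cis (2 * pi * y)) = \<i> * (2 * pi * y) + (of_int (2 * n) * pi) * \<i>"
      by (auto simp only: exp_eq)
    then have "Im (Ln (cis (2 * pi * y))) / (2 * pi) = y + of_int n"
      by (simp add: field_simps)
    then show ?thesis by (simp add: h_def periodic_int[of D, OF periodic])
  qed
  have unit: "z = cis (2 * pi * (Im (Ln z) / (2 * pi)))" if "norm z = 1" for z
  proof -
    have "z \<noteq> 0" using that by auto
    then have "z = exp (Ln z)" "Re (Ln z) = 0" using that by simp_all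
    then have "z = cis (Im (Ln z))" by (simp add: exp_eq_polar[of "Ln z"])
    then show ?thesis by simp
  qed
  \<comment> \<open>a second branch of the argument, for continuity of \<open>h\<close> at \<open>-1\<close>\<close>
  have hm: "h z = D (Im (Ln (-z)) / (2 * pi) + 1/2)" if "norm z = 1" for z
  proof -
    have "- z = cis (2 * pi * (Im (Ln (-z)) / (2 * pi)))" using unit[of "-z"] that by simp
    then have "z = - cis (2 * pi * (Im (Ln (-z)) / (2 * pi)))" by simp
    also have "\<dots> = cis (2 * pi * (Im (Ln (-z)) / (2 * pi) + 1/2))"
      by (simp add: distrib_left cis_mult[symmetric])
    finally show ?thesis using h by metis
  qed
  have conth: "continuous_on (sphere 0 1) h"
  proof -
    let ?S = "sphere 0 1 - \<real>\<^sub>\<le>\<^sub>0" and ?T = "sphere 0 1 - {z::complex. - z \<in> \<real>\<^sub>\<le>\<^sub>0}"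
    have cD: "continuous_on S (\<lambda>z. D (f z))" if "continuous_on S f" for S and f :: "complex \<Rightarrow> real"
      using continuous_on_compose2[OF cont that] by auto
    have 1: "continuous_on ?S h" unfolding h_def by (intro cD continuous_intros) auto
    have "continuous_on ?T (\<lambda>z. D (Im (Ln (-z)) / (2 * pi) + 1/2))"
      by (intro cD continuous_intros) auto
    then have 2: "continuous_on ?T h" by (rule continuous_on_eq) (auto simp: hm)
    have un: "?S \<union> ?T = sphere 0 1"
      by (auto simp: complex_nonpos_Reals_iff complex_eq_iff cmod_def)
    have cl2: "closed {z::complex. - z \<in> \<real>\<^sub>\<le>\<^sub>0}"
    proof -
      have "{z::complex. - z \<in> \<real>\<^sub>\<le>\<^sub>0} = \<real>\<^sub>\<ge>\<^sub>0"
        by (auto simp: complex_nonpos_Reals_iff complex_nonneg_Reals_iff)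
      then show ?thesis by (simp add: closed_nonneg_Reals_complex)
    qed
    have "openin (top_of_set (?S \<union> ?T)) ?S" unfolding un
      by (auto simp: openin_open intro!: exI[of _ "- \<real>\<^sub>\<le>\<^sub>0"])
    moreover have "openin (top_of_set (?S \<union> ?T)) ?T" unfolding un
      using cl2 by (auto simp: openin_open intro!: exI[of _ "- {z::complex. - z \<in> \<real>\<^sub>\<le>\<^sub>0}"])
    ultimately have "continuous_on (?S \<union> ?T) h" using 1 2 by (rule continuous_on_Un_local_open)
    then show ?thesis unfolding un .
  qed
  define N where "N = (\<lambda>x. (norm (D x))^2)"
  have cD: "continuous_on {0..1} D" using cont continuous_on_subset by blast
  have cN: "continuous_on {0..1} N" unfolding N_def by (intro continuous_intros cD)
  have cN': "continuous_on {0..1} (\<lambda>y. complex_of_real (N y))" by (intro continuous_intros cN)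
  have "bounded (D ` {0..1})" using cD by (intro compact_imp_bounded compact_continuous_image) auto
  then obtain M where M: "M > 0" "\<And>y. y \<in> {0..1} \<Longrightarrow> norm (D y) \<le> M" by (auto simp: bounded_pos)
  \<comment> \<open>a polynomial close to \<open>cnj h\<close> is orthogonal to \<open>D\<close>, so the square norm of \<open>D\<close> is below any bound\<close>
  have small: "norm (integral {0..1} (\<lambda>y. complex_of_real (N y))) \<le> e * M" if e: "e > 0" for e
  proof -
    have "continuous_on (sphere 0 1) (\<lambda>z. cnj (h z))" by (intro continuous_intros conth)
    then obtain g where g: "polynomial_function g" "\<And>z. z \<in> sphere 0 1 \<Longrightarrow> norm (cnj (h z) - g z) < e"
      using Stone_Weierstrass_polynomial_function[of "sphere 0 1" "\<lambda>z. cnj (h z)" e] e by auto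
    have r: "real_polynomial_function (\<lambda>z. Re (g z))" "real_polynomial_function (\<lambda>z. Im (g z))"
      using g(1) bounded_linear_Re bounded_linear_Im unfolding polynomial_function_def o_def by blast+
    have "null_fourier (\<lambda>y. 1 * (D y * of_real (Re (g (cis (2 * pi * y))))) + \<i> * (D y * of_real (Im (g (cis (2 * pi * y))))))"
      by (intro null_fourier_linear null_fourier_poly[OF r(1)] null_fourier_poly[OF r(2)] nf)
    moreover have "1 * (D y * of_real (Re (g (cis (2 * pi * y))))) + \<i> * (D y * of_real (Im (g (cis (2 * pi * y))))) = D y * g (cis (2 * pi * y))" for y
      by (subst (3) complex_eq) (simp add: algebra_simps)
    ultimately have nf2: "null_fourier (\<lambda>y. D y * g (cis (2 * pi * y)))" by simp
    then have z: "integral {0..1} (\<lambda>y. D y * g (cis (2 * pi * y))) = 0"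
      unfolding null_fourier_def by (auto dest: spec[where x = 0])
    have cg: "continuous_on {0..1} (\<lambda>y. D y * g (cis (2 * pi * y)))" using nf2 by (simp add: null_fourier_def)
    have "integral {0..1} (\<lambda>y. complex_of_real (N y)) =
       integral {0..1} (\<lambda>y. complex_of_real (N y)) - integral {0..1} (\<lambda>y. D y * g (cis (2 * pi * y)))" using z by simp
    also have "\<dots> = integral {0..1} (\<lambda>y. complex_of_real (N y) - D y * g (cis (2 * pi * y)))"
      by (rule integral_diff[symmetric, OF integrable_continuous_real[OF cN'] integrable_continuous_real[OF cg]])
    also have "norm \<dots> \<le> (e * M) * (1 - 0)"
    proof (rule integral_bound)
      show "continuous_on {0..1} (\<lambda>y. complex_of_real (N y) - D y * g (cis (2 * pi * y)))"
        by (rule continuous_on_diff[OF cN' cg])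
      fix y :: real assume y: "y \<in> {0..1}"
      have "complex_of_real (N y) - D y * g (cis (2 * pi * y)) = D y * (cnj (h (cis (2 * pi * y))) - g (cis (2 * pi * y)))"
        by (simp only: N_def h complex_norm_square right_diff_distrib)
      then have "norm (complex_of_real (N y) - D y * g (cis (2 * pi * y))) \<le> M * e"
        using M(2)[OF y] g(2)[of "cis (2 * pi * y)"] M(1) by (auto simp: norm_mult intro!: mult_mono)
      then show "norm (complex_of_real (N y) - D y * g (cis (2 * pi * y))) \<le> e * M" by (simp add: mult.commute)
    qed simp
    finally show ?thesis by simp
  qed
  have "norm (integral {0..1} (\<lambda>y. complex_of_real (N y))) \<le> 0"
  proof (rule field_le_epsilon)
    fix e :: real assume "e > 0"
    with small[of "e / M"] M show "norm (integral {0..1} (\<lambda>y. complex_of_real (N y))) \<le> 0 + e" by simp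
  qed
  moreover have "((\<lambda>y. complex_of_real (N y)) has_integral complex_of_real (integral {0..1} N)) {0..1}"
    using cN by (intro has_integral_of_real integrable_integral integrable_continuous_real)
  then have "integral {0..1} (\<lambda>y. complex_of_real (N y)) = complex_of_real (integral {0..1} N)"
    by (rule integral_unique)
  ultimately have "integral {0..1} N = 0" by simp
  then have "N x = 0"
    using integral_eq_0_iff[OF cN] x by (auto simp: N_def)
  then show ?thesis by (simp add: N_def)
qed

section \<open>Poisson summation for Gaussians\<close>

text \<open>A rescaling of the characteristic function of the standard normal distribution.\<close>

lemma gauss_fourier:
  fixes t s :: real
  assumes t: "t > 0"
  shows "integrable lborel (\<lambda>y. complex_of_real (exp (- pi * t * y^2)) * cis (2 * pi * s * y))"
    and "(LINT y|lborel. complex_of_real (exp (- pi * t * y^2)) * cis (2 * pi * s * y)) = of_real (exp (- pi * s^2 / t) / sqrt t)"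
proof -
  define c where "c = sqrt (2 * pi * t)"
  have c: "c > 0" "c^2 = 2 * pi * t" using t by (auto simp: c_def)
  define w where "w = 2 * pi * s / c"
  let ?f = "\<lambda>x. std_normal_density x *\<^sub>R iexp (w * x)"
  have int: "integrable lborel ?f"
  proof -
    have "integrable lborel std_normal_density"
      using integrable_std_normal_moment[of 0] by simp
    then show ?thesis
      by (rule Bochner_Integration.integrable_bound) (auto simp: normal_density_nonneg)
  qed
  have val: "(LINT x|lborel. ?f x) = of_real (exp (- (w^2) / 2))"
  proof -
    have "char std_normal_distribution w = (LINT x|lborel. ?f x)"
      unfolding char_def by (subst integral_density) (auto simp: normal_density_nonneg)
    then show ?thesis by (simp add: char_std_normal_distribution)
  qed
  have e: "?f (0 + c * y) = (1 / sqrt (2 * pi)) *\<^sub>R (complex_of_real (exp (- pi * t * y^2)) * cis (2 * pi * s * y))" for y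
  proof -
    have "std_normal_density (c * y) = 1 / sqrt (2 * pi) * exp (- pi * t * y^2)"
      by (simp add: std_normal_density_def power_mult_distrib c(2))
    moreover have "iexp (w * (c * y)) = cis (2 * pi * s * y)" using c(1) by (simp add: w_def cis_conv_exp mult.assoc)
    ultimately show ?thesis by (simp add: scaleR_conv_of_real)
  qed
  have i2: "integrable lborel (\<lambda>y. (1 / sqrt (2 * pi)) *\<^sub>R (complex_of_real (exp (- pi * t * y^2)) * cis (2 * pi * s * y)))"
    using lborel_integrable_real_affine[OF int, of c 0] c unfolding e by simp
  then show I: "integrable lborel (\<lambda>y. complex_of_real (exp (- pi * t * y^2)) * cis (2 * pi * s * y))"
    using Bochner_Integration.integrable_scaleR_right[OF i2, of "sqrt (2 * pi)"] by simp
  have "of_real (exp (- (w^2) / 2)) = \<bar>c\<bar> *\<^sub>R (LINT y|lborel. ?f (0 + c * y))"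
    unfolding val[symmetric] using c by (intro lborel_integral_real_affine) auto
  also have "\<dots> = \<bar>c\<bar> *\<^sub>R ((1 / sqrt (2 * pi)) *\<^sub>R (LINT y|lborel. complex_of_real (exp (- pi * t * y^2)) * cis (2 * pi * s * y)))"
    unfolding e by simp
  also have "\<dots> = sqrt t *\<^sub>R (LINT y|lborel. complex_of_real (exp (- pi * t * y^2)) * cis (2 * pi * s * y))"
  proof -
    have "\<bar>c\<bar> / sqrt (2 * pi) = sqrt t" using t by (simp add: c_def real_sqrt_mult)
    then show ?thesis by simp
  qed
  finally have fin: "of_real (exp (- (w^2) / 2)) = sqrt t *\<^sub>R (LINT y|lborel. complex_of_real (exp (- pi * t * y^2)) * cis (2 * pi * s * y))" .
  have "- (w^2) / 2 = - pi * s^2 / t"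
  proof -
    have "w^2 = (2 * pi * s)^2 / (2 * pi * t)" unfolding c(2)[symmetric] w_def by (rule power_divide)
    then show ?thesis using t by (simp add: field_simps power2_eq_square)
  qed
  with fin have "of_real (exp (- pi * s^2 / t)) = of_real (sqrt t) * (LINT y|lborel. complex_of_real (exp (- pi * t * y^2)) * cis (2 * pi * s * y))"
    by (simp only: scaleR_conv_of_real)
  then have "(LINT y|lborel. complex_of_real (exp (- pi * t * y^2)) * cis (2 * pi * s * y)) = of_real (exp (- pi * s^2 / t)) / of_real (sqrt t)"
    using t by (intro eq_divide_imp) (auto simp only: mult.commute of_real_eq_0_iff real_sqrt_eq_0_iff less_irrefl)
  then show "(LINT y|lborel. complex_of_real (exp (- pi * t * y^2)) * cis (2 * pi * s * y)) = of_real (exp (- pi * s^2 / t) / sqrt t)"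
    by (simp only: of_real_divide)
qed

lemma uniform_limit_mult_cis:
  assumes "uniform_limit {0..1::real} (\<lambda>N x. \<Sum>j<N. f j x) F sequentially" "\<And>j. continuous_on {0..1} (f j)"
  shows "(\<lambda>j. integral {0..1} (\<lambda>x. f j x * cis (c * x))) sums integral {0..1} (\<lambda>x. F x * cis (c * x))"
proof -
  have ul: "uniform_limit {0..1::real} (\<lambda>N x. \<Sum>j<N. f j x * cis (c * x)) (\<lambda>x. F x * cis (c * x)) sequentially"
    unfolding uniform_limit_iff
  proof (intro allI impI)
    fix e :: real assume "e > 0"
    with assms(1) have "\<forall>\<^sub>F N in sequentially. \<forall>x\<in>{0..1}. dist (\<Sum>j<N. f j x) (F x) < e"
      by (auto simp: uniform_limit_iff)
    then show "\<forall>\<^sub>F N in sequentially. \<forall>x\<in>{0..1}. dist (\<Sum>j<N. f j x * cis (c * x)) (F x * cis (c * x)) < e"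
    proof eventually_elim
      case (elim N)
      have "dist (\<Sum>j<N. f j x * cis (c * x)) (F x * cis (c * x)) = dist (\<Sum>j<N. f j x) (F x)" for x
        unfolding dist_norm sum_distrib_right[symmetric] left_diff_distrib[symmetric] norm_mult by simp
      with elim show ?case by simp
    qed
  qed
  obtain I J where IJ: "\<And>n. ((\<lambda>x. \<Sum>j<n. f j x * cis (c * x)) has_integral I n) {0..1}"
    "((\<lambda>x. F x * cis (c * x)) has_integral J) {0..1}" "I \<longlonglongrightarrow> J"
    by (rule uniform_limit_integral[OF ul]) (use assms in \<open>auto intro!: continuous_intros\<close>)
  have "I n = (\<Sum>j<n. integral {0..1} (\<lambda>x. f j x * cis (c * x)))" for n
  proof -
    have "I n = integral {0..1} (\<lambda>x. \<Sum>j<n. f j x * cis (c * x))" by (rule integral_unique[OF IJ(1), symmetric])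
    also have "\<dots> = (\<Sum>j<n. integral {0..1} (\<lambda>x. f j x * cis (c * x)))"
      by (intro integral_sum integrable_continuous_real continuous_intros assms) auto
    finally show ?thesis .
  qed
  then have "I = (\<lambda>n. \<Sum>j<n. integral {0..1} (\<lambda>x. f j x * cis (c * x)))" by (rule ext)
  with IJ(3) integral_unique[OF IJ(2)] show ?thesis by (simp only: sums_def)
qed

text \<open>Sums over the integers are arranged as series, so that uniform convergence of partial sums is
  available.\<close>

abbreviation int_dec where "int_dec \<equiv> (\<lambda>j. real_of_int (int_decode j))"

lemma summable_dec_gauss:
  assumes "0 < r" "r < 1"
  shows "summable (\<lambda>j. r powi ((int_decode j)^2) :: real)"
proof -
  have "((\<lambda>n::int. r powi (n^2)) \<circ> int_decode) summable_on UNIV"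
    using summable_on_theta_real[of r 1] assms summable_on_reindex_bij_betw[OF bij_int_decode, of "\<lambda>n. r powi (n^2)"] by (simp add: o_def)
  then show ?thesis using summable_on_imp_summable by (auto simp: o_def)
qed

definition gauss_term :: "real \<Rightarrow> nat \<Rightarrow> real \<Rightarrow> complex" where
  "gauss_term t j x = of_real (exp (- pi * t * (x + int_dec j)^2))"

definition gauss_sum :: "real \<Rightarrow> real \<Rightarrow> complex" where
  "gauss_sum t x = (\<Sum>j. gauss_term t j x)"

lemma gauss_term_bound:
  assumes "t > 0" "\<bar>x\<bar> \<le> R"
  shows "norm (gauss_term t j x) \<le> exp (pi * t * R^2) * exp (- pi * t / 2) powi ((int_decode j)^2)"
proof -
  have "(x + int_dec j)^2 \<ge> (int_dec j)^2 / 2 - x^2"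
    using sum_squares_ge_zero[of "2 * x + int_dec j" 0] by (simp add: power2_eq_square algebra_simps)
  moreover have "x^2 \<le> R^2" using assms(2) by (metis abs_le_square_iff abs_of_nonneg abs_ge_zero order.trans)
  ultimately have "(int_dec j)^2 / 2 - R^2 \<le> (x + int_dec j)^2" by linarith
  then have "pi * t * ((int_dec j)^2 / 2 - R^2) \<le> pi * t * (x + int_dec j)^2"
    using assms(1) by (intro mult_left_mono) auto
  then have "exp (- pi * t * (x + int_dec j)^2) \<le> exp (pi * t * R^2 + - pi * t / 2 * (int_dec j)^2)"
    by (simp add: algebra_simps)
  also have "\<dots> = exp (pi * t * R^2) * exp (- pi * t / 2 * (int_dec j)^2)" by (rule exp_add)
  also have "exp (- pi * t / 2 * (int_dec j)^2) = exp (- pi * t / 2) powi ((int_decode j)^2)"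
    by (simp add: exp_power_int mult.commute)
  finally show ?thesis by (simp add: gauss_term_def)
qed

lemma gauss_sum_uniform:
  assumes "t > 0"
  shows "uniform_limit {-R..R} (\<lambda>N x. \<Sum>j<N. gauss_term t j x) (gauss_sum t) sequentially"
  unfolding gauss_sum_def
proof (rule Weierstrass_m_test)
  show "norm (gauss_term t j x) \<le> exp (pi * t * R^2) * exp (- pi * t / 2) powi ((int_decode j)^2)" if "x \<in> {-R..R}" for j x
    using gauss_term_bound[OF assms, of x R] that by auto
  show "summable (\<lambda>j. exp (pi * t * R^2) * exp (- pi * t / 2) powi ((int_decode j)^2))"
    by (intro summable_mult summable_dec_gauss) (use assms in auto)
qed

lemma gauss_sum_has_sum:
  assumes "t > 0"
  shows "((\<lambda>n::int. complex_of_real (exp (- pi * t * (x + real_of_int n)^2))) has_sum gauss_sum t x) UNIV"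
proof -
  have s: "summable (\<lambda>j. norm (gauss_term t j x))"
  proof (rule summable_comparison_test')
    show "summable (\<lambda>j. exp (pi * t * \<bar>x\<bar>^2) * exp (- pi * t / 2) powi ((int_decode j)^2))"
      by (intro summable_mult summable_dec_gauss) (use assms in auto)
    show "norm (norm (gauss_term t j x)) \<le> exp (pi * t * \<bar>x\<bar>^2) * exp (- pi * t / 2) powi ((int_decode j)^2)" if "j \<ge> 0" for j
      using gauss_term_bound[OF assms, of x "\<bar>x\<bar>" j] by simp
  qed
  then have "((\<lambda>j. gauss_term t j x) has_sum gauss_sum t x) UNIV"
    unfolding gauss_sum_def using norm_summable_imp_has_sum[OF s summable_sums[OF summable_norm_cancel[OF s]]] by blast
  then show ?thesis
    using has_sum_reindex_bij_betw[OF bij_int_decode, of "\<lambda>n. complex_of_real (exp (- pi * t * (x + real_of_int n)^2))"]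
    by (simp add: gauss_term_def[abs_def])
qed

lemma gauss_sum_periodic: "t > 0 \<Longrightarrow> gauss_sum t (x + 1) = gauss_sum t x"
proof -
  assume t: "t > 0"
  have "bij (\<lambda>n::int. n + 1)" by (rule bij_betw_byWitness[where f' = "\<lambda>n. n - 1"]) auto
  from has_sum_reindex_bij_betw[OF this, of "\<lambda>n. complex_of_real (exp (- pi * t * (x + real_of_int n)^2))"] gauss_sum_has_sum[OF t, of x]
  have "((\<lambda>n::int. complex_of_real (exp (- pi * t * (x + real_of_int (n + 1))^2))) has_sum gauss_sum t x) UNIV"
    by blast
  moreover have "x + real_of_int (n + 1) = x + 1 + real_of_int n" for n by simp
  ultimately have "((\<lambda>n::int. complex_of_real (exp (- pi * t * (x + 1 + real_of_int n)^2))) has_sum gauss_sum t x) UNIV"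
    by (simp only:)
  with gauss_sum_has_sum[OF t, of "x+1"] show ?thesis using has_sum_unique by blast
qed

lemma gauss_sum_continuous:
  assumes t: "t > 0"
  shows "continuous_on UNIV (gauss_sum t)"
  unfolding continuous_on_eq_continuous_at[OF open_UNIV]
proof
  fix x :: real
  have "continuous_on {-(\<bar>x\<bar>+1)..\<bar>x\<bar>+1} (gauss_sum t)"
    by (rule uniform_limit_theorem[OF _ gauss_sum_uniform[OF t]])
       (auto intro!: always_eventually continuous_intros simp: gauss_term_def)
  then show "isCont (gauss_sum t) x"
    by (rule continuous_on_interior) auto
qed

lemma integral_Ico_Icc: "integral {a..<b} f = integral {a..b::real} (f :: real \<Rightarrow> complex)"
proof (rule integral_subset_negligible)
  have "{a..b} - {a..<b} \<subseteq> {b}" by auto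
  then show "negligible ({a..b} - {a..<b})" using negligible_subset negligible_sing by blast
qed auto

text \<open>Unfolding: the integral over a period of the sum of all translates is the integral over the
  line.\<close>

lemma gauss_sum_fourier:
  assumes t: "t > 0"
  shows "integral {0..1} (\<lambda>x. gauss_sum t x * cis (2 * pi * of_int k * x)) = of_real (exp (- pi * (of_int k)^2 / t) / sqrt t)"
proof -
  let ?u = "\<lambda>y. complex_of_real (exp (- pi * t * y^2)) * cis (2 * pi * of_int k * y)"
  have ul: "uniform_limit {0..1} (\<lambda>N x. \<Sum>j<N. gauss_term t j x) (gauss_sum t) sequentially"
    by (rule uniform_limit_on_subset[OF gauss_sum_uniform[OF t, of 1]]) auto
  have s1: "(\<lambda>j. integral {0..1} (\<lambda>x. gauss_term t j x * cis (2 * pi * of_int k * x))) sums integral {0..1} (\<lambda>x. gauss_sum t x * cis (2 * pi * of_int k * x))"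
    by (rule uniform_limit_mult_cis[OF ul]) (auto simp: gauss_term_def intro!: continuous_intros)
  let ?A = "\<lambda>j. {int_dec j..<int_dec j + 1}"
  have eq: "integral {0..1} (\<lambda>x. gauss_term t j x * cis (2 * pi * of_int k * x)) = (LINT y:?A j|lborel. ?u y)" for j
  proof -
    have si: "set_integrable lborel (?A j) ?u"
      using gauss_fourier(1)[OF t, of "of_int k"] unfolding set_integrable_def
      by (intro integrable_mult_indicator) auto
    have c: "cis (2 * pi * of_int k * x) = cis (2 * pi * of_int k * (x + int_dec j))" for x
    proof -
      have "cis (2 * pi * of_int k * (x + int_dec j)) = cis (2 * pi * of_int k * x) * cis (2 * pi * of_int (k * int_decode j))"
        by (simp add: cis_mult algebra_simps)
      then show ?thesis by (simp add: cis_multiple_2pi)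
    qed
    have "integral {0..1} (\<lambda>x. gauss_term t j x * cis (2 * pi * of_int k * x)) = integral {0..1} (\<lambda>x. ?u (x + int_dec j))"
      using c by (simp add: gauss_term_def)
    also have "\<dots> = integral {int_dec j..int_dec j + 1} ?u"
      using integral_shift_real_ivl[of "int_dec j" "int_dec j" "int_dec j + 1" ?u] by simp
    also have "\<dots> = (LINT y:?A j|lborel. ?u y)"
      using set_borel_integral_eq_integral(2)[OF si] by (simp add: integral_Ico_Icc)
    finally show ?thesis .
  qed
  have un: "(\<Union>j. ?A j) = UNIV"
  proof (intro set_eqI iffI UNIV_I)
    fix y :: real
    have "y \<in> ?A (int_encode \<lfloor>y\<rfloor>)" by (simp add: floor_correct)
    then show "y \<in> (\<Union>j. ?A j)" by blast
  qed
  have "(LINT x:(\<Union>i. ?A i)|lborel. ?u x) = (\<Sum>i. (LINT x:(?A i)|lborel. ?u x))"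
  proof (rule lebesgue_integral_countable_add)
    fix i j :: nat assume "i \<noteq> j"
    then have "int_decode i \<noteq> int_decode j" by (metis int_decode_inverse)
    then have "int_decode i + 1 \<le> int_decode j \<or> int_decode j + 1 \<le> int_decode i" by linarith
    then have "int_dec i + 1 \<le> int_dec j \<or> int_dec j + 1 \<le> int_dec i" by linarith
    then show "?A i \<inter> ?A j = {}" by auto
  qed (use gauss_fourier(1)[OF t, of "of_int k"] in \<open>auto simp: un set_integrable_def\<close>)
  then have "(LINT x|lborel. ?u x) = (\<Sum>i. (LINT x:(?A i)|lborel. ?u x))"
    unfolding un by (simp add: set_lebesgue_integral_def)
  with s1 show ?thesis unfolding eq using gauss_fourier(2)[OF t, of "of_int k"] by (simp add: sums_iff)
qed

definition dual_term :: "real \<Rightarrow> nat \<Rightarrow> real \<Rightarrow> complex" where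
  "dual_term t j x = of_real (exp (- pi * (int_dec j)^2 / t) / sqrt t) * cis (2 * pi * int_dec j * x)"

lemma dual_term_norm:
  assumes t: "t > 0"
  shows "norm (dual_term t j x) = (1 / sqrt t) * exp (- pi / t) powi ((int_decode j)^2)"
proof -
  have "exp (- pi * (int_dec j)^2 / t) = exp (- pi / t) powi ((int_decode j)^2)"
    by (simp add: exp_power_int mult.commute)
  moreover have "norm (dual_term t j x) = (1 / sqrt t) * exp (- pi * (int_dec j)^2 / t)"
    using t by (simp add: dual_term_def norm_mult norm_divide)
  ultimately show ?thesis by (simp only:)
qed

lemma dual_term_summable: "t > 0 \<Longrightarrow> summable (\<lambda>j. (1 / sqrt t) * exp (- pi / t) powi ((int_decode j)^2))"
  by (intro summable_mult summable_dec_gauss) auto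

lemma dual_sum_uniform: "t > 0 \<Longrightarrow> uniform_limit UNIV (\<lambda>N x. \<Sum>j<N. dual_term t j x) (\<lambda>x. \<Sum>j. dual_term t j x) sequentially"
  by (rule Weierstrass_m_test[OF _ dual_term_summable]) (simp_all add: dual_term_norm)

lemma integral_cis_int: "integral {0..1} (\<lambda>x. cis (2 * pi * of_int m * x)) = (if m = 0 then 1 else 0)"
proof (cases "m = 0")
  case False
  have "((\<lambda>x. cis (2 * pi * of_int m * x)) has_integral (cis (2 * pi * of_int m * 1) / (\<i> * (2 * pi * of_int m)) - cis (2 * pi * of_int m * 0) / (\<i> * (2 * pi * of_int m)))) {0..1}"
  proof (rule fundamental_theorem_of_calculus)
    fix x :: real
    have "((\<lambda>x. cis (2 * pi * of_int m * x) / (\<i> * (2 * pi * of_int m))) has_vector_derivative (2 * pi * of_int m) *\<^sub>R (\<i> * cis (2 * pi * of_int m * x)) / (\<i> * (2 * pi * of_int m))) (at x within {0..1})"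
      unfolding cis_conv_exp using False
      by (auto intro!: derivative_eq_intros has_vector_derivative_real_field simp: scaleR_conv_of_real)
    then show "((\<lambda>x. cis (2 * pi * of_int m * x) / (\<i> * (2 * pi * of_int m))) has_vector_derivative cis (2 * pi * of_int m * x)) (at x within {0..1})"
      using False by (simp add: scaleR_conv_of_real)
  qed auto
  then have "integral {0..1} (\<lambda>x. cis (2 * pi * of_int m * x)) = 0"
    using cis_multiple_2pi[of "of_int m"] by (intro integral_unique) simp
  then show ?thesis using False by simp
qed simp

lemma dual_sum_fourier:
  assumes t: "t > 0"
  shows "integral {0..1} (\<lambda>x. (\<Sum>j. dual_term t j x) * cis (2 * pi * of_int k * x)) = of_real (exp (- pi * (of_int k)^2 / t) / sqrt t)"
proof -
  have ul: "uniform_limit {0..1} (\<lambda>N x. \<Sum>j<N. dual_term t j x) (\<lambda>x. \<Sum>j. dual_term t j x) sequentially"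
    by (rule uniform_limit_on_subset[OF dual_sum_uniform[OF t]]) auto
  have s1: "(\<lambda>j. integral {0..1} (\<lambda>x. dual_term t j x * cis (2 * pi * of_int k * x))) sums integral {0..1} (\<lambda>x. (\<Sum>j. dual_term t j x) * cis (2 * pi * of_int k * x))"
    by (rule uniform_limit_mult_cis[OF ul]) (use t in \<open>auto simp: dual_term_def intro!: continuous_intros\<close>)
  define j0 where "j0 = int_encode (- k)"
  have "integral {0..1} (\<lambda>x. dual_term t j x * cis (2 * pi * of_int k * x)) =
     (if j = j0 then of_real (exp (- pi * (of_int k)^2 / t) / sqrt t) else 0)" for j
  proof -
    have "dual_term t j x * cis (2 * pi * of_int k * x) = of_real (exp (- pi * (int_dec j)^2 / t) / sqrt t) * cis (2 * pi * of_int (int_decode j + k) * x)" for x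
      by (simp add: dual_term_def mult.assoc cis_mult algebra_simps)
    moreover have "int_decode j + k = 0 \<longleftrightarrow> j = j0" unfolding j0_def
      by (metis add.commute add_eq_0_iff int_decode_inverse int_encode_inverse add.inverse_inverse)
    moreover have "int_decode j0 = - k" by (simp add: j0_def)
    moreover note integral_cis_int[of "int_decode j + k"]
    ultimately show ?thesis by (simp only: integral_mult_right) auto
  qed
  with s1 have "(\<lambda>j. if j = j0 then of_real (exp (- pi * (of_int k)^2 / t) / sqrt t) else 0) sums integral {0..1} (\<lambda>x. (\<Sum>j. dual_term t j x) * cis (2 * pi * of_int k * x))"
    by simp
  moreover have "(\<lambda>j. if j = j0 then of_real (exp (- pi * (of_int k)^2 / t) / sqrt t) else 0) sums (of_real (exp (- pi * (of_int k)^2 / t) / sqrt t) :: complex)"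
    by (rule sums_single)
  ultimately show ?thesis using sums_unique2 by blast
qed

text \<open>Both sides are continuous and periodic and have the same Fourier coefficients.\<close>

theorem poisson_gauss:
  assumes t: "t > 0" and x: "x \<in> {0..1}"
  shows "gauss_sum t x = (\<Sum>j. dual_term t j x)"
proof -
  let ?P = "\<lambda>x. (\<Sum>j. dual_term t j x)"
  let ?D = "\<lambda>x. 1 * gauss_sum t x + (- 1) * ?P x"
  have cP: "continuous_on UNIV ?P"
    by (rule uniform_limit_theorem[OF _ dual_sum_uniform[OF t]])
       (use t in \<open>auto intro!: always_eventually continuous_intros simp: dual_term_def\<close>)
  have cG: "continuous_on UNIV (gauss_sum t)" by (rule gauss_sum_continuous[OF t])
  have pp: "dual_term t j (x + 1) = dual_term t j x" for j x
  proof -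
    have "cis (2 * pi * int_dec j * (x + 1)) = cis (2 * pi * int_dec j * x) * cis (2 * pi * int_dec j)"
      by (simp add: cis_mult algebra_simps)
    then show ?thesis by (simp add: dual_term_def cis_multiple_2pi)
  qed
  have "integral {0..1} (\<lambda>x. ?D x * cis (2 * pi * of_int k * x)) = 0" for k
  proof -
    have "integral {0..1} (\<lambda>x. gauss_sum t x * cis (2 * pi * of_int k * x) - ?P x * cis (2 * pi * of_int k * x)) =
      integral {0..1} (\<lambda>x. gauss_sum t x * cis (2 * pi * of_int k * x)) - integral {0..1} (\<lambda>x. ?P x * cis (2 * pi * of_int k * x))"
      by (intro integral_diff integrable_continuous_real continuous_intros continuous_on_subset[OF cP] continuous_on_subset[OF cG]) auto
    moreover have "?D x * cis (2 * pi * of_int k * x) = gauss_sum t x * cis (2 * pi * of_int k * x) - ?P x * cis (2 * pi * of_int k * x)" for x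
      by (simp add: algebra_simps)
    ultimately show ?thesis by (simp only: gauss_sum_fourier[OF t] dual_sum_fourier[OF t] diff_self)
  qed
  then have "null_fourier ?D" unfolding null_fourier_def
    by (auto intro!: continuous_intros continuous_on_subset[OF cP] continuous_on_subset[OF cG])
  moreover have "continuous_on UNIV ?D" by (intro continuous_intros cP cG)
  ultimately have "?D x = 0"
    by (intro fourier_unique[OF _ _ _ x]) (auto simp: pp gauss_sum_periodic[OF t])
  then show ?thesis by simp
qed

section \<open>The eta function under the modular group\<close>

abbreviation upper_half :: "complex set" where "upper_half \<equiv> {\<tau>. Im \<tau> > 0}"

lemma eta_phi:
  fixes \<tau> :: complex
  shows "dedekind_eta \<tau> = exp (\<i> * (pi * \<tau> / 12)) * euler_phi (exp (2 * \<i> * (pi * \<tau>)))"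
proof -
  have "exp (2 * pi * \<i> * of_nat (Suc n) * \<tau>) = exp (2 * \<i> * (pi * \<tau>)) ^ Suc n" for n
    unfolding exp_of_nat_mult[symmetric] by (rule arg_cong[where f = exp]) (simp add: algebra_simps)
  then show ?thesis unfolding dedekind_eta_def euler_phi_def
    by (simp add: mult_ac)
qed

lemma norm_nome:
  fixes \<tau> :: complex
  assumes "Im \<tau> > 0"
  shows "norm (exp (2 * \<i> * (pi * \<tau>))) < 1"
  using assms by simp

lemma eta_nonzero:
  assumes "Im \<tau> > 0"
  shows "dedekind_eta \<tau> \<noteq> 0"
  using euler_phi_nonzero[OF norm_nome[OF assms]] by (simp add: eta_phi)

lemma open_HH: "open upper_half" by (rule open_halfspace_Im_gt)

lemma convex_HH: "convex upper_half" by (rule convex_halfspace_Im_gt)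

lemma eta_holomorphic_aux: "dedekind_eta holomorphic_on upper_half"
proof -
  have "(\<lambda>\<tau>. euler_phi (exp (2 * \<i> * (pi * \<tau>)))) holomorphic_on upper_half"
    by (rule holomorphic_on_compose_gen[OF _ euler_phi_holomorphic, unfolded o_def])
       (auto intro!: holomorphic_intros)
  then have "(\<lambda>\<tau>. exp (\<i> * (pi * \<tau> / 12)) * euler_phi (exp (2 * \<i> * (pi * \<tau>)))) holomorphic_on upper_half"
    by (intro holomorphic_intros) auto
  then show ?thesis by (simp add: eta_phi[abs_def])
qed

lemma eta_holomorphic [holomorphic_intros]:
  assumes "f holomorphic_on S" "\<And>z. z \<in> S \<Longrightarrow> Im (f z) > 0"
  shows "(\<lambda>z. dedekind_eta (f z)) holomorphic_on S"
  using holomorphic_on_compose_gen[OF assms(1) eta_holomorphic_aux] assms(2) by (auto simp: o_def)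

lemma euler_phi_cnj:
  assumes "norm q < 1"
  shows "euler_phi (cnj q) = cnj (euler_phi q)"
proof (rule LIMSEQ_unique)
  show "(\<lambda>N. \<Prod>n<N. 1 - cnj q ^ Suc n) \<longlonglongrightarrow> euler_phi (cnj q)"
    using assms by (intro euler_phi_tendsto) auto
  show "(\<lambda>N. \<Prod>n<N. 1 - cnj q ^ Suc n) \<longlonglongrightarrow> cnj (euler_phi q)"
    using tendsto_cnj[OF euler_phi_tendsto[OF assms]] by simp
qed

lemma eta_reflect: "Im \<tau> > 0 \<Longrightarrow> dedekind_eta (- cnj \<tau>) = cnj (dedekind_eta \<tau>)"
  using euler_phi_cnj[OF norm_nome[of \<tau>]] by (simp add: eta_phi exp_cnj)

text \<open>The three theta constants on the imaginary axis as Gaussian sums, so that Poisson summation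
  exchanges the first with the third and preserves the second.\<close>

definition axis_theta2 :: "real \<Rightarrow> complex" where "axis_theta2 t = gauss_sum t (1/2)"

definition axis_theta3 :: "real \<Rightarrow> complex" where "axis_theta3 t = gauss_sum t 0"

definition axis_theta4 :: "real \<Rightarrow> complex" where "axis_theta4 t = (\<Sum>j. of_real (exp (- pi * t * (int_dec j)^2)) * cis (pi * int_dec j))"

lemma nome_powi: "exp (complex_of_real x) powi n = of_real (exp (x * of_int n))"
  by (simp add: exp_power_int mult.commute flip: exp_of_real)

lemma axis_theta3_eq: "t > 0 \<Longrightarrow> axis_theta3 t = theta3 (exp (complex_of_real (- pi * t)))"
proof -
  assume t: "t > 0"
  have "((\<lambda>n::int. exp (complex_of_real (- pi * t)) powi (n^2)) has_sum axis_theta3 t) UNIV"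
    unfolding nome_powi axis_theta3_def using gauss_sum_has_sum[OF t, of 0] by simp
  then show ?thesis by (simp only: theta3_def infsumI)
qed

lemma axis_theta2_eq: "t > 0 \<Longrightarrow> axis_theta2 t = of_real (exp (- pi * t / 4)) * theta2 (exp (complex_of_real (- pi * t)))"
proof -
  assume t: "t > 0"
  have e: "complex_of_real (exp (- pi * t * (1/2 + real_of_int n)^2)) = of_real (exp (- pi * t / 4)) * exp (complex_of_real (- pi * t)) powi (n^2+n)" for n
    unfolding nome_powi of_real_mult[symmetric] exp_add[symmetric]
    by (rule arg_cong[where f = "\<lambda>x. of_real (exp x)"]) (simp add: power2_eq_square field_simps)
  have "((\<lambda>n::int. of_real (exp (- pi * t / 4)) * exp (complex_of_real (- pi * t)) powi (n^2+n)) has_sum axis_theta2 t) UNIV"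
    using gauss_sum_has_sum[OF t, of "1/2"] unfolding e axis_theta2_def .
  from has_sum_cmult_right[OF this, of "of_real (exp (pi * t / 4))"]
  have "((\<lambda>n::int. exp (complex_of_real (- pi * t)) powi (n^2+n)) has_sum of_real (exp (pi * t / 4)) * axis_theta2 t) UNIV"
    by (simp add: mult.assoc[symmetric] of_real_mult[symmetric] exp_add[symmetric] del: of_real_mult)
  then have "theta2 (exp (complex_of_real (- pi * t))) = of_real (exp (pi * t / 4)) * axis_theta2 t" by (simp only: theta2_def infsumI)
  then show ?thesis
    by (simp add: mult.assoc[symmetric] of_real_mult[symmetric] exp_add[symmetric] del: of_real_mult)
qed

lemma cis_pi_int: "cis (pi * of_int n) = (-1) powi n"
  by (metis DeMoivre2 cis_pi cis_power_int mult.commute)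

lemma axis_theta4_eq: "t > 0 \<Longrightarrow> axis_theta4 t = theta4 (exp (complex_of_real (- pi * t)))"
proof -
  assume t: "t > 0"
  define q where "q = exp (complex_of_real (- pi * t))"
  have q: "q \<noteq> 0" "norm q < 1" using t by (auto simp: q_def)
  have "((\<lambda>n::int. (-1) powi n * q powi (n^2)) has_sum theta4 q) UNIV"
    using theta4_has_sum[OF q] by (simp add: theta4_def infsumI)
  then have "((\<lambda>j. (-1) powi (int_decode j) * q powi ((int_decode j)^2)) has_sum theta4 q) UNIV"
    using has_sum_reindex_bij_betw[OF bij_int_decode, of "\<lambda>n. (-1) powi n * q powi (n^2)"] by blast
  then have "(\<lambda>j. (-1) powi (int_decode j) * q powi ((int_decode j)^2)) sums theta4 q"
    by (rule has_sum_imp_sums)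
  moreover have "(-1) powi (int_decode j) * q powi ((int_decode j)^2) = of_real (exp (- pi * t * (int_dec j)^2)) * cis (pi * int_dec j)" for j
    unfolding q_def nome_powi cis_pi_int by (simp add: mult.commute)
  ultimately show ?thesis unfolding axis_theta4_def q_def[symmetric] by (simp add: sums_iff)
qed

lemma axis_theta3_inv: "t > 0 \<Longrightarrow> axis_theta3 t = of_real (1 / sqrt t) * axis_theta3 (1/t)"
proof -
  assume t: "t > 0"
  have "axis_theta3 t = (\<Sum>j. dual_term t j 0)" unfolding axis_theta3_def using t by (intro poisson_gauss) auto
  also have "\<dots> = (\<Sum>j. of_real (1 / sqrt t) * gauss_term (1/t) j 0)"
    by (simp add: dual_term_def gauss_term_def mult.commute)
  also have "\<dots> = of_real (1 / sqrt t) * axis_theta3 (1/t)" unfolding axis_theta3_def gauss_sum_def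
    using gauss_sum_uniform[of "1/t" 1] t
    by (intro suminf_mult) (auto simp: summable_iff_convergent convergent_def dest!: tendsto_uniform_limitI[of _ _ _ _ 0])
  finally show ?thesis .
qed

lemma axis_theta2_inv: "t > 0 \<Longrightarrow> axis_theta2 t = of_real (1 / sqrt t) * axis_theta4 (1/t)"
proof -
  assume t: "t > 0"
  have "axis_theta2 t = (\<Sum>j. dual_term t j (1/2))" unfolding axis_theta2_def using t by (intro poisson_gauss) auto
  also have "\<dots> = (\<Sum>j. of_real (1 / sqrt t) * (of_real (exp (- pi * (1/t) * (int_dec j)^2)) * cis (pi * int_dec j)))"
    by (simp add: dual_term_def mult_ac)
  also have "\<dots> = of_real (1 / sqrt t) * axis_theta4 (1/t)" unfolding axis_theta4_def
  proof (rule suminf_mult)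
    have "summable (\<lambda>j. norm (dual_term (t) j (1/2)))" using dual_term_summable[OF t] by (simp add: dual_term_norm[OF t])
    then have "summable (\<lambda>j. dual_term t j (1/2))" by (rule summable_norm_cancel)
    then have "summable (\<lambda>j. of_real (sqrt t) * dual_term t j (1/2))" by (rule summable_mult)
    then show "summable (\<lambda>j. complex_of_real (exp (- pi * (1/t) * (int_dec j)^2)) * cis (pi * int_dec j))"
      using t by (simp add: dual_term_def mult_ac)
  qed
  finally show ?thesis .
qed

text \<open>The product formulas for the theta constants multiply to the cube of the eta function. The three
  factors are permuted by the inversion, which is why the cube is the accessible power.\<close>

lemma eta_cubed:
  assumes t: "t > 0"
  shows "2 * dedekind_eta (\<i> * of_real t) ^ 3 = axis_theta2 t * axis_theta3 t * axis_theta4 t"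
proof -
  define q where "q = exp (complex_of_real (- pi * t))"
  have q: "q \<noteq> 0" "norm q < 1" using t by (auto simp: q_def)
  have nz: "euler_phi q \<noteq> 0" "euler_phi (q^2) \<noteq> 0" "euler_phi (q^4) \<noteq> 0"
    using euler_phi_nonzero q norm_power2_lt_1[of q] norm_power2_lt_1[of "q^2"] by auto
  have "theta2 q * theta3 q * theta4 q = 2 * euler_phi (q^2) ^ 3"
    unfolding theta2_eq[OF q] theta3_eq[OF q] theta4_eq[OF q] using nz by (simp add: field_simps) (simp add: numeral_eq_Suc)
  moreover have "dedekind_eta (\<i> * of_real t) = of_real (exp (- pi * t / 12)) * euler_phi (q^2)"
    unfolding eta_phi q_def by (simp add: exp_of_real[symmetric] exp_of_nat_mult[symmetric] mult_ac)
  moreover have "of_real (exp (- pi * t / 12)) ^ 3 = complex_of_real (exp (- pi * t / 4))"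
    by (simp only: of_real_power[symmetric] exp_of_nat_mult[symmetric]) simp
  ultimately show ?thesis
    unfolding axis_theta2_eq[OF t] axis_theta3_eq[OF t] axis_theta4_eq[OF t] q_def[symmetric] by (simp add: power_mult_distrib mult_ac)
qed

lemma eta_imag_pos:
  assumes t: "t > 0"
  obtains x where "x > 0" "dedekind_eta (\<i> * of_real t) = of_real x"
proof -
  define r where "r = exp (- 2 * pi * t)"
  have r: "0 < r" "r < 1" using t by (auto simp: r_def)
  define P where "P = (\<lambda>N. \<Prod>n<N. 1 - r ^ Suc n)"
  have P: "(\<lambda>N. complex_of_real (P N)) \<longlonglongrightarrow> euler_phi (of_real r)"
    using euler_phi_tendsto[of "of_real r"] r by (simp add: P_def)
  have "Im (euler_phi (of_real r)) = 0"
    using euler_phi_cnj[of "of_real r"] r by (simp add: complex_eq_iff)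
  then have real: "euler_phi (of_real r) = of_real (Re (euler_phi (of_real r)))" by (simp add: complex_eq_iff)
  have "P \<longlonglongrightarrow> Re (euler_phi (of_real r))" using tendsto_Re[OF P] by simp
  moreover have "P N \<ge> 0" for N unfolding P_def using r by (intro prod_nonneg) (auto intro!: power_le_one simp del: power_Suc)
  ultimately have "Re (euler_phi (of_real r)) \<ge> 0" by (meson LIMSEQ_le_const)
  moreover have "Re (euler_phi (of_real r)) \<noteq> 0" using real euler_phi_nonzero[of "of_real r"] r by auto
  ultimately have pos: "Re (euler_phi (of_real r)) > 0" by simp
  have "dedekind_eta (\<i> * of_real t) = of_real (exp (- pi * t / 12)) * euler_phi (of_real r)"
    unfolding eta_phi r_def by (simp add: exp_of_real[symmetric] mult_ac)
  also have "\<dots> = of_real (exp (- pi * t / 12) * Re (euler_phi (of_real r)))" by (subst real) simp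
  finally show thesis using that[of "exp (- pi * t / 12) * Re (euler_phi (of_real r))"] pos by simp
qed

text \<open>Poisson summation gives the transformation of the cube; positivity on the imaginary axis removes
  the cube root.\<close>

lemma eta_inv_imag:
  assumes t: "t > 0"
  shows "dedekind_eta (\<i> * of_real (1/t)) = of_real (sqrt t) * dedekind_eta (\<i> * of_real t)"
proof -
  obtain x where x: "x > 0" "dedekind_eta (\<i> * of_real t) = of_real x" using eta_imag_pos[OF t] by blast
  obtain y where y: "y > 0" "dedekind_eta (\<i> * of_real (1/t)) = of_real y" using eta_imag_pos[of "1/t"] t by auto
  have s: "sqrt t > 0" "sqrt t ^ 2 = t" using t by auto
  have "axis_theta2 t * axis_theta3 t * axis_theta4 t * of_real (sqrt t) ^ 3 = axis_theta2 (1/t) * axis_theta3 (1/t) * axis_theta4 (1/t)"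
  proof -
    define u where "u = complex_of_real (sqrt t)"
    have u: "u \<noteq> 0" using t by (simp add: u_def)
    have i: "of_real (1 / sqrt t) = inverse u" by (simp add: u_def divide_inverse)
    have j: "of_real (1 / sqrt (1/t)) = u" by (simp add: u_def real_sqrt_divide)
    have "axis_theta2 (1/t) = u * axis_theta4 t" using axis_theta2_inv[of "1/t"] t unfolding j by simp
    moreover have "axis_theta4 (1/t) = u * axis_theta2 t" using axis_theta2_inv[OF t] u unfolding i by (simp add: field_simps)
    moreover have "axis_theta3 (1/t) = u * axis_theta3 t" using axis_theta3_inv[OF t] u unfolding i by (simp add: field_simps)
    ultimately show ?thesis unfolding u_def[symmetric] by (simp add: power3_eq_cube mult_ac)
  qed
  then have "(2 * of_real x ^ 3) * of_real (sqrt t) ^ 3 = 2 * complex_of_real y ^ 3"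
    using eta_cubed[OF t, unfolded x(2)] eta_cubed[of "1/t", unfolded y(2)] t by simp
  then have "complex_of_real (x ^ 3 * sqrt t ^ 3) = of_real (y ^ 3)" by simp
  then have "(x * sqrt t) ^ 3 = y ^ 3" by (simp only: of_real_eq_iff power_mult_distrib)
  \<comment> \<open>the cube root is unique because both sides are positive reals\<close>
  then have "x * sqrt t = y"
    by (rule power_eq_imp_eq_base) (use x(1) y(1) s(1) in \<open>simp_all add: less_imp_le\<close>)
  then have "complex_of_real y = of_real (sqrt t) * of_real x" by (metis of_real_mult mult.commute)
  then show ?thesis unfolding x(2) y(2) .
qed

lemma Im_neg_inverse: "Im (- 1 / \<tau>) = Im \<tau> / (norm \<tau>)^2"
  by (simp add: Im_divide cmod_def power2_eq_square)

text \<open>Both sides are holomorphic and agree on the imaginary axis by \<open>eta_inv_imag\<close>.\<close>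

theorem eta_S:
  assumes \<tau>: "Im \<tau> > 0"
  shows "dedekind_eta (- 1 / \<tau>) = csqrt (- \<i> * \<tau>) * dedekind_eta \<tau>"
proof -
  let ?f = "\<lambda>\<tau>. dedekind_eta (- 1 / \<tau>) - csqrt (- \<i> * \<tau>) * dedekind_eta \<tau>"
  have "?f holomorphic_on upper_half"
  proof (intro holomorphic_intros)
    fix z assume z: "z \<in> upper_half"
    then have "z \<noteq> 0" by auto
    then show "0 < Im (- 1 / z)" using z unfolding Im_neg_inverse by (auto intro!: divide_pos_pos)
    show "- \<i> * z \<notin> \<real>\<^sub>\<le>\<^sub>0" using z by (auto simp: complex_nonpos_Reals_iff)
  qed auto
  \<comment> \<open>a segment of the imaginary axis suffices for the identity theorem\<close>
  moreover define U where "U = (\<lambda>t. \<i> * of_real t) ` {1..2::real}"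
  moreover have "U \<subseteq> upper_half" by (auto simp: U_def)
  moreover have "\<i> islimpt U"
  proof -
    have "\<i> islimpt closed_segment \<i> (2 * \<i>)"
    proof -
      have "closed_segment \<i> (2 * \<i>) \<noteq> {a}" for a
      proof
        assume "closed_segment \<i> (2 * \<i>) = {a}"
        moreover have "\<i> \<in> closed_segment \<i> (2 * \<i>)" "2 * \<i> \<in> closed_segment \<i> (2 * \<i>)"
          by (rule ends_in_segment)+
        ultimately have "\<i> \<in> {a}" "2 * \<i> \<in> {a}" by blast+
        then show False by (auto simp: complex_eq_iff)
      qed
      then show ?thesis
        by (rule connected_imp_perfect[OF connected_segment(1) ends_in_segment(1)])
    qed
    moreover have "closed_segment \<i> (2 * \<i>) = U"
      unfolding U_def closed_segment_def
    proof (intro set_eqI iffI; clarsimp)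
      fix u :: real assume "0 \<le> u" "u \<le> 1"
      then show "(1 - u) *\<^sub>R \<i> + u *\<^sub>R (2 * \<i>) \<in> (\<lambda>x. \<i> * complex_of_real x) ` {1..2}"
        by (intro image_eqI[of _ _ "1 + u"]) (auto simp: complex_eq_iff)
    next
      fix x :: real assume "1 \<le> x" "x \<le> 2"
      then show "\<exists>u. \<i> * complex_of_real x = (1 - u) *\<^sub>R \<i> + u *\<^sub>R (2 * \<i>) \<and> 0 \<le> u \<and> u \<le> 1"
        by (intro exI[of _ "x - 1"]) (auto simp: complex_eq_iff)
    qed
    ultimately show ?thesis by simp
  qed
  moreover have "?f z = 0" if "z \<in> U" for z
  proof -
    from that obtain t where t: "z = \<i> * of_real t" "t \<ge> 1" by (auto simp: U_def)
    have "- 1 / z = \<i> * of_real (1/t)" using t by (simp add: field_simps)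
    moreover have "csqrt (- \<i> * z) = of_real (sqrt t)" using t by (simp add: csqrt_of_real_nonneg)
    ultimately show ?thesis using eta_inv_imag[of t] t by simp
  qed
  ultimately have "?f \<tau> = 0"
    using \<tau> by (intro analytic_continuation[of ?f upper_half U \<i> \<tau>]) (auto simp: open_HH convex_connected convex_HH)
  then show ?thesis by simp
qed

section \<open>Eta quotients of weight three\<close>

definition zeta :: complex where "zeta = cis (pi / 24)"

lemma zeta_nonzero [simp]: "zeta \<noteq> 0" by (simp add: zeta_def)

lemma norm_zeta [simp]: "norm zeta = 1" by (simp add: zeta_def)

lemma zeta_powi: "zeta powi n = cis (pi * of_int n / 24)"
  by (simp add: zeta_def cis_power_int mult.commute)

lemma eta_T: "dedekind_eta (\<tau> + 1) = zeta ^ 2 * dedekind_eta \<tau>"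
proof -
  have "exp (2 * \<i> * (pi * (\<tau> + 1))) = exp (2 * \<i> * (pi * \<tau>))"
    by (simp add: algebra_simps exp_add)
  moreover have "exp (\<i> * (pi * (\<tau> + 1) / 12)) = zeta ^ 2 * exp (\<i> * (pi * \<tau> / 12))"
    by (simp add: zeta_def cis_conv_exp exp_of_nat_mult[symmetric] exp_add[symmetric] algebra_simps add_divide_distrib)
  ultimately show ?thesis by (simp add: eta_phi)
qed

text \<open>The translation by 1 leaves the family of functions \<open>dedekind_eta (\<tau>/2)\<close>,
  \<open>dedekind_eta \<tau>\<close>, \<open>dedekind_eta (2 * \<tau>)\<close> only apparently: the new
  argument is a product of the old ones. This makes the family of eta quotients below closed under the
  modular group.\<close>

lemma eta_T_half:
  assumes "Im \<tau> > 0"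
  shows "dedekind_eta ((\<tau> + 1) / 2) = zeta * dedekind_eta \<tau> ^ 3 / (dedekind_eta (\<tau>/2) * dedekind_eta (2 * \<tau>))"
proof -
  define p where "p = exp (\<i> * (pi * \<tau>))"
  have p: "norm p < 1" using assms by (simp add: p_def)
  define u where "u = exp (\<i> * (pi * \<tau> / 24))"
  have 1: "exp (2 * \<i> * (pi * ((\<tau> + 1) / 2))) = - p"
    by (simp add: p_def algebra_simps add_divide_distrib exp_add)
  have 2: "exp (2 * \<i> * (pi * (\<tau> / 2))) = p" by (simp add: p_def)
  have 3: "exp (2 * \<i> * (pi * \<tau>)) = p^2" by (simp add: p_def exp_of_nat_mult[symmetric] mult.assoc)
  have 4: "exp (2 * \<i> * (pi * (2 * \<tau>))) = p^4" by (simp add: p_def exp_of_nat_mult[symmetric])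
  have e1: "exp (\<i> * (pi * ((\<tau> + 1) / 2) / 12)) = zeta * u"
    by (simp add: zeta_def u_def cis_conv_exp exp_add[symmetric] algebra_simps add_divide_distrib)
  have e2: "exp (\<i> * (pi * (\<tau> / 2) / 12)) = u" by (simp add: u_def mult_ac)
  have e3: "exp (\<i> * (pi * \<tau> / 12)) = u^2" by (simp add: u_def exp_of_nat_mult[symmetric] mult_ac)
  have e4: "exp (\<i> * (pi * (2 * \<tau>) / 12)) = u^4" by (simp add: u_def exp_of_nat_mult[symmetric] mult_ac)
  have nz: "euler_phi p \<noteq> 0" "euler_phi (p^2) \<noteq> 0" "euler_phi (p^4) \<noteq> 0" "u \<noteq> 0"
    using euler_phi_nonzero p norm_power2_lt_1[of p] norm_power2_lt_1[of "p^2"] by (auto simp: u_def)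
  have m: "euler_phi (-p) = euler_phi (p^2) ^ 3 / (euler_phi p * euler_phi (p^4))"
    using euler_phi_minus[OF p] nz by (simp add: field_simps)
  show ?thesis unfolding eta_phi 1 2 3 4 e1 e2 e3 e4 m using nz
    by (simp add: field_simps) (simp add: numeral_eq_Suc)
qed

text \<open>The exponents add up to 6, so the weight is 3. In the exponents \<open>(a, c)\<close> the
  generators of the modular group act by \<open>(a, c) \<mapsto> (c, a)\<close> and \<open>(a, c) \<mapsto>
  (- a, c - a)\<close>, through a group isomorphic to the symmetric group on three letters.\<close>

definition eta_quot :: "int \<Rightarrow> int \<Rightarrow> complex \<Rightarrow> complex" where
  "eta_quot a c \<tau> = dedekind_eta (\<tau>/2) powi a * dedekind_eta \<tau> powi (6 - a - c) * dedekind_eta (2 * \<tau>) powi c"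

lemma eta_quot_nonzero: "Im \<tau> > 0 \<Longrightarrow> eta_quot a c \<tau> \<noteq> 0"
  by (auto simp: eta_quot_def eta_nonzero)

lemma eta_quot_holomorphic: "eta_quot a c holomorphic_on upper_half"
  unfolding eta_quot_def[abs_def] by (intro holomorphic_intros) (auto simp: eta_nonzero)

lemma eta_quot_reflect: "Im \<tau> > 0 \<Longrightarrow> eta_quot a c (- cnj \<tau>) = cnj (eta_quot a c \<tau>)"
  using eta_reflect[of \<tau>] eta_reflect[of "\<tau>/2"] eta_reflect[of "2*\<tau>"]
  by (simp add: eta_quot_def)

lemma csqrt_real_mult: "r > 0 \<Longrightarrow> csqrt (of_real r * z) = of_real (sqrt r) * csqrt z"
proof -
  assume r: "r > 0"
  show ?thesis
  proof (rule csqrt_unique)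
    show "(of_real (sqrt r) * csqrt z)^2 = of_real r * z"
      using r by (simp add: power_mult_distrib flip: of_real_power)
    show "0 < Re (of_real (sqrt r) * csqrt z) \<or> Re (of_real (sqrt r) * csqrt z) = 0 \<and> 0 \<le> Im (of_real (sqrt r) * csqrt z)"
      using csqrt_principal[of z] r by auto
  qed
qed

lemma eta_quot_S:
  assumes "Im \<tau> > 0"
  shows "eta_quot a c (- 1 / \<tau>) = (- \<i> * \<tau>) ^ 3 * of_real (sqrt 2) powi (a - c) * eta_quot c a \<tau>"
proof -
  define w where "w = csqrt (- \<i> * \<tau>)"
  have w: "w \<noteq> 0" using assms by (auto simp: w_def)
  have w6: "w powi 6 = (- \<i> * \<tau>) ^ 3"
  proof -
    have "w powi 6 = (w^2)^3" by (simp add: power_mult[symmetric])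
    then show ?thesis by (simp add: w_def)
  qed
  define r where "r = complex_of_real (sqrt 2)"
  have r: "r \<noteq> 0" "r^2 = 2" by (auto simp: r_def simp flip: of_real_power)
  have 1: "dedekind_eta (- 1 / \<tau> / 2) = r * w * dedekind_eta (2 * \<tau>)"
    using eta_S[of "2 * \<tau>"] csqrt_real_mult[of 2 "- \<i> * \<tau>"] assms by (simp add: w_def r_def mult_ac)
  have 2: "dedekind_eta (2 * (- 1 / \<tau>)) = (w / r) * dedekind_eta (\<tau>/2)"
    using eta_S[of "\<tau>/2"] csqrt_real_mult[of "1/2" "- \<i> * \<tau>"] assms by (simp add: w_def r_def real_sqrt_divide)
  have 3: "dedekind_eta (- 1 / \<tau>) = w * dedekind_eta \<tau>" using eta_S[OF assms] by (simp add: w_def)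
  have "eta_quot a c (- 1 / \<tau>) = (w powi a * w powi (6 - a - c) * w powi c) * (r powi a / r powi c) * eta_quot c a \<tau>"
    unfolding eta_quot_def 1 2 3 by (simp add: power_int_mult_distrib power_int_divide_distrib algebra_simps)
  also have "w powi a * w powi (6 - a - c) * w powi c = w powi 6"
    using w by (simp add: power_int_add[symmetric])
  also have "r powi a / r powi c = r powi (a - c)" using r by (simp add: power_int_diff)
  finally show ?thesis unfolding w6 r_def .
qed

lemma eta_quot_T:
  assumes "Im \<tau> > 0"
  shows "eta_quot a c (\<tau> + 1) = zeta powi (12 - a + 2 * c) * eta_quot (-a) (c - a) \<tau>"
proof -
  define x y z where "x = dedekind_eta (\<tau>/2)" and "y = dedekind_eta \<tau>" and "z = dedekind_eta (2 * \<tau>)"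
  have nz: "x \<noteq> 0" "y \<noteq> 0" "z \<noteq> 0" using assms by (auto simp: x_def y_def z_def eta_nonzero)
  have 1: "dedekind_eta ((\<tau> + 1) / 2) = zeta * (y powi 3 * x powi -1 * z powi -1)"
    using eta_T_half[OF assms] by (simp add: x_def y_def z_def field_simps)
  have 2: "dedekind_eta (\<tau> + 1) = zeta powi 2 * y" by (simp add: eta_T y_def)
  have 3: "dedekind_eta (2 * (\<tau> + 1)) = zeta powi 4 * z"
    using eta_T[of "2 * \<tau>"] eta_T[of "2 * \<tau> + 1"] by (simp add: z_def algebra_simps)
  have "eta_quot a c (\<tau> + 1) = zeta powi (a + 2 * (6 - a - c) + 4 * c) * (x powi (-a) * y powi (3 * a + (6 - a - c)) * z powi (c - a))"
  proof -
    have p1: "(zeta * (y powi 3 * x powi -1 * z powi -1)) powi a = zeta powi a * (y powi (3 * a) * x powi (-a) * z powi (-a))"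
      by (simp only: power_int_mult_distrib power_int_mult[symmetric]) simp
    have p2: "(zeta powi 2 * y) powi (6 - a - c) = zeta powi (2 * (6 - a - c)) * y powi (6 - a - c)"
      by (simp only: power_int_mult_distrib power_int_mult[symmetric])
    have p3: "(zeta powi 4 * z) powi c = zeta powi (4 * c) * z powi c"
      by (simp only: power_int_mult_distrib power_int_mult[symmetric])
    have "z powi (-a) * z powi c = z powi (c - a)" using nz by (simp add: power_int_add[symmetric])
    moreover have "y powi (3 * a) * y powi (6 - a - c) = y powi (3 * a + (6 - a - c))" by (rule power_int_add[symmetric]) (use nz in simp)
    moreover have "zeta powi a * zeta powi (2 * (6 - a - c)) * zeta powi (4 * c) = zeta powi (a + 2 * (6 - a - c) + 4 * c)"
      by (simp only: power_int_add[OF disjI1[OF zeta_nonzero]])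
    moreover have "eta_quot a c (\<tau> + 1) = (zeta powi a * zeta powi (2 * (6 - a - c)) * zeta powi (4 * c)) * (x powi (-a) * (y powi (3 * a) * y powi (6 - a - c)) * (z powi (-a) * z powi c))"
      unfolding eta_quot_def 1 2 3 p1 p2 p3 by (simp only: mult_ac)
    ultimately show ?thesis by simp
  qed
  also have "a + 2 * (6 - a - c) + 4 * c = 12 - a + 2 * c" by simp
  also have "3 * a + (6 - a - c) = 6 - (-a) - (c - a)" by simp
  finally show ?thesis by (simp add: eta_quot_def x_def y_def z_def)
qed

lemma euler_phi_powi_bounded:
  assumes "\<rho> < 1"
  obtains C where "C \<ge> 1" "\<And>q n. norm q \<le> \<rho> \<Longrightarrow> norm (euler_phi q powi n) \<le> C powi \<bar>n\<bar>"
proof -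
  have sub: "cball 0 \<rho> \<subseteq> ball 0 (1::real)" using assms by auto
  have c: "continuous_on (cball 0 \<rho>) euler_phi"
    using holomorphic_on_imp_continuous_on[OF euler_phi_holomorphic] continuous_on_subset assms
    by (metis (no_types, lifting) cball_subset_ball_iff dist_self add_0 )
  have nz: "euler_phi q \<noteq> 0" if "q \<in> cball 0 \<rho>" for q
    using euler_phi_nonzero that assms by auto
  have "bounded (euler_phi ` cball 0 \<rho>)" using c by (intro compact_imp_bounded compact_continuous_image) auto
  then obtain A where A: "\<forall>q\<in>cball 0 \<rho>. norm (euler_phi q) \<le> A" by (auto simp: bounded_iff)
  have "bounded ((\<lambda>q. inverse (euler_phi q)) ` cball 0 \<rho>)"
    using c nz by (intro compact_imp_bounded compact_continuous_image continuous_intros) auto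
  then obtain B where B: "\<forall>q\<in>cball 0 \<rho>. norm (inverse (euler_phi q)) \<le> B" by (auto simp: bounded_iff)
  define C where "C = max 1 (max A B)"
  show thesis
  proof (rule that[of C])
    fix q :: complex and n :: int assume q: "norm q \<le> \<rho>"
    then have AC: "norm (euler_phi q) \<le> C" "norm (inverse (euler_phi q)) \<le> C" using bspec[OF A, of q] bspec[OF B, of q] by (auto simp: C_def)
    show "norm (euler_phi q powi n) \<le> C powi \<bar>n\<bar>"
    proof (cases "n \<ge> 0")
      case True
      then obtain k where "n = int k" using nonneg_int_cases by blast
      then show ?thesis using AC by (simp add: norm_power power_mono)
    next
      case False
      then obtain k where "n = - int k" by (cases n rule: int_cases2) auto
      moreover have "norm (inverse (euler_phi q) ^ k) \<le> C ^ k" unfolding norm_power using AC by (intro power_mono) auto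
      ultimately show ?thesis by (simp add: power_int_minus power_inverse)
    qed
  qed (simp add: C_def)
qed

text \<open>The exponential factor displays the order of vanishing \<open>(12 - a + 2 * c) / 48\<close> at
  infinity; the remaining factors stay bounded.\<close>

lemma eta_quot_norm:
  fixes \<tau> :: complex
  shows "norm (eta_quot a c \<tau>) = exp (- (pi / 24) * of_int (12 - a + 2 * c) * Im \<tau>) *
     (norm (euler_phi (exp (2 * \<i> * (pi * (\<tau>/2)))) powi a) * norm (euler_phi (exp (2 * \<i> * (pi * \<tau>))) powi (6 - a - c)) * norm (euler_phi (exp (2 * \<i> * (pi * (2 * \<tau>)))) powi c))"
proof -
  have n: "norm (exp (\<i> * (pi * z / 12)) powi k) = exp (- (pi / 12) * Im z * of_int k)" for z :: complex and k :: int
    by (simp add: norm_power_int exp_power_int mult_ac)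
  have "norm (eta_quot a c \<tau>) = (exp (- (pi / 12) * Im (\<tau>/2) * of_int a) * exp (- (pi / 12) * Im \<tau> * of_int (6 - a - c)) * exp (- (pi / 12) * Im (2 * \<tau>) * of_int c)) *
     (norm (euler_phi (exp (2 * \<i> * (pi * (\<tau>/2)))) powi a) * norm (euler_phi (exp (2 * \<i> * (pi * \<tau>))) powi (6 - a - c)) * norm (euler_phi (exp (2 * \<i> * (pi * (2 * \<tau>)))) powi c))"
    unfolding eta_quot_def eta_phi power_int_mult_distrib norm_mult n by (simp only: mult_ac)
  also have "exp (- (pi / 12) * Im (\<tau>/2) * of_int a) * exp (- (pi / 12) * Im \<tau> * of_int (6 - a - c)) * exp (- (pi / 12) * Im (2 * \<tau>) * of_int c)
     = exp (- (pi / 24) * of_int (12 - a + 2 * c) * Im \<tau>)"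
    unfolding exp_add[symmetric] by (rule arg_cong[where f = exp]) (simp add: field_simps)
  finally show ?thesis .
qed

lemma eta_quot_decay:
  obtains C where "C > 0" "\<And>\<tau>. Im \<tau> \<ge> 1/2 \<Longrightarrow> norm (eta_quot a c \<tau>) \<le> C * exp (- (pi / 24) * of_int (12 - a + 2 * c) * Im \<tau>)"
proof -
  obtain C where C: "C \<ge> 1" "\<And>q n. norm q \<le> exp (- pi / 2) \<Longrightarrow> norm (euler_phi q powi n) \<le> C powi \<bar>n\<bar>"
    using euler_phi_powi_bounded[of "exp (- pi / 2)"] by auto
  show thesis
  proof (rule that[of "C powi \<bar>a\<bar> * C powi \<bar>6 - a - c\<bar> * C powi \<bar>c\<bar>"])
    show "0 < C powi \<bar>a\<bar> * C powi \<bar>6 - a - c\<bar> * C powi \<bar>c\<bar>" using C by simp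
    fix \<tau> :: complex assume t: "Im \<tau> \<ge> 1/2"
    have "norm (euler_phi (exp (2 * \<i> * (pi * (\<tau>/2)))) powi a) * norm (euler_phi (exp (2 * \<i> * (pi * \<tau>))) powi (6 - a - c)) * norm (euler_phi (exp (2 * \<i> * (pi * (2 * \<tau>)))) powi c)
       \<le> C powi \<bar>a\<bar> * C powi \<bar>6 - a - c\<bar> * C powi \<bar>c\<bar>"
      using t C(1) by (intro mult_mono C(2)) (auto intro!: mult_nonneg_nonneg)
    from mult_left_mono[OF this, of "exp (- (pi / 24) * of_int (12 - a + 2 * c) * Im \<tau>)"]
    show "norm (eta_quot a c \<tau>) \<le> C powi \<bar>a\<bar> * C powi \<bar>6 - a - c\<bar> * C powi \<bar>c\<bar> * exp (- (pi / 24) * of_int (12 - a + 2 * c) * Im \<tau>)"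
      unfolding eta_quot_norm by (simp add: mult_ac)
  qed
qed

section \<open>Growth of eta quotients towards the cusps\<close>

lemma exp_ge_term:
  fixes x :: real assumes "x \<ge> 0"
  shows "x ^ n / fact n \<le> exp x"
proof -
  have "(\<Sum>i\<in>{n}. inverse (fact i) * x ^ i) \<le> (\<Sum>i. inverse (fact i) * x ^ i)"
    by (rule sum_le_suminf[OF summable_exp]) (use assms in auto)
  then show ?thesis by (simp add: exp_def divide_inverse mult.commute)
qed

text \<open>Every point of the upper half-plane is carried to \<open>Im \<tau> \<ge> 1/2\<close> by
  translations and inversions. This replaces a fundamental domain.\<close>

lemma modular_induct:
  assumes base: "\<And>\<tau>. Im \<tau> \<ge> 1/2 \<Longrightarrow> P \<tau>"
    and T: "\<And>\<tau>. Im \<tau> > 0 \<Longrightarrow> P (\<tau> + 1) \<longleftrightarrow> P \<tau>"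
    and S: "\<And>\<tau>. Im \<tau> > 0 \<Longrightarrow> P (- 1 / \<tau>) \<Longrightarrow> P \<tau>"
    and \<tau>: "Im \<tau> > 0"
  shows "P \<tau>"
proof -
  have Tn: "P (\<tau> + of_int n) \<longleftrightarrow> P \<tau>" if "Im \<tau> > 0" for \<tau> n
  proof (induction n rule: int_induct[where k = 0])
    case (step1 i)
    then show ?case using T[of "\<tau> + of_int i"] that by (simp add: add.assoc)
  next
    case (step2 i)
    then show ?case using T[of "\<tau> + of_int i - 1"] that by (simp add: add_diff_eq)
  qed simp
  have "P \<tau>" if "Im \<tau> > 0" "Im \<tau> * 2 ^ n \<ge> 1/2" for n \<tau>
    using that
  proof (induction n arbitrary: \<tau>)
    case 0
    then show ?case by (intro base) simp
  next
    case (Suc n)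
    \<comment> \<open>with \<open>Re\<close> reduced to at most \<open>1/2\<close> and \<open>Im < 1/2\<close>, the inversion at least doubles the imaginary part\<close>
    define \<sigma> where "\<sigma> = \<tau> + of_int (- round (Re \<tau>))"
    have im: "Im \<sigma> = Im \<tau>" by (simp add: \<sigma>_def)
    have re: "\<bar>Re \<sigma>\<bar> \<le> 1/2" using of_int_round_abs_le[of "Re \<tau>"] by (simp add: \<sigma>_def abs_minus_commute)
    have "P \<sigma>"
    proof (cases "Im \<sigma> \<ge> 1/2")
      case True
      then show ?thesis by (rule base)
    next
      case False
      have n0: "norm \<sigma> > 0" using Suc.prems(1) im by auto
      have "(Re \<sigma>)^2 \<le> (1/2)^2" using re by (metis abs_le_square_iff abs_of_nonneg zero_le_divide_1_iff zero_le_numeral)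
      moreover have "(Im \<sigma>)^2 \<le> (1/2)^2" using False Suc.prems(1) im by (intro power_mono) auto
      ultimately have n2: "(norm \<sigma>)^2 \<le> 1/2" by (simp add: cmod_power2 power_divide)
      have I: "Im (- 1 / \<sigma>) \<ge> 2 * Im \<sigma>"
      proof -
        have "2 * Im \<sigma> = Im \<sigma> / (1/2)" by simp
        also have "\<dots> \<le> Im \<sigma> / (norm \<sigma>)^2" using n0 n2 im Suc.prems(1) by (intro divide_left_mono) auto
        finally show ?thesis by (simp only: Im_neg_inverse)
      qed
      have "Im (- 1 / \<sigma>) * 2 ^ n \<ge> 2 * Im \<sigma> * 2 ^ n" using I by (intro mult_right_mono) auto
      then have "Im (- 1 / \<sigma>) * 2 ^ n \<ge> 1/2" using Suc.prems(2) im by simp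
      then have "P (- 1 / \<sigma>)" using I Suc.prems(1) im by (intro Suc.IH) auto
      then show ?thesis using S Suc.prems(1) im by simp
    qed
    then show ?case using Tn[of \<tau> "- round (Re \<tau>)"] Suc.prems(1) by (simp add: \<sigma>_def)
  qed
  moreover obtain n where "1 / (2 * Im \<tau>) < 2 ^ n" using real_arch_pow[of 2 "1 / (2 * Im \<tau>)"] by auto
  then have "Im \<tau> * 2 ^ n \<ge> 1/2" using \<tau> by (simp add: field_simps)
  ultimately show ?thesis using \<tau> by blast
qed

text \<open>Positive order at the three cusps of the level two congruence subgroup; the three numbers are
  proportional to the orders at infinity of the functions \<open>eta_quot\<close> for the images of
  \<open>(a, c)\<close>.\<close>

definition cuspidal :: "int \<Rightarrow> int \<Rightarrow> bool" where
  "cuspidal a c \<longleftrightarrow> 12 - a + 2 * c > 0 \<and> 12 + 2 * a - c > 0 \<and> 12 - a - c > 0"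

lemma cuspidal_S: "cuspidal a c \<Longrightarrow> cuspidal c a" and cuspidal_T: "cuspidal a c \<Longrightarrow> cuspidal (-a) (c - a)"
  by (auto simp: cuspidal_def)

definition s3_orbit :: "int \<Rightarrow> int \<Rightarrow> (int \<times> int) set" where
  "s3_orbit a c = {(a,c), (c,a), (-a,c-a), (c-a,-a), (-c,a-c), (a-c,-c)}"

lemma s3_orbit_S: "(x,y) \<in> s3_orbit a c \<Longrightarrow> (y,x) \<in> s3_orbit a c"
  unfolding s3_orbit_def by blast

lemma s3_orbit_T: "(x,y) \<in> s3_orbit a c \<Longrightarrow> (-x,y-x) \<in> s3_orbit a c"
  unfolding s3_orbit_def insert_iff prod.inject by (elim disjE) simp_all

lemma s3_orbit_cusp: "(x,y) \<in> s3_orbit a c \<Longrightarrow> cuspidal a c \<Longrightarrow> cuspidal x y"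
  unfolding s3_orbit_def insert_iff prod.inject by (elim disjE) (simp_all add: cuspidal_def)

text \<open>The Petersson norm, with a power of 2 that compensates the factor of the inversion; with this
  weight it is permuted along the orbit by the whole modular group.\<close>

definition petersson :: "int \<Rightarrow> int \<Rightarrow> complex \<Rightarrow> real" where
  "petersson a c \<tau> = 2 powr (of_int (2 * c - a) / 3) * (norm (eta_quot a c \<tau>))^2 * Im \<tau> ^ 3"

lemma petersson_T: "Im \<tau> > 0 \<Longrightarrow> petersson a c (\<tau> + 1) = petersson (-a) (c - a) \<tau>"
  by (simp add: petersson_def eta_quot_T norm_mult norm_power_int)

lemma petersson_S: assumes "Im \<tau> > 0" shows "petersson a c (- 1 / \<tau>) = petersson c a \<tau>"
proof -
  have n: "norm \<tau> > 0" using assms by auto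
  have "(norm (eta_quot a c (- 1 / \<tau>)))^2 = (norm \<tau>)^6 * 2 powr of_int (a - c) * (norm (eta_quot c a \<tau>))^2"
  proof -
    have "(sqrt 2 powi (a - c))^2 = 2 powr of_int (a - c)"
    proof -
      have "(sqrt 2 powi (a - c))^2 = (sqrt 2 ^ 2) powi (a - c)"
        by (simp only: power_int_mult_distrib power2_eq_square)
      then show ?thesis using powr_real_of_int'[of 2 "a - c"] by simp
    qed
    then show ?thesis unfolding eta_quot_S[OF assms]
      by (simp add: norm_mult norm_power norm_power_int power_mult_distrib power_mult[symmetric])
  qed
  moreover have p: "2 powr (of_int (2 * c - a) / 3) * 2 powr of_int (a - c) = (2 powr (of_int (2 * a - c) / 3) :: real)"
    by (simp add: powr_add[symmetric] field_simps)
  moreover have i: "Im (- 1 / \<tau>) ^ 3 * (norm \<tau>)^6 = Im \<tau> ^ 3"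
    unfolding Im_neg_inverse using n by (simp add: power_divide power_mult[symmetric])
  ultimately have "petersson a c (- 1 / \<tau>) = 2 powr (of_int (2 * c - a) / 3) * ((norm \<tau>)^6 * 2 powr of_int (a - c) * (norm (eta_quot c a \<tau>))^2) * Im (- 1 / \<tau>) ^ 3"
    by (simp only: petersson_def)
  also have "\<dots> = (2 powr (of_int (2 * c - a) / 3) * 2 powr of_int (a - c)) * (norm (eta_quot c a \<tau>))^2 * (Im (- 1 / \<tau>) ^ 3 * (norm \<tau>)^6)"
    by (simp only: mult_ac)
  finally show ?thesis by (simp only: p i petersson_def)
qed

lemma cube_exp_bound:
  fixes k y :: real assumes "k > 0" "y \<ge> 0"
  shows "y ^ 3 * exp (- k * y) \<le> 6 / k ^ 3"
proof -
  have "(k * y) ^ 3 / fact 3 \<le> exp (k * y)" by (rule exp_ge_term) (use assms in auto)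
  then have "k ^ 3 * y ^ 3 * exp (- k * y) \<le> 6"
    by (simp add: fact_numeral power_mult_distrib exp_minus field_simps)
  then show ?thesis using assms by (simp add: field_simps)
qed

text \<open>The six norms are bounded for \<open>Im \<tau> \<ge> 1/2\<close> and permuted by the modular
  group, so the bound spreads to the half-plane.\<close>

lemma petersson_bounded:
  assumes "cuspidal a c"
  obtains B where "\<And>\<tau>. Im \<tau> > 0 \<Longrightarrow> petersson a c \<tau> \<le> B"
proof -
  have ex: "\<exists>B. \<forall>\<tau>. Im \<tau> \<ge> 1/2 \<longrightarrow> petersson x y \<tau> \<le> B" if "cuspidal x y" for x y
  proof -
    obtain C where C: "C > 0" "\<And>\<tau>. Im \<tau> \<ge> 1/2 \<Longrightarrow> norm (eta_quot x y \<tau>) \<le> C * exp (- (pi / 24) * of_int (12 - x + 2 * y) * Im \<tau>)"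
      using eta_quot_decay[of x y] by blast
    define k where "k = (pi / 24) * of_int (12 - x + 2 * y) * 2"
    have k: "k > 0" using that by (simp add: k_def cuspidal_def)
    have "petersson x y \<tau> \<le> 2 powr (of_int (2 * y - x) / 3) * (C^2 * (6 / k^3))" if t: "Im \<tau> \<ge> 1/2" for \<tau>
    proof -
      have "(norm (eta_quot x y \<tau>))^2 \<le> (C * exp (- (pi / 24) * of_int (12 - x + 2 * y) * Im \<tau>))^2"
        by (intro power_mono C t) auto
      also have "\<dots> = C^2 * exp (- k * Im \<tau>)"
        by (simp add: power_mult_distrib exp_of_nat_mult[symmetric] k_def algebra_simps)
      finally have "(norm (eta_quot x y \<tau>))^2 * Im \<tau> ^ 3 \<le> C^2 * exp (- k * Im \<tau>) * Im \<tau> ^ 3"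
        using t by (intro mult_right_mono) auto
      also have "\<dots> = C^2 * (Im \<tau> ^ 3 * exp (- k * Im \<tau>))" by simp
      also have "\<dots> \<le> C^2 * (6 / k^3)" using t k by (intro mult_left_mono cube_exp_bound) auto
      finally show ?thesis unfolding petersson_def mult.assoc by (intro mult_left_mono) auto
    qed
    then show ?thesis by blast
  qed
  have "\<forall>p\<in>s3_orbit a c. \<exists>B. \<forall>\<tau>. Im \<tau> \<ge> 1/2 \<longrightarrow> petersson (fst p) (snd p) \<tau> \<le> B"
    using ex s3_orbit_cusp assms by (metis prod.collapse)
  then obtain B where B: "\<And>p \<tau>. p \<in> s3_orbit a c \<Longrightarrow> Im \<tau> \<ge> 1/2 \<Longrightarrow> petersson (fst p) (snd p) \<tau> \<le> B p" by metis
  define M where "M = Max (B ` s3_orbit a c)"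
  have fin: "finite (s3_orbit a c)" by (simp add: s3_orbit_def)
  have "\<forall>x y. (x,y) \<in> s3_orbit a c \<longrightarrow> petersson x y \<tau> \<le> M" if "Im \<tau> > 0" for \<tau>
    using _ _ _ that
  proof (rule modular_induct)
    fix \<tau> :: complex assume t: "Im \<tau> \<ge> 1/2"
    show "\<forall>x y. (x,y) \<in> s3_orbit a c \<longrightarrow> petersson x y \<tau> \<le> M"
    proof (intro allI impI)
      fix x y assume xy: "(x,y) \<in> s3_orbit a c"
      then have "petersson x y \<tau> \<le> B (x,y)" using B[of "(x,y)" \<tau>] t by simp
      also have "\<dots> \<le> M" unfolding M_def using fin xy by (intro Max_ge) auto
      finally show "petersson x y \<tau> \<le> M" .
    qed
  next
    fix \<tau> :: complex assume t: "Im \<tau> > 0"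
    show "(\<forall>x y. (x,y) \<in> s3_orbit a c \<longrightarrow> petersson x y (\<tau> + 1) \<le> M) \<longleftrightarrow> (\<forall>x y. (x,y) \<in> s3_orbit a c \<longrightarrow> petersson x y \<tau> \<le> M)"
      using s3_orbit_T[of _ _ a c] unfolding petersson_T[OF t] by (metis (no_types, lifting) add.inverse_inverse diff_add_cancel diff_minus_eq_add)
  next
    fix \<tau> :: complex assume t: "Im \<tau> > 0" and "\<forall>x y. (x,y) \<in> s3_orbit a c \<longrightarrow> petersson x y (- 1 / \<tau>) \<le> M"
    then show "\<forall>x y. (x,y) \<in> s3_orbit a c \<longrightarrow> petersson x y \<tau> \<le> M"
      unfolding petersson_S[OF t] using s3_orbit_S by blast
  qed
  then have "petersson a c \<tau> \<le> M" if "Im \<tau> > 0" for \<tau>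
    using that by (auto simp: s3_orbit_def)
  then show thesis using that by blast
qed

text \<open>The bound for the Petersson norm gives exponent \<open>3/2\<close>; the rounded exponent 2
  suffices for the convergence of Dirichlet series.\<close>

lemma eta_quot_growth:
  assumes "cuspidal a c"
  obtains B where "B > 0" "\<And>\<tau>. Im \<tau> > 0 \<Longrightarrow> Im \<tau> \<le> 1 \<Longrightarrow> norm (eta_quot a c \<tau>) \<le> B / (Im \<tau>)^2"
proof -
  obtain B where B: "\<And>\<tau>. Im \<tau> > 0 \<Longrightarrow> petersson a c \<tau> \<le> B" using petersson_bounded[OF assms] by blast
  define w where "w = 2 powr (of_int (2 * c - a) / 3 :: real)"
  have w: "w > 0" by (simp add: w_def)
  define M where "M = max 1 (B / w)"
  show thesis
  proof (rule that[of "M"])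
    fix \<tau> :: complex assume t: "Im \<tau> > 0" "Im \<tau> \<le> 1"
    have "(norm (eta_quot a c \<tau>))^2 * Im \<tau> ^ 4 \<le> (norm (eta_quot a c \<tau>))^2 * Im \<tau> ^ 3"
      using t by (intro mult_left_mono power_decreasing) auto
    also have "\<dots> \<le> B / w"
    proof -
      have "w * ((norm (eta_quot a c \<tau>))^2 * Im \<tau> ^ 3) \<le> B"
        using B[OF t(1)] unfolding petersson_def w_def by (simp only: mult.assoc)
      then show ?thesis using w by (simp add: field_simps)
    qed
    also have "\<dots> \<le> M" by (simp add: M_def)
    also have "\<dots> \<le> M^2" by (rule self_le_power) (auto simp: M_def)
    finally have "(norm (eta_quot a c \<tau>) * Im \<tau> ^ 2)^2 \<le> M^2" by (simp add: power_mult_distrib power_mult[symmetric])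
    then have "norm (eta_quot a c \<tau>) * Im \<tau> ^ 2 \<le> M" by (rule power2_le_imp_le) (auto simp: M_def)
    then show "norm (eta_quot a c \<tau>) \<le> M / (Im \<tau>)^2" using t by (simp add: field_simps)
  qed (simp add: M_def)
qed

lemma eta_quot_decay':
  assumes "cuspidal a c"
  obtains C k where "C > 0" "k > 0" "\<And>\<tau>. Im \<tau> \<ge> 1/2 \<Longrightarrow> norm (eta_quot a c \<tau>) \<le> C * exp (- k * Im \<tau>)"
proof -
  obtain C where C: "C > 0" "\<And>\<tau>. Im \<tau> \<ge> 1/2 \<Longrightarrow> norm (eta_quot a c \<tau>) \<le> C * exp (- (pi / 24) * of_int (12 - a + 2 * c) * Im \<tau>)"
    using eta_quot_decay[of a c] by blast
  show thesis
    by (rule that[of C "(pi / 24) * of_int (12 - a + 2 * c)"]) (use C assms in \<open>auto simp: cuspidal_def\<close>)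
qed

text \<open>Inversion carries the angle at 0 to a region where the imaginary part dominates, and there the
  decay at infinity beats the cube of the absolute value.\<close>

lemma eta_quot_stolz:
  assumes "cuspidal a c"
  obtains B where "\<And>\<tau>. 0 < norm \<tau> \<Longrightarrow> norm \<tau> \<le> 1/2 \<Longrightarrow> Im \<tau> \<ge> norm \<tau> / 4 \<Longrightarrow> norm (eta_quot a c \<tau>) \<le> B"
proof -
  obtain C k where C: "C > 0" "k > 0" "\<And>\<tau>. Im \<tau> \<ge> 1/2 \<Longrightarrow> norm (eta_quot c a \<tau>) \<le> C * exp (- k * Im \<tau>)"
    using eta_quot_decay'[OF cuspidal_S[OF assms]] by blast
  show thesis
  proof (rule that)
    fix \<tau> :: complex assume t: "0 < norm \<tau>" "norm \<tau> \<le> 1/2" "Im \<tau> \<ge> norm \<tau> / 4"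
    define \<sigma> where "\<sigma> = - 1 / \<tau>"
    have ns: "norm \<sigma> = 1 / norm \<tau>" by (simp add: \<sigma>_def norm_divide)
    have Is: "Im \<sigma> \<ge> norm \<sigma> / 4"
    proof -
      have "norm \<sigma> / 4 = (norm \<tau> / 4) / (norm \<tau>)^2" using t by (simp add: ns power2_eq_square)
      also have "\<dots> \<le> Im \<tau> / (norm \<tau>)^2" using t by (intro divide_right_mono) auto
      finally show ?thesis by (simp only: \<sigma>_def Im_neg_inverse)
    qed
    have s1: "norm \<sigma> \<ge> 2" using t by (simp add: ns field_simps)
    have Ip: "Im \<sigma> > 0" "Im \<sigma> \<ge> 1/2" using Is s1 by linarith+
    have "\<tau> = - 1 / \<sigma>" by (simp add: \<sigma>_def)
    then have "norm (eta_quot a c \<tau>) = norm \<sigma> ^ 3 * sqrt 2 powi (a - c) * norm (eta_quot c a \<sigma>)"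
      using eta_quot_S[OF Ip(1), of a c] by (simp add: norm_mult norm_power norm_power_int)
    also have "\<dots> \<le> norm \<sigma> ^ 3 * sqrt 2 powi (a - c) * (C * exp (- k * Im \<sigma>))"
      by (intro mult_left_mono C Ip) auto
    also have "\<dots> \<le> norm \<sigma> ^ 3 * sqrt 2 powi (a - c) * (C * exp (- (k / 4) * norm \<sigma>))"
      using Is C by (intro mult_left_mono) auto
    also have "\<dots> = sqrt 2 powi (a - c) * C * (norm \<sigma> ^ 3 * exp (- (k / 4) * norm \<sigma>))" by simp
    also have "\<dots> \<le> sqrt 2 powi (a - c) * C * (6 / (k / 4) ^ 3)"
      using C by (intro mult_left_mono cube_exp_bound) auto
    finally show "norm (eta_quot a c \<tau>) \<le> sqrt 2 powi (a - c) * C * (6 / (k / 4) ^ 3)" .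
  qed
qed

text \<open>Decay faster than any exponential in the logarithmic coordinate \<open>u\<close>. For \<open>h u
  = f (\<i> * exp u)\<close> it makes the Mellin transform entire.\<close>

definition rapid_decay :: "(real \<Rightarrow> complex) \<Rightarrow> bool" where
  "rapid_decay h \<longleftrightarrow> continuous_on UNIV h \<and> (\<forall>R. \<exists>C. \<forall>u. norm (h u) \<le> C * exp (- R * \<bar>u\<bar>))"

lemma rapid_decay_decay_linear:
  assumes "rapid_decay h" "rapid_decay g"
  shows "rapid_decay (\<lambda>u. a * h u + b * g u)"
  unfolding rapid_decay_def
proof (intro conjI allI)
  show "continuous_on UNIV (\<lambda>u. a * h u + b * g u)" using assms by (auto simp: rapid_decay_def intro!: continuous_intros)
  fix R
  obtain C D where CD: "\<And>u. norm (h u) \<le> C * exp (- R * \<bar>u\<bar>)" "\<And>u. norm (g u) \<le> D * exp (- R * \<bar>u\<bar>)"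
    using assms unfolding rapid_decay_def by metis
  have "norm (a * h u + b * g u) \<le> (norm a * C + norm b * D) * exp (- R * \<bar>u\<bar>)" for u
  proof -
    have "norm (a * h u + b * g u) \<le> norm a * norm (h u) + norm b * norm (g u)"
      by (metis norm_mult norm_triangle_ineq)
    also have "\<dots> \<le> norm a * (C * exp (- R * \<bar>u\<bar>)) + norm b * (D * exp (- R * \<bar>u\<bar>))"
      by (intro add_mono mult_left_mono CD) auto
    finally show ?thesis by (simp add: algebra_simps)
  qed
  then show "\<exists>C. \<forall>u. norm (a * h u + b * g u) \<le> C * exp (- R * \<bar>u\<bar>)" by blast
qed

lemma integrable_exp_abs: "integrable lborel (\<lambda>u::real. exp (- \<bar>u\<bar>))"
proof -
  have 1: "integrable lborel (exponential_density 1)"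
    using prob_space_exponential_density[of 1]
    by (intro integrableI_bounded) (auto simp: prob_space.emeasure_space_1 emeasure_density
       exponential_density_nonneg prob_space_def prob_space_axioms_def space_density dest!: prob_space.emeasure_space_1)
  then have 2: "integrable lborel (\<lambda>u. exponential_density 1 (0 + (-1) * u))"
    by (rule lborel_integrable_real_affine) simp
  show ?thesis
  proof (rule Bochner_Integration.integrable_bound[OF Bochner_Integration.integrable_add[OF 1 2]])
    show "AE u in lborel. norm (exp (- \<bar>u\<bar>)) \<le> norm (exponential_density 1 u + exponential_density 1 (0 + (-1) * u))"
      by (auto simp: exponential_density_def)
  qed auto
qed

lemma rapid_decay_integrable:
  fixes s :: complex
  assumes "rapid_decay h"
  shows "integrable lborel (\<lambda>u. h u * exp (u * s))"
proof -
  obtain C where C: "\<And>u. norm (h u) \<le> C * exp (- (\<bar>Re s\<bar> + 1) * \<bar>u\<bar>)" using assms unfolding rapid_decay_def by blast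
  have c: "continuous_on UNIV h" using assms by (simp add: rapid_decay_def)
  have "integrable lborel (\<lambda>u. C * exp (- \<bar>u\<bar>))" by (intro integrable_mult_right integrable_exp_abs)
  then show ?thesis
  proof (rule Bochner_Integration.integrable_bound)
    show "(\<lambda>u. h u * exp (u * s)) \<in> borel_measurable lborel"
      using c by (simp, intro borel_measurable_continuous_onI continuous_intros)
    show "AE u in lborel. norm (h u * exp (u * s)) \<le> norm (C * exp (- \<bar>u\<bar>))"
    proof (intro AE_I2)
      fix u :: real
      have "norm (h u * exp (u * s)) = norm (h u) * exp (u * Re s)" by (simp add: norm_mult)
      also have "\<dots> \<le> (C * exp (- (\<bar>Re s\<bar> + 1) * \<bar>u\<bar>)) * exp (\<bar>u\<bar> * \<bar>Re s\<bar>)"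
        using C[of u] order_trans[OF norm_ge_zero C[of u]] by (intro mult_mono) (auto simp flip: abs_mult)
      also have "\<dots> = C * exp (- \<bar>u\<bar>)" by (simp add: mult.assoc exp_add[symmetric] algebra_simps)
      finally show "norm (h u * exp (u * s)) \<le> norm (C * exp (- \<bar>u\<bar>))" by simp
    qed
  qed
qed

lemma exp_exp_bound:
  fixes k R :: real assumes "k > 0"
  obtains C where "C > 0" "\<And>u. u \<ge> 0 \<Longrightarrow> exp (- k * exp u) \<le> C * exp (- R * u)"
proof -
  obtain n :: nat where n: "R \<le> n" using real_arch_simple by blast
  show thesis
  proof (rule that[of "fact n / k ^ n"])
    fix u :: real assume u: "u \<ge> 0"
    have "(k * exp u) ^ n / fact n \<le> exp (k * exp u)" by (rule exp_ge_term) (use assms in auto)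
    then have "exp (- k * exp u) \<le> fact n / (k * exp u) ^ n"
      using assms by (simp add: exp_minus field_simps)
    also have "\<dots> = fact n / k ^ n * exp (- n * u)" by (simp add: power_mult_distrib exp_minus exp_of_nat_mult exp_of_nat2_mult field_simps)
    also have "\<dots> \<le> fact n / k ^ n * exp (- R * u)"
      using n u assms by (intro mult_left_mono) (auto intro!: mult_right_mono)
    finally show "exp (- k * exp u) \<le> fact n / k ^ n * exp (- R * u)" .
  qed (use assms in auto)
qed

lemma eta_quot_S_imag:
  "eta_quot a c (\<i> * exp (of_real (- u))) = exp (of_real (3 * u)) * of_real (sqrt 2) powi (a - c) * eta_quot c a (\<i> * exp (of_real u))"
proof -
  have "eta_quot a c (- 1 / (\<i> * exp (of_real u))) = (- \<i> * (\<i> * exp (of_real u))) ^ 3 * of_real (sqrt 2) powi (a - c) * eta_quot c a (\<i> * exp (of_real u))"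
    by (rule eta_quot_S) (simp add: exp_of_real)
  moreover have "- 1 / (\<i> * exp (of_real u)) = \<i> * exp (of_real (- u))" by (simp add: exp_minus field_simps)
  moreover have "(- \<i> * (\<i> * exp (of_real u))) ^ 3 = exp (of_real (3 * u) :: complex)"
    by (simp add: exp_of_nat_mult[symmetric])
  ultimately show ?thesis by simp
qed

lemma eta_quot_rapid:
  assumes "cuspidal a c"
  shows "rapid_decay (\<lambda>u. eta_quot a c (\<i> * exp (of_real u)))"
  unfolding rapid_decay_def
proof (intro conjI allI)
  show "continuous_on UNIV (\<lambda>u. eta_quot a c (\<i> * exp (of_real u)))"
    by (rule continuous_on_compose2[OF holomorphic_on_imp_continuous_on[OF eta_quot_holomorphic]])
       (auto intro!: continuous_intros simp: exp_of_real)
  fix R :: real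
  have half: "\<exists>C. C > 0 \<and> (\<forall>u\<ge>0. norm (eta_quot x y (\<i> * exp (of_real u))) \<le> C * exp (- R * u))" if "cuspidal x y" for x y R
  proof -
    note xy = that
    obtain C k where C: "C > 0" "k > 0" "\<And>\<tau>. Im \<tau> \<ge> 1/2 \<Longrightarrow> norm (eta_quot x y \<tau>) \<le> C * exp (- k * Im \<tau>)"
      using eta_quot_decay'[OF xy] by blast
    obtain D where D: "D > 0" "\<And>u. u \<ge> 0 \<Longrightarrow> exp (- k * exp u) \<le> D * exp (- R * u)"
      using exp_exp_bound[OF C(2)] by blast
    have "norm (eta_quot x y (\<i> * exp (of_real u))) \<le> (C * D) * exp (- R * u)" if u: "u \<ge> 0" for u
    proof -
      have e: "exp u \<ge> 1" using u by simp
      have "norm (eta_quot x y (\<i> * exp (of_real u))) \<le> C * exp (- k * exp u)"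
        using C(3)[of "\<i> * exp (of_real u)"] e by (simp add: exp_of_real)
      also have "\<dots> \<le> C * (D * exp (- R * u))" using C D u by (intro mult_left_mono) auto
      finally show ?thesis by simp
    qed
    then show ?thesis using C D by (intro exI[of _ "C * D"]) auto
  qed
  obtain C where C: "C > 0" "\<And>u. u \<ge> 0 \<Longrightarrow> norm (eta_quot a c (\<i> * exp (of_real u))) \<le> C * exp (- R * u)"
    using half[OF assms, of R] by blast
  obtain D where D: "D > 0" "\<And>u. u \<ge> 0 \<Longrightarrow> norm (eta_quot c a (\<i> * exp (of_real u))) \<le> D * exp (- (R + 3) * u)"
    using half[OF cuspidal_S[OF assms], of "R + 3"] by blast
  define W where "W = sqrt 2 powi (a - c)"
  have W: "W > 0" by (simp add: W_def)
  have "norm (eta_quot a c (\<i> * exp (of_real u))) \<le> (C + W * D) * exp (- R * \<bar>u\<bar>)" for u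
  proof (cases "u \<ge> 0")
    case True
    then have "norm (eta_quot a c (\<i> * exp (of_real u))) \<le> C * exp (- R * \<bar>u\<bar>)" using C by simp
    also have "\<dots> \<le> (C + W * D) * exp (- R * \<bar>u\<bar>)" using W D by (intro mult_right_mono) auto
    finally show ?thesis .
  next
    case False
    define v where "v = - u"
    have v: "v \<ge> 0" "u = - v" "\<bar>u\<bar> = v" using False by (auto simp: v_def)
    have "norm (eta_quot a c (\<i> * exp (of_real u))) = exp (3 * v) * W * norm (eta_quot c a (\<i> * exp (of_real v)))"
      unfolding v(2) eta_quot_S_imag by (simp add: norm_mult norm_power_int W_def)
    also have "\<dots> \<le> exp (3 * v) * W * (D * exp (- (R + 3) * v))" using W v D by (intro mult_left_mono) auto
    also have "\<dots> = W * D * exp (- R * \<bar>u\<bar>)" by (simp add: v(3) exp_add[symmetric] algebra_simps flip: exp_add)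
    also have "\<dots> \<le> (C + W * D) * exp (- R * \<bar>u\<bar>)" using C by (intro mult_right_mono) auto
    finally show ?thesis .
  qed
  then show "\<exists>C. \<forall>u. norm (eta_quot a c (\<i> * exp (of_real u))) \<le> C * exp (- R * \<bar>u\<bar>)" by blast
qed

section \<open>The L-value at 1 as a line integral\<close>

lemma disc_point:
  fixes w :: complex
  assumes "w \<noteq> 0" "norm w < 1"
  obtains \<tau> where "Im \<tau> > 0" "exp (2 * pi * \<i> * \<tau>) = w"
proof (rule that)
  show "exp (2 * pi * \<i> * (Ln w / (2 * pi * \<i>))) = w" using assms by simp
  have "Im (Ln w / (2 * pi * \<i>)) = - Re (Ln w) / (2 * pi)"
    by (simp add: Im_divide power2_eq_square field_simps)
  also have "\<dots> > 0" using assms by (simp add: divide_neg_pos)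
  finally show "Im (Ln w / (2 * pi * \<i>)) > 0" .
qed

lemma q_expansion_unique:
  assumes a: "has_q_expansion f a" and b: "has_q_expansion f b"
  shows "a = b"
proof (rule ccontr)
  assume "a \<noteq> b"
  define c where "c = (\<lambda>n. a n - b n)"
  \<comment> \<open>the hypothesis says nothing at \<open>w = 0\<close>, which is no value of the exponential; the constant term comes from the limit there\<close>
  have s: "(\<lambda>n. c n * w ^ n) sums 0" if w: "w \<noteq> 0" "norm w < 1" for w
  proof -
    obtain \<tau> where "Im \<tau> > 0" "exp (2 * pi * \<i> * \<tau>) = w" using disc_point[OF w] by blast
    then have "(\<lambda>n. a n * w ^ n) sums f \<tau>" "(\<lambda>n. b n * w ^ n) sums f \<tau>"
      using a b by (auto simp: has_q_expansion_def)
    from sums_diff[OF this] show ?thesis by (simp add: c_def algebra_simps)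
  qed
  have "((\<lambda>_. 0) \<longlongrightarrow> c 0) (at (0::complex))" by (rule powser_limit_0_strong[where f = "\<lambda>_. 0" and a = c and s = 1]) (use s in auto)
  then have c0: "c 0 = 0" using tendsto_unique[OF _ tendsto_const] by (metis trivial_limit_at)
  from \<open>a \<noteq> b\<close> obtain m where m: "c m \<noteq> 0" by (auto simp: c_def)
  then have "m > 0" using c0 by (cases m) auto
  have sm: "(\<lambda>n. c n * (w - 0) ^ n) sums (\<lambda>_. 0) w" if "norm (w - 0) < 1" for w
    using s[of w] that powser_sums_zero[of c] c0 by (cases "w = 0") auto
  show False
  proof (rule powser_0_nonzero[OF zero_less_one sm refl m \<open>m > 0\<close>])
    fix r :: real assume r: "0 < r" "\<And>z::complex. z \<in> cball 0 r - {0} \<Longrightarrow> (0::complex) \<noteq> 0"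
    have "complex_of_real (r/2) \<in> cball 0 r - {0}" using r(1) by simp
    then show False using r(2) by blast
  qed
qed

text \<open>The properties of a cusp form that the analytic continuation of its L-function uses. They are
  stable under linear combinations, so they need to be checked for eta quotients only.\<close>

definition mellin_admissible :: "(complex \<Rightarrow> complex) \<Rightarrow> bool" where
  "mellin_admissible f \<longleftrightarrow>
     (\<exists>g. g holomorphic_on ball 0 1 \<and> g 0 = 0 \<and> (\<forall>\<tau>. Im \<tau> > 0 \<longrightarrow> f \<tau> = g (exp (2 * pi * \<i> * \<tau>)))) \<and>
     (\<exists>B. \<forall>\<tau>. 0 < Im \<tau> \<longrightarrow> Im \<tau> \<le> 1 \<longrightarrow> norm (f \<tau>) \<le> B / (Im \<tau>)^2) \<and>
     rapid_decay (\<lambda>u. f (\<i> * exp (of_real u)))"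

lemma mellin_admissible_linear:
  assumes "mellin_admissible f" "mellin_admissible h"
  shows "mellin_admissible (\<lambda>\<tau>. a * f \<tau> + b * h \<tau>)"
proof -
  obtain g where g: "g holomorphic_on ball 0 1" "g 0 = 0" "\<And>\<tau>. Im \<tau> > 0 \<Longrightarrow> f \<tau> = g (exp (2 * pi * \<i> * \<tau>))"
    using assms(1) by (auto simp: mellin_admissible_def)
  obtain k where k: "k holomorphic_on ball 0 1" "k 0 = 0" "\<And>\<tau>. Im \<tau> > 0 \<Longrightarrow> h \<tau> = k (exp (2 * pi * \<i> * \<tau>))"
    using assms(2) by (auto simp: mellin_admissible_def)
  obtain B where B: "\<And>\<tau>. 0 < Im \<tau> \<Longrightarrow> Im \<tau> \<le> 1 \<Longrightarrow> norm (f \<tau>) \<le> B / (Im \<tau>)^2" using assms(1) by (auto simp: mellin_admissible_def)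
  obtain C where C: "\<And>\<tau>. 0 < Im \<tau> \<Longrightarrow> Im \<tau> \<le> 1 \<Longrightarrow> norm (h \<tau>) \<le> C / (Im \<tau>)^2" using assms(2) by (auto simp: mellin_admissible_def)
  have "norm (a * f \<tau> + b * h \<tau>) \<le> (norm a * B + norm b * C) / (Im \<tau>)^2" if t: "0 < Im \<tau>" "Im \<tau> \<le> 1" for \<tau>
  proof -
    have "norm (a * f \<tau> + b * h \<tau>) \<le> norm a * norm (f \<tau>) + norm b * norm (h \<tau>)"
      by (metis norm_mult norm_triangle_ineq)
    also have "\<dots> \<le> norm a * (B / (Im \<tau>)^2) + norm b * (C / (Im \<tau>)^2)"
      by (intro add_mono mult_left_mono B C t) auto
    finally show ?thesis by (simp add: add_divide_distrib)
  qed
  moreover have "(\<lambda>q. a * g q + b * k q) holomorphic_on ball 0 1" by (intro holomorphic_intros g k)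
  moreover have "rapid_decay (\<lambda>u. a * f (\<i> * exp (of_real u)) + b * h (\<i> * exp (of_real u)))"
    using assms by (intro rapid_decay_decay_linear) (auto simp: mellin_admissible_def)
  ultimately show ?thesis unfolding mellin_admissible_def using g k
    by (intro conjI exI[of _ "\<lambda>q. a * g q + b * k q"] exI[of _ "norm a * B + norm b * C"]) auto
qed

text \<open>The integral of \<open>f\<close> over the imaginary axis, \<open>t = exp u\<close>. The
  logarithmic coordinate turns scaling of the variable into translation.\<close>

definition axis_integral :: "(complex \<Rightarrow> complex) \<Rightarrow> complex" where
  "axis_integral f = (LINT u|lborel. f (\<i> * exp (of_real u)) * exp (of_real u))"

lemma mellin_admissible_integrable: "mellin_admissible f \<Longrightarrow> integrable lborel (\<lambda>u. f (\<i> * exp (of_real u)) * exp (of_real u))"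
  using rapid_decay_integrable[of "\<lambda>u. f (\<i> * exp (of_real u))" 1] by (simp add: mellin_admissible_def exp_of_real)

lemma axis_integral_linear:
  assumes "mellin_admissible f" "mellin_admissible h"
  shows "axis_integral (\<lambda>\<tau>. a * f \<tau> + b * h \<tau>) = a * axis_integral f + b * axis_integral h"
proof -
  have "axis_integral (\<lambda>\<tau>. a * f \<tau> + b * h \<tau>) = (LINT u|lborel. a * (f (\<i> * exp (of_real u)) * exp (of_real u)) + b * (h (\<i> * exp (of_real u)) * exp (of_real u)))"
    unfolding axis_integral_def by (simp add: algebra_simps)
  then show ?thesis using mellin_admissible_integrable[OF assms(1)] mellin_admissible_integrable[OF assms(2)]
    by (simp add: axis_integral_def)
qed

lemma gamma_log_integrable:
  fixes s :: complex
  assumes s: "Re s \<ge> 1"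
  shows "integrable lborel (\<lambda>u. of_real (exp (- exp u)) * exp (u * s))"
proof -
  obtain C where C: "C > 0" "\<And>u. u \<ge> 0 \<Longrightarrow> exp (- 1 * exp u) \<le> C * exp (- (Re s + 1) * u)"
    using exp_exp_bound[of 1 "Re s + 1"] by auto
  have "integrable lborel (\<lambda>u. (C + 1) * exp (- \<bar>u\<bar>))" by (intro integrable_mult_right integrable_exp_abs)
  then show ?thesis
  proof (rule Bochner_Integration.integrable_bound)
    show "(\<lambda>u. complex_of_real (exp (- exp u)) * exp (u * s)) \<in> borel_measurable lborel"
      by simp
    show "AE u in lborel. norm (complex_of_real (exp (- exp u)) * exp (u * s)) \<le> norm ((C + 1) * exp (- \<bar>u\<bar>))"
    proof (intro AE_I2)
      fix u :: real
      have n: "norm (complex_of_real (exp (- exp u)) * exp (u * s)) = exp (- exp u) * exp (u * Re s)" by (simp add: norm_mult)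
      have "exp (- exp u) * exp (u * Re s) \<le> (C + 1) * exp (- \<bar>u\<bar>)"
      proof (cases "u \<ge> 0")
        case True
        have "exp (- exp u) * exp (u * Re s) \<le> (C * exp (- (Re s + 1) * u)) * exp (u * Re s)"
          using C(2)[OF True] by (intro mult_right_mono) auto
        also have "\<dots> = C * exp (- \<bar>u\<bar>)" using True by (simp add: mult.assoc exp_add[symmetric] algebra_simps)
        also have "\<dots> \<le> (C + 1) * exp (- \<bar>u\<bar>)" by (intro mult_right_mono) auto
        finally show ?thesis .
      next
        case False
        have "exp (- exp u) * exp (u * Re s) \<le> 1 * exp (u * 1)"
          using False s by (intro mult_mono) (auto intro!: mult_left_mono_neg)
        also have "\<dots> \<le> (C + 1) * exp (- \<bar>u\<bar>)" using False C by simp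
        finally show ?thesis .
      qed
      then show "norm (complex_of_real (exp (- exp u)) * exp (u * s)) \<le> norm ((C + 1) * exp (- \<bar>u\<bar>))"
        unfolding n using C by simp
    qed
  qed
qed

text \<open>Euler's integral after the substitution \<open>t = exp u\<close>.\<close>

lemma gamma_log:
  fixes s :: complex
  assumes s: "Re s \<ge> 1"
  shows "(LINT u|lborel. of_real (exp (- exp u)) * exp (u * s)) = Gamma s"
proof -
  let ?f = "\<lambda>t. complex_of_real t powr (s - 1) / of_real (exp t)"
  have e: "exp u *\<^sub>R ?f (exp u) = of_real (exp (- exp u)) * exp (u * s)" for u :: real
  proof -
    have "complex_of_real (exp u) powr (s - 1) = exp (u * (s - 1))"
      by (simp add: powr_def exp_of_real[symmetric] mult.commute)
    moreover have "of_real (exp u) * exp (u * (s - 1)) = exp (u * s)"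
      by (simp add: exp_of_real[symmetric] exp_add[symmetric] algebra_simps)
    ultimately show ?thesis
      by (simp add: scaleR_conv_of_real exp_minus divide_inverse mult.assoc[symmetric])
  qed
  have abs: "?f absolutely_integrable_on {0<..}" using s by (intro absolutely_integrable_Gamma_integral') auto
  have si: "set_integrable lborel {0<..} ?f"
  proof -
    have "(\<lambda>x. indicator {0<..} x *\<^sub>R ?f x) \<in> borel_measurable borel"
      by (rule borel_measurable_continuous_on_indicator)
         (auto intro!: continuous_intros simp: complex_nonpos_Reals_iff)
    with abs show ?thesis unfolding set_integrable_def
      by (subst (asm) integrable_completion) auto
  qed
  have "(LBINT t=0..\<infinity>. ?f t) = (LBINT u=-\<infinity>..\<infinity>. exp u *\<^sub>R ?f (exp u))"
  proof (rule interval_integral_substitution_integrable[where g = exp and g' = exp])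
    show "set_integrable lborel (einterval (- \<infinity>) \<infinity>) (\<lambda>x. exp x *\<^sub>R ?f (exp x))"
      unfolding e using gamma_log_integrable[OF s] by (simp add: set_integrable_def)
    show "set_integrable lborel (einterval 0 \<infinity>) ?f" using si by (simp add: einterval_def greaterThan_def)
    show "((ereal \<circ> exp \<circ> real_of_ereal) \<longlongrightarrow> 0) (at_right (- \<infinity>))"
      unfolding zero_ereal_def ereal_tendsto_simps by (rule exp_at_bot)
    show "((ereal \<circ> exp \<circ> real_of_ereal) \<longlongrightarrow> \<infinity>) (at_left \<infinity>)"
      unfolding ereal_tendsto_simps by (rule exp_at_top)
    fix x :: real
    show "isCont ?f (exp x)"
      by (auto intro!: continuous_intros simp: complex_nonpos_Reals_iff)
  qed (auto intro!: derivative_eq_intros continuous_intros)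
  also have "(LBINT u=-\<infinity>..\<infinity>. exp u *\<^sub>R ?f (exp u)) = (LINT u|lborel. of_real (exp (- exp u)) * exp (u * s))"
    unfolding e by (simp add: interval_lebesgue_integral_def set_lebesgue_integral_def)
  also have "(LBINT t=0..\<infinity>. ?f t) = (LINT t:{0<..}|lborel. ?f t)"
    by (simp add: interval_lebesgue_integral_def einterval_def greaterThan_def)
  also have "\<dots> = integral {0<..} ?f" using set_borel_integral_eq_integral(2)[OF si] .
  also have "\<dots> = integral {0..} ?f"
  proof (rule integral_subset_negligible)
    have "{0..} - {0<..} \<subseteq> {0::real}" by auto
    then show "negligible ({0..} - {0::real<..})" using negligible_subset negligible_sing by blast
  qed auto
  also have "\<dots> = Gamma s" using s by (intro integral_unique Gamma_integral_complex) auto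
  finally show ?thesis by simp
qed

lemma gamma_log_scaled:
  fixes s :: complex and c :: real
  assumes s: "Re s \<ge> 1" and c: "c > 0"
  shows "integrable lborel (\<lambda>u. of_real (exp (- c * exp u)) * exp (u * s))"
    and "(LINT u|lborel. of_real (exp (- c * exp u)) * exp (u * s)) = Gamma s * exp (- s * ln c)"
proof -
  let ?f = "\<lambda>u. of_real (exp (- exp u)) * exp (u * s)"
  have e: "of_real (exp (- c * exp u)) * exp (u * s) = exp (- s * ln c) * ?f (ln c + 1 * u)" for u
  proof -
    have "exp (ln c + 1 * u) = c * exp u" using c by (simp add: exp_add)
    moreover have "exp (- s * ln c) * exp ((ln c + 1 * u) * s) = exp (u * s)"
      by (simp add: exp_add[symmetric] algebra_simps)
    ultimately show ?thesis by (simp add: mult.left_commute)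
  qed
  have i: "integrable lborel (\<lambda>u. ?f (ln c + 1 * u))"
    by (intro lborel_integrable_real_affine gamma_log_integrable s) auto
  show "integrable lborel (\<lambda>u. of_real (exp (- c * exp u)) * exp (u * s))"
    unfolding e by (intro integrable_mult_right i)
  have "(LINT u|lborel. of_real (exp (- c * exp u)) * exp (u * s)) = exp (- s * ln c) * (LINT u|lborel. ?f (ln c + 1 * u))"
    unfolding e by (rule integral_mult_right_zero)
  also have "(LINT u|lborel. ?f (ln c + 1 * u)) = Gamma s"
    using lborel_integral_real_affine[of 1 ?f "ln c"] gamma_log[OF s] by simp
  finally show "(LINT u|lborel. of_real (exp (- c * exp u)) * exp (u * s)) = Gamma s * exp (- s * ln c)"
    by (simp add: mult.commute)
qed

text \<open>The truncated integrals are entire and converge locally uniformly.\<close>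

lemma mellin_entire:
  assumes h: "rapid_decay h"
  shows "(\<lambda>s::complex. LINT u|lborel. h u * exp (u * s)) holomorphic_on UNIV"
proof (rule holomorphic_uniform_sequence[OF open_UNIV])
  let ?M = "\<lambda>n (s::complex). integral {- real n..real n} (\<lambda>u. h u * exp (u * s))"
  have ch: "continuous_on UNIV h" using h by (simp add: rapid_decay_def)
  show "?M n holomorphic_on UNIV" for n
  proof -
    have "(\<lambda>s::complex. integral (cbox (- real n) (real n)) (\<lambda>u. h u * exp (u * s))) holomorphic_on UNIV"
    proof (rule leibniz_rule_holomorphic)
      show "((\<lambda>s. h t * exp (t * s)) has_field_derivative h t * (exp (t * s) * t)) (at s within UNIV)" for s :: complex and t :: real
        by (auto intro!: derivative_eq_intros)
      show "(\<lambda>u. h u * exp (u * s)) integrable_on cbox (- real n) (real n)" for s :: complex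
        by (intro integrable_continuous continuous_intros continuous_on_subset[OF ch]) auto
      show "continuous_on (UNIV \<times> cbox (- real n) (real n)) (\<lambda>(x::complex, t). h t * (exp (t * x) * t))"
        unfolding case_prod_unfold
        by (intro continuous_intros continuous_on_compose2[OF ch]) auto
    qed auto
    then show ?thesis by simp
  qed
  fix s0 :: complex
  define R where "R = \<bar>Re s0\<bar> + 1"
  obtain C where C: "\<And>u. norm (h u) \<le> C * exp (- (R + 2) * \<bar>u\<bar>)" using h unfolding rapid_decay_def by blast
  have C0: "C \<ge> 0" using order_trans[OF norm_ge_zero C[of 0]] by simp
  define K :: real where "K = (LINT u|lborel. exp (- \<bar>u\<bar>))"
  have K0: "K \<ge> 0" unfolding K_def by (intro integral_nonneg_AE) auto
  have bd: "norm (?M n s - (LINT u|lborel. h u * exp (u * s))) \<le> exp (- real n) * (C * K)" if s: "s \<in> cball s0 1" for n s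
  proof -
    have "\<bar>Re s - Re s0\<bar> \<le> norm (s - s0)" by (metis abs_Re_le_cmod minus_complex.simps(1))
    then have Rs: "\<bar>Re s\<bar> \<le> R" using s by (simp add: R_def dist_norm norm_minus_commute)
    have ib: "integrable lborel (\<lambda>u. h u * exp (u * s))" by (rule rapid_decay_integrable[OF h])
    have si: "set_integrable lborel {- real n..real n} (\<lambda>u. h u * exp (u * s))"
      unfolding set_integrable_def by (intro integrable_mult_indicator ib) auto
    have "?M n s = (LINT u|lborel. indicator {- real n..real n} u *\<^sub>R (h u * exp (u * s)))"
      using set_borel_integral_eq_integral(2)[OF si] by (simp add: set_lebesgue_integral_def)
    then have "?M n s - (LINT u|lborel. h u * exp (u * s)) = (LINT u|lborel. indicator {- real n..real n} u *\<^sub>R (h u * exp (u * s)) - h u * exp (u * s))"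
      using ib si by (simp add: set_integrable_def)
    also have "norm \<dots> \<le> (LINT u|lborel. exp (- real n) * (C * exp (- \<bar>u\<bar>)))"
    proof (rule Bochner_Integration.integral_norm_bound_integral)
      show "integrable lborel (\<lambda>u. indicator {- real n..real n} u *\<^sub>R (h u * exp (u * s)) - h u * exp (u * s))"
        using ib si by (simp add: set_integrable_def)
      show "integrable lborel (\<lambda>u. exp (- real n) * (C * exp (- \<bar>u\<bar>)))" by (intro integrable_mult_right integrable_exp_abs)
      fix u :: real
      show "norm (indicator {- real n..real n} u *\<^sub>R (h u * exp (u * s)) - h u * exp (u * s)) \<le> exp (- real n) * (C * exp (- \<bar>u\<bar>))"
      proof (cases "u \<in> {- real n..real n}")
        case False
        then have u: "\<bar>u\<bar> \<ge> real n" by auto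
        have "norm (h u * exp (u * s)) = norm (h u) * exp (u * Re s)" by (simp add: norm_mult)
        also have "\<dots> \<le> (C * exp (- (R + 2) * \<bar>u\<bar>)) * exp (\<bar>u\<bar> * R)"
        proof (intro mult_mono C)
          have "u * Re s \<le> \<bar>u\<bar> * \<bar>Re s\<bar>" by (metis abs_ge_self abs_mult)
          also have "\<dots> \<le> \<bar>u\<bar> * R" using Rs by (intro mult_left_mono) auto
          finally show "exp (u * Re s) \<le> exp (\<bar>u\<bar> * R)" by simp
        qed (use C0 in auto)
        also have "\<dots> = C * (exp (- \<bar>u\<bar>) * exp (- \<bar>u\<bar>))" by (simp add: mult.assoc exp_add[symmetric] algebra_simps)
        also have "\<dots> \<le> C * (exp (- real n) * exp (- \<bar>u\<bar>))" using u C0 by (intro mult_left_mono mult_right_mono) auto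
        finally show ?thesis using False by (simp add: mult_ac)
      qed (use C0 in auto)
    qed
    also have "\<dots> = exp (- real n) * (C * K)" by (simp add: K_def)
    finally show ?thesis .
  qed
  have "uniform_limit (cball s0 1) ?M (\<lambda>s. LINT u|lborel. h u * exp (u * s)) sequentially"
    unfolding uniform_limit_iff
  proof (intro allI impI)
    fix e :: real assume e: "e > 0"
    have "(\<lambda>n. exp (- real n) * (C * K)) \<longlonglongrightarrow> 0 * (C * K)"
    proof (intro tendsto_mult tendsto_const)
      have "(\<lambda>n. exp (-1) ^ n) \<longlonglongrightarrow> (0::real)" by (intro LIMSEQ_realpow_zero) auto
      then show "(\<lambda>n. exp (- real n)) \<longlonglongrightarrow> 0" by (simp add: exp_of_nat_mult[symmetric])
    qed
    then have "\<forall>\<^sub>F n in sequentially. exp (- real n) * (C * K) < e" using e by (intro order_tendstoD(2)) auto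
    then show "\<forall>\<^sub>F n in sequentially. \<forall>s\<in>cball s0 1. dist (?M n s) (LINT u|lborel. h u * exp (u * s)) < e"
    proof eventually_elim
      case (elim n)
      show ?case
      proof
        fix s assume "s \<in> cball s0 1"
        from bd[OF this, of n] elim show "dist (?M n s) (LINT u|lborel. h u * exp (u * s)) < e"
          unfolding dist_norm by (rule le_less_trans)
      qed
    qed
  qed
  then show "\<exists>d>0. cball s0 d \<subseteq> UNIV \<and> uniform_limit (cball s0 d) ?M (\<lambda>s. LINT u|lborel. h u * exp (u * s)) sequentially"
    by (intro exI[of _ 1]) auto
qed

text \<open>The Mellin transform of \<open>f\<close>, divided by \<open>Gamma\<close>, is entire and agrees
  with the Dirichlet series far to the right, where sum and integral may be exchanged. An entire function
  with this property is unique, and at 1 it is the asserted integral.\<close>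

lemma L_function_value:
  assumes f: "mellin_admissible f"
  shows "L_function f 1 = 2 * pi * axis_integral f"
proof -
  obtain g where g: "g holomorphic_on ball 0 1" "g 0 = 0" "\<And>\<tau>. Im \<tau> > 0 \<Longrightarrow> f \<tau> = g (exp (2 * pi * \<i> * \<tau>))"
    using f by (auto simp: mellin_admissible_def)
  obtain B where B: "\<And>\<tau>. 0 < Im \<tau> \<Longrightarrow> Im \<tau> \<le> 1 \<Longrightarrow> norm (f \<tau>) \<le> B / (Im \<tau>)^2" using f by (auto simp: mellin_admissible_def)
  have rap: "rapid_decay (\<lambda>u. f (\<i> * exp (of_real u)))" using f by (simp add: mellin_admissible_def)
  define a where "a = (\<lambda>n. (deriv ^^ n) g 0 / fact n)"
  have sg: "(\<lambda>n. a n * w ^ n) sums g w" if "norm w < 1" for w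
    using holomorphic_power_series[OF g(1), of w] that by (simp add: a_def)
  have qe: "has_q_expansion f a"
    unfolding has_q_expansion_def using sg g(3) by auto
  have qc: "q_coeff f = a" unfolding q_coeff_def
    using qe q_expansion_unique by (intro the_equality) auto
  have a0: "a 0 = 0" by (simp add: a_def g)
  have B0: "B \<ge> 0" using order_trans[OF norm_ge_zero B[of \<i>]] by simp
  define A where "A = exp (2 * pi) * B"
  have A0: "A \<ge> 0" using B0 by (simp add: A_def)
  \<comment> \<open>Cauchy estimate on the circle of radius \<open>exp (- 2 * pi / Suc n)\<close>: quadratic growth of the coefficients\<close>
  have an: "norm (a (Suc n)) \<le> A * (real (Suc n))^2" for n
  proof -
    define y where "y = 1 / real (Suc n)"
    have y: "y > 0" "y \<le> 1" by (auto simp: y_def)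
    define r where "r = exp (- 2 * pi * y)"
    have r: "0 < r" "r < 1" using y by (auto simp: r_def)
    have "norm ((deriv ^^ Suc n) g 0) \<le> fact (Suc n) * (B / y^2) / r ^ Suc n"
    proof (rule Cauchy_inequality)
      show "g holomorphic_on ball 0 r" using g(1) r by (auto intro: holomorphic_on_subset)
      show "continuous_on (cball 0 r) g"
        using r by (intro continuous_on_subset[OF holomorphic_on_imp_continuous_on[OF g(1)]]) auto
      show "0 < r" by (rule r)
      fix w :: complex assume w: "norm (0 - w) = r"
      then have "w \<noteq> 0" "norm w < 1" using r by auto
      then obtain \<tau> where t: "Im \<tau> > 0" "exp (2 * pi * \<i> * \<tau>) = w" using disc_point by blast
      have "exp (- 2 * pi * Im \<tau>) = exp (- 2 * pi * y)" using w t(2) by (auto simp: r_def)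
      then have "Im \<tau> = y" by simp
      then show "norm (g w) \<le> B / y^2" using B[of \<tau>] g(3)[OF t(1)] t y by simp
    qed
    then have "norm (a (Suc n)) \<le> (B / y^2) / r ^ Suc n"
      by (simp add: a_def norm_divide field_simps del: power_Suc fact_Suc funpow.simps)
    also have "r ^ Suc n = exp (- 2 * pi)"
    proof -
      have "r ^ Suc n = exp (real (Suc n) * (- 2 * pi * y))" unfolding r_def by (rule exp_of_nat_mult[symmetric])
      then show ?thesis by (simp add: y_def)
    qed
    also have "(B / y^2) / exp (- 2 * pi) = A * (real (Suc n))^2"
      by (simp add: y_def A_def exp_minus field_simps)
    finally show ?thesis .
  qed
  define h where "h = (\<lambda>u::real. f (\<i> * exp (of_real u)))"
  define M where "M = (\<lambda>s::complex. LINT u|lborel. h u * exp (u * s))"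
  \<comment> \<open>the reciprocal Gamma function is entire, so \<open>L\<close> has no poles\<close>
  define L where "L = (\<lambda>s::complex. exp (s * ln (2 * pi)) * rGamma s * M s)"
  have Mhol: "M holomorphic_on UNIV" unfolding M_def h_def by (rule mellin_entire[OF rap])
  have Lhol: "L holomorphic_on UNIV" unfolding L_def
    by (intro holomorphic_intros Mhol)
  \<comment> \<open>four units of real part leave room for the quadratic growth of the coefficients\<close>
  have dirichlet: "(\<lambda>n. a (Suc n) * of_nat (Suc n) powr (- s)) sums L s" if s: "Re s > 4" for s
  proof -
    define F where "F = (\<lambda>n u. a (Suc n) * (of_real (exp (- (2 * pi * real (Suc n)) * exp u)) * exp (u * s)))"
    have s1: "Re s \<ge> 1" using s by simp
    have Fi: "integrable lborel (F n)" for n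
      unfolding F_def by (intro integrable_mult_right gamma_log_scaled s1) simp
    have FI: "(LINT u|lborel. F n u) = a (Suc n) * (Gamma s * exp (- s * ln (2 * pi * real (Suc n))))" for n
      unfolding F_def using gamma_log_scaled(2)[OF s1, of "2 * pi * real (Suc n)"] by simp
    define \<sigma> where "\<sigma> = complex_of_real (Re s)"
    have nF: "norm (F n u) = norm (a (Suc n)) * Re (of_real (exp (- (2 * pi * real (Suc n)) * exp u)) * exp (u * \<sigma>))" for n u
    proof -
      have "complex_of_real (exp (- (2 * pi * real (Suc n)) * exp u)) * exp (u * \<sigma>) = of_real (exp (- (2 * pi * real (Suc n)) * exp u) * exp (u * Re s))"
        by (simp add: \<sigma>_def exp_of_real[symmetric])
      then show ?thesis by (simp add: F_def norm_mult)
    qed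
    have sg1: "Re \<sigma> \<ge> 1" using s by (simp add: \<sigma>_def)
    have nFI: "(LINT u|lborel. norm (F n u)) = norm (a (Suc n)) * Re (Gamma \<sigma> * exp (- \<sigma> * ln (2 * pi * real (Suc n))))" for n
      unfolding nF using gamma_log_scaled[OF sg1, of "2 * pi * real (Suc n)"]
      by (subst integral_mult_right_zero, subst integral_Re) auto
    have Fu: "(\<lambda>n. F n u) sums (h u * exp (u * s))" for u
    proof -
      have "(\<lambda>n. a n * exp (2 * pi * \<i> * (\<i> * exp (of_real u))) ^ n) sums h u"
        using qe unfolding has_q_expansion_def h_def by (auto simp: exp_of_real)
      then have "(\<lambda>n. a (Suc n) * exp (2 * pi * \<i> * (\<i> * exp (of_real u))) ^ Suc n) sums h u"
        using a0 by (subst sums_Suc_iff) simp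
      moreover have "exp (2 * pi * \<i> * (\<i> * exp (complex_of_real u))) ^ Suc n = of_real (exp (- (2 * pi * real (Suc n)) * exp u))" for n
      proof -
        have "2 * pi * \<i> * (\<i> * exp (complex_of_real u)) = of_real (- (2 * pi) * exp u)"
          by (simp add: exp_of_real complex_eq_iff)
        then have "exp (2 * pi * \<i> * (\<i> * exp (complex_of_real u))) = of_real (exp (- (2 * pi) * exp u))"
          by (simp only: exp_of_real)
        then have "exp (2 * pi * \<i> * (\<i> * exp (complex_of_real u))) ^ Suc n = of_real (exp (- (2 * pi) * exp u) ^ Suc n)"
          by (simp only: of_real_power)
        also have "exp (- (2 * pi) * exp u) ^ Suc n = exp (real (Suc n) * (- (2 * pi) * exp u))"
          by (rule exp_of_nat_mult[symmetric])
        finally show ?thesis by (simp add: algebra_simps)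
      qed
      ultimately have "(\<lambda>n. a (Suc n) * of_real (exp (- (2 * pi * real (Suc n)) * exp u))) sums h u" by simp
      from sums_mult2[OF this, of "exp (u * s)"] show ?thesis by (simp add: F_def mult.assoc)
    qed
    have sumF: "summable (\<lambda>n. LINT u|lborel. norm (F n u))"
    proof -
      define G where "G = norm (Gamma \<sigma>)"
      have bnd: "norm (LINT u|lborel. norm (F n u)) \<le> (A * G) * inverse (real (Suc n) ^ 2)" for n
      proof -
        have "(LINT u|lborel. norm (F n u)) \<ge> 0" by (intro integral_nonneg_AE) auto
        then have "norm (LINT u|lborel. norm (F n u)) = norm (a (Suc n)) * Re (Gamma \<sigma> * exp (- \<sigma> * ln (2 * pi * real (Suc n))))"
          using nFI by simp
        also have "\<dots> \<le> norm (a (Suc n)) * norm (Gamma \<sigma> * exp (- \<sigma> * ln (2 * pi * real (Suc n))))"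
          by (intro mult_left_mono complex_Re_le_cmod) auto
        also have "\<dots> = norm (a (Suc n)) * (G * exp (- Re s * ln (2 * pi * real (Suc n))))"
          by (simp add: norm_mult G_def \<sigma>_def del: of_nat_Suc)
        also have "\<dots> \<le> (A * (real (Suc n))^2) * (G * inverse (real (Suc n) ^ 4))"
        proof (intro mult_mono an mult_left_mono)
          have l: "ln (real (Suc n)) \<le> ln (2 * pi * real (Suc n))"
          proof -
            have "1 * real (Suc n) \<le> 2 * pi * real (Suc n)" using pi_gt3 by (intro mult_right_mono) auto
            then show ?thesis by simp
          qed
          have "4 * ln (real (Suc n)) \<le> Re s * ln (2 * pi * real (Suc n))"
            using s l by (intro mult_mono) auto
          then have "exp (- Re s * ln (2 * pi * real (Suc n))) \<le> exp (- (4 * ln (real (Suc n))))" by simp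
          also have "\<dots> = inverse (real (Suc n) ^ 4)"
          proof -
            have "exp (4 * ln (real (Suc n))) = real (Suc n) ^ 4"
              using exp_of_nat_mult[of 4 "ln (real (Suc n))"] by simp
            then show ?thesis by (simp only: exp_minus)
          qed
          finally show "exp (- Re s * ln (2 * pi * real (Suc n))) \<le> inverse (real (Suc n) ^ 4)" .
        qed (use A0 in \<open>auto simp: G_def\<close>)
        also have "\<dots> = (A * G) * inverse (real (Suc n) ^ 2)"
          by (simp add: field_simps power4_eq_xxxx power2_eq_square del: of_nat_Suc)
        finally show ?thesis .
      qed
      have "summable (\<lambda>n. inverse (real (Suc n) ^ 2))"
        using inverse_power_summable[of 2, where ?'a = real] by (subst summable_Suc_iff) simp
      then have "summable (\<lambda>n. (A * G) * inverse (real (Suc n) ^ 2))" by (rule summable_mult)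
      then show ?thesis by (rule summable_comparison_test') (use bnd in auto)
    qed
    have abs: "AE u in lborel. summable (\<lambda>n. norm (F n u))"
    proof (intro AE_I2)
      fix u
      have "norm (exp (2 * pi * \<i> * (\<i> * exp (complex_of_real u)))) < 1" by (simp add: exp_of_real)
      define w where "w = complex_of_real (exp (- (2 * pi) * exp u))"
      define w' where "w' = complex_of_real (exp (- pi * exp u))"
      have ww: "norm w < norm w'" "norm w' < 1" by (simp_all add: w_def w'_def)
      have "summable (\<lambda>n. a n * w' ^ n)" using sg[OF ww(2)] by (rule sums_summable)
      then have "summable (\<lambda>n. norm (a n * w ^ n))" using ww(1) by (rule powser_insidea)
      then have "summable (\<lambda>n. norm (a (Suc n) * w ^ Suc n))" by (subst summable_Suc_iff)
      then have "summable (\<lambda>n. norm (a (Suc n) * w ^ Suc n) * norm (exp (u * s)))" by (rule summable_mult2)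
      moreover have "norm (F n u) = norm (a (Suc n) * w ^ Suc n) * norm (exp (u * s))" for n
      proof -
        have "w ^ Suc n = of_real (exp (- (2 * pi) * exp u) ^ Suc n)" by (simp only: w_def of_real_power)
        also have "exp (- (2 * pi) * exp u) ^ Suc n = exp (real (Suc n) * (- (2 * pi) * exp u))"
          by (rule exp_of_nat_mult[symmetric])
        finally have "w ^ Suc n = of_real (exp (- (2 * pi * real (Suc n)) * exp u))" by (simp add: algebra_simps)
        then show ?thesis unfolding F_def norm_mult by (simp only: mult.assoc)
      qed
      ultimately show "summable (\<lambda>n. norm (F n u))" by simp
    qed
    have "(\<lambda>n. LINT u|lborel. F n u) sums (LINT u|lborel. (\<Sum>n. F n u))"
      by (rule sums_integral[OF Fi abs sumF])
    also have "(LINT u|lborel. (\<Sum>n. F n u)) = M s"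
      unfolding M_def using sums_unique[OF Fu] by simp
    finally have "(\<lambda>n. a (Suc n) * (Gamma s * exp (- s * ln (2 * pi * real (Suc n))))) sums M s" unfolding FI .
    from sums_mult[OF this, of "exp (s * ln (2 * pi)) * rGamma s"]
    have "(\<lambda>n. exp (s * ln (2 * pi)) * rGamma s * (a (Suc n) * (Gamma s * exp (- s * ln (2 * pi * real (Suc n)))))) sums L s"
      by (simp add: L_def)
    moreover have "exp (s * ln (2 * pi)) * rGamma s * (a (Suc n) * (Gamma s * exp (- s * ln (2 * pi * real (Suc n))))) = a (Suc n) * of_nat (Suc n) powr (- s)" for n
    proof -
      have "s \<notin> \<int>\<^sub>\<le>\<^sub>0" using s by (auto elim!: nonpos_Ints_cases)
      then have G: "rGamma s * Gamma s = 1" by (simp add: Gamma_def rGamma_eq_zero_iff)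
      have "ln (2 * pi * real (Suc n)) = ln (2 * pi) + ln (real (Suc n))" by (rule ln_mult_pos) auto
      then have "exp (s * ln (2 * pi)) * exp (- s * ln (2 * pi * real (Suc n))) = exp (- s * ln (real (Suc n)))"
        by (simp add: exp_add[symmetric] algebra_simps del: of_nat_Suc)
      also have "\<dots> = of_nat (Suc n) powr (- s)"
        by (simp add: powr_def Ln_of_nat mult.commute del: of_nat_Suc)
      finally have E: "exp (s * ln (2 * pi)) * exp (- s * ln (2 * pi * real (Suc n))) = of_nat (Suc n) powr (- s)" .
      have "exp (s * ln (2 * pi)) * rGamma s * (a (Suc n) * (Gamma s * exp (- s * ln (2 * pi * real (Suc n))))) =
         a (Suc n) * (rGamma s * Gamma s) * (exp (s * ln (2 * pi)) * exp (- s * ln (2 * pi * real (Suc n))))"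
        by (simp only: mult_ac)
      then show ?thesis unfolding E G by simp
    qed
    ultimately show ?thesis by (simp only:)
  qed
  have isL: "is_L_function f L" unfolding is_L_function_def qc using Lhol dirichlet by blast
  have "L_function f = L" unfolding L_function_def
  proof (rule the_equality[where P = "is_L_function f", OF isL])
    fix L' assume L': "is_L_function f L'"
    then obtain c where c: "\<And>s. Re s > c \<Longrightarrow> (\<lambda>n. q_coeff f (Suc n) * of_nat (Suc n) powr (- s)) sums L' s"
      and hol: "L' holomorphic_on UNIV" by (auto simp: is_L_function_def)
    define S where "S = {s. Re s > max c 4}"
    have eq: "L' s - L s = 0" if "s \<in> S" for s
      using c[of s] dirichlet[of s] that sums_unique2 by (auto simp: S_def qc)
    have opS: "open S" unfolding S_def by (rule open_halfspace_Re_gt)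
    have "complex_of_real (max c 4 + 1) \<in> S" by (auto simp: S_def max_def)
    show "L' = L"
    proof
      fix s
      have "L' s - L s = 0"
      proof (rule analytic_continuation[of "\<lambda>s. L' s - L s" UNIV S "complex_of_real (max c 4 + 1)"])
        show "complex_of_real (max c 4 + 1) islimpt S"
          using opS \<open>_ \<in> S\<close> by (intro interior_limit_point) (simp add: interior_open)
      qed (use eq hol Lhol in \<open>auto intro!: holomorphic_intros\<close>)
      then show "L' s = L s" by simp
    qed
  qed
  then have "L_function f 1 = L 1" by simp
  also have "\<dots> = 2 * pi * axis_integral f"
    by (simp add: L_def M_def h_def axis_integral_def rGamma_1 exp_of_real[symmetric] flip: exp_of_real) (simp add: exp_of_real)
  finally show ?thesis .
qed

section \<open>Cauchy's theorem for the ideal triangle 0, 1, infinity\<close>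

lemma integral_symmetric_limit:
  fixes h :: "real \<Rightarrow> complex"
  assumes "integrable lborel h" "continuous_on UNIV h"
  shows "(\<lambda>n. integral {- real n..real n} h) \<longlonglongrightarrow> (LINT u|lborel. h u)"
proof -
  have "(\<lambda>n. LINT u|lborel. indicator {- real n..real n} u *\<^sub>R h u) \<longlonglongrightarrow> (LINT u|lborel. h u)"
  proof (rule integral_dominated_convergence[where w = "\<lambda>u. norm (h u)"])
    show "AE u in lborel. (\<lambda>n. indicator {- real n..real n} u *\<^sub>R h u) \<longlonglongrightarrow> h u"
    proof (intro AE_I2)
      fix u :: real
      obtain N where "\<bar>u\<bar> \<le> real N" using real_arch_simple by blast
      then have "eventually (\<lambda>n. indicator {- real n..real n} u *\<^sub>R h u = h u) sequentially"
        by (intro eventually_mono[OF eventually_ge_at_top[of N]]) (auto simp: indicator_def)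
      then show "(\<lambda>n. indicator {- real n..real n} u *\<^sub>R h u) \<longlonglongrightarrow> h u" by (rule tendsto_eventually)
    qed
  qed (use assms in \<open>auto simp: indicator_def\<close>)
  moreover have "(LINT u|lborel. indicator {- real n..real n} u *\<^sub>R h u) = integral {- real n..real n} h" for n
  proof -
    have "set_integrable lborel {- real n..real n} h"
      unfolding set_integrable_def using assms by (intro integrable_mult_indicator) auto
    from set_borel_integral_eq_integral(2)[OF this] show ?thesis by (simp add: set_lebesgue_integral_def)
  qed
  ultimately show ?thesis by simp
qed

text \<open>The sector is convex, so a segment between two of its points stays inside.\<close>

lemma stolz_segment:
  assumes a: "Im a \<ge> norm a / 2" "Im a > 0" "norm a \<le> \<delta>" and b: "Im b \<ge> norm b / 2" "Im b > 0" "norm b \<le> \<delta>"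
    and x: "x \<in> closed_segment a b"
  shows "Im x \<ge> norm x / 2" "Im x > 0" "norm x \<le> \<delta>"
proof -
  obtain t where t: "x = (1 - t) *\<^sub>R a + t *\<^sub>R b" "0 \<le> t" "t \<le> 1" using x by (auto simp: closed_segment_def)
  have n: "norm x \<le> (1 - t) * norm a + t * norm b"
    unfolding t(1) using t by (intro order.trans[OF norm_triangle_ineq]) auto
  have i: "Im x = (1 - t) * Im a + t * Im b" by (simp add: t(1))
  have "(1 - t) * (norm a / 2) + t * (norm b / 2) \<le> (1 - t) * Im a + t * Im b"
    using a b t by (intro add_mono mult_left_mono) auto
  then show "Im x \<ge> norm x / 2" using n i by (simp add: field_simps)
  show "Im x > 0"
  proof (cases "t = 0")
    case False
    then have "t * Im b > 0" using t b by simp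
    moreover have "(1 - t) * Im a \<ge> 0" using t a by simp
    ultimately show ?thesis using i by linarith
  qed (use i a in simp)
  have "(1 - t) * norm a + t * norm b \<le> (1 - t) * \<delta> + t * \<delta>" using a b t by (intro add_mono mult_left_mono) auto
  then show "norm x \<le> \<delta>" using n by (simp add: algebra_simps)
qed

lemma primitive_difference:
  assumes G: "\<And>x. x \<in> upper_half \<Longrightarrow> (G has_field_derivative f x) (at x within upper_half)"
    and seg: "closed_segment a b \<subseteq> upper_half" and bd: "\<And>x. x \<in> closed_segment a b \<Longrightarrow> norm (f x) \<le> B"
  shows "norm (G a - G b) \<le> B * norm (a - b)"
  by (rule field_differentiable_bound[OF convex_closed_segment[of a b]])
     (use seg in \<open>auto intro: bd DERIV_subset[OF G]\<close>)

text \<open>Boundedness in an angle at the vertex 0. This is all that Cauchy's theorem below needs to know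
  about a finite vertex.\<close>

definition bounded_stolz :: "(complex \<Rightarrow> complex) \<Rightarrow> bool" where
  "bounded_stolz f \<longleftrightarrow> (\<exists>B \<delta>. \<delta> > 0 \<and> (\<forall>\<tau>. 0 < Im \<tau> \<longrightarrow> norm \<tau> \<le> \<delta> \<longrightarrow> Im \<tau> \<ge> norm \<tau> / 2 \<longrightarrow> norm (f \<tau>) \<le> B))"

lemma stolz_difference_limit:
  assumes G: "\<And>x. x \<in> upper_half \<Longrightarrow> (G has_field_derivative f x) (at x within upper_half)"
    and b: "bounded_stolz (\<lambda>\<tau>. f (c + \<tau>))" and c: "Im c = 0"
    and x: "\<And>n. Im (x n) > 0 \<and> Im (x n) \<ge> norm (x n) / 2 \<and> norm (x n) \<le> exp (- real n)"
    and y: "\<And>n. Im (y n) > 0 \<and> Im (y n) \<ge> norm (y n) / 2 \<and> norm (y n) \<le> exp (- real n)"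
  shows "(\<lambda>n. G (c + x n) - G (c + y n)) \<longlonglongrightarrow> 0"
proof -
  obtain B \<delta> where B: "\<delta> > 0" "\<And>\<tau>. 0 < Im \<tau> \<Longrightarrow> norm \<tau> \<le> \<delta> \<Longrightarrow> Im \<tau> \<ge> norm \<tau> / 2 \<Longrightarrow> norm (f (c + \<tau>)) \<le> B"
    using b by (auto simp: bounded_stolz_def)
  define B' where "B' = max B 0"
  have e0: "(\<lambda>n. exp (- real n)) \<longlonglongrightarrow> 0"
  proof -
    have "(\<lambda>n. exp (-1) ^ n) \<longlonglongrightarrow> (0::real)" by (intro LIMSEQ_realpow_zero) auto
    then show ?thesis by (simp add: exp_of_nat_mult[symmetric])
  qed
  have "\<forall>\<^sub>F n in sequentially. exp (- real n) < \<delta>" using e0 B(1) by (rule order_tendstoD)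
  then have "\<forall>\<^sub>F n in sequentially. norm (G (c + x n) - G (c + y n)) \<le> B' * (2 * exp (- real n))"
  proof eventually_elim
    case (elim n)
    have s: "Im z \<ge> norm z / 2" "Im z > 0" "norm z \<le> \<delta>" if "z \<in> closed_segment (x n) (y n)" for z
      using stolz_segment[of "x n" \<delta> "y n" z] x[of n] y[of n] elim that by auto
    have t: "\<exists>z\<in>closed_segment (x n) (y n). w = c + z" if "w \<in> closed_segment (c + x n) (c + y n)" for w
      using that closed_segment_translation[of c "x n" "y n"] by auto
    have "norm (G (c + x n) - G (c + y n)) \<le> B' * norm ((c + x n) - (c + y n))"
    proof (rule primitive_difference[OF G])
      show "closed_segment (c + x n) (c + y n) \<subseteq> upper_half"
      proof
        fix w assume "w \<in> closed_segment (c + x n) (c + y n)"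
        then obtain z where z: "z \<in> closed_segment (x n) (y n)" "w = c + z" using t by blast
        show "w \<in> upper_half" using s(2)[OF z(1)] z(2) c by simp
      qed
      fix w assume "w \<in> closed_segment (c + x n) (c + y n)"
      then obtain z where z: "z \<in> closed_segment (x n) (y n)" "w = c + z" using t by blast
      show "norm (f w) \<le> B'" using B(2)[of z] s[OF z(1)] z(2) by (auto simp: B'_def)
    qed
    also have "\<dots> \<le> B' * (2 * exp (- real n))"
    proof (rule mult_left_mono)
      have "norm ((c + x n) - (c + y n)) \<le> norm (x n) + norm (y n)" by (simp add: norm_triangle_ineq4)
      then show "norm ((c + x n) - (c + y n)) \<le> 2 * exp (- real n)" using x[of n] y[of n] by linarith
    qed (simp add: B'_def)
    finally show ?case .
  qed
  moreover have "(\<lambda>n. B' * (2 * exp (- real n))) \<longlonglongrightarrow> B' * (2 * 0)" by (intro tendsto_intros e0)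
  then have "(\<lambda>n. B' * (2 * exp (- real n))) \<longlonglongrightarrow> 0" by simp
  ultimately show ?thesis by (rule Lim_null_comparison)
qed

lemma integrable_tail:
  fixes h :: "real \<Rightarrow> complex"
  assumes c: "continuous_on UNIV h" and bd: "\<And>u. \<bar>u\<bar> \<ge> R \<Longrightarrow> norm (h u) \<le> B * exp (- \<bar>u\<bar>)"
  shows "integrable lborel h"
proof -
  have "bounded (h ` {-\<bar>R\<bar>..\<bar>R\<bar>})"
    by (intro compact_imp_bounded compact_continuous_image continuous_on_subset[OF c]) auto
  then obtain M where M: "M > 0" "\<And>u. u \<in> {-\<bar>R\<bar>..\<bar>R\<bar>} \<Longrightarrow> norm (h u) \<le> M" by (auto simp: bounded_pos)
  have all: "norm (h u) \<le> (\<bar>B\<bar> + M * exp \<bar>R\<bar>) * exp (- \<bar>u\<bar>)" for u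
  proof (cases "\<bar>u\<bar> \<le> \<bar>R\<bar>")
    case True
    have "norm (h u) \<le> M * 1" using M True by (auto simp: abs_le_iff)
    also have "\<dots> \<le> M * (exp \<bar>R\<bar> * exp (- \<bar>u\<bar>))" using M True by (intro mult_left_mono) (auto simp: exp_add[symmetric])
    also have "\<dots> \<le> (\<bar>B\<bar> + M * exp \<bar>R\<bar>) * exp (- \<bar>u\<bar>)" by (simp add: algebra_simps)
    finally show ?thesis .
  next
    case False
    then have "norm (h u) \<le> B * exp (- \<bar>u\<bar>)" by (intro bd) auto
    also have "\<dots> \<le> (\<bar>B\<bar> + M * exp \<bar>R\<bar>) * exp (- \<bar>u\<bar>)" using M by (intro mult_right_mono) (auto intro: add_increasing2)
    finally show ?thesis .
  qed
  have "integrable lborel (\<lambda>u. (\<bar>B\<bar> + M * exp \<bar>R\<bar>) * exp (- \<bar>u\<bar>))" by (intro integrable_mult_right integrable_exp_abs)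
  then show ?thesis
  proof (rule Bochner_Integration.integrable_bound)
    show "h \<in> borel_measurable lborel" using c by (simp add: borel_measurable_continuous_onI)
    show "AE u in lborel. norm (h u) \<le> norm ((\<bar>B\<bar> + M * exp \<bar>R\<bar>) * exp (- \<bar>u\<bar>))"
      using all M by (auto simp: abs_mult)
  qed
qed

lemma vertical_integrable:
  assumes hol: "f holomorphic_on upper_half"
    and inf: "k > 0" "\<And>\<tau>. Im \<tau> \<ge> 2 \<Longrightarrow> norm (f \<tau>) \<le> C * exp (- k * Im \<tau>)"
    and b: "bounded_stolz (\<lambda>\<tau>. f (c + \<tau>))" and c: "Im c = 0"
  shows "integrable lborel (\<lambda>u. f (c + \<i> * exp (of_real u)) * exp (of_real u))"
proof -
  obtain B \<delta> where B: "\<delta> > 0" "\<And>\<tau>. 0 < Im \<tau> \<Longrightarrow> norm \<tau> \<le> \<delta> \<Longrightarrow> Im \<tau> \<ge> norm \<tau> / 2 \<Longrightarrow> norm (f (c + \<tau>)) \<le> B"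
    using b by (auto simp: bounded_stolz_def)
  obtain D where D: "D > 0" "\<And>u. u \<ge> 0 \<Longrightarrow> exp (- k * exp u) \<le> D * exp (- 2 * u)"
    using exp_exp_bound[OF inf(1)] by blast
  have C0: "C \<ge> 0"
  proof -
    have "0 \<le> C * exp (- k * 2)" using order_trans[OF norm_ge_zero inf(2)[of "2 * \<i>"]] by simp
    then show ?thesis by (simp add: zero_le_mult_iff)
  qed
  show ?thesis
  proof (rule integrable_tail[where R = "max 1 (- ln \<delta>)" and B = "max B (C * D)"])
    show "continuous_on UNIV (\<lambda>u. f (c + \<i> * exp (of_real u)) * exp (of_real u))"
      by (intro continuous_intros continuous_on_compose2[OF holomorphic_on_imp_continuous_on[OF hol]])
         (auto simp: c exp_of_real)
    fix u :: real assume u: "\<bar>u\<bar> \<ge> max 1 (- ln \<delta>)"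
    have nn: "norm (f (c + \<i> * exp (of_real u)) * exp (of_real u)) = norm (f (c + \<i> * exp (of_real u))) * exp u"
      by (simp add: norm_mult)
    show "norm (f (c + \<i> * exp (of_real u)) * exp (of_real u)) \<le> max B (C * D) * exp (- \<bar>u\<bar>)"
    proof (cases "u \<ge> 0")
      case True
      have "exp u \<ge> 2" using u True exp_ge_add_one_self[of u] by linarith
      then have "norm (f (c + \<i> * exp (of_real u))) \<le> C * exp (- k * exp u)"
        using inf(2)[of "c + \<i> * exp (of_real u)"] c by (simp add: exp_of_real)
      also have "\<dots> \<le> C * (D * exp (- 2 * u))" using D True C0 by (intro mult_left_mono) auto
      finally have "norm (f (c + \<i> * exp (of_real u))) * exp u \<le> (C * (D * exp (- 2 * u))) * exp u" by (intro mult_right_mono) auto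
      also have "\<dots> = (C * D) * exp (- \<bar>u\<bar>)" using True by (simp add: exp_add[symmetric] mult.assoc)
      also have "\<dots> \<le> max B (C * D) * exp (- \<bar>u\<bar>)" by (intro mult_right_mono) auto
      finally show ?thesis unfolding nn .
    next
      case False
      then have "u \<le> ln \<delta>" using u by auto
      then have "exp u \<le> \<delta>" using B(1) by (metis exp_le_cancel_iff exp_ln)
      then have "norm (f (c + \<i> * exp (of_real u))) \<le> B"
        by (intro B(2)) (auto simp: exp_of_real norm_mult)
      then have "norm (f (c + \<i> * exp (of_real u))) * exp u \<le> B * exp (- \<bar>u\<bar>)" using False by simp
      also have "\<dots> \<le> max B (C * D) * exp (- \<bar>u\<bar>)" by (intro mult_right_mono) auto
      finally show ?thesis unfolding nn .
    qed
  qed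
qed

text \<open>Cauchy's theorem for the triangle with the vertices 0, 1 and infinity, through a primitive
  \<open>G\<close> of \<open>f\<close> on the half-plane. Each side is truncated to logarithmic parameters
  of absolute value at most \<open>n\<close>, and at each vertex the difference of the values of
  \<open>G\<close> on the two adjacent sides tends to 0. The third side is parametrised as the image of the
  imaginary axis under \<open>w \<mapsto> w / (1 + w)\<close>.\<close>

theorem ideal_triangle:
  fixes f :: "complex \<Rightarrow> complex"
  assumes hol: "f holomorphic_on upper_half"
    and inf: "k > 0" "\<And>\<tau>. Im \<tau> \<ge> 2 \<Longrightarrow> norm (f \<tau>) \<le> C * exp (- k * Im \<tau>)"
    and b0: "bounded_stolz f" and b1: "bounded_stolz (\<lambda>\<tau>. f (1 + \<tau>))"
  shows "(LINT u|lborel. f (\<i> * exp (of_real u)) * exp (of_real u)) - (LINT u|lborel. f (1 + \<i> * exp (of_real u)) * exp (of_real u))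
       = (LINT u|lborel. f (\<i> * exp (of_real u) / (1 + \<i> * exp (of_real u))) * (exp (of_real u) / (1 + \<i> * exp (of_real u))^2))"
proof -
  obtain G where G: "\<And>x. x \<in> upper_half \<Longrightarrow> (G has_field_derivative f x) (at x within upper_half)"
    using holomorphic_convex_primitive'[OF convex_HH open_HH hol] by blast
  then have G': "(G has_field_derivative f x) (at x)" if "Im x > 0" for x
    using that at_within_open[OF _ open_HH, of x] by fastforce
  \<comment> \<open>logarithmic coordinates: \<open>e\<close> runs along the imaginary axis, \<open>\<gamma>\<close> along the semicircle from 0 to 1\<close>
  define e where "e = (\<lambda>u::real. \<i> * exp (complex_of_real u))"
  define \<gamma> where "\<gamma> = (\<lambda>u. e u / (1 + e u))"
  have eI: "Im (e u) > 0" "Re (e u) = 0" "norm (e u) = exp u" "Im (e u) = exp u" for u by (simp_all add: e_def exp_of_real norm_mult)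
  have ne: "1 + e u \<noteq> 0" for u using eI(1)[of u] by (auto simp: complex_eq_iff)
  have nsq: "(norm (1 + e u))^2 = 1 + (exp u)^2" for u by (simp add: cmod_power2 eI)
  have \<gamma>I: "Im (\<gamma> u) = exp u / (1 + (exp u)^2)" for u
    using nsq[of u] by (simp add: \<gamma>_def Im_divide eI cmod_power2 power2_eq_square)
  have \<gamma>pos: "Im (\<gamma> u) > 0" for u unfolding \<gamma>I by (intro divide_pos_pos add_pos_nonneg) auto
  have de: "((\<lambda>u. e u) has_vector_derivative e u) (at u within S)" for u S
    unfolding e_def by (auto intro!: derivative_eq_intros has_vector_derivative_real_field)
  have ft: "((\<lambda>u. f (p u) * p' u) has_integral (G (p b) - G (p a))) {a..b}"
    if "a \<le> b" "\<And>u S. (p has_vector_derivative p' u) (at u within S)" "\<And>u. Im (p u) > 0" for p p' and a b :: real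
  proof (rule fundamental_theorem_of_calculus[OF that(1)])
    fix u assume "u \<in> {a..b}"
    have "((G \<circ> p) has_vector_derivative p' u * f (p u)) (at u within {a..b})"
      by (rule field_vector_diff_chain_within[OF that(2) has_field_derivative_at_within[OF G'[OF that(3)]]])
    then show "((\<lambda>u. G (p u)) has_vector_derivative f (p u) * p' u) (at u within {a..b})"
      by (simp add: o_def mult.commute)
  qed
  have dg: "(\<gamma> has_vector_derivative e u / (1 + e u)^2) (at u within S)" for u S
  proof -
    have "((\<lambda>w. w / (1 + w)) has_field_derivative 1 / (1 + e u)^2) (at (e u))"
      using ne[of u] by (auto intro!: derivative_eq_intros simp: power2_eq_square)
    then have "((\<lambda>w. w / (1 + w)) has_field_derivative 1 / (1 + e u)^2) (at (e u) within (e ` S))"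
      by (rule DERIV_subset) auto
    from field_vector_diff_chain_within[OF de this] show ?thesis by (simp add: \<gamma>_def o_def)
  qed
  have ce: "continuous_on UNIV e" unfolding e_def by (intro continuous_intros)
  have cf: "continuous_on UNIV (\<lambda>u. f (p u))" if "continuous_on UNIV p" "\<And>u. Im (p u) > 0" for p
    by (rule continuous_on_compose2[OF holomorphic_on_imp_continuous_on[OF hol] that(1)]) (use that in auto)
  let ?I0 = "\<lambda>n. integral {- real n..real n} (\<lambda>u. f (e u) * exp (of_real u))"
  let ?I1 = "\<lambda>n. integral {- real n..real n} (\<lambda>u. f (1 + e u) * exp (of_real u))"
  let ?I2 = "\<lambda>n. integral {- real n..real n} (\<lambda>u. f (\<gamma> u) * (exp (of_real u) / (1 + e u)^2))"
  have i0: "integrable lborel (\<lambda>u. f (e u) * exp (of_real u))"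
    using vertical_integrable[OF hol inf, of 0] b0 by (simp add: e_def)
  have i1: "integrable lborel (\<lambda>u. f (1 + e u) * exp (of_real u))"
    using vertical_integrable[OF hol inf b1] by (simp add: e_def)
  have L0: "?I0 \<longlonglongrightarrow> (LINT u|lborel. f (e u) * exp (of_real u))"
    by (rule integral_symmetric_limit) (use i0 eI in \<open>auto intro!: continuous_intros cf ce\<close>)
  have L1: "?I1 \<longlonglongrightarrow> (LINT u|lborel. f (1 + e u) * exp (of_real u))"
    by (rule integral_symmetric_limit) (use i1 eI in \<open>auto intro!: continuous_intros cf ce\<close>)
  have v0: "\<i> * ?I0 n = G (e (real n)) - G (e (- real n))" for n
  proof -
    have "((\<lambda>u. f (e u) * e u) has_integral (G (e (real n)) - G (e (- real n)))) {- real n..real n}"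
      by (rule ft) (use de eI in auto)
    moreover have "f (e u) * e u = \<i> * (f (e u) * exp (of_real u))" for u by (simp add: e_def)
    ultimately show ?thesis by (simp add: integral_unique flip: integral_mult_right)
  qed
  have v1: "\<i> * ?I1 n = G (1 + e (real n)) - G (1 + e (- real n))" for n
  proof -
    have "((\<lambda>u. f (1 + e u) * e u) has_integral (G (1 + e (real n)) - G (1 + e (- real n)))) {- real n..real n}"
      by (rule ft) (use de eI in \<open>auto intro!: derivative_eq_intros\<close>)
    moreover have "f (1 + e u) * e u = \<i> * (f (1 + e u) * exp (of_real u))" for u by (simp add: e_def)
    ultimately show ?thesis by (simp add: integral_unique flip: integral_mult_right)
  qed
  have v2: "\<i> * ?I2 n = G (\<gamma> (real n)) - G (\<gamma> (- real n))" for n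
  proof -
    have "((\<lambda>u. f (\<gamma> u) * (e u / (1 + e u)^2)) has_integral (G (\<gamma> (real n)) - G (\<gamma> (- real n)))) {- real n..real n}"
      by (rule ft) (use dg \<gamma>pos in auto)
    moreover have "f (\<gamma> u) * (e u / (1 + e u)^2) = \<i> * (f (\<gamma> u) * (exp (of_real u) / (1 + e u)^2))" for u by (simp add: e_def)
    ultimately have "((\<lambda>u. \<i> * (f (\<gamma> u) * (exp (of_real u) / (1 + e u)^2))) has_integral (G (\<gamma> (real n)) - G (\<gamma> (- real n)))) {- real n..real n}"
      by (simp only:)
    from integral_unique[OF this] show ?thesis by (simp only: integral_mult_right)
  qed
  have en: "Im (e (- real n)) > 0 \<and> Im (e (- real n)) \<ge> norm (e (- real n)) / 2 \<and> norm (e (- real n)) \<le> exp (- real n)" for n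
    by (simp add: eI)
  have n1: "norm (1 + e u) \<ge> 1" "norm (1 + e u) \<ge> exp u" for u
    by (rule power2_le_imp_le; simp add: nsq)+
  have gm: "Im (\<gamma> u) > 0 \<and> Im (\<gamma> u) \<ge> norm (\<gamma> u) / 2 \<and> norm (\<gamma> u) \<le> exp u" if "u \<le> 0" for u
  proof -
    have "norm (\<gamma> u) = exp u / norm (1 + e u)" by (simp add: \<gamma>_def norm_divide eI)
    also have "\<dots> \<le> exp u / 1" using n1 by (intro divide_left_mono) (auto simp: ne)
    finally have a: "norm (\<gamma> u) \<le> exp u" by simp
    have "(exp u)^2 \<le> 1" using that by (simp add: power_le_one)
    then have "exp u / 2 \<le> Im (\<gamma> u)" unfolding \<gamma>I by (intro divide_left_mono) (auto intro: add_pos_nonneg)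
    with a show ?thesis using \<gamma>pos by auto
  qed
  have gp: "Im (\<gamma> u - 1) > 0 \<and> Im (\<gamma> u - 1) \<ge> norm (\<gamma> u - 1) / 2 \<and> norm (\<gamma> u - 1) \<le> exp (- u)" if "u \<ge> 0" for u
  proof -
    have "\<gamma> u - 1 = - 1 / (1 + e u)" using ne[of u] by (simp add: \<gamma>_def field_simps)
    then have "norm (\<gamma> u - 1) = 1 / norm (1 + e u)" by (simp add: norm_divide)
    also have "\<dots> \<le> 1 / exp u" using n1 by (intro divide_left_mono) (auto simp: ne)
    finally have a: "norm (\<gamma> u - 1) \<le> exp (- u)" by (simp add: exp_minus field_simps)
    have "1 \<le> (exp u)^2" using that by (simp add: one_le_power)
    then have "exp u / (2 * (exp u)^2) \<le> Im (\<gamma> u)" unfolding \<gamma>I by (intro divide_left_mono) (auto intro: add_pos_nonneg)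
    moreover have "exp u / (2 * (exp u)^2) = exp (- u) / 2" by (simp add: power2_eq_square exp_minus field_simps)
    ultimately show ?thesis using a \<gamma>pos[of u] by auto
  qed
  have i2: "integrable lborel (\<lambda>u. f (\<gamma> u) * (exp (of_real u) / (1 + e u)^2))"
  proof -
    obtain B0 \<delta>0 where B0: "\<delta>0 > 0" "\<And>\<tau>. 0 < Im \<tau> \<Longrightarrow> norm \<tau> \<le> \<delta>0 \<Longrightarrow> Im \<tau> \<ge> norm \<tau> / 2 \<Longrightarrow> norm (f \<tau>) \<le> B0"
      using b0 by (auto simp: bounded_stolz_def)
    obtain B1 \<delta>1 where B1: "\<delta>1 > 0" "\<And>\<tau>. 0 < Im \<tau> \<Longrightarrow> norm \<tau> \<le> \<delta>1 \<Longrightarrow> Im \<tau> \<ge> norm \<tau> / 2 \<Longrightarrow> norm (f (1 + \<tau>)) \<le> B1"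
      using b1 by (auto simp: bounded_stolz_def)
    show ?thesis
    proof (rule integrable_tail[where R = "max (- ln \<delta>0) (- ln \<delta>1)" and B = "max (max B0 B1) 0"])
      have "continuous_on UNIV \<gamma>" unfolding \<gamma>_def by (intro continuous_intros ce) (use ne in auto)
      then show "continuous_on UNIV (\<lambda>u. f (\<gamma> u) * (exp (of_real u) / (1 + e u)^2))"
        by (intro continuous_intros cf ce) (use ne \<gamma>pos in auto)
      fix u :: real assume u: "\<bar>u\<bar> \<ge> max (- ln \<delta>0) (- ln \<delta>1)"
      have nn: "norm (f (\<gamma> u) * (exp (of_real u) / (1 + e u)^2)) = norm (f (\<gamma> u)) * (exp u / (norm (1 + e u))^2)"
        by (simp add: norm_mult norm_divide norm_power)
      have main: "norm (f (\<gamma> u)) \<le> max (max B0 B1) 0 \<and> exp u / (norm (1 + e u))^2 \<le> exp (- \<bar>u\<bar>)"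
      proof (cases "u \<le> 0")
        case True
        then have "u \<le> ln \<delta>0" using u by auto
        then have "exp u \<le> \<delta>0" using B0(1) by (metis exp_le_cancel_iff exp_ln)
        then have "norm (f (\<gamma> u)) \<le> B0" using gm[OF True] by (intro B0(2)) auto
        moreover have "exp u / (norm (1 + e u))^2 \<le> exp u / 1"
          using n1(1)[of u] by (intro divide_left_mono) (simp_all add: ne one_le_power)
        ultimately show ?thesis using True by auto
      next
        case False
        then have "- u \<le> ln \<delta>1" using u by auto
        then have "exp (- u) \<le> \<delta>1" using B1(1) by (metis exp_le_cancel_iff exp_ln)
        then have "norm (f (1 + (\<gamma> u - 1))) \<le> B1" using gp[of u] False by (intro B1(2)) auto
        moreover have "exp u / (norm (1 + e u))^2 \<le> exp u / (exp u)^2"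
          using n1(2)[of u] by (intro divide_left_mono power_mono) (simp_all add: ne)
        moreover have "exp u / (exp u)^2 = exp (- u)" by (simp add: power2_eq_square exp_minus field_simps)
        ultimately show ?thesis using False by auto
      qed
      then show "norm (f (\<gamma> u) * (exp (of_real u) / (1 + e u)^2)) \<le> max (max B0 B1) 0 * exp (- \<bar>u\<bar>)"
        unfolding nn by (intro mult_mono) auto
    qed
  qed
  have L2: "?I2 \<longlonglongrightarrow> (LINT u|lborel. f (\<gamma> u) * (exp (of_real u) / (1 + e u)^2))"
  proof (rule integral_symmetric_limit)
    have "continuous_on UNIV \<gamma>" unfolding \<gamma>_def by (intro continuous_intros ce) (use ne in auto)
    then show "continuous_on UNIV (\<lambda>u. f (\<gamma> u) * (exp (of_real u) / (1 + e u)^2))"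
      by (intro continuous_intros cf ce) (use ne \<gamma>pos in auto)
  qed (use i2 in \<open>simp add: \<gamma>_def e_def\<close>)
  \<comment> \<open>near the vertices 0 and 1 the two sides stay in a common angle, so the primitive has the same limit along both\<close>
  have l0: "(\<lambda>n. G (0 + e (- real n)) - G (0 + \<gamma> (- real n))) \<longlonglongrightarrow> 0"
    by (rule stolz_difference_limit[OF G _ _ en gm]) (use b0 in auto)
  have l1: "(\<lambda>n. G (1 + e (- real n)) - G (1 + (\<gamma> (real n) - 1))) \<longlonglongrightarrow> 0"

  proof (rule stolz_difference_limit[OF G b1 _ en])
    show "Im (\<gamma> (real n) - 1) > 0 \<and> Im (\<gamma> (real n) - 1) \<ge> norm (\<gamma> (real n) - 1) / 2 \<and> norm (\<gamma> (real n) - 1) \<le> exp (- real n)" for n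
      using gp[of "real n"] by simp
  qed auto
  have C0: "C \<ge> 0"
  proof -
    have "0 \<le> C * exp (- k * 2)" using order_trans[OF norm_ge_zero inf(2)[of "2 * \<i>"]] by simp
    then show ?thesis by (simp add: zero_le_mult_iff)
  qed
  \<comment> \<open>at the vertex at infinity the horizontal segment of length 1 contributes an exponentially small amount\<close>
  have li: "(\<lambda>n. G (e (real n)) - G (1 + e (real n))) \<longlonglongrightarrow> 0"
  proof (rule Lim_null_comparison)
    show "\<forall>\<^sub>F n in sequentially. norm (G (e (real n)) - G (1 + e (real n))) \<le> C * exp (- k * real n)"
    proof (rule eventually_mono[OF eventually_ge_at_top[of 1]])
      fix n :: nat assume n: "1 \<le> n"
      have I: "Im z = exp (real n)" if "z \<in> closed_segment (e (real n)) (1 + e (real n))" for z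
        using that by (auto simp: closed_segment_def eI algebra_simps)
      have ex: "exp (real n) \<ge> 2" "exp (real n) \<ge> real n" using exp_ge_add_one_self[of "real n"] n by linarith+
      have "norm (G (e (real n)) - G (1 + e (real n))) \<le> (C * exp (- k * real n)) * norm (e (real n) - (1 + e (real n)))"
      proof (rule primitive_difference[OF G])
        show "closed_segment (e (real n)) (1 + e (real n)) \<subseteq> upper_half" using I by auto
        fix z assume z: "z \<in> closed_segment (e (real n)) (1 + e (real n))"
        have "norm (f z) \<le> C * exp (- k * Im z)" using I[OF z] ex by (intro inf) auto
        also have "\<dots> \<le> C * exp (- k * real n)" using I[OF z] ex C0 inf(1) by (intro mult_left_mono) auto
        finally show "norm (f z) \<le> C * exp (- k * real n)" .
      qed
      then show "norm (G (e (real n)) - G (1 + e (real n))) \<le> C * exp (- k * real n)" by simp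
    qed
    have "(\<lambda>n. exp (- k) ^ n) \<longlonglongrightarrow> 0" using inf(1) by (intro LIMSEQ_realpow_zero) auto
    then have "(\<lambda>n. exp (- k * real n)) \<longlonglongrightarrow> 0" by (simp add: exp_of_nat_mult[symmetric] mult.commute)
    from tendsto_mult[OF tendsto_const this, of C] show "(\<lambda>n. C * exp (- k * real n)) \<longlonglongrightarrow> 0" by simp
  qed
  have "(\<lambda>n. (G (e (real n)) - G (1 + e (real n))) - (G (0 + e (- real n)) - G (0 + \<gamma> (- real n))) + (G (1 + e (- real n)) - G (1 + (\<gamma> (real n) - 1)))) \<longlonglongrightarrow> 0 - 0 + 0"
    by (intro tendsto_intros li l0 l1)
  moreover have "(G (e (real n)) - G (1 + e (real n))) - (G (0 + e (- real n)) - G (0 + \<gamma> (- real n))) + (G (1 + e (- real n)) - G (1 + (\<gamma> (real n) - 1))) = \<i> * (?I0 n - ?I1 n - ?I2 n)" for n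
    using v0[of n] v1[of n] v2[of n] by (simp add: right_diff_distrib)
  ultimately have "(\<lambda>n. \<i> * (?I0 n - ?I1 n - ?I2 n)) \<longlonglongrightarrow> 0" by simp
  moreover have "(\<lambda>n. \<i> * (?I0 n - ?I1 n - ?I2 n)) \<longlonglongrightarrow> \<i> * ((LINT u|lborel. f (e u) * exp (of_real u)) - (LINT u|lborel. f (1 + e u) * exp (of_real u)) - (LINT u|lborel. f (\<gamma> u) * (exp (of_real u) / (1 + e u)^2)))"
    by (intro tendsto_intros L0 L1 L2)
  ultimately have "\<i> * ((LINT u|lborel. f (e u) * exp (of_real u)) - (LINT u|lborel. f (1 + e u) * exp (of_real u)) - (LINT u|lborel. f (\<gamma> u) * (exp (of_real u) / (1 + e u)^2))) = 0"
    using LIMSEQ_unique by blast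
  then show ?thesis by (simp add: e_def \<gamma>_def)
qed

section \<open>Periods of eta quotients\<close>

definition period :: "int \<Rightarrow> int \<Rightarrow> complex" where "period a c = axis_integral (eta_quot a c)"

lemma period_integrable: "cuspidal a c \<Longrightarrow> integrable lborel (\<lambda>u. eta_quot a c (\<i> * exp (of_real u)) * exp (of_real u))"
  using rapid_decay_integrable[OF eta_quot_rapid, of a c 1] by (simp add: exp_of_real)

lemma period_real: "cnj (period a c) = period a c"
proof -
  have r: "cnj (eta_quot a c (\<i> * exp (of_real u)) * exp (of_real u)) = eta_quot a c (\<i> * exp (of_real u)) * exp (of_real u)" for u :: real
  proof -
    have "- cnj (\<i> * exp (complex_of_real u)) = \<i> * exp (of_real u)" by (simp add: exp_of_real)
    then have "cnj (eta_quot a c (\<i> * exp (of_real u))) = eta_quot a c (\<i> * exp (of_real u))"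
      using eta_quot_reflect[of "\<i> * exp (of_real u)" a c] by (simp add: exp_of_real)
    then show ?thesis by (simp add: exp_of_real)
  qed
  have "cnj (period a c) = (LINT u|lborel. cnj (eta_quot a c (\<i> * exp (of_real u)) * exp (of_real u)))"
    unfolding period_def axis_integral_def by (rule Bochner_Integration.integral_cnj[symmetric])
  then show ?thesis unfolding r by (simp only: period_def axis_integral_def)
qed

text \<open>The inversion, in logarithmic coordinates \<open>u \<mapsto> - u\<close>. The factor \<open>exp
  u ^ 3\<close> of weight 3 exchanges the moments 1 and 2.\<close>

lemma axis_integral_inversion:
  assumes "cuspidal a c"
  shows "integrable lborel (\<lambda>u. eta_quot a c (\<i> * exp (of_real u)) * exp (of_real u)^2)"
    and "(LINT u|lborel. eta_quot a c (\<i> * exp (of_real u)) * exp (of_real u)^2) = of_real (sqrt 2) powi (a - c) * period c a"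
proof -
  have e2: "exp (complex_of_real u)^2 = exp (of_real u * 2)" for u
    by (simp add: exp_of_nat_mult[symmetric] mult.commute)
  show I: "integrable lborel (\<lambda>u. eta_quot a c (\<i> * exp (of_real u)) * exp (of_real u)^2)"
    unfolding e2 using rapid_decay_integrable[OF eta_quot_rapid[OF assms], of 2] by simp
  have "(LINT u|lborel. eta_quot a c (\<i> * exp (of_real u)) * exp (of_real u)^2) =
     \<bar>- 1\<bar> *\<^sub>R (LINT u|lborel. eta_quot a c (\<i> * exp (of_real (0 + (-1) * u))) * exp (of_real (0 + (-1) * u))^2)"
    by (rule lborel_integral_real_affine) simp
  also have "\<dots> = (LINT u|lborel. of_real (sqrt 2) powi (a - c) * (eta_quot c a (\<i> * exp (of_real u)) * exp (of_real u)))"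
  proof -
    have "eta_quot a c (\<i> * exp (of_real (0 + (-1) * u))) * exp (of_real (0 + (-1) * u))^2 = of_real (sqrt 2) powi (a - c) * (eta_quot c a (\<i> * exp (of_real u)) * exp (of_real u))" for u
    proof -
      have "exp (of_real (3 * u)) * exp (of_real (- u))^2 = exp (complex_of_real u)"
        by (simp add: exp_of_nat_mult[symmetric] exp_add[symmetric])
      then show ?thesis using eta_quot_S_imag[of a c u] by (simp add: mult_ac)
    qed
    then show ?thesis by simp
  qed
  finally show "(LINT u|lborel. eta_quot a c (\<i> * exp (of_real u)) * exp (of_real u)^2) = of_real (sqrt 2) powi (a - c) * period c a"
    by (simp add: period_def axis_integral_def)
qed

lemma eta_quot_shift:
  assumes "Im \<tau> > 0"
  shows "eta_quot x y (\<tau> + of_int n) = zeta powi (n * (12 - x + 2 * y)) * (if even n then eta_quot x y \<tau> else eta_quot (-x) (y - x) \<tau>)"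
proof -
  have step: "eta_quot x y (\<tau> + of_int (i + 1)) = zeta powi (12 - x + 2 * y) * eta_quot (-x) (y - x) (\<tau> + of_int i)" for x y i
    using eta_quot_T[of "\<tau> + of_int i" x y] assms by (simp add: add.assoc)
  have inv: "12 - (-x) + 2 * (y - x) = 12 - x + 2 * y" for x y :: int by simp
  have "\<forall>x y. eta_quot x y (\<tau> + of_int n) = zeta powi (n * (12 - x + 2 * y)) * (if even n then eta_quot x y \<tau> else eta_quot (-x) (y - x) \<tau>)"
  proof (induction n rule: int_induct[where k = 0])
    case (step1 i)
    show ?case
    proof (intro allI)
      fix x y
      show "eta_quot x y (\<tau> + of_int (i + 1)) = zeta powi ((i + 1) * (12 - x + 2 * y)) * (if even (i + 1) then eta_quot x y \<tau> else eta_quot (-x) (y - x) \<tau>)"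
        unfolding step using step1(2)[rule_format, of "-x" "y - x", unfolded inv]
        by (auto simp: power_int_add distrib_right)
    qed
  next
    case (step2 i)
    show ?case
    proof (intro allI)
      fix x y
      define e :: int where "e = 12 - x + 2 * y"
      have "eta_quot (-x) (y - x) (\<tau> + of_int i) = zeta powi e * eta_quot x y (\<tau> + of_int (i - 1))"
        using step[of "-x" "y - x" "i - 1"] by (simp add: e_def algebra_simps)
      then have "eta_quot x y (\<tau> + of_int (i - 1)) = zeta powi (- e) * eta_quot (-x) (y - x) (\<tau> + of_int i)"
        by (simp add: power_int_minus)
      also have "\<dots> = zeta powi ((i - 1) * (12 - x + 2 * y)) * (if even (i - 1) then eta_quot x y \<tau> else eta_quot (-x) (y - x) \<tau>)"
      proof -
        have "zeta powi (- e) * zeta powi (i * e) = zeta powi ((i - 1) * e)"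
          by (simp add: power_int_add[symmetric] algebra_simps)
        then show ?thesis using step2(2)[rule_format, of "-x" "y - x", unfolded inv, folded e_def] unfolding e_def[symmetric]
          by (auto simp: mult.assoc[symmetric])
      qed
      finally show "eta_quot x y (\<tau> + of_int (i - 1)) = zeta powi ((i - 1) * (12 - x + 2 * y)) * (if even (i - 1) then eta_quot x y \<tau> else eta_quot (-x) (y - x) \<tau>)" .
    qed
  qed simp
  then show ?thesis by blast
qed

lemma bounded_stolz_eta_quot: "cuspidal a c \<Longrightarrow> bounded_stolz (eta_quot a c)"
proof -
  assume "cuspidal a c"
  then obtain B where B: "\<And>\<tau>. 0 < norm \<tau> \<Longrightarrow> norm \<tau> \<le> 1/2 \<Longrightarrow> Im \<tau> \<ge> norm \<tau> / 4 \<Longrightarrow> norm (eta_quot a c \<tau>) \<le> B"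
    using eta_quot_stolz by blast
  show ?thesis unfolding bounded_stolz_def
  proof (rule exI[of _ B], rule exI[of _ "1/2"], intro conjI allI impI)
    fix \<tau> :: complex assume "0 < Im \<tau>" "norm \<tau> \<le> 1/2" "Im \<tau> \<ge> norm \<tau> / 2"
    then show "norm (eta_quot a c \<tau>) \<le> B" by (intro B) auto
  qed simp
qed

lemma bounded_stolz_cong:
  assumes "bounded_stolz f" "\<And>\<tau>. Im \<tau> > 0 \<Longrightarrow> norm (g \<tau>) = norm (f \<tau>)"
  shows "bounded_stolz g"
  using assms by (auto simp: bounded_stolz_def)

text \<open>The map \<open>w \<mapsto> w / (1 + w)\<close> is inversion, translation by \<open>-1\<close>
  and inversion again.\<close>

lemma eta_quot_arc:
  assumes w: "Im w > 0"
  shows "eta_quot a c (w / (1 + w)) = of_real (sqrt 2) powi (- c) * zeta powi (- (12 + 2 * a - c)) * (1 + w)^3 * eta_quot (a - c) (- c) w"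
proof -
  define \<sigma> where "\<sigma> = - 1 / w - 1"
  have w0: "w \<noteq> 0" "1 + w \<noteq> 0" "w \<noteq> - 1" "- 1 \<noteq> w" using w by (auto simp: complex_eq_iff)
  have s1: "\<sigma> + 1 = - 1 / w" by (simp add: \<sigma>_def)
  have Is: "Im \<sigma> > 0" using w0 w unfolding \<sigma>_def minus_complex.simps Im_neg_inverse by simp
  have "- 1 / \<sigma> = w / (1 + w)" using w0 by (simp add: \<sigma>_def divide_simps) (simp add: algebra_simps)
  then have 1: "eta_quot a c (w / (1 + w)) = (- \<i> * \<sigma>) ^ 3 * of_real (sqrt 2) powi (a - c) * eta_quot c a \<sigma>"
    using eta_quot_S[OF Is, of a c] by simp
  have "zeta powi (12 - (- c) + 2 * (a - c)) * eta_quot (- (- c)) (a - c - (- c)) \<sigma> = eta_quot (- c) (a - c) (\<sigma> + 1)"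
    using eta_quot_T[OF Is, of "- c" "a - c"] by simp
  also have "\<dots> = (- \<i> * w) ^ 3 * of_real (sqrt 2) powi (- c - (a - c)) * eta_quot (a - c) (- c) w"
    unfolding s1 by (rule eta_quot_S[OF w])
  finally have "zeta powi (12 + 2 * a - c) * eta_quot c a \<sigma> = (- \<i> * w) ^ 3 * of_real (sqrt 2) powi (- a) * eta_quot (a - c) (- c) w"
    by (simp add: algebra_simps)
  then have 2: "eta_quot c a \<sigma> = zeta powi (- (12 + 2 * a - c)) * ((- \<i> * w) ^ 3 * of_real (sqrt 2) powi (- a) * eta_quot (a - c) (- c) w)"
    by (simp only: power_int_minus) (simp add: field_simps)
  have 3: "(- \<i> * \<sigma>) ^ 3 * (- \<i> * w) ^ 3 = (1 + w)^3"
  proof -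
    have "(- \<i> * \<sigma>) * (- \<i> * w) = 1 + w" using w0 by (simp add: \<sigma>_def algebra_simps)
    then show ?thesis by (metis power_mult_distrib)
  qed
  have 4: "complex_of_real (sqrt 2) powi (a - c) * of_real (sqrt 2) powi (- a) = of_real (sqrt 2) powi (- c)"
    by (simp add: power_int_add[symmetric])
  have "eta_quot a c (w / (1 + w)) = (complex_of_real (sqrt 2) powi (a - c) * of_real (sqrt 2) powi (- a)) * zeta powi (- (12 + 2 * a - c)) * ((- \<i> * \<sigma>) ^ 3 * (- \<i> * w) ^ 3) * eta_quot (a - c) (- c) w"
    unfolding 1 2 by (simp only: mult_ac)
  then show ?thesis unfolding 3 4 .
qed

text \<open>On each side of the ideal triangle the eta quotient pulls back to another member of the same
  orbit on the imaginary axis. On the third side the automorphy factor \<open>1 + w\<close> is linear in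
  \<open>w\<close>, which is why both moments and hence two periods appear.\<close>

theorem triangle_relation:
  assumes cu: "cuspidal a c"
  shows "period a c - zeta powi (12 - a + 2 * c) * period (-a) (c - a) =
     zeta powi (- (12 + 2 * a - c)) * (of_real (sqrt 2) powi (- c) * period (a - c) (- c) + \<i> * of_real (sqrt 2) powi (a - c) * period (- c) (a - c))"
proof -
  have cuT: "cuspidal (-a) (c - a)" and cu3: "cuspidal (a - c) (- c)" using cu by (auto simp: cuspidal_def)
  obtain C k where C: "C > 0" "k > 0" "\<And>\<tau>. Im \<tau> \<ge> 1/2 \<Longrightarrow> norm (eta_quot a c \<tau>) \<le> C * exp (- k * Im \<tau>)"
    using eta_quot_decay'[OF cu] by blast
  have T: "eta_quot a c (1 + \<tau>) = zeta powi (12 - a + 2 * c) * eta_quot (-a) (c - a) \<tau>" if "Im \<tau> > 0" for \<tau>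
    using eta_quot_T[OF that, of a c] by (simp add: add.commute)
  have b1: "bounded_stolz (\<lambda>\<tau>. eta_quot a c (1 + \<tau>))"
    by (rule bounded_stolz_cong[OF bounded_stolz_eta_quot[OF cuT]]) (simp add: T norm_mult norm_power_int)
  let ?e = "\<lambda>u. \<i> * exp (complex_of_real u)"
  have Ie: "Im (?e u) > 0" for u by (simp add: exp_of_real)
  define W where "W = zeta powi (- (12 + 2 * a - c)) * of_real (sqrt 2) powi (- c)"
  have "(LINT u|lborel. eta_quot a c (?e u) * exp (of_real u)) - (LINT u|lborel. eta_quot a c (1 + ?e u) * exp (of_real u)) =
     (LINT u|lborel. eta_quot a c (?e u / (1 + ?e u)) * (exp (of_real u) / (1 + ?e u)^2))"
    by (rule ideal_triangle[where C = C, OF eta_quot_holomorphic C(2) _ bounded_stolz_eta_quot[OF cu] b1]) (use C(3) in auto)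
  also have "(LINT u|lborel. eta_quot a c (?e u) * exp (of_real u)) = period a c" by (simp add: period_def axis_integral_def)
  also have "(LINT u|lborel. eta_quot a c (1 + ?e u) * exp (of_real u)) = zeta powi (12 - a + 2 * c) * period (-a) (c - a)"
    unfolding T[OF Ie] mult.assoc by (simp add: period_def axis_integral_def)
  also have "(LINT u|lborel. eta_quot a c (?e u / (1 + ?e u)) * (exp (of_real u) / (1 + ?e u)^2)) =
     (LINT u|lborel. W * (eta_quot (a - c) (- c) (?e u) * exp (of_real u)) + (W * \<i>) * (eta_quot (a - c) (- c) (?e u) * exp (of_real u)^2))"
  proof (rule Bochner_Integration.integral_cong[OF refl])
    fix u :: real
    have n: "1 + ?e u \<noteq> 0" using Ie[of u] by (auto simp: complex_eq_iff)
    then have "(1 + ?e u)^3 / (1 + ?e u)^2 = 1 + ?e u" by (simp add: power3_eq_cube power2_eq_square)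
    moreover have "eta_quot a c (?e u / (1 + ?e u)) * (exp (of_real u) / (1 + ?e u)^2) = W * ((1 + ?e u)^3 / (1 + ?e u)^2) * eta_quot (a - c) (- c) (?e u) * exp (of_real u)"
      unfolding eta_quot_arc[OF Ie] W_def by (simp add: field_simps)
    ultimately show "eta_quot a c (?e u / (1 + ?e u)) * (exp (of_real u) / (1 + ?e u)^2) = W * (eta_quot (a - c) (- c) (?e u) * exp (of_real u)) + (W * \<i>) * (eta_quot (a - c) (- c) (?e u) * exp (of_real u)^2)"
      by (simp add: algebra_simps power2_eq_square)
  qed
  also have "\<dots> = W * period (a - c) (- c) + (W * \<i>) * (of_real (sqrt 2) powi a * period (- c) (a - c))"
    using period_integrable[OF cu3] axis_integral_inversion[OF cu3] by (simp add: period_def axis_integral_def)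
  also have "\<dots> = zeta powi (- (12 + 2 * a - c)) * (of_real (sqrt 2) powi (- c) * period (a - c) (- c) + \<i> * of_real (sqrt 2) powi (a - c) * period (- c) (a - c))"
  proof -
    have "complex_of_real (sqrt 2) powi (a - c) = of_real (sqrt 2) powi (- c) * of_real (sqrt 2) powi a"
      by (simp add: power_int_add[symmetric])
    then show ?thesis by (simp add: W_def algebra_simps)
  qed
  finally show ?thesis .
qed

lemma lborel_integral_shift:
  fixes F :: "real \<Rightarrow> complex"
  shows "(LINT u|lborel. F u) = (LINT u|lborel. F (t + u))"
  using lborel_integral_real_affine[of 1 F t] by simp

text \<open>Integrating the Hecke relation along the imaginary axis leads to this line: modulo even
  integers, the shift \<open>32/3\<close> of the operator is \<open>2/3\<close>, and \<open>16/3\<close> is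
  its mirror image.\<close>

definition thirds_period :: "int \<Rightarrow> int \<Rightarrow> complex" where
  "thirds_period a c = (LINT u|lborel. eta_quot a c (2/3 + \<i> * exp (of_real u)) * exp (of_real u))"

lemma zeta_add: "zeta powi m * zeta powi n = zeta powi (m + n)"
  by (simp add: power_int_add)

lemma zeta48: "zeta powi (48 * n) = 1"
  using cis_multiple_2pi[of "of_int n"] by (simp add: zeta_powi field_simps)

lemma eta_quot_arc3:
  assumes w: "Im w > 0"
  shows "eta_quot a c ((2 + w) / (3 + w)) = \<i> * zeta powi (- (4 * a + c)) * of_real (sqrt 2) powi (- c) * (3 + w)^3 * eta_quot (a - c) (- c) w"
proof -
  define \<sigma> where "\<sigma> = - 1 / (w + 3)"
  have I3: "Im (w + 3) > 0" using w by simp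
  then have w3: "3 + w \<noteq> 0" by (auto simp: complex_eq_iff)
  have Is: "Im \<sigma> > 0" unfolding \<sigma>_def Im_neg_inverse using I3 w3 by (auto simp: add.commute)
  have "(2 + w) / (3 + w) = \<sigma> + 1" using w3 by (simp add: \<sigma>_def divide_simps add.commute)
  then have "eta_quot a c ((2 + w) / (3 + w)) = zeta powi (12 - a + 2 * c) * eta_quot (- a) (c - a) \<sigma>"
    using eta_quot_T[OF Is] by simp
  also have "eta_quot (- a) (c - a) \<sigma> = (- \<i> * (w + 3)) ^ 3 * of_real (sqrt 2) powi (- a - (c - a)) * eta_quot (c - a) (- a) (w + 3)"
    unfolding \<sigma>_def by (rule eta_quot_S[OF I3])
  also have "eta_quot (c - a) (- a) (w + 3) = zeta powi (3 * (12 - (c - a) + 2 * (- a))) * eta_quot (- (c - a)) (- a - (c - a)) w"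
    using eta_quot_shift[OF w, of "c - a" "- a" 3] by simp
  also have "zeta powi (12 - a + 2 * c) * ((- \<i> * (w + 3)) ^ 3 * of_real (sqrt 2) powi (- a - (c - a)) * (zeta powi (3 * (12 - (c - a) + 2 * (- a))) * eta_quot (- (c - a)) (- a - (c - a)) w))
     = (zeta powi (12 - a + 2 * c) * zeta powi (3 * (12 - (c - a) + 2 * (- a)))) * (- \<i> * (w + 3)) ^ 3 * of_real (sqrt 2) powi (- c) * eta_quot (a - c) (- c) w"
    by simp
  also have "zeta powi (12 - a + 2 * c) * zeta powi (3 * (12 - (c - a) + 2 * (- a))) = zeta powi (48 * 1) * zeta powi (- (4 * a + c))"
    unfolding zeta_add by (rule arg_cong[where f = "\<lambda>k. zeta powi k"]) (simp add: algebra_simps)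
  also have "(- \<i> * (w + 3)) ^ 3 = \<i> * (3 + w)^3"
    by (simp only: power_mult_distrib add.commute[of w]) (simp add: power3_eq_cube)
  finally show ?thesis by (simp only: zeta48 mult_1_left) (simp only: mult_ac)
qed

text \<open>The map \<open>\<tau> \<mapsto> (2 + \<tau>) / 3\<close> sends 0, 1, infinity to
  \<open>2/3\<close>, 1, infinity. Over 1 the eta quotient is a translate of a member of its orbit, and the
  semicircle from \<open>2/3\<close> to 1 is the image of the imaginary axis under \<open>w \<mapsto> (2 +
  w) / (3 + w)\<close>, a modular substitution.\<close>

lemma thirds_period_relation:
  assumes cu: "cuspidal a c"
  shows "thirds_period a c = zeta powi (12 - a + 2 * c) * period (-a) (c - a) +
     \<i> * zeta powi (- (4 * a + c)) * of_real (sqrt 2) powi (- c) * (3 * period (a - c) (- c) + \<i> * of_real (sqrt 2) powi a * period (- c) (a - c))" (is ?rel)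
    and "integrable lborel (\<lambda>u. eta_quot a c ((2 + \<i> * exp (of_real u)) / 3) * exp (of_real u))" (is ?int)
proof -
  have cuT: "cuspidal (-a) (c - a)" and cu3: "cuspidal (a - c) (- c)" using cu by (auto simp: cuspidal_def)
  \<comment> \<open>the vertical line over \<open>2/3\<close> becomes the imaginary axis, so that the triangle 0, 1, infinity applies\<close>
  define f where "f = (\<lambda>\<tau>. eta_quot a c ((2 + \<tau>) / 3))"
  have hol: "f holomorphic_on upper_half" unfolding f_def
    by (rule holomorphic_on_compose_gen[OF _ eta_quot_holomorphic, unfolded o_def]) (auto intro!: holomorphic_intros)
  obtain C k where C: "C > 0" "k > 0" "\<And>\<tau>. Im \<tau> \<ge> 1/2 \<Longrightarrow> norm (eta_quot a c \<tau>) \<le> C * exp (- k * Im \<tau>)"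
    using eta_quot_decay'[OF cu] by blast
  have inf: "norm (f \<tau>) \<le> C * exp (- (k / 3) * Im \<tau>)" if "Im \<tau> \<ge> 2" for \<tau>
    using C(3)[of "(2 + \<tau>) / 3"] that by (simp add: f_def)
  define W where "W = \<i> * zeta powi (- (4 * a + c)) * of_real (sqrt 2) powi (- c)"
  have nW: "norm W = sqrt 2 powi (- c)" by (simp add: W_def norm_mult norm_power_int)
  have b0: "bounded_stolz f"
  proof -
    obtain B where B: "\<And>\<tau>. 0 < norm \<tau> \<Longrightarrow> norm \<tau> \<le> 1/2 \<Longrightarrow> Im \<tau> \<ge> norm \<tau> / 4 \<Longrightarrow> norm (eta_quot (a - c) (- c) \<tau>) \<le> B"
      using eta_quot_stolz[OF cu3] by blast
    show ?thesis unfolding bounded_stolz_def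
    proof (rule exI[of _ "sqrt 2 powi (- c) * 4 ^ 3 * B"], rule exI[of _ "1/8"], intro conjI allI impI)
      fix \<tau> :: complex assume t: "0 < Im \<tau>" "norm \<tau> \<le> 1/8" "Im \<tau> \<ge> norm \<tau> / 2"
      define w where "w = 3 / (1 - \<tau>) - 3"
      have n1: "norm (1 - \<tau>) \<ge> 7/8" "norm (1 - \<tau>) \<le> 2"
        using t(2) norm_triangle_ineq2[of 1 \<tau>] norm_triangle_ineq4[of 1 \<tau>] by auto
      then have ne: "1 - \<tau> \<noteq> 0" "norm (1 - \<tau>) > 0" by auto
      have wt: "w = 3 * \<tau> / (1 - \<tau>)" using ne by (simp add: w_def field_simps)
      have Iw: "Im w = 3 * Im \<tau> / (norm (1 - \<tau>))^2"
        by (simp add: w_def Im_divide cmod_power2)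
      have Iwp: "Im w > 0" unfolding Iw using t ne by simp
      have nw: "norm w = 3 * norm \<tau> / norm (1 - \<tau>)" by (simp add: wt norm_mult norm_divide)
      have "norm w \<le> (3 * (1/8)) / (7/8)" unfolding nw using n1(1) t(2) by (intro frac_le mult_left_mono) simp_all
      then have nw2: "norm w \<le> 1/2" by simp
      have "norm w / 4 = 3 * (norm \<tau> / 2) * (norm (1 - \<tau>) / 2) / (norm (1 - \<tau>))^2"
        unfolding nw using ne by (simp add: power2_eq_square field_simps)
      also have "\<dots> \<le> 3 * Im \<tau> * 1 / (norm (1 - \<tau>))^2"
        using t n1 by (intro divide_right_mono mult_mono) auto
      finally have nw3: "Im w \<ge> norm w / 4" unfolding Iw by simp
      have w3: "3 + w = 3 / (1 - \<tau>)" by (simp add: w_def)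
      have "(2 + w) / (3 + w) = (2 + \<tau>) / 3" unfolding w3 using ne by (simp add: w_def field_simps)
      then have "f \<tau> = eta_quot a c ((2 + w) / (3 + w))" by (simp only: f_def)
      also have "\<dots> = W * (3 + w)^3 * eta_quot (a - c) (- c) w" by (simp only: eta_quot_arc3[OF Iwp] W_def)
      finally have "norm (f \<tau>) = sqrt 2 powi (- c) * norm (3 + w)^3 * norm (eta_quot (a - c) (- c) w)"
        by (simp only: norm_mult norm_power nW)
      also have "\<dots> \<le> sqrt 2 powi (- c) * 4 ^ 3 * B"
      proof (intro mult_mono power_mono)
        have "norm (3 + w) = 3 / norm (1 - \<tau>)" unfolding w3 by (simp add: norm_divide)
        also have "\<dots> \<le> 3 / (7/8)" using n1 by (intro divide_left_mono) auto
        finally show "norm (3 + w) \<le> 4" by simp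
        show "norm (eta_quot (a - c) (- c) w) \<le> B" using Iwp nw2 nw3 by (intro B) auto
      qed auto
      finally show "norm (f \<tau>) \<le> sqrt 2 powi (- c) * 4 ^ 3 * B" .
    qed simp
  qed
  have T: "eta_quot a c (1 + \<tau>) = zeta powi (12 - a + 2 * c) * eta_quot (-a) (c - a) \<tau>" if "Im \<tau> > 0" for \<tau>
    using eta_quot_T[OF that, of a c] by (simp add: add.commute)
  have f1: "f (1 + \<tau>) = zeta powi (12 - a + 2 * c) * eta_quot (-a) (c - a) (\<tau> / 3)" if "Im \<tau> > 0" for \<tau>
    using T[of "\<tau> / 3"] that by (simp add: f_def add_divide_distrib add.assoc[symmetric])
  have b1: "bounded_stolz (\<lambda>\<tau>. f (1 + \<tau>))"
  proof -
    obtain B where B: "\<And>\<tau>. 0 < norm \<tau> \<Longrightarrow> norm \<tau> \<le> 1/2 \<Longrightarrow> Im \<tau> \<ge> norm \<tau> / 4 \<Longrightarrow> norm (eta_quot (-a) (c - a) \<tau>) \<le> B"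
      using eta_quot_stolz[OF cuT] by blast
    show ?thesis unfolding bounded_stolz_def
    proof (rule exI[of _ B], rule exI[of _ "1/2"], intro conjI allI impI)
      fix \<tau> :: complex assume t: "0 < Im \<tau>" "norm \<tau> \<le> 1/2" "Im \<tau> \<ge> norm \<tau> / 2"
      then have "norm (eta_quot (-a) (c - a) (\<tau> / 3)) \<le> B" by (intro B) (auto simp: norm_divide)
      then show "norm (f (1 + \<tau>)) \<le> B" using f1[OF t(1)] by (simp add: norm_mult norm_power_int)
    qed simp
  qed
  let ?e = "\<lambda>u. \<i> * exp (complex_of_real u)"
  have Ie: "Im (?e u) > 0" for u by (simp add: exp_of_real)
  have e3: "exp (complex_of_real (ln 3 + u)) = 3 * exp (of_real u)" for u
    by (simp add: exp_add exp_of_real)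
  have e3': "exp (complex_of_real (- ln 3 + u)) = exp (of_real u) / 3" for u
    by (simp add: exp_add exp_of_real exp_minus exp_diff)
  have tri: "(LINT u|lborel. f (?e u) * exp (of_real u)) - (LINT u|lborel. f (1 + ?e u) * exp (of_real u)) =
     (LINT u|lborel. f (?e u / (1 + ?e u)) * (exp (of_real u) / (1 + ?e u)^2))"
    by (rule ideal_triangle[where C = C and k = "k/3", OF hol _ inf b0 b1]) (use C in auto)
  have 1: "(LINT u|lborel. f (?e u) * exp (of_real u)) = 3 * thirds_period a c"
  proof -
    have "(LINT u|lborel. f (?e u) * exp (of_real u)) = (LINT u|lborel. f (?e (ln 3 + u)) * exp (of_real (ln 3 + u)))"
      by (rule lborel_integral_shift)
    also have "\<dots> = (LINT u|lborel. 3 * (eta_quot a c (2/3 + ?e u) * exp (of_real u)))"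
      unfolding e3 by (rule Bochner_Integration.integral_cong[OF refl]) (simp add: f_def add_divide_distrib)
    finally show ?thesis by (simp add: thirds_period_def)
  qed
  have 2: "(LINT u|lborel. f (1 + ?e u) * exp (of_real u)) = 3 * (zeta powi (12 - a + 2 * c) * period (-a) (c - a))"
  proof -
    have "(LINT u|lborel. f (1 + ?e u) * exp (of_real u)) = (LINT u|lborel. f (1 + ?e (ln 3 + u)) * exp (of_real (ln 3 + u)))"
      by (rule lborel_integral_shift)
    also have "\<dots> = (LINT u|lborel. (3 * zeta powi (12 - a + 2 * c)) * (eta_quot (-a) (c - a) (?e u) * exp (of_real u)))"
      unfolding f1[OF Ie] unfolding e3 by (simp add: mult_ac)
    finally show ?thesis by (simp add: period_def axis_integral_def)
  qed
  have 3: "(LINT u|lborel. f (?e u / (1 + ?e u)) * (exp (of_real u) / (1 + ?e u)^2)) = 3 * (W * (3 * period (a - c) (- c) + \<i> * of_real (sqrt 2) powi a * period (- c) (a - c)))"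
  proof -
    have "(LINT u|lborel. f (?e u / (1 + ?e u)) * (exp (of_real u) / (1 + ?e u)^2)) =
      (LINT u|lborel. f (?e (- ln 3 + u) / (1 + ?e (- ln 3 + u))) * (exp (of_real (- ln 3 + u)) / (1 + ?e (- ln 3 + u))^2))"
      by (rule lborel_integral_shift)
    also have "\<dots> = (LINT u|lborel. (9 * W) * (eta_quot (a - c) (- c) (?e u) * exp (of_real u)) + (3 * W * \<i>) * (eta_quot (a - c) (- c) (?e u) * exp (of_real u)^2))"
    proof (rule Bochner_Integration.integral_cong[OF refl])
      fix u :: real
      define w where "w = ?e u"
      have Iw: "Im w > 0" using Ie by (simp add: w_def)
      have ne: "3 + w \<noteq> 0" "1 + w / 3 \<noteq> 0" using Iw by (auto simp: complex_eq_iff)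
      have a1: "f ((w/3) / (1 + w/3)) = W * (3 + w)^3 * eta_quot (a - c) (- c) w"
      proof -
        have e1: "(w/3) / (1 + w/3) = w / (3 + w)" using ne by (simp add: field_simps)
        have e2: "(2 + w / (3 + w)) / 3 = (2 + w) / (3 + w)"
        proof -
          have "(2 + w / (3 + w)) * (3 + w) = 3 * (2 + w)" using ne by (simp add: distrib_right)
          then have "2 + w / (3 + w) = 3 * ((2 + w) / (3 + w))" using ne by (simp add: eq_divide_eq)
          then show ?thesis by (metis nonzero_mult_div_cancel_left zero_neq_numeral)
        qed
        show ?thesis unfolding f_def e1 e2 using eta_quot_arc3[OF Iw, of a c] by (simp add: W_def)
      qed
      have a2: "(exp (of_real u) / 3) / (1 + w/3)^2 = 3 * exp (of_real u) / (3 + w)^2"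
      proof -
        have h: "(1 + w/3)^2 = (3 + w)^2 / 9" by (simp add: power2_eq_square field_simps)
        show ?thesis unfolding h by simp
      qed
      have "f ((w/3) / (1 + w/3)) * ((exp (of_real u) / 3) / (1 + w/3)^2) = 3 * W * eta_quot (a - c) (- c) w * exp (of_real u) * ((3 + w)^3 / (3 + w)^2)"
        unfolding a1 a2 by (simp add: mult_ac)
      also have "(3 + w)^3 / (3 + w)^2 = 3 + w" using ne by (simp add: power3_eq_cube power2_eq_square)
      also have "3 * W * eta_quot (a - c) (- c) w * exp (of_real u) * (3 + w) = (9 * W) * (eta_quot (a - c) (- c) w * exp (of_real u)) + (3 * W * \<i>) * (eta_quot (a - c) (- c) w * exp (of_real u)^2)"
        by (subst (2) w_def) (simp add: algebra_simps power2_eq_square)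
      finally show "f (?e (- ln 3 + u) / (1 + ?e (- ln 3 + u))) * (exp (of_real (- ln 3 + u)) / (1 + ?e (- ln 3 + u))^2) = (9 * W) * (eta_quot (a - c) (- c) (?e u) * exp (of_real u)) + (3 * W * \<i>) * (eta_quot (a - c) (- c) (?e u) * exp (of_real u)^2)"
        unfolding e3' by (simp add: w_def)
    qed
    also have "\<dots> = (9 * W) * period (a - c) (- c) + (3 * W * \<i>) * (of_real (sqrt 2) powi a * period (- c) (a - c))"
      using period_integrable[OF cu3] axis_integral_inversion[OF cu3] by (simp add: period_def axis_integral_def)
    finally show ?thesis by (simp add: algebra_simps)
  qed
  have div3: "p = q + r" if "3 * p - 3 * q = 3 * r" for p q r :: complex
    using that by (simp only: right_diff_distrib[symmetric] mult_cancel_left) (simp add: diff_eq_eq add.commute)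
  show ?int using vertical_integrable[OF hol _ inf, of 0] b0 C by (simp add: f_def)
  show ?rel using div3[OF tri[unfolded 1 2 3]] unfolding W_def .
qed

section \<open>The Hecke operator at 3\<close>

text \<open>The sign that makes the term \<open>3 * \<tau>\<close> of the operator below transform like the
  other three.\<close>

definition hecke_sign :: "int \<Rightarrow> int \<Rightarrow> complex" where "hecke_sign \<alpha> \<gamma> = (if even (\<alpha> * \<gamma>) then 1 else - 1)"

text \<open>The Hecke operator of degree 3 in weight 3, up to normalisation, on the eta quotient with the
  exponents \<open>3 * \<alpha>\<close>, \<open>3 * \<gamma>\<close>. This eta quotient has period 16, so
  the multiples of 16 are the natural representatives of the residue classes mod 3.\<close>

definition hecke3 :: "int \<Rightarrow> int \<Rightarrow> complex \<Rightarrow> complex" where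
  "hecke3 \<alpha> \<gamma> \<tau> = eta_quot (3*\<alpha>) (3*\<gamma>) (\<tau> / 3) + eta_quot (3*\<alpha>) (3*\<gamma>) ((\<tau> + 16) / 3) + eta_quot (3*\<alpha>) (3*\<gamma>) ((\<tau> + 32) / 3)
     + 27 * hecke_sign \<alpha> \<gamma> * eta_quot (3*\<alpha>) (3*\<gamma>) (3 * \<tau>)"

lemma zeta24: "zeta powi (24 * n) = (if even n then 1 else - 1)"
  by (simp add: zeta_powi cis_pi_int power_int_minus_left)

text \<open>This is the law of the eta quotient with the exponents \<open>\<alpha>\<close>,
  \<open>\<gamma>\<close> up to a root of unity, so the quotients of the two are permuted by
  translation.\<close>

lemma hecke3_T:
  assumes t: "Im \<tau> > 0"
  shows "hecke3 \<alpha> \<gamma> (\<tau> + 1) = zeta powi (- 5 * (12 - 3 * \<alpha> + 6 * \<gamma>)) * hecke3 (-\<alpha>) (\<gamma> - \<alpha>) \<tau>"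
proof -
  define ord where "ord = 12 - 3 * \<alpha> + 6 * \<gamma>"
  have odd_shift: "eta_quot (3*\<alpha>) (3*\<gamma>) (\<sigma> + of_int n) = zeta powi (n * ord) * eta_quot (3*(-\<alpha>)) (3*(\<gamma>-\<alpha>)) \<sigma>" if "Im \<sigma> > 0" "odd n" for \<sigma> n
    using eta_quot_shift[OF that(1), of "3*\<alpha>" "3*\<gamma>" n] that(2) by (simp add: ord_def right_diff_distrib)
  have i: "Im (\<tau> / 3) > 0" "Im ((\<tau> + 16) / 3) > 0" "Im ((\<tau> + 32) / 3) > 0" "Im (3 * \<tau>) > 0" using t by auto
  \<comment> \<open>the three translates are permuted cyclically, up to shifts by odd integers\<close>
  have p0: "(\<tau> + 1) / 3 = (\<tau> + 16) / 3 + of_int (- 5)" "(\<tau> + 1 + 16) / 3 = (\<tau> + 32) / 3 + of_int (- 5)"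
    "(\<tau> + 1 + 32) / 3 = \<tau> / 3 + of_int 11" "3 * (\<tau> + 1) = 3 * \<tau> + of_int 3" by (simp_all add: field_simps)
  have z1: "zeta powi (11 * ord) = zeta powi (- 5 * ord)"
  proof -
    have "11 * ord = - 5 * ord + 48 * (4 - \<alpha> + 2 * \<gamma>)" by (simp add: ord_def)
    then show ?thesis by (simp only: power_int_add[OF disjI1[OF zeta_nonzero]] zeta48 mult_1_right)
  qed
  have z2: "hecke_sign \<alpha> \<gamma> * zeta powi (3 * ord) = zeta powi (- 5 * ord) * hecke_sign (-\<alpha>) (\<gamma> - \<alpha>)"
  proof -
    have "3 * ord = - 5 * ord + 24 * (4 - \<alpha> + 2 * \<gamma>)" by (simp add: ord_def)
    then have "zeta powi (3 * ord) = zeta powi (- 5 * ord) * (if even \<alpha> then 1 else - 1)"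
      by (simp only: power_int_add[OF disjI1[OF zeta_nonzero]] zeta24) simp
    moreover have "hecke_sign \<alpha> \<gamma> * (if even \<alpha> then 1 else - 1) = hecke_sign (-\<alpha>) (\<gamma> - \<alpha>)" by (auto simp: hecke_sign_def)
    ultimately show ?thesis by (simp add: mult_ac)
  qed
  show ?thesis
    unfolding hecke3_def p0 odd_shift[OF i(1), of 11, simplified] odd_shift[OF i(2), of "-5", simplified] odd_shift[OF i(3), of "-5", simplified] odd_shift[OF i(4), of 3, simplified]
      ord_def[symmetric]
    using z1 z2 odd_shift[OF i(1), of 11] odd_shift[OF i(2), of "-5"] odd_shift[OF i(3), of "-5"] odd_shift[OF i(4), of 3]
    by (simp add: algebra_simps)
qed

lemma zeta12: "zeta powi 12 = \<i>" by (simp only: zeta_powi) simp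

lemma eta_quot_scaleS3:
  assumes "Im \<tau> > 0"
  shows "eta_quot x y (- 1 / \<tau> / 3) = 27 * (- \<i> * \<tau>)^3 * of_real (sqrt 2) powi (x - y) * eta_quot y x (3 * \<tau>)"
    and "27 * eta_quot x y (3 * (- 1 / \<tau>)) = (- \<i> * \<tau>)^3 * of_real (sqrt 2) powi (x - y) * eta_quot y x (\<tau> / 3)"
  using eta_quot_S[of "3 * \<tau>" x y] eta_quot_S[of "\<tau> / 3" x y] assms by (simp_all add: power_mult_distrib power_divide mult_ac)

text \<open>A modular substitution given by a continued fraction with two odd partial quotients.\<close>

lemma eta_quot_word:
  assumes v: "Im v > 0" and s: "\<sigma> = of_int m - 1 / v" and r: "\<rho> = of_int n - 1 / \<sigma>" and odd: "odd m" "odd n"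
  shows "eta_quot x y \<rho> = zeta powi (n * (12 - x + 2 * y) + m * (12 - x - y)) * (- \<sigma> * v)^3 * of_real (sqrt 2) powi (x - y) * eta_quot (- y) (x - y) v"
proof -
  have Iv: "Im (- 1 / v) > 0" unfolding Im_neg_inverse using v by (auto intro!: divide_pos_pos)
  have s': "\<sigma> = - 1 / v + of_int m" and r': "\<rho> = - 1 / \<sigma> + of_int n" using s r by simp_all
  have Is: "Im \<sigma> > 0" using Iv by (simp add: s')
  have Ir: "Im (- 1 / \<sigma>) > 0" unfolding Im_neg_inverse using Is by (auto intro!: divide_pos_pos)
  have "eta_quot x y \<rho> = zeta powi (n * (12 - x + 2 * y)) * eta_quot (-x) (y - x) (- 1 / \<sigma>)"
    unfolding r' using eta_quot_shift[OF Ir, of x y n] odd by simp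
  also have "eta_quot (-x) (y - x) (- 1 / \<sigma>) = (- \<i> * \<sigma>) ^ 3 * of_real (sqrt 2) powi (- x - (y - x)) * eta_quot (y - x) (- x) \<sigma>"
    by (rule eta_quot_S[OF Is])
  also have "eta_quot (y - x) (- x) \<sigma> = zeta powi (m * (12 - (y - x) + 2 * (- x))) * eta_quot (- (y - x)) (- x - (y - x)) (- 1 / v)"
    unfolding s' using eta_quot_shift[OF Iv, of "y - x" "- x" m] odd by simp
  also have "eta_quot (- (y - x)) (- x - (y - x)) (- 1 / v) = (- \<i> * v) ^ 3 * of_real (sqrt 2) powi (- (y - x) - (- x - (y - x))) * eta_quot (- x - (y - x)) (- (y - x)) v"
    by (rule eta_quot_S[OF v])
  finally have "eta_quot x y \<rho> = (zeta powi (n * (12 - x + 2 * y)) * zeta powi (m * (12 - (y - x) + 2 * (- x)))) * ((- \<i> * \<sigma>) ^ 3 * (- \<i> * v) ^ 3) *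
     (of_real (sqrt 2) powi (- x - (y - x)) * of_real (sqrt 2) powi (- (y - x) - (- x - (y - x)))) * eta_quot (- x - (y - x)) (- (y - x)) v"
    by (simp only: mult_ac)
  moreover have "(- \<i> * \<sigma>) ^ 3 * (- \<i> * v) ^ 3 = (- \<sigma> * v)^3"
    unfolding power_mult_distrib[symmetric] by (rule arg_cong[where f = "\<lambda>z. z^3"]) (simp add: algebra_simps)
  moreover have "zeta powi (n * (12 - x + 2 * y)) * zeta powi (m * (12 - (y - x) + 2 * (- x))) = zeta powi (n * (12 - x + 2 * y) + m * (12 - x - y))"
    unfolding zeta_add by (rule arg_cong[where f = "\<lambda>k. zeta powi k"]) (simp add: algebra_simps)
  moreover have "complex_of_real (sqrt 2) powi (- x - (y - x)) * of_real (sqrt 2) powi (- (y - x) - (- x - (y - x))) = of_real (sqrt 2) powi (x - y)"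
    by (simp add: power_int_add[symmetric])
  ultimately show ?thesis by simp
qed

text \<open>The inversion exchanges the terms \<open>\<tau> / 3\<close> and \<open>3 * \<tau>\<close>, and
  the two others with each other.\<close>

lemma hecke3_S:
  assumes t: "Im \<tau> > 0" and odd: "odd \<alpha> \<or> odd \<gamma>"
  shows "hecke3 \<alpha> \<gamma> (- 1 / \<tau>) = hecke_sign \<alpha> \<gamma> * (- \<i> * \<tau>)^3 * of_real (sqrt 2) powi (3 * \<alpha> - 3 * \<gamma>) * hecke3 \<gamma> \<alpha> \<tau>"
proof -
  have t0: "\<tau> \<noteq> 0" "\<tau> \<noteq> 1" "\<tau> \<noteq> - 1" using t by (auto simp: complex_eq_iff)
  define x y where "x = 3 * \<alpha>" and "y = 3 * \<gamma>"
  define R where "R = complex_of_real (sqrt 2) powi (x - y)"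
  have par: "odd (x + y) \<longleftrightarrow> odd (\<alpha> + \<gamma>)" by (simp add: x_def y_def)
  have c2: "hecke_sign \<alpha> \<gamma> = - (if even (x + y) then 1 else - 1)" using odd par by (auto simp: hecke_sign_def)
  have cc: "hecke_sign \<alpha> \<gamma> * hecke_sign \<alpha> \<gamma> = 1" "hecke_sign \<gamma> \<alpha> = hecke_sign \<alpha> \<gamma>" by (auto simp: hecke_sign_def mult.commute)
  have i3: "(- \<i> * \<tau>)^3 = \<i> * \<tau>^3" by (simp only: power_mult_distrib) (simp add: power3_eq_cube)
  \<comment> \<open>the matrices of determinant 3 are permuted by the inversion; here \<open>\<tau> - 1\<close> over 3 comes from the Euclidean algorithm for 16 and 3\<close>
  have w1: "eta_quot x y ((- 1 / \<tau> + 16) / 3) = hecke_sign \<alpha> \<gamma> * (- \<i> * \<tau>)^3 * R * eta_quot y x ((\<tau> + 32) / 3)"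
  proof -
    define v where "v = (\<tau> - 1) / 3"
    define \<sigma> where "\<sigma> = of_int (-3) - 1 / v"
    have v: "Im v > 0" using t by (simp add: v_def)
    have v0: "v \<noteq> 0" using v by auto
    have sv: "- \<sigma> * v = \<tau>" using v0 by (simp add: \<sigma>_def v_def field_simps)
    have s0: "\<sigma> \<noteq> 0" using sv t0 by auto
    have rho: "(- 1 / \<tau> + 16) / 3 = of_int 5 - 1 / \<sigma>"
    proof -
      have "1 / \<sigma> = - v / \<tau>" using sv s0 t0 v0 by (simp add: field_simps)
      then show ?thesis using t0 by (simp add: v_def field_simps)
    qed
    have "eta_quot x y ((- 1 / \<tau> + 16) / 3) = zeta powi (5 * (12 - x + 2 * y) + (-3) * (12 - x - y)) * \<tau>^3 * R * eta_quot (- y) (x - y) v"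
      using eta_quot_word[OF v \<sigma>_def rho, of x y] unfolding sv by (simp add: R_def)
    also have "eta_quot (- y) (x - y) v = zeta powi ((-11) * (12 - (- y) + 2 * (x - y))) * eta_quot y x ((\<tau> + 32) / 3)"
    proof -
      have "v = (\<tau> + 32) / 3 + of_int (-11)" by (simp add: v_def field_simps)
      then show ?thesis using eta_quot_shift[of "(\<tau> + 32) / 3" "- y" "x - y" "-11"] t by simp
    qed
    finally have "eta_quot x y ((- 1 / \<tau> + 16) / 3) = (zeta powi (5 * (12 - x + 2 * y) + (-3) * (12 - x - y)) * zeta powi ((-11) * (12 - (- y) + 2 * (x - y)))) * \<tau>^3 * R * eta_quot y x ((\<tau> + 32) / 3)"
      by (simp only: mult_ac)
    also have "zeta powi (5 * (12 - x + 2 * y) + (-3) * (12 - x - y)) * zeta powi ((-11) * (12 - (- y) + 2 * (x - y))) = zeta powi 12 * zeta powi (24 * (- 5 - x + y))"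
      unfolding zeta_add by (rule arg_cong[where f = "\<lambda>k. zeta powi k"]) (simp add: algebra_simps)
    also have "\<dots> * \<tau>^3 = hecke_sign \<alpha> \<gamma> * (- \<i> * \<tau>)^3"
      unfolding zeta12 zeta24 c2 i3 by auto
    finally show ?thesis .
  qed
  \<comment> \<open>the same continued fraction for 32 and 3\<close>
  have w2: "eta_quot x y ((- 1 / \<tau> + 32) / 3) = hecke_sign \<alpha> \<gamma> * (- \<i> * \<tau>)^3 * R * eta_quot y x ((\<tau> + 16) / 3)"
  proof -
    define v where "v = (\<tau> + 1) / 3"
    define \<sigma> where "\<sigma> = of_int 3 - 1 / v"
    have v: "Im v > 0" using t by (simp add: v_def)
    have v0: "v \<noteq> 0" using v by auto
    have "\<sigma> * v = 3 * v - 1" using v0 by (simp add: \<sigma>_def left_diff_distrib)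
    moreover have "3 * v = \<tau> + 1" by (metis v_def nonzero_mult_div_cancel_left times_divide_eq_right zero_neq_numeral)
    ultimately have sv: "\<sigma> * v = \<tau>" by (metis add_diff_cancel_right')
    have s0: "\<sigma> \<noteq> 0" using sv t0 by auto
    have rho: "(- 1 / \<tau> + 32) / 3 = of_int 11 - 1 / \<sigma>"
    proof -
      have "1 / \<sigma> = v / \<tau>" using sv s0 t0 v0 by (simp add: field_simps)
      then show ?thesis using t0 by (simp add: v_def field_simps)
    qed
    have "eta_quot x y ((- 1 / \<tau> + 32) / 3) = zeta powi (11 * (12 - x + 2 * y) + 3 * (12 - x - y)) * (- \<tau>)^3 * R * eta_quot (- y) (x - y) v"
      using eta_quot_word[OF v \<sigma>_def rho] sv by (simp add: R_def)
    also have "eta_quot (- y) (x - y) v = zeta powi ((-5) * (12 - (- y) + 2 * (x - y))) * eta_quot y x ((\<tau> + 16) / 3)"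
    proof -
      have "v = (\<tau> + 16) / 3 + of_int (-5)" by (simp add: v_def field_simps)
      then show ?thesis using eta_quot_shift[of "(\<tau> + 16) / 3" "- y" "x - y" "-5"] t by simp
    qed
    finally have "eta_quot x y ((- 1 / \<tau> + 32) / 3) = (zeta powi (11 * (12 - x + 2 * y) + 3 * (12 - x - y)) * zeta powi ((-5) * (12 - (- y) + 2 * (x - y)))) * (- \<tau>)^3 * R * eta_quot y x ((\<tau> + 16) / 3)"
      by (simp only: mult_ac)
    also have "zeta powi (11 * (12 - x + 2 * y) + 3 * (12 - x - y)) * zeta powi ((-5) * (12 - (- y) + 2 * (x - y))) = zeta powi 12 * zeta powi (24 * (4 - x + y))"
      unfolding zeta_add by (rule arg_cong[where f = "\<lambda>k. zeta powi k"]) (simp add: algebra_simps)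
    also have "\<dots> * (- \<tau>)^3 = hecke_sign \<alpha> \<gamma> * (- \<i> * \<tau>)^3"
      unfolding zeta12 zeta24 c2 i3 by auto
    finally show ?thesis .
  qed
  define N where "N = (- \<i> * \<tau>)^3"
  have "hecke3 \<alpha> \<gamma> (- 1 / \<tau>) = 27 * N * R * eta_quot y x (3 * \<tau>) + hecke_sign \<alpha> \<gamma> * N * R * eta_quot y x ((\<tau> + 32) / 3) + hecke_sign \<alpha> \<gamma> * N * R * eta_quot y x ((\<tau> + 16) / 3) + hecke_sign \<alpha> \<gamma> * (N * R * eta_quot y x (\<tau> / 3))"
    using eta_quot_scaleS3[OF t, of x y] w1 w2 unfolding hecke3_def x_def[symmetric] y_def[symmetric] R_def[symmetric] N_def[symmetric]
    by (simp add: mult_ac)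
  also have "\<dots> = hecke_sign \<alpha> \<gamma> * N * R * hecke3 \<gamma> \<alpha> \<tau>"
    unfolding hecke3_def x_def[symmetric] y_def[symmetric] cc(2) using cc(1) by algebra
  finally show ?thesis by (simp add: N_def R_def x_def y_def)
qed

section \<open>Rigidity: the Hecke relation\<close>

text \<open>The Euler products have no zeros in the disc, so the decay at infinity is exactly the order of
  vanishing.\<close>

lemma eta_quot_lower:
  obtains C where "C > 0" "\<And>\<tau>. Im \<tau> \<ge> 1/2 \<Longrightarrow> C * exp (- (pi / 24) * of_int (12 - a + 2 * c) * Im \<tau>) \<le> norm (eta_quot a c \<tau>)"
proof -
  obtain C where C: "C \<ge> 1" "\<And>q n. norm q \<le> exp (- pi / 2) \<Longrightarrow> norm (euler_phi q powi n) \<le> C powi \<bar>n\<bar>"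
    using euler_phi_powi_bounded[of "exp (- pi / 2)"] by auto
  have low: "norm (euler_phi q powi n) \<ge> inverse (C powi \<bar>n\<bar>)" if q: "norm q \<le> exp (- pi / 2)" for q n
  proof -
    have "norm q < 1" using q by (rule le_less_trans) simp
    then have nz: "euler_phi q \<noteq> 0" by (rule euler_phi_nonzero)
    have "inverse (norm (euler_phi q powi n)) = norm (euler_phi q powi (- n))"
      by (simp add: power_int_minus norm_inverse)
    also have "\<dots> \<le> C powi \<bar>n\<bar>" using C(2)[OF q, of "- n"] by simp
    finally have "inverse (C powi \<bar>n\<bar>) \<le> inverse (inverse (norm (euler_phi q powi n)))"
      using nz C(1) by (intro le_imp_inverse_le) auto
    then show ?thesis by simp
  qed
  show thesis
  proof (rule that[of "inverse (C powi \<bar>a\<bar>) * inverse (C powi \<bar>6 - a - c\<bar>) * inverse (C powi \<bar>c\<bar>)"])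
    show "0 < inverse (C powi \<bar>a\<bar>) * inverse (C powi \<bar>6 - a - c\<bar>) * inverse (C powi \<bar>c\<bar>)" using C by simp
    fix \<tau> :: complex assume t: "Im \<tau> \<ge> 1/2"
    have "inverse (C powi \<bar>a\<bar>) * inverse (C powi \<bar>6 - a - c\<bar>) * inverse (C powi \<bar>c\<bar>) \<le>
       norm (euler_phi (exp (2 * \<i> * (pi * (\<tau>/2)))) powi a) * norm (euler_phi (exp (2 * \<i> * (pi * \<tau>))) powi (6 - a - c)) * norm (euler_phi (exp (2 * \<i> * (pi * (2 * \<tau>)))) powi c)"
      using t C(1) by (intro mult_mono low) (auto intro!: mult_nonneg_nonneg)
    from mult_left_mono[OF this, of "exp (- (pi / 24) * of_int (12 - a + 2 * c) * Im \<tau>)"]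
    show "inverse (C powi \<bar>a\<bar>) * inverse (C powi \<bar>6 - a - c\<bar>) * inverse (C powi \<bar>c\<bar>) * exp (- (pi / 24) * of_int (12 - a + 2 * c) * Im \<tau>) \<le> norm (eta_quot a c \<tau>)"
      unfolding eta_quot_norm by (simp add: mult_ac)
  qed
qed

text \<open>A function of period 2 descends to the punctured disc of \<open>exp (\<i> * pi *
  \<tau>)\<close>, and the growth condition leaves a removable singularity.\<close>

lemma periodic_disc_extension:
  assumes hol: "\<Phi> holomorphic_on upper_half" and periodic: "\<And>\<tau>. Im \<tau> > 0 \<Longrightarrow> \<Phi> (\<tau> + 2) = \<Phi> \<tau>"
    and bd: "\<And>\<tau>. Im \<tau> \<ge> 3/2 \<Longrightarrow> norm (\<Phi> \<tau>) \<le> D * exp ((pi / 3) * Im \<tau>)"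
  obtains g where "g holomorphic_on ball 0 1" "\<And>\<tau>. Im \<tau> > 0 \<Longrightarrow> \<Phi> \<tau> = g (exp (\<i> * pi * \<tau>))"
proof -
  define g0 where "g0 = (\<lambda>w. \<Phi> (Ln w / (\<i> * pi)))"
  have ImL: "Im (Ln w / (\<i> * pi)) = - ln (norm w) / pi" if "w \<noteq> 0" for w
    using that by (simp add: Im_divide power2_eq_square)
  have perm: "\<Phi> (\<tau> + 2 * of_int n) = \<Phi> \<tau>" if "Im \<tau> > 0" for \<tau> n
  proof (induction n rule: int_induct[where k = 0])
    case (step1 i)
    have "\<tau> + 2 * of_int (i + 1) = (\<tau> + 2 * of_int i) + 2" by simp
    then show ?case using periodic[of "\<tau> + 2 * of_int i"] step1 that by (simp only:) simp
  next
    case (step2 i)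
    have "\<tau> + 2 * of_int i = (\<tau> + 2 * of_int (i - 1)) + 2" by simp
    then have "\<Phi> (\<tau> + 2 * of_int i) = \<Phi> (\<tau> + 2 * of_int (i - 1))"
      using periodic[of "\<tau> + 2 * of_int (i - 1)"] that by (simp only:) simp
    then show ?case using step2 that by simp
  qed simp
  have g0: "\<Phi> \<tau> = g0 (exp (\<i> * pi * \<tau>))" if t: "Im \<tau> > 0" for \<tau>
  proof -
    have "exp (Ln (exp (\<i> * pi * \<tau>))) = exp (\<i> * pi * \<tau>)" by simp
    then obtain n :: int where "Ln (exp (\<i> * pi * \<tau>)) = \<i> * pi * \<tau> + (of_int (2 * n) * pi) * \<i>"
      by (auto simp only: exp_eq)
    then have "Ln (exp (\<i> * pi * \<tau>)) / (\<i> * pi) = \<tau> + 2 * of_int n" by (simp add: field_simps)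
    then show ?thesis using perm[OF t, of n] by (simp add: g0_def)
  qed
  have hol0: "g0 holomorphic_on (ball 0 1 - {0})"
  proof -
    have op: "open (ball (0::complex) 1 - {0})" by (intro open_Diff) auto
    have "g0 field_differentiable (at w)" if w: "w \<in> ball 0 1 - {0}" for w
    proof (cases "w \<in> \<real>\<^sub>\<le>\<^sub>0")
      case False
      define S where "S = (ball 0 1 - {0}) - (\<real>\<^sub>\<le>\<^sub>0 :: complex set)"
      have "open S" unfolding S_def by (intro open_Diff op) auto
      moreover have "g0 holomorphic_on S" unfolding g0_def
      proof (rule holomorphic_on_compose_gen[OF _ hol, unfolded o_def])
        show "(\<lambda>w. Ln w / (\<i> * pi)) holomorphic_on S" unfolding S_def by (intro holomorphic_intros) auto
        show "(\<lambda>w. Ln w / (\<i> * pi)) ` S \<subseteq> upper_half" using ImL by (auto simp: S_def divide_neg_pos)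
      qed
      ultimately show ?thesis using w False by (auto simp: S_def intro: holomorphic_on_imp_differentiable_at)
    next
      case True
      define S where "S = (ball 0 1 - {0}) \<inter> (uminus -` (- (\<real>\<^sub>\<le>\<^sub>0 :: complex set)))"
      have "open S" unfolding S_def by (intro open_Int op open_vimage) (auto intro!: continuous_intros)
      have ImL2: "Im (Ln (- z) / (\<i> * pi) + 1) > 0" if "z \<in> S" for z
        using ImL[of "- z"] that by (auto simp: S_def divide_neg_pos)
      have "(\<lambda>z. \<Phi> (Ln (- z) / (\<i> * pi) + 1)) holomorphic_on S"
      proof (rule holomorphic_on_compose_gen[OF _ hol, unfolded o_def])
        show "(\<lambda>z. Ln (- z) / (\<i> * pi) + 1) holomorphic_on S" unfolding S_def by (intro holomorphic_intros) auto
        show "(\<lambda>z. Ln (- z) / (\<i> * pi) + 1) ` S \<subseteq> upper_half" using ImL2 by auto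
      qed
      moreover have "\<Phi> (Ln (- z) / (\<i> * pi) + 1) = g0 z" if z: "z \<in> S" for z
      proof -
        have "z \<noteq> 0" using z by (auto simp: S_def)
        then have "exp (\<i> * pi * (Ln (- z) / (\<i> * pi) + 1)) = z"
          by (simp add: distrib_left exp_add)
        then show ?thesis using g0[OF ImL2[OF z]] by simp
      qed
      ultimately have "g0 holomorphic_on S" by (rule holomorphic_transform)
      moreover have "w \<in> S" using w True by (auto simp: S_def complex_nonpos_Reals_iff complex_eq_iff)
      ultimately show ?thesis using \<open>open S\<close> by (auto intro: holomorphic_on_imp_differentiable_at)
    qed
    then show ?thesis using op by (simp add: holomorphic_on_open field_differentiable_def)
  qed
  \<comment> \<open>growth of order \<open>norm z\<close> to the power \<open>-1/3\<close> excludes a pole\<close>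
  have "((\<lambda>z. (z - 0) * g0 z) \<longlongrightarrow> 0) (at 0)"
  proof (rule Lim_null_comparison)
    define r where "r = exp (- 2 * pi)"
    have "eventually (\<lambda>z. z \<in> ball 0 r - {0}) (at (0::complex))"
      by (rule eventually_at_in_open) (auto simp: r_def)
    then show "\<forall>\<^sub>F z in at 0. norm ((z - 0) * g0 z) \<le> D * norm z powr (2/3)"
    proof eventually_elim
      case (elim z)
      then have z: "z \<noteq> 0" "norm z < r" by auto
      define \<tau> where "\<tau> = Ln z / (\<i> * pi)"
      have I: "Im \<tau> = - ln (norm z) / pi" using ImL[OF z(1)] by (simp add: \<tau>_def)
      have "ln (norm z) < ln r" using z by (intro ln_less_cancel_iff[THEN iffD2]) (auto simp: r_def)
      then have "Im \<tau> \<ge> 3/2" unfolding I by (simp add: r_def field_simps) (smt (verit) pi_gt_zero)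
      then have "norm (g0 z) \<le> D * exp ((pi / 3) * Im \<tau>)" unfolding g0_def \<tau>_def[symmetric] by (rule bd)
      also have "exp ((pi / 3) * Im \<tau>) = norm z powr (- (1/3))" using z by (simp add: I powr_def)
      finally have "norm z * norm (g0 z) \<le> norm z * (D * norm z powr (- (1/3)))" by (intro mult_left_mono) auto
      also have "\<dots> = D * (norm z powr 1 * norm z powr (- (1/3)))" using z by simp
      also have "\<dots> = D * norm z powr (2/3)" unfolding powr_add[symmetric] by simp
      finally show ?case by (simp add: norm_mult)
    qed
    have "((\<lambda>z::complex. D * norm z powr (2/3)) \<longlongrightarrow> D * norm (0::complex) powr (2/3)) (at 0)"
      by (intro tendsto_intros tendsto_powr') auto
    then show "((\<lambda>z::complex. D * norm z powr (2/3)) \<longlongrightarrow> 0) (at 0)" by simp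
  qed
  then obtain g where g: "g holomorphic_on ball 0 1" "\<forall>z\<in>ball 0 1 - {0}. g z = g0 z"
    using holomorphic_on_extend_lim[OF hol0] by auto
  show thesis
  proof (rule that[OF g(1)])
    fix \<tau> :: complex assume t: "Im \<tau> > 0"
    have "exp (\<i> * pi * \<tau>) \<in> ball 0 1 - {0}" using t by simp
    then show "\<Phi> \<tau> = g (exp (\<i> * pi * \<tau>))" using g(2) g0[OF t] by simp
  qed
qed

text \<open>A holomorphic function on the half-plane, since the eta function has no zeros there, and of
  weight 0. For the exponents in question it will turn out to be constant.\<close>

definition hecke_ratio :: "int \<Rightarrow> int \<Rightarrow> complex \<Rightarrow> complex" where
  "hecke_ratio \<alpha> \<gamma> \<tau> = hecke3 \<alpha> \<gamma> \<tau> / eta_quot \<alpha> \<gamma> \<tau>"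

lemma hecke_ratio_T:
  assumes "Im \<tau> > 0"
  shows "hecke_ratio \<alpha> \<gamma> (\<tau> + 1) = zeta powi (16 * \<alpha> - 32 * \<gamma> - 72) * hecke_ratio (-\<alpha>) (\<gamma> - \<alpha>) \<tau>"
proof -
  have "zeta powi (- 5 * (12 - 3 * \<alpha> + 6 * \<gamma>)) / zeta powi (12 - \<alpha> + 2 * \<gamma>) = zeta powi (16 * \<alpha> - 32 * \<gamma> - 72)"
    by (subst power_int_diff[symmetric]) (auto intro!: arg_cong[where f = "\<lambda>k. zeta powi k"])
  then show ?thesis
    unfolding hecke_ratio_def hecke3_T[OF assms] eta_quot_T[OF assms] by (metis times_divide_times_eq)
qed

lemma hecke_ratio_S:
  assumes t: "Im \<tau> > 0" and odd: "odd \<alpha> \<or> odd \<gamma>"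
  shows "hecke_ratio \<alpha> \<gamma> (- 1 / \<tau>) = hecke_sign \<alpha> \<gamma> * of_real (sqrt 2) powi (2 * (\<alpha> - \<gamma>)) * hecke_ratio \<gamma> \<alpha> \<tau>"
proof -
  have t0: "(- \<i> * \<tau>)^3 \<noteq> 0" using t by auto
  have e1: "complex_of_real (sqrt 2) powi (3 * \<alpha> - 3 * \<gamma>) / of_real (sqrt 2) powi (\<alpha> - \<gamma>) = of_real (sqrt 2) powi (2 * (\<alpha> - \<gamma>))"
    by (subst power_int_diff[symmetric]) (auto intro!: arg_cong[where f = "\<lambda>k. complex_of_real (sqrt 2) powi k"])
  have e2: "(x * N * A * T) / (N * B * E) = x * (A / B) * (T / E)" if "N \<noteq> 0" for x N A T B E :: complex
    using that by simp
  show ?thesis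
    unfolding hecke_ratio_def hecke3_S[OF t odd] eta_quot_S[OF t] e2[OF t0] e1 ..
qed

lemma eta_quot_affine_holomorphic:
  assumes "r > 0" "Im c = 0"
  shows "(\<lambda>\<tau>. eta_quot a b (of_real r * \<tau> + c)) holomorphic_on upper_half"
  by (rule holomorphic_on_compose_gen[OF _ eta_quot_holomorphic, unfolded o_def])
     (use assms in \<open>auto intro!: holomorphic_intros\<close>)

lemma hecke3_alt: "hecke3 \<alpha> \<gamma> = (\<lambda>\<tau>. eta_quot (3*\<alpha>) (3*\<gamma>) (of_real (1/3) * \<tau> + 0) + eta_quot (3*\<alpha>) (3*\<gamma>) (of_real (1/3) * \<tau> + 16 / 3) + eta_quot (3*\<alpha>) (3*\<gamma>) (of_real (1/3) * \<tau> + 32 / 3)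
     + 27 * hecke_sign \<alpha> \<gamma> * eta_quot (3*\<alpha>) (3*\<gamma>) (of_real 3 * \<tau> + 0))"
  by (simp add: hecke3_def fun_eq_iff add_divide_distrib)

lemma hecke_ratio_holomorphic: "hecke_ratio \<alpha> \<gamma> holomorphic_on upper_half"
proof -
  have "hecke3 \<alpha> \<gamma> holomorphic_on upper_half"
    unfolding hecke3_alt by (intro holomorphic_intros eta_quot_affine_holomorphic) auto
  then have "(\<lambda>\<tau>. hecke3 \<alpha> \<gamma> \<tau> / eta_quot \<alpha> \<gamma> \<tau>) holomorphic_on upper_half"
    by (intro holomorphic_intros eta_quot_holomorphic) (auto simp: eta_quot_nonzero)
  then show ?thesis by (simp add: hecke_ratio_def[abs_def])
qed

lemma hecke_ratio_growth:
  assumes m: "4 - \<alpha> + 2 * \<gamma> \<ge> 1"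
  obtains D where "\<And>\<tau>. Im \<tau> \<ge> 3/2 \<Longrightarrow> norm (hecke_ratio \<alpha> \<gamma> \<tau>) \<le> D * exp ((pi / 3) * Im \<tau>)"
proof -
  define m where "m = 4 - \<alpha> + 2 * \<gamma>"
  have o3: "12 - 3 * \<alpha> + 2 * (3 * \<gamma>) = 3 * m" and o1: "12 - \<alpha> + 2 * \<gamma> = m + 8" by (auto simp: m_def)
  have m1: "m \<ge> 1" using m by (simp add: m_def)
  obtain C where C: "C > 0" "\<And>\<tau>. Im \<tau> \<ge> 1/2 \<Longrightarrow> norm (eta_quot (3*\<alpha>) (3*\<gamma>) \<tau>) \<le> C * exp (- (pi / 24) * of_int (3 * m) * Im \<tau>)"
    using eta_quot_decay[of "3*\<alpha>" "3*\<gamma>"] unfolding o3 by blast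
  obtain c where c: "c > 0" "\<And>\<tau>. Im \<tau> \<ge> 1/2 \<Longrightarrow> c * exp (- (pi / 24) * of_int (m + 8) * Im \<tau>) \<le> norm (eta_quot \<alpha> \<gamma> \<tau>)"
    using eta_quot_lower[of \<alpha> \<gamma>] unfolding o1 by blast
  show thesis
  proof (rule that)
    fix \<tau> :: complex assume t: "Im \<tau> \<ge> 3/2"
    define e where "e = exp (- (pi / 24) * of_int m * Im \<tau>)"
    have third: "norm (eta_quot (3*\<alpha>) (3*\<gamma>) \<sigma>) \<le> C * e" if "Im \<sigma> = Im \<tau> / 3" for \<sigma>
      using C(2)[of \<sigma>] that t by (simp add: e_def)
    have "norm (eta_quot (3*\<alpha>) (3*\<gamma>) (3 * \<tau>)) \<le> C * exp (- (pi / 24) * of_int (3 * m) * Im (3 * \<tau>))"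
      using t by (intro C(2)) auto
    also have "\<dots> \<le> C * e"
    proof -
      have "(pi / 24) * (of_int m * Im \<tau>) \<le> 9 * ((pi / 24) * (of_int m * Im \<tau>))"
      proof -
        have "0 \<le> (pi / 24) * (of_int m * Im \<tau>)" using t m1 by simp
        then show ?thesis by linarith
      qed
      then show ?thesis using C(1) by (simp add: e_def mult_ac)
    qed
    finally have nine: "norm (eta_quot (3*\<alpha>) (3*\<gamma>) (3 * \<tau>)) \<le> C * e" .
    have nchi: "norm (hecke_sign \<alpha> \<gamma>) = 1" by (simp add: hecke_sign_def)
    \<comment> \<open>the leading exponents in the numerator and in the denominator differ by \<open>8 * (pi / 24)\<close>, which is \<open>pi / 3\<close>\<close>
    have "norm (hecke3 \<alpha> \<gamma> \<tau>) \<le> C * e + C * e + C * e + 27 * (C * e)"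
      unfolding hecke3_def
      by (intro norm_triangle_mono third) (use nine nchi in \<open>auto simp: norm_mult\<close>)
    also have "\<dots> = 30 * C * e" by simp
    finally have num: "norm (hecke3 \<alpha> \<gamma> \<tau>) \<le> 30 * C * e" .
    have e0: "e > 0" by (simp add: e_def)
    define d where "d = exp (- (pi / 24) * of_int (m + 8) * Im \<tau>)"
    have d0: "d > 0" by (simp add: d_def)
    have de: "e = d * exp ((pi / 3) * Im \<tau>)"
      by (simp add: e_def d_def exp_add[symmetric] algebra_simps)
    have den: "c * d \<le> norm (eta_quot \<alpha> \<gamma> \<tau>)" using c(2)[of \<tau>] t by (simp add: d_def)
    have "norm (hecke_ratio \<alpha> \<gamma> \<tau>) = norm (hecke3 \<alpha> \<gamma> \<tau>) / norm (eta_quot \<alpha> \<gamma> \<tau>)" by (simp add: hecke_ratio_def norm_divide)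
    also have "\<dots> \<le> (30 * C * e) / (c * d)"
      using num den c(1) d0 C(1) e0 by (intro frac_le) auto
    also have "\<dots> = 30 * C / c * exp ((pi / 3) * Im \<tau>)" unfolding de using c(1) d0 by simp
    finally show "norm (hecke_ratio \<alpha> \<gamma> \<tau>) \<le> 30 * C / c * exp ((pi / 3) * Im \<tau>)" .
  qed
qed

text \<open>Both pairs for which the Hecke relation is used, \<open>(1, -1)\<close> and \<open>(-1,
  1)\<close>, lie in this orbit, so one application of the maximum principle serves both.\<close>

abbreviation "hecke_orbit \<equiv> s3_orbit 1 (- 1)"

lemma hecke_orbit_cases: "(\<alpha>, \<gamma>) \<in> hecke_orbit \<longleftrightarrow> (\<alpha>, \<gamma>) \<in> {(1,-1), (-1,1), (-1,-2), (-2,-1), (1,2), (2,1)}"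
  by (auto simp: s3_orbit_def)

text \<open>The power of 2 makes the six absolute values a family that the modular group permutes.\<close>

definition weighted_ratio :: "int \<Rightarrow> int \<Rightarrow> complex \<Rightarrow> real" where
  "weighted_ratio \<alpha> \<gamma> \<tau> = 2 powr (of_int (2 * \<gamma> - \<alpha>) / 3) * norm (hecke_ratio \<alpha> \<gamma> \<tau>)"

lemma weighted_ratio_T: "Im \<tau> > 0 \<Longrightarrow> weighted_ratio \<alpha> \<gamma> (\<tau> + 1) = weighted_ratio (-\<alpha>) (\<gamma> - \<alpha>) \<tau>"
  by (simp add: weighted_ratio_def hecke_ratio_T norm_mult norm_power_int)

lemma weighted_ratio_S:
  assumes "Im \<tau> > 0" "odd \<alpha> \<or> odd \<gamma>"
  shows "weighted_ratio \<alpha> \<gamma> (- 1 / \<tau>) = weighted_ratio \<gamma> \<alpha> \<tau>"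
proof -
  have f1: "norm (complex_of_real (sqrt 2) powi (2 * (\<alpha> - \<gamma>))) = 2 powr of_int (\<alpha> - \<gamma>)"
  proof -
    have "norm (complex_of_real (sqrt 2) powi (2 * (\<alpha> - \<gamma>))) = sqrt 2 powi (2 * (\<alpha> - \<gamma>))" by (simp add: norm_power_int)
    also have "\<dots> = (sqrt 2 powi 2) powi (\<alpha> - \<gamma>)" by (rule power_int_mult)
    also have "\<dots> = 2 powr of_int (\<alpha> - \<gamma>)" by (simp add: powr_real_of_int' del: of_int_diff)
    finally show ?thesis .
  qed
  have f2: "norm (hecke_sign \<alpha> \<gamma>) = 1" by (simp add: hecke_sign_def)
  have f3: "2 powr (of_int (2 * \<gamma> - \<alpha>) / 3) * 2 powr of_int (\<alpha> - \<gamma>) = (2::real) powr (of_int (2 * \<alpha> - \<gamma>) / 3)"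
    unfolding powr_add[symmetric] by (rule arg_cong[where f = "\<lambda>x. 2 powr x"]) (simp add: field_simps)
  show ?thesis unfolding weighted_ratio_def hecke_ratio_S[OF assms] norm_mult f1 f2 mult_1_left mult.assoc[symmetric] f3 ..
qed

lemma hecke_ratio_period:
  assumes "Im \<tau> > 0" "(\<alpha>, \<gamma>) \<in> hecke_orbit"
  shows "hecke_ratio \<alpha> \<gamma> (\<tau> + 2) = hecke_ratio \<alpha> \<gamma> \<tau>"
proof -
  have "hecke_ratio \<alpha> \<gamma> (\<tau> + 1 + 1) = zeta powi (16 * \<alpha> - 32 * \<gamma> - 72) * (zeta powi (16 * (-\<alpha>) - 32 * (\<gamma> - \<alpha>) - 72) * hecke_ratio \<alpha> \<gamma> \<tau>)"
    using hecke_ratio_T[of "\<tau> + 1" \<alpha> \<gamma>] hecke_ratio_T[of \<tau> "-\<alpha>" "\<gamma> - \<alpha>"] assms by simp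
  also have "\<dots> = (zeta powi (16 * \<alpha> - 32 * \<gamma> - 72) * zeta powi (16 * (-\<alpha>) - 32 * (\<gamma> - \<alpha>) - 72)) * hecke_ratio \<alpha> \<gamma> \<tau>"
    by (simp only: mult.assoc)
  also have "zeta powi (16 * \<alpha> - 32 * \<gamma> - 72) * zeta powi (16 * (-\<alpha>) - 32 * (\<gamma> - \<alpha>) - 72) = zeta powi (32 * \<alpha> - 64 * \<gamma> - 144)"
    unfolding zeta_add by (rule arg_cong[where f = "\<lambda>k. zeta powi k"]) simp
  also have "zeta powi (32 * \<alpha> - 64 * \<gamma> - 144) = 1"
  proof -
    have "3 dvd \<alpha> + \<gamma>" using assms(2) unfolding hecke_orbit_cases by auto
    then obtain j where "\<alpha> + \<gamma> = 3 * j" by (auto elim: dvdE)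
    then have "32 * \<alpha> - 64 * \<gamma> - 144 = 48 * (2 * \<alpha> - 4 * j - 3)" by simp
    then show ?thesis by (simp only: zeta48)
  qed
  finally show ?thesis by (simp add: add.assoc)
qed

definition hecke_ratio_is_constant :: "int \<Rightarrow> int \<Rightarrow> bool" where
  "hecke_ratio_is_constant \<alpha> \<gamma> \<longleftrightarrow> (\<exists>k. \<forall>\<tau>. Im \<tau> > 0 \<longrightarrow> hecke_ratio \<alpha> \<gamma> \<tau> = k)"

lemma hecke_ratio_is_constant_T: "hecke_ratio_is_constant \<alpha> \<gamma> \<Longrightarrow> hecke_ratio_is_constant (-\<alpha>) (\<gamma> - \<alpha>)"
proof -
  assume "hecke_ratio_is_constant \<alpha> \<gamma>"
  then obtain k where k: "\<And>\<tau>. Im \<tau> > 0 \<Longrightarrow> hecke_ratio \<alpha> \<gamma> \<tau> = k" by (auto simp: hecke_ratio_is_constant_def)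
  have "hecke_ratio (-\<alpha>) (\<gamma> - \<alpha>) \<tau> = k / zeta powi (16 * \<alpha> - 32 * \<gamma> - 72)" if "Im \<tau> > 0" for \<tau>
    using hecke_ratio_T[OF that, of \<alpha> \<gamma>] k[of "\<tau> + 1"] that by (simp add: field_simps)
  then show ?thesis by (auto simp: hecke_ratio_is_constant_def)
qed

lemma hecke_ratio_is_constant_S: "hecke_ratio_is_constant \<alpha> \<gamma> \<Longrightarrow> odd \<alpha> \<or> odd \<gamma> \<Longrightarrow> hecke_ratio_is_constant \<gamma> \<alpha>"
proof -
  assume "hecke_ratio_is_constant \<alpha> \<gamma>" and odd: "odd \<alpha> \<or> odd \<gamma>"
  then obtain k where k: "\<And>\<tau>. Im \<tau> > 0 \<Longrightarrow> hecke_ratio \<alpha> \<gamma> \<tau> = k" by (auto simp: hecke_ratio_is_constant_def)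
  have "hecke_ratio \<gamma> \<alpha> \<tau> = k / (hecke_sign \<alpha> \<gamma> * of_real (sqrt 2) powi (2 * (\<alpha> - \<gamma>)))" if "Im \<tau> > 0" for \<tau>
  proof -
    have "Im (- 1 / \<tau>) > 0" unfolding Im_neg_inverse using that by (auto intro!: divide_pos_pos)
    then have "k = hecke_sign \<alpha> \<gamma> * of_real (sqrt 2) powi (2 * (\<alpha> - \<gamma>)) * hecke_ratio \<gamma> \<alpha> \<tau>"
      using hecke_ratio_S[OF that odd] k[of "- 1 / \<tau>"] by simp
    moreover have "hecke_sign \<alpha> \<gamma> * of_real (sqrt 2) powi (2 * (\<alpha> - \<gamma>)) \<noteq> 0" by (simp add: hecke_sign_def)
    ultimately show ?thesis by (metis nonzero_mult_div_cancel_left)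
  qed
  then show ?thesis by (auto simp: hecke_ratio_is_constant_def)
qed

text \<open>The six quotients extend holomorphically to the cusp and are permuted by the modular group up to
  constants of known absolute value. Therefore the largest of the six suprema is attained for \<open>Im
  \<tau> \<ge> 1/2\<close>, cusp included; the function that attains it is constant by the maximum
  principle, and then so are its companions in the orbit.\<close>

lemma hecke_ratio_constant:
  assumes "(\<alpha>, \<gamma>) \<in> {(1, -1), (-1, 1)}"
  obtains k where "\<And>\<tau>. Im \<tau> > 0 \<Longrightarrow> hecke3 \<alpha> \<gamma> \<tau> = k * eta_quot \<alpha> \<gamma> \<tau>"
proof -
  have fin: "finite hecke_orbit" by (simp add: s3_orbit_def)
  have "\<exists>g. g holomorphic_on ball 0 1 \<and> (\<forall>\<tau>. Im \<tau> > 0 \<longrightarrow> hecke_ratio (fst p) (snd p) \<tau> = g (exp (\<i> * pi * \<tau>)))" if p: "p \<in> hecke_orbit" for p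
  proof -
    obtain a c where ac: "p = (a, c)" by (cases p)
    then have pp: "(a, c) \<in> hecke_orbit" using p by simp
    then have "4 - a + 2 * c \<ge> 1" unfolding hecke_orbit_cases by auto
    then obtain D where "\<And>\<tau>. Im \<tau> \<ge> 3/2 \<Longrightarrow> norm (hecke_ratio a c \<tau>) \<le> D * exp ((pi / 3) * Im \<tau>)"
      using hecke_ratio_growth by blast
    then obtain g where "g holomorphic_on ball 0 1" "\<And>\<tau>. Im \<tau> > 0 \<Longrightarrow> hecke_ratio a c \<tau> = g (exp (\<i> * pi * \<tau>))"
      using periodic_disc_extension[OF hecke_ratio_holomorphic hecke_ratio_period[OF _ pp]] by blast
    then show ?thesis by (auto simp: ac)
  qed
  then obtain g where ghol: "\<And>p. p \<in> hecke_orbit \<Longrightarrow> g p holomorphic_on ball 0 1"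
    and g: "\<And>p \<tau>. p \<in> hecke_orbit \<Longrightarrow> Im \<tau> > 0 \<Longrightarrow> hecke_ratio (fst p) (snd p) \<tau> = g p (exp (\<i> * pi * \<tau>))"
    by metis
  define K where "K = cball (0::complex) (exp (- pi / 2))"
  define h where "h = (\<lambda>p z. 2 powr (of_int (2 * snd p - fst p) / 3) * norm (g p z))"
  have "exp (- pi / 2) < 1" by simp
  then have K1: "K \<subseteq> ball 0 1" unfolding K_def by (auto simp del: exp_less_one_iff)
  have "\<exists>w\<in>K. \<forall>z\<in>K. h p z \<le> h p w" if p: "p \<in> hecke_orbit" for p
  proof (rule continuous_attains_sup)
    show "compact K" "K \<noteq> {}" by (auto simp: K_def)
    show "continuous_on K (h p)" unfolding h_def
      using holomorphic_on_imp_continuous_on[OF ghol[OF p]] K1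
      by (intro continuous_intros) (auto intro: continuous_on_subset)
  qed
  then obtain w where w: "\<And>p. p \<in> hecke_orbit \<Longrightarrow> w p \<in> K" "\<And>p z. p \<in> hecke_orbit \<Longrightarrow> z \<in> K \<Longrightarrow> h p z \<le> h p (w p)"
    by metis
  \<comment> \<open>the largest of the six maxima over the closed disc that corresponds to \<open>Im \<tau> \<ge> 1/2\<close>\<close>
  define M where "M = Max ((\<lambda>p. h p (w p)) ` hecke_orbit)"
  have ne: "hecke_orbit \<noteq> {}" by (simp add: s3_orbit_def)
  have "M \<in> (\<lambda>p. h p (w p)) ` hecke_orbit" unfolding M_def using fin ne by (intro Max_in) auto
  then obtain P where P: "P \<in> hecke_orbit" "M = h P (w P)" by auto
  have odd: "odd a \<or> odd c" if "(a, c) \<in> hecke_orbit" for a c using that unfolding hecke_orbit_cases by auto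
  have "\<forall>a c. (a,c) \<in> hecke_orbit \<longrightarrow> weighted_ratio a c \<tau> \<le> M" if "Im \<tau> > 0" for \<tau>
    using _ _ _ that
  proof (rule modular_induct)
    fix \<tau> :: complex assume t: "Im \<tau> \<ge> 1/2"
    have K: "exp (\<i> * pi * \<tau>) \<in> K" using t by (simp add: K_def)
    show "\<forall>a c. (a,c) \<in> hecke_orbit \<longrightarrow> weighted_ratio a c \<tau> \<le> M"
    proof (intro allI impI)
      fix a c assume ac: "(a,c) \<in> hecke_orbit"
      have "weighted_ratio a c \<tau> = h (a,c) (exp (\<i> * pi * \<tau>))" using g[OF ac, of \<tau>] t by (simp add: weighted_ratio_def h_def)
      also have "\<dots> \<le> h (a,c) (w (a,c))" by (rule w(2)[OF ac K])
      also have "\<dots> \<le> M" unfolding M_def using fin ac by (intro Max_ge) auto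
      finally show "weighted_ratio a c \<tau> \<le> M" .
    qed
  next
    fix \<tau> :: complex assume t: "Im \<tau> > 0"
    show "(\<forall>a c. (a,c) \<in> hecke_orbit \<longrightarrow> weighted_ratio a c (\<tau> + 1) \<le> M) \<longleftrightarrow> (\<forall>a c. (a,c) \<in> hecke_orbit \<longrightarrow> weighted_ratio a c \<tau> \<le> M)"
      using s3_orbit_T[of _ _ 1 "- 1"] unfolding weighted_ratio_T[OF t] by (metis (no_types, lifting) add.inverse_inverse diff_add_cancel diff_minus_eq_add)
  next
    fix \<tau> :: complex assume t: "Im \<tau> > 0" and IH: "\<forall>a c. (a,c) \<in> hecke_orbit \<longrightarrow> weighted_ratio a c (- 1 / \<tau>) \<le> M"
    show "\<forall>a c. (a,c) \<in> hecke_orbit \<longrightarrow> weighted_ratio a c \<tau> \<le> M"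
    proof (intro allI impI)
      fix a c assume ac: "(a,c) \<in> hecke_orbit"
      then have ca: "(c,a) \<in> hecke_orbit" by (rule s3_orbit_S)
      then show "weighted_ratio a c \<tau> \<le> M" using IH weighted_ratio_S[OF t odd[OF ca]] by metis
    qed
  qed
  \<comment> \<open>so the function attaining \<open>M\<close> has a maximum of its absolute value inside the disc\<close>
  then have bound: "h P z \<le> h P (w P)" if z: "z \<in> ball 0 1" for z
  proof (cases "z = 0")
    case True
    then show ?thesis using w(2)[OF P(1), of 0] by (simp add: K_def)
  next
    case False
    define \<tau> where "\<tau> = Ln z / (\<i> * pi)"
    have "Im \<tau> = - ln (norm z) / pi" using False by (simp add: \<tau>_def Im_divide power2_eq_square)
    then have t: "Im \<tau> > 0" using z False by (simp add: divide_neg_pos)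
    have e: "exp (\<i> * pi * \<tau>) = z" using False by (simp add: \<tau>_def)
    have "weighted_ratio (fst P) (snd P) \<tau> \<le> M"
      using \<open>\<And>\<tau>. Im \<tau> > 0 \<Longrightarrow> \<forall>a c. (a,c) \<in> hecke_orbit \<longrightarrow> weighted_ratio a c \<tau> \<le> M\<close>[OF t] P(1) by (metis prod.collapse)
    then show ?thesis using g[OF P(1) t] by (simp add: weighted_ratio_def h_def P(2) e)
  qed
  have "g P constant_on ball 0 1"
  proof (rule maximum_modulus_principle[OF ghol[OF P(1)]])
    show "w P \<in> ball 0 1" using w(1)[OF P(1)] K1 by auto
    show "norm (g P z) \<le> norm (g P (w P))" if "z \<in> ball 0 1" for z using bound[OF that] by (simp add: h_def)
  qed auto
  then obtain k where k: "\<And>z. z \<in> ball 0 1 \<Longrightarrow> g P z = k" by (auto simp: constant_on_def)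
  have "hecke_ratio (fst P) (snd P) \<tau> = k" if "Im \<tau> > 0" for \<tau>
    using g[OF P(1) that] k[of "exp (\<i> * pi * \<tau>)"] that by simp
  then have "hecke_ratio_is_constant (fst P) (snd P)" by (auto simp: hecke_ratio_is_constant_def)
  moreover have "(fst P, snd P) \<in> hecke_orbit" using P(1) by simp
  ultimately have c: "\<exists>(a,c) \<in> {(1,-1), (-1,1), (-1,-2), (-2,-1), (1,2), (2,1)}. hecke_ratio_is_constant a c"
    unfolding hecke_orbit_cases by blast
  \<comment> \<open>constancy spreads along the orbit by the two generators\<close>
  have st: "hecke_ratio_is_constant 1 (-1) \<Longrightarrow> hecke_ratio_is_constant (-1) 1" "hecke_ratio_is_constant (-1) 1 \<Longrightarrow> hecke_ratio_is_constant 1 (-1)"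
    "hecke_ratio_is_constant (-1) (-2) \<Longrightarrow> hecke_ratio_is_constant 1 (-1)" "hecke_ratio_is_constant 1 2 \<Longrightarrow> hecke_ratio_is_constant (-1) 1"
    "hecke_ratio_is_constant (-2) (-1) \<Longrightarrow> hecke_ratio_is_constant (-1) (-2)" "hecke_ratio_is_constant 2 1 \<Longrightarrow> hecke_ratio_is_constant 1 2"
    using hecke_ratio_is_constant_S[of 1 "-1"] hecke_ratio_is_constant_S[of "-1" 1] hecke_ratio_is_constant_T[of "-1" "-2"] hecke_ratio_is_constant_T[of 1 2]
      hecke_ratio_is_constant_S[of "-2" "-1"] hecke_ratio_is_constant_S[of 2 1] by simp_all
  have "hecke_ratio_is_constant \<alpha> \<gamma>" using c st assms by auto
  then obtain k where k: "\<And>\<tau>. Im \<tau> > 0 \<Longrightarrow> hecke_ratio \<alpha> \<gamma> \<tau> = k" by (auto simp: hecke_ratio_is_constant_def)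
  show thesis
    by (rule that[of k]) (use k eta_quot_nonzero in \<open>force simp: hecke_ratio_def field_simps\<close>)
qed

text \<open>The eta quotient without its leading power, as a function of \<open>exp (\<i> * pi *
  \<tau>)\<close>.\<close>

definition phi_quot :: "int \<Rightarrow> int \<Rightarrow> complex \<Rightarrow> complex" where
  "phi_quot a c x = euler_phi x powi a * euler_phi (x^2) powi (6 - a - c) * euler_phi (x^4) powi c"

lemma eta_quot_FF:
  fixes \<tau> :: complex
  shows "eta_quot a c \<tau> = exp (\<i> * (pi * \<tau> * of_int (12 - a + 2 * c) / 24)) * phi_quot a c (exp (\<i> * (pi * \<tau>)))"
proof -
  have e: "exp (\<i> * (pi * z / 12)) powi k = exp (of_int k * (\<i> * (pi * z / 12)))" for z :: complex and k :: int
    by (simp add: exp_power_int mult_ac)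
  have p: "exp (2 * \<i> * (pi * (\<tau>/2))) = exp (\<i> * (pi * \<tau>))" "exp (2 * \<i> * (pi * \<tau>)) = exp (\<i> * (pi * \<tau>))^2"
     "exp (2 * \<i> * (pi * (2 * \<tau>))) = exp (\<i> * (pi * \<tau>))^4"
    by (simp_all add: exp_of_nat_mult[symmetric] mult_ac)
  have "eta_quot a c \<tau> = (exp (of_int a * (\<i> * (pi * (\<tau>/2) / 12))) * exp (of_int (6 - a - c) * (\<i> * (pi * \<tau> / 12))) * exp (of_int c * (\<i> * (pi * (2 * \<tau>) / 12)))) * phi_quot a c (exp (\<i> * (pi * \<tau>)))"
    unfolding eta_quot_def eta_phi power_int_mult_distrib e p phi_quot_def by (simp only: mult_ac)
  also have "exp (of_int a * (\<i> * (pi * (\<tau>/2) / 12))) * exp (of_int (6 - a - c) * (\<i> * (pi * \<tau> / 12))) * exp (of_int c * (\<i> * (pi * (2 * \<tau>) / 12)))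
     = exp (\<i> * (pi * \<tau> * of_int (12 - a + 2 * c) / 24))"
    unfolding exp_add[symmetric] by (rule arg_cong[where f = exp]) (simp add: field_simps)
  finally show ?thesis .
qed

lemma phi_quot_holomorphic: "phi_quot a c holomorphic_on ball 0 1"
proof -
  have "(\<lambda>x. euler_phi (x ^ Suc n)) holomorphic_on ball 0 1" for n
    by (rule holomorphic_on_compose_gen[OF _ euler_phi_holomorphic, unfolded o_def])
       (auto intro!: holomorphic_intros simp: norm_power power_less_one_iff simp del: power_Suc)
  from this[of 1] this[of 3] euler_phi_holomorphic show ?thesis unfolding phi_quot_def[abs_def]
    by (intro holomorphic_intros) (auto simp: numeral_2_eq_2 numeral_eq_Suc euler_phi_nonzero norm_mult power_less_one_iff norm_power simp del: power_Suc intro!: euler_phi_nonzero)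
qed

lemma phi_quot_0 [simp]: "phi_quot a c 0 = 1"
  by (simp add: phi_quot_def)

lemma phi_quot_deriv_0: "(phi_quot a c has_field_derivative - of_int a) (at 0)"
proof -
  have p: "((\<lambda>x. euler_phi (x ^ Suc (Suc n))) has_field_derivative 0) (at 0)" for n
  proof -
    have "((\<lambda>x::complex. x ^ Suc (Suc n)) has_field_derivative 0) (at 0)" by (auto intro!: derivative_eq_intros)
    from DERIV_chain2[of euler_phi "- 1" "\<lambda>x. x ^ Suc (Suc n)", OF _ this] euler_phi_deriv_0 show ?thesis by simp
  qed
  from p[of 0] p[of 2] have "((\<lambda>x. euler_phi (x^2)) has_field_derivative 0) (at 0)" "((\<lambda>x. euler_phi (x^4)) has_field_derivative 0) (at 0)"
    by (simp_all add: numeral_eq_Suc)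
  then show ?thesis unfolding phi_quot_def[abs_def]
    using euler_phi_deriv_0 by (auto intro!: derivative_eq_intros)
qed

text \<open>The constant is the ratio of the first coefficients of the two sides. The sum over the three
  translates extracts every third coefficient, three times, and the first of these is the linear coefficient
  \<open>-3 * \<alpha>\<close>. The term \<open>3 * \<tau>\<close> contributes to the first coefficient in
  the case \<open>\<alpha> = 1\<close> only.\<close>

lemma hecke3_eq:
  assumes ag: "(\<alpha>, \<gamma>, k) = (1, -1, -36) \<or> (\<alpha>, \<gamma>, k) = (-1, 1, 9)" and t: "Im \<tau> > 0"
  shows "hecke3 \<alpha> \<gamma> \<tau> = k * eta_quot \<alpha> \<gamma> \<tau>"
proof -
  obtain l where l: "\<And>\<tau>. Im \<tau> > 0 \<Longrightarrow> hecke3 \<alpha> \<gamma> \<tau> = l * eta_quot \<alpha> \<gamma> \<tau>"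
    using ag hecke_ratio_constant[of \<alpha> \<gamma>] by blast
  define \<omega> where "\<omega> = exp (\<i> * (2 * pi / 3))"
  have w3: "\<omega> ^ 3 = 1" by (auto simp: \<omega>_def exp_of_nat_mult[symmetric] exp_eq_1 intro!: exI[of _ 1])
  have w1: "\<omega> \<noteq> 1"
  proof
    assume "\<omega> = 1"
    then obtain n :: int where "real_of_int (3 * n) = 1" by (auto simp: \<omega>_def exp_eq_1)
    then have "3 * n = 1" by (simp only: of_int_eq_1_iff)
    then show False by presburger
  qed
  have w0: "1 + \<omega> + \<omega>^2 = 0"
  proof -
    have "(\<omega> - 1) * (1 + \<omega> + \<omega>^2) = 0" using w3 by (simp add: algebra_simps power2_eq_square power3_eq_cube)
    then show ?thesis using w1 by simp
  qed
  define m :: nat where "m = (if \<alpha> = 1 then 1 else 7)"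
  have m: "int m = 4 - \<alpha> + 2 * \<gamma>" using ag by (auto simp: m_def)
  have mr: "of_int (12 - 3 * \<alpha> + 2 * (3 * \<gamma>)) = (3 * of_nat m :: complex)" "of_int (12 - \<alpha> + 2 * \<gamma>) = (of_nat m + 8 :: complex)"
    using ag by (auto simp: m_def)
  let ?G = "phi_quot (3*\<alpha>) (3*\<gamma>)"
  \<comment> \<open>with \<open>x = exp (\<i> * pi * \<tau>)\<close> and a common factor removed, the two sides at \<open>3 * \<tau>\<close> are \<open>A x\<close> and \<open>B x\<close>; their derivatives at 0 give \<open>l\<close>\<close>
  define A where "A = (\<lambda>x. ?G x + \<omega> * ?G (\<omega>^2 * x) + \<omega>^2 * ?G (\<omega> * x) + 27 * hecke_sign \<alpha> \<gamma> * x ^ m * ?G (x^9))"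
  define B where "B = (\<lambda>x. l * x * phi_quot \<alpha> \<gamma> (x^3))"
  have AB: "A x = B x" if x: "x \<in> ball 0 1" for x
  proof (cases "x = 0")
    case True
    then show ?thesis using w0 by (simp add: A_def B_def m_def)
  next
    case False
    define \<tau> where "\<tau> = Ln x / (\<i> * pi)"
    have "Im \<tau> = - ln (norm x) / pi" using False by (simp add: \<tau>_def Im_divide power2_eq_square)
    then have t: "Im \<tau> > 0" using x False by (simp add: divide_neg_pos)
    have e: "exp (\<i> * (pi * \<tau>)) = x" using False by (simp add: \<tau>_def)
    have en: "exp (\<i> * (pi * (of_nat n * \<tau>))) = x ^ n" for n
      unfolding e[symmetric] exp_of_nat_mult[symmetric] by (simp add: mult_ac)
    define U where "U = exp (\<i> * (pi * \<tau> * (3 * of_nat m) / 24))"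
    have wn: "exp (\<i> * (pi * (of_nat n * 2 / 3))) = \<omega> ^ n" for n
      unfolding \<omega>_def exp_of_nat_mult[symmetric] by (simp add: mult_ac)
    \<comment> \<open>the cube roots of unity that a shift by a multiple of \<open>2/3\<close> produces in front of and inside the power series\<close>
    have sh: "eta_quot (3*\<alpha>) (3*\<gamma>) (\<tau> + of_nat n * 2 / 3) = U * \<omega> ^ r * ?G (x * \<omega> ^ s)" if "(n * m) = 8 * r + 24 * v" "n = s + 3 * z" for n r s v z
    proof -
      have p3: "\<omega> ^ (s + 3 * z) = \<omega> ^ s" by (simp add: power_add power_mult w3)
      have "exp (\<i> * (pi * (\<tau> + of_nat n * 2 / 3))) = x * \<omega> ^ s"
        using wn[of n] e that(2) p3 by (simp add: distrib_left exp_add)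
      moreover have "exp (\<i> * (pi * (\<tau> + of_nat n * 2 / 3) * (3 * of_nat m) / 24)) = U * \<omega> ^ r"
      proof -
        have "of_nat n * (of_nat m :: complex) = 8 * of_nat r + 24 * of_nat v"
          using arg_cong[OF that(1), of "of_nat :: nat \<Rightarrow> complex"] by simp
        then have nm: "\<i> * pi * (of_nat n * of_nat m) / 12 = \<i> * (pi * (of_nat (r + 3 * v) * 2 / 3))"
          by (simp add: field_simps)
        have "\<i> * (pi * (\<tau> + of_nat n * 2 / 3) * (3 * of_nat m) / 24) = \<i> * (pi * \<tau> * (3 * of_nat m) / 24) + \<i> * pi * (of_nat n * of_nat m) / 12"
          by (simp add: field_simps)
        also note nm
        finally have "exp (\<i> * (pi * (\<tau> + of_nat n * 2 / 3) * (3 * of_nat m) / 24)) = U * \<omega> ^ (r + 3 * v)"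
          unfolding U_def wn[symmetric] exp_add[symmetric] by (rule arg_cong)
        then show ?thesis by (simp add: power_add power_mult w3)
      qed
      ultimately show ?thesis unfolding eta_quot_FF mr by simp
    qed
    have 0: "eta_quot (3*\<alpha>) (3*\<gamma>) \<tau> = U * ?G x" unfolding eta_quot_FF mr e U_def ..
    have 1: "eta_quot (3*\<alpha>) (3*\<gamma>) (\<tau> + 16 / 3) = U * (\<omega> * ?G (\<omega>^2 * x))"
    proof -
      have "8 * m = 8 * 1 + 24 * (if m = 1 then 0 else 2)" by (simp add: m_def)
      from sh[OF this, of 2 2] have "eta_quot (3*\<alpha>) (3*\<gamma>) (\<tau> + 16 / 3) = U * \<omega> * ?G (x * \<omega>^2)" by simp
      then show ?thesis by (simp only: mult.assoc mult.commute[of x])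
    qed
    have 2: "eta_quot (3*\<alpha>) (3*\<gamma>) (\<tau> + 32 / 3) = U * (\<omega>^2 * ?G (\<omega> * x))"
    proof -
      have "16 * m = 8 * 2 + 24 * (if m = 1 then 0 else 4)" by (simp add: m_def)
      from sh[OF this, of 1 5] have "eta_quot (3*\<alpha>) (3*\<gamma>) (\<tau> + 32 / 3) = U * \<omega>^2 * ?G (x * \<omega>)" by simp
      then show ?thesis by (simp only: mult.assoc mult.commute[of x])
    qed
    have 3: "eta_quot (3*\<alpha>) (3*\<gamma>) (9 * \<tau>) = U * (x ^ m * ?G (x^9))"
    proof -
      have "exp (\<i> * (pi * (9 * \<tau>) * (3 * of_nat m) / 24)) = U * x ^ m"
        unfolding U_def en[symmetric] exp_add[symmetric] by (rule arg_cong[where f = exp]) (simp add: field_simps)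
      then show ?thesis unfolding eta_quot_FF mr using en[of 9] by simp
    qed
    have 4: "eta_quot \<alpha> \<gamma> (3 * \<tau>) = U * (x * phi_quot \<alpha> \<gamma> (x^3))"
    proof -
      have "exp (\<i> * (pi * (3 * \<tau>) * (of_nat m + 8) / 24)) = U * exp (\<i> * (pi * \<tau>))"
        unfolding U_def exp_add[symmetric] by (rule arg_cong[where f = exp]) (simp add: field_simps)
      then show ?thesis unfolding eta_quot_FF mr using en[of 3] e by simp
    qed
    have "U * A x = hecke3 \<alpha> \<gamma> (3 * \<tau>)"
      unfolding hecke3_def A_def using 0 1 2 3 by (simp add: add_divide_distrib algebra_simps)
    also have "\<dots> = U * B x" using l[of "3 * \<tau>"] t 4 by (simp add: B_def)
    finally show ?thesis by (simp add: U_def)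
  qed
  have dG: "((\<lambda>x. ?G (c * x)) has_field_derivative (- of_int (3 * \<alpha>)) * c) (at 0)" for c
  proof -
    have "((\<lambda>x. c * x) has_field_derivative c) (at 0)" by (auto intro!: derivative_eq_intros)
    from DERIV_chain2[of ?G "- of_int (3*\<alpha>)" "\<lambda>x. c * x", OF _ this] phi_quot_deriv_0[of "3*\<alpha>" "3*\<gamma>"] show ?thesis by simp
  qed
  have dF: "((\<lambda>x. phi_quot a b (x ^ Suc (Suc n))) has_field_derivative 0) (at 0)" for a b n
  proof -
    have "((\<lambda>x::complex. x ^ Suc (Suc n)) has_field_derivative 0) (at 0)" by (auto intro!: derivative_eq_intros)
    from DERIV_chain2[of "phi_quot a b" "- of_int a" "\<lambda>x. x ^ Suc (Suc n)", OF _ this] phi_quot_deriv_0[of a b] show ?thesis by simp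
  qed
  have d3: "((\<lambda>x. phi_quot a b (x ^ 3)) has_field_derivative 0) (at 0)" "((\<lambda>x. phi_quot a b (x ^ 9)) has_field_derivative 0) (at 0)" for a b
    using dF[of a b 1] dF[of a b 7] by (simp_all add: numeral_eq_Suc)
  have dm: "((\<lambda>x::complex. x ^ m) has_field_derivative (if m = 1 then 1 else 0)) (at 0)"
    by (auto simp: m_def intro!: derivative_eq_intros)
  have "(B has_field_derivative l) (at 0)"
    unfolding B_def by (auto intro!: derivative_eq_intros d3)
  moreover have "(A has_field_derivative - of_int (3 * \<alpha>) * (1 + 2 * \<omega>^3) + 27 * hecke_sign \<alpha> \<gamma> * (if m = 1 then 1 else 0)) (at 0)"
    unfolding A_def
    by (rule DERIV_cong[OF DERIV_add[OF DERIV_add[OF DERIV_add[OF phi_quot_deriv_0 DERIV_cmult[OF dG]] DERIV_cmult[OF dG]] DERIV_mult[OF DERIV_cmult[OF dm] d3(2)]]])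
       (simp add: algebra_simps power2_eq_square power3_eq_cube)
  then have "(B has_field_derivative - of_int (3 * \<alpha>) * (1 + 2 * \<omega>^3) + 27 * hecke_sign \<alpha> \<gamma> * (if m = 1 then 1 else 0)) (at 0)"
    by (rule has_field_derivative_transform_within_open[where S = "ball 0 1"]) (auto simp: AB)
  ultimately have "l = - of_int (3 * \<alpha>) * (1 + 2 * \<omega>^3) + 27 * hecke_sign \<alpha> \<gamma> * (if m = 1 then 1 else 0)"
    by (rule DERIV_unique)
  also have "\<dots> = k" unfolding w3 using ag by (auto simp: m_def hecke_sign_def)
  finally show ?thesis using l[OF t] by simp
qed

section \<open>Linear relations between periods\<close>

lemma scale_integrable:
  fixes G :: "real \<Rightarrow> complex"
  assumes "integrable lborel G"
  shows "integrable lborel (\<lambda>u. G (t + u))"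
  using lborel_integrable_real_affine[OF assms, of 1 t] by simp

lemma axis_integral_scale:
  assumes r: "r > 0" and int: "integrable lborel (\<lambda>u. f (\<i> * exp (of_real u)) * exp (of_real u))"
  shows "integrable lborel (\<lambda>u. f (of_real r * (\<i> * exp (of_real u))) * exp (of_real u))"
    and "axis_integral (\<lambda>\<tau>. f (of_real r * \<tau>)) = axis_integral f / of_real r"
proof -
  define G where "G = (\<lambda>u::real. f (\<i> * exp (of_real u)) * exp (complex_of_real u))"
  have e: "exp (complex_of_real (ln r + u)) = of_real r * exp (of_real u)" for u
    using r by (simp add: exp_add exp_of_real)
  have eq: "f (of_real r * (\<i> * exp (of_real u))) * exp (of_real u) = inverse (of_real r) * G (ln r + u)" for u :: real
    using r unfolding G_def e by (simp add: mult_ac)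
  have G: "integrable lborel G" using int by (simp add: G_def)
  show "integrable lborel (\<lambda>u. f (of_real r * (\<i> * exp (of_real u))) * exp (of_real u))"
    unfolding eq using scale_integrable[OF G] by simp
  show "axis_integral (\<lambda>\<tau>. f (of_real r * \<tau>)) = axis_integral f / of_real r"
    unfolding axis_integral_def eq using lborel_integral_shift[of G "ln r"] by (simp add: G_def field_simps)
qed

text \<open>The periods are real because the eta quotients are real on the imaginary axis.\<close>

definition period_re :: "int \<Rightarrow> int \<Rightarrow> real" where "period_re a c = Re (period a c)"

lemma period_lm: "period a c = of_real (period_re a c)"
  using period_real[of a c] by (simp add: period_re_def complex_eq_iff)

text \<open>The triangle relation separates into real and imaginary parts; \<open>zeta_re\<close>,
  \<open>zeta_im\<close> and \<open>root2\<close> name the coefficients, which are then tabulated.\<close>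

definition zeta_re :: "int \<Rightarrow> real" where "zeta_re n = Re (zeta powi n)"

definition zeta_im :: "int \<Rightarrow> real" where "zeta_im n = Im (zeta powi n)"

definition root2 :: "int \<Rightarrow> real" where "root2 n = sqrt 2 powi n"

lemma sqrt2_powi: "complex_of_real (sqrt 2) powi n = of_real (root2 n)"
  by (simp add: root2_def)

text \<open>The integral of the Hecke relation over the imaginary axis. The terms \<open>\<tau> / 3\<close>
  and \<open>3 * \<tau>\<close> rescale the period, and the two translates give complex conjugate integrals
  over the lines over \<open>2/3\<close> and \<open>-2/3\<close>.\<close>

lemma hecke_period:
  assumes cu: "cuspidal (3 * \<alpha>) (3 * \<gamma>)"
    and mult: "\<And>\<tau>. Im \<tau> > 0 \<Longrightarrow> hecke3 \<alpha> \<gamma> \<tau> = of_real k * eta_quot \<alpha> \<gamma> \<tau>"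
    and n: "18 * (4 - \<alpha> + 2 * \<gamma>) = 48 * j - n"
  shows "k * period_re \<alpha> \<gamma> = (3 + 9 * Re (hecke_sign \<alpha> \<gamma>)) * period_re (3 * \<alpha>) (3 * \<gamma>) + 6 * Re (zeta powi n * thirds_period (3 * \<alpha>) (3 * \<gamma>))"
proof -
  define a c where "a = 3 * \<alpha>" and "c = 3 * \<gamma>"
  have cu': "cuspidal a c" using cu by (simp add: a_def c_def)
  let ?e = "\<lambda>u. \<i> * exp (complex_of_real u)"
  have Ie: "Im (?e u) > 0" for u by (simp add: exp_of_real)
  define G where "G = (\<lambda>u::real. eta_quot a c (2/3 + ?e u) * exp (of_real u))"
  define H where "H = (\<lambda>u::real. eta_quot a c ((2 + ?e u) / 3) * exp (complex_of_real u))"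
  have e3: "exp (complex_of_real (- ln 3 + u)) = exp (of_real u) / 3" for u
    by (simp add: exp_add exp_of_real exp_minus exp_diff)
  have Hint: "integrable lborel H" using thirds_period_relation(2)[OF cu'] by (simp add: H_def)
  have HG: "H u = 3 * G (- ln 3 + u)" for u unfolding H_def G_def e3 by (simp add: add_divide_distrib)
  have Hval: "integral\<^sup>L lborel H = 3 * thirds_period a c"
  proof -
    have "integral\<^sup>L lborel H = (LINT u|lborel. 3 * G (- ln 3 + u))" by (rule Bochner_Integration.integral_cong[OF refl HG])
    also have "\<dots> = 3 * (LINT u|lborel. G u)" using lborel_integral_shift[of G "- ln 3"] by simp
    finally show ?thesis by (simp add: G_def thirds_period_def)
  qed
  have zc: "cnj (zeta powi n) = zeta powi (- n)" by (simp add: zeta_powi cis_cnj)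
  \<comment> \<open>modulo even integers the two shifts by \<open>16/3\<close> and \<open>32/3\<close> are \<open>-2/3\<close> and \<open>2/3\<close>, mirror images of each other\<close>
  have s1: "eta_quot a c ((?e u + 32) / 3) * exp (of_real u) = zeta powi n * H u" for u
  proof -
    have f1: "eta_quot a c ((2 + ?e u) / 3 + of_int 10) = zeta powi (10 * (12 - a + 2 * c)) * eta_quot a c ((2 + ?e u) / 3)"
      by (subst eta_quot_shift) (use Ie[of u] in auto)
    have f2: "(2 + ?e u) / 3 + of_int 10 = (?e u + 32) / 3" by (simp add: field_simps)
    have f3: "zeta powi (10 * (12 - a + 2 * c)) = zeta powi n"
    proof -
      have "10 * (12 - a + 2 * c) = n + 48 * (4 - \<alpha> + 2 * \<gamma> - j)" using n by (simp add: a_def c_def)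
      then show ?thesis by (simp only: zeta_add[symmetric] zeta48 mult_1_right)
    qed
    show ?thesis unfolding H_def f2[symmetric] f1 f3 by simp
  qed
  have s2: "eta_quot a c ((?e u + 16) / 3) * exp (of_real u) = cnj (zeta powi n * H u)" for u
  proof -
    have f1: "eta_quot a c (- cnj ((2 + ?e u) / 3) + of_int 6) = zeta powi (6 * (12 - a + 2 * c)) * eta_quot a c (- cnj ((2 + ?e u) / 3))"
      by (subst eta_quot_shift) (use Ie[of u] in auto)
    have f2: "- cnj ((2 + ?e u) / 3) + of_int 6 = (?e u + 16) / 3" by (simp add: exp_cnj field_simps)
    have f3: "eta_quot a c (- cnj ((2 + ?e u) / 3)) = cnj (eta_quot a c ((2 + ?e u) / 3))"
      by (rule eta_quot_reflect) (use Ie[of u] in auto)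
    have f4: "zeta powi (6 * (12 - a + 2 * c)) = zeta powi (- n)"
    proof -
      have "6 * (12 - a + 2 * c) = - n + 48 * j" using n by (simp add: a_def c_def)
      then show ?thesis by (simp only: zeta_add[symmetric] zeta48 mult_1_right)
    qed
    show ?thesis unfolding H_def f2[symmetric] f1 f3 f4 complex_cnj_mult zc by (simp add: exp_cnj)
  qed
  have i0: "integrable lborel (\<lambda>u. eta_quot a c (?e u) * exp (of_real u))" by (rule period_integrable[OF cu'])
  note i1 = axis_integral_scale[of "1/3" "eta_quot a c", OF _ i0, simplified] and i3 = axis_integral_scale[of 3 "eta_quot a c", OF _ i0, simplified]
  have "of_real k * period \<alpha> \<gamma> = (LINT u|lborel. hecke3 \<alpha> \<gamma> (?e u) * exp (of_real u))"
    unfolding period_def axis_integral_def mult[OF Ie] by (simp add: mult_ac)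
  also have "\<dots> = (LINT u|lborel. eta_quot a c (?e u / 3) * exp (of_real u) + cnj (zeta powi n * H u) + zeta powi n * H u
      + 27 * hecke_sign \<alpha> \<gamma> * (eta_quot a c (3 * ?e u) * exp (of_real u)))"
    unfolding s2[symmetric] unfolding s1[symmetric] hecke3_def a_def[symmetric] c_def[symmetric] by (simp add: algebra_simps)
  also have "\<dots> = (LINT u|lborel. eta_quot a c (?e u / 3) * exp (of_real u)) + (LINT u|lborel. cnj (zeta powi n * H u)) + (LINT u|lborel. zeta powi n * H u)
      + 27 * hecke_sign \<alpha> \<gamma> * (LINT u|lborel. eta_quot a c (3 * ?e u) * exp (of_real u))"
    using i1(1) i3(1) Hint by (simp add: mult.assoc)
  also have "(LINT u|lborel. eta_quot a c (?e u / 3) * exp (of_real u)) = 3 * period a c" using i1(2) by (simp add: axis_integral_def period_def)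
  also have "(LINT u|lborel. eta_quot a c (3 * ?e u) * exp (of_real u)) = period a c / 3" using i3(2) by (simp add: axis_integral_def period_def)
  also have "(LINT u|lborel. cnj (zeta powi n * H u)) = cnj (LINT u|lborel. zeta powi n * H u)" by (rule integral_bounded_linear[OF bounded_linear_cnj]) (simp add: Hint)
  also have "(LINT u|lborel. zeta powi n * H u) = zeta powi n * (3 * thirds_period a c)" by (simp add: Hval)
  finally have eq: "of_real k * period \<alpha> \<gamma> = 3 * period a c + cnj (zeta powi n * (3 * thirds_period a c)) + zeta powi n * (3 * thirds_period a c) + 27 * hecke_sign \<alpha> \<gamma> * (period a c / 3)" .
  have "Im (hecke_sign \<alpha> \<gamma>) = 0" by (simp add: hecke_sign_def)
  moreover obtain w where w: "zeta powi n * thirds_period a c = w" by blast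
  then have w3: "zeta powi n * (3 * thirds_period a c) = 3 * w" by simp
  ultimately show ?thesis using arg_cong[OF eq[unfolded w3], of Re] unfolding period_lm a_def[symmetric] c_def[symmetric] w
    by (simp add: algebra_simps)
qed

lemma triangle_real:
  assumes cu: "cuspidal a c"
  shows "zeta_re (a + c) * period_re (-a) (c - a) - zeta_im (2 * a - c) * period_re a c = root2 (- c) * period_re (a - c) (- c)"
    and "zeta_re (2 * a - c) * period_re a c + zeta_im (a + c) * period_re (-a) (c - a) = root2 (a - c) * period_re (- c) (a - c)"
proof -
  define Y where "Y = of_real (sqrt 2) powi (- c) * period (a - c) (- c) + \<i> * of_real (sqrt 2) powi (a - c) * period (- c) (a - c)"
  have "zeta powi (12 + 2 * a - c) * (period a c - zeta powi (12 - a + 2 * c) * period (-a) (c - a)) = zeta powi (12 + 2 * a - c) * (zeta powi (- (12 + 2 * a - c)) * Y)"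
    using triangle_relation[OF cu] by (simp add: Y_def)
  also have "\<dots> = Y" by (simp only: mult.assoc[symmetric] zeta_add) simp
  finally have "zeta powi (12 + 2 * a - c) * period a c - (zeta powi (12 + 2 * a - c) * zeta powi (12 - a + 2 * c)) * period (-a) (c - a) = Y"
    by (simp only: right_diff_distrib mult.assoc)
  moreover have "zeta powi (12 + 2 * a - c) = \<i> * zeta powi (2 * a - c)"
    using zeta_add[of 12 "2 * a - c"] unfolding zeta12 by (simp add: add_diff_eq)
  moreover have "zeta powi (12 + 2 * a - c) * zeta powi (12 - a + 2 * c) = - (zeta powi (a + c))"
  proof -
    have "zeta powi (12 + 2 * a - c) * zeta powi (12 - a + 2 * c) = zeta powi (24 * 1) * zeta powi (a + c)"
      unfolding zeta_add by (rule arg_cong[where f = "\<lambda>k. zeta powi k"]) simp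
    then show ?thesis by (simp only: zeta24) simp
  qed
  ultimately have E: "\<i> * zeta powi (2 * a - c) * of_real (period_re a c) + zeta powi (a + c) * of_real (period_re (-a) (c - a)) = Y"
    by (simp add: period_lm)
  show "zeta_re (a + c) * period_re (-a) (c - a) - zeta_im (2 * a - c) * period_re a c = root2 (- c) * period_re (a - c) (- c)"
    using arg_cong[OF E, of Re] unfolding Y_def period_lm sqrt2_powi by (simp add: zeta_re_def zeta_im_def)
  show "zeta_re (2 * a - c) * period_re a c + zeta_im (a + c) * period_re (-a) (c - a) = root2 (a - c) * period_re (- c) (a - c)"
    using arg_cong[OF E, of Im] unfolding Y_def period_lm sqrt2_powi by (simp add: zeta_re_def zeta_im_def)
qed

lemma thirds_period_real:
  assumes "cuspidal a c"
  shows "Re (zeta powi n * thirds_period a c) = zeta_re (n + 12 - a + 2 * c) * period_re (-a) (c - a)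
     - root2 (- c) * (3 * zeta_im (n - 4 * a - c) * period_re (a - c) (- c) + zeta_re (n - 4 * a - c) * (root2 a * period_re (- c) (a - c)))"
proof -
  have z: "zeta powi n * zeta powi (12 - a + 2 * c) = zeta powi (n + 12 - a + 2 * c)" "zeta powi n * zeta powi (- (4 * a + c)) = zeta powi (n - 4 * a - c)"
    unfolding zeta_add by (rule arg_cong[where f = "\<lambda>k. zeta powi k"], simp)+
  have "zeta powi n * thirds_period a c = (zeta powi n * zeta powi (12 - a + 2 * c)) * of_real (period_re (-a) (c - a)) +
     \<i> * (zeta powi n * zeta powi (- (4 * a + c))) * of_real (root2 (- c)) * (3 * of_real (period_re (a - c) (- c)) + \<i> * of_real (root2 a) * of_real (period_re (- c) (a - c)))"
    unfolding thirds_period_relation(1)[OF assms] period_lm sqrt2_powi by (simp only: distrib_left mult_ac)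
  note e = arg_cong[OF this, of Re, unfolded z]
  show ?thesis unfolding e by (simp add: zeta_re_def zeta_im_def algebra_simps)
qed

text \<open>The Landen transformation of the theta constants, each written as a quotient of Euler products
  and multiplied by a common monomial.\<close>

lemma phi_quot_landen:
  assumes p: "p \<noteq> 0" "norm p < 1"
  shows "phi_quot (-4) (- k - 4) p = phi_quot k (-4) (p^2) + 4 * p * phi_quot (k + 4) 4 (p^2)"
proof -
  define f1 f2 f4 f8 where "f1 = euler_phi p" and "f2 = euler_phi (p^2)" and "f4 = euler_phi (p^4)" and "f8 = euler_phi (p^8)"
  have nz: "f1 \<noteq> 0" "f2 \<noteq> 0" "f4 \<noteq> 0" "f8 \<noteq> 0"
    using p by (auto simp: f1_def f2_def f4_def f8_def norm_power power_less_one_iff intro!: euler_phi_nonzero)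
  have p2: "p^2 \<noteq> 0" "norm (p^2) < 1" using p by (auto simp: norm_power2_lt_1)
  have pp: "(p^2)^2 = p^4" "(p^2)^4 = p^8" by (simp_all add: power_mult[symmetric])
  have T: "(f2^5 / (f1^2 * f4^2))^2 = (f4^5 / (f2^2 * f8^2))^2 + p * (2 * f8^2 / f4)^2"
    using theta_landen[OF p] unfolding theta3_eq[OF p] theta3_eq[OF p2] theta2_eq[OF p2] pp f1_def f2_def f4_def f8_def .
  \<comment> \<open>the factor that turns the squares of theta constants into eta quotients of weight three\<close>
  define A where "A = f2 powi (k + 4) * f4 powi (- k)"
  have "phi_quot (-4) (- k - 4) p = A * (f2^5 / (f1^2 * f4^2))^2"
    unfolding phi_quot_def f1_def[symmetric] f2_def[symmetric] f4_def[symmetric] A_def using nz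
    by (simp add: power_int_diff power_int_add power_int_minus field_simps)
  moreover have "phi_quot k (-4) (p^2) = A * (f4^5 / (f2^2 * f8^2))^2"
    unfolding phi_quot_def pp f2_def[symmetric] f4_def[symmetric] f8_def[symmetric] A_def using nz
    by (simp add: power_int_diff power_int_add power_int_minus field_simps)
  moreover have "4 * p * phi_quot (k + 4) 4 (p^2) = A * (p * (2 * f8^2 / f4)^2)"
    unfolding phi_quot_def pp f2_def[symmetric] f4_def[symmetric] f8_def[symmetric] A_def using nz
    by (simp add: power_int_diff power_int_add power_int_minus field_simps)
  ultimately show ?thesis unfolding T by (simp only: distrib_left)
qed

lemma eta_quot_landen:
  assumes t: "Im \<tau> > 0"
  shows "eta_quot (-4) (- k - 4) (\<tau> / 2) = eta_quot k (-4) \<tau> + 4 * eta_quot (k + 4) 4 \<tau>"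
proof -
  define p where "p = exp (\<i> * (pi * (\<tau> / 2)))"
  have p: "p \<noteq> 0" "norm p < 1" using t by (auto simp: p_def)
  have p2: "exp (\<i> * (pi * \<tau>)) = p^2" by (simp add: p_def exp_of_nat_mult[symmetric])
  define U where "U = exp (\<i> * (pi * \<tau> * (4 - of_int k) / 24))"
  have 1: "exp (\<i> * (pi * (\<tau> / 2) * of_int (12 - (- 4) + 2 * (- k - 4)) / 24)) = U"
    unfolding U_def by (rule arg_cong[where f = exp]) (simp add: field_simps)
  have 2: "exp (\<i> * (pi * \<tau> * of_int (12 - k + 2 * (- 4)) / 24)) = U"
    unfolding U_def by (rule arg_cong[where f = exp]) simp
  have 3: "exp (\<i> * (pi * \<tau> * of_int (12 - (k + 4) + 2 * 4) / 24)) = U * p"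
    unfolding U_def p_def exp_add[symmetric] by (rule arg_cong[where f = exp]) (simp add: field_simps)
  show ?thesis unfolding eta_quot_FF[of "-4"] eta_quot_FF[of k] eta_quot_FF[of "k + 4"] 1 2 3 p2 p_def[symmetric] phi_quot_landen[OF p] by (simp add: algebra_simps)
qed

text \<open>The companion for the difference is the same identity after a translation, which changes the
  sign of one term.\<close>

lemma eta_quot_landen':
  assumes t: "Im \<tau> > 0"
  shows "eta_quot 4 (- k) (\<tau> / 2) = eta_quot k (-4) \<tau> - 4 * eta_quot (k + 4) 4 \<tau>"
proof -
  have I: "Im (\<tau> / 2) > 0" "Im (\<tau> + 2) > 0" using t by auto
  have e: "(\<tau> + 2) / 2 = \<tau> / 2 + 1" by (simp add: add_divide_distrib)
  have s: "eta_quot a c (\<tau> + 2) = zeta powi (2 * (12 - a + 2 * c)) * eta_quot a c \<tau>" for a c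
    using eta_quot_shift[OF t, of a c 2] by simp
  define Z where "Z = zeta powi (8 - 2 * k)"
  have "zeta powi (12 - (-4) + 2 * (- k - 4)) * eta_quot 4 (- k) (\<tau> / 2) = zeta powi (2 * (12 - k + 2 * (-4))) * eta_quot k (-4) \<tau> + 4 * (zeta powi (2 * (12 - (k + 4) + 2 * 4)) * eta_quot (k + 4) 4 \<tau>)"
    using eta_quot_landen[OF I(2), of k] unfolding e eta_quot_T[OF I(1)] s by simp
  moreover have "zeta powi (12 - (-4) + 2 * (- k - 4)) = Z" "zeta powi (2 * (12 - k + 2 * (-4))) = Z"
    by (simp_all add: Z_def)
  moreover have "zeta powi (2 * (12 - (k + 4) + 2 * 4)) = - Z"
  proof -
    have "2 * (12 - (k + 4) + 2 * 4) = (8 - 2 * k) + 24 * 1" by simp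
    then show ?thesis by (simp only: zeta_add[symmetric] zeta24 Z_def) simp
  qed
  ultimately have "Z * eta_quot 4 (- k) (\<tau> / 2) = Z * (eta_quot k (-4) \<tau> - 4 * eta_quot (k + 4) 4 \<tau>)" by (simp add: algebra_simps)
  then show ?thesis by (simp add: Z_def)
qed

text \<open>Integrated over the imaginary axis, where the argument \<open>\<tau> / 2\<close> doubles the
  period.\<close>

lemma period_landen:
  assumes "cuspidal k (-4)" "cuspidal (k + 4) 4" "cuspidal (-4) (- k - 4)" "cuspidal 4 (- k)"
  shows "2 * period_re (-4) (- k - 4) = period_re k (-4) + 4 * period_re (k + 4) 4"
    and "2 * period_re 4 (- k) = period_re k (-4) - 4 * period_re (k + 4) 4"
proof -
  let ?e = "\<lambda>u. \<i> * exp (complex_of_real u)"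
  have Ie: "Im (?e u) > 0" for u by (simp add: exp_of_real)
  have h: "(LINT u|lborel. eta_quot a c (?e u / 2) * exp (of_real u)) = 2 * period a c" if "cuspidal a c" for a c
    using axis_integral_scale(2)[of "1/2" "eta_quot a c", OF _ period_integrable[OF that]] by (simp add: axis_integral_def period_def)
  note i = period_integrable[OF assms(1)] period_integrable[OF assms(2)]
  have "2 * period (-4) (- k - 4) = period k (-4) + 4 * period (k + 4) 4"
    unfolding h[OF assms(3), symmetric] eta_quot_landen[OF Ie] using i by (simp add: period_def axis_integral_def distrib_right mult.assoc)
  from arg_cong[OF this, of Re] show "2 * period_re (-4) (- k - 4) = period_re k (-4) + 4 * period_re (k + 4) 4" by (simp add: period_lm)
  have "2 * period 4 (- k) = period k (-4) - 4 * period (k + 4) 4"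
    unfolding h[OF assms(4), symmetric] eta_quot_landen'[OF Ie] using i by (simp add: period_def axis_integral_def left_diff_distrib mult.assoc)
  from arg_cong[OF this, of Re] show "2 * period_re 4 (- k) = period_re k (-4) - 4 * period_re (k + 4) 4" by (simp add: period_lm)
qed

section \<open>Solving the relations\<close>

lemma zeta_re_im: "zeta_re n = cos (pi * of_int n / 24)" "zeta_im n = sin (pi * of_int n / 24)"
  by (simp_all add: zeta_re_def zeta_im_def zeta_powi)

lemma zeta_re_im_shift:
  "zeta_re (- n) = zeta_re n" "zeta_im (- n) = - zeta_im n" "zeta_re (12 - n) = zeta_im n" "zeta_im (12 - n) = zeta_re n"
  "zeta_re (24 + n) = - zeta_re n" "zeta_im (24 + n) = - zeta_im n"
proof -
  show "zeta_re (- n) = zeta_re n" "zeta_im (- n) = - zeta_im n" by (simp_all add: zeta_re_im)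
  have 1: "pi * of_int (12 - n) / 24 = pi / 2 - pi * of_int n / 24" by (simp add: field_simps)
  show "zeta_re (12 - n) = zeta_im n" "zeta_im (12 - n) = zeta_re n" unfolding zeta_re_im 1 by (simp_all add: cos_diff sin_diff)
  have 2: "pi * of_int (24 + n) / 24 = pi + pi * of_int n / 24" by (simp add: field_simps)
  show "zeta_re (24 + n) = - zeta_re n" "zeta_im (24 + n) = - zeta_im n" unfolding zeta_re_im 2 by simp_all
qed

lemma zeta_re_im_pythagoras: "(zeta_re n)^2 + (zeta_im n)^2 = 1"
  by (simp add: zeta_re_im)

lemma zeta_re_im_double: "zeta_re (2 * n) = 2 * (zeta_re n)^2 - 1" "zeta_im (2 * n) = 2 * zeta_im n * zeta_re n"
proof -
  have "pi * of_int (2 * n) / 24 = 2 * (pi * of_int n / 24)" by simp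
  then show "zeta_re (2 * n) = 2 * (zeta_re n)^2 - 1" "zeta_im (2 * n) = 2 * zeta_im n * zeta_re n"
    unfolding zeta_re_im by (simp_all only: cos_double_cos sin_double)
qed

lemma zeta_re_im_basic: "zeta_re 0 = 1" "zeta_im 0 = 0" "zeta_re 4 = sqrt 3 / 2" "zeta_im 4 = 1 / 2" "zeta_re 6 = sqrt 2 / 2" "zeta_im 6 = sqrt 2 / 2" "zeta_re 8 = 1 / 2" "zeta_im 8 = sqrt 3 / 2"
proof -
  have e: "pi * of_int 4 / 24 = pi / 6" "pi * of_int 6 / 24 = pi / 4" "pi * of_int 8 / 24 = pi / 3" by simp_all
  show "zeta_re 0 = 1" "zeta_im 0 = 0" by (simp_all add: zeta_re_im)
  show "zeta_re 4 = sqrt 3 / 2" "zeta_im 4 = 1 / 2" "zeta_re 6 = sqrt 2 / 2" "zeta_im 6 = sqrt 2 / 2" "zeta_re 8 = 1 / 2" "zeta_im 8 = sqrt 3 / 2"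
    unfolding zeta_re_im e by (simp_all add: cos_30 sin_30 cos_45 sin_45 cos_60 sin_60)
qed

definition cos_pi8 :: real where "cos_pi8 = zeta_re 3"

definition sin_pi8 :: real where "sin_pi8 = zeta_im 3"

lemma pi8_values: "cos_pi8 > 0" "sin_pi8 > 0" "cos_pi8^2 = (2 + sqrt 2) / 4" "sin_pi8^2 = (2 - sqrt 2) / 4" "sin_pi8 * cos_pi8 = sqrt 2 / 4" "cos_pi8 = (1 + sqrt 2) * sin_pi8"
proof -
  show S0: "sin_pi8 > 0" unfolding sin_pi8_def zeta_re_im by (intro sin_gt_zero) auto
  show "cos_pi8 > 0" unfolding cos_pi8_def zeta_re_im by (intro cos_gt_zero) auto
  show C2: "cos_pi8^2 = (2 + sqrt 2) / 4" using zeta_re_im_double(1)[of 3] zeta_re_im_basic(5) by (simp add: cos_pi8_def field_simps)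
  show S2: "sin_pi8^2 = (2 - sqrt 2) / 4" using C2 zeta_re_im_pythagoras[of 3] by (simp add: cos_pi8_def sin_pi8_def field_simps)
  show pi8_values: "sin_pi8 * cos_pi8 = sqrt 2 / 4" using zeta_re_im_double(2)[of 3] zeta_re_im_basic(6) by (simp add: cos_pi8_def sin_pi8_def)
  have "sin_pi8 * ((1 + sqrt 2) * sin_pi8) = (1 + sqrt 2) * sin_pi8^2" by (simp add: power2_eq_square)
  also have "\<dots> = sin_pi8 * cos_pi8" unfolding pi8_values S2 by (simp add: algebra_simps)
  finally have "sin_pi8 * ((1 + sqrt 2) * sin_pi8) = sin_pi8 * cos_pi8" .
  then show "cos_pi8 = (1 + sqrt 2) * sin_pi8" using S0 by simp
qed

lemma zeta_re_im_table: "zeta_re 3 = cos_pi8" "zeta_im 3 = sin_pi8" "zeta_re (-3) = cos_pi8" "zeta_im (-3) = - sin_pi8" "zeta_re 9 = sin_pi8" "zeta_im 9 = cos_pi8" "zeta_re (-9) = sin_pi8" "zeta_im (-9) = - cos_pi8"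
  "zeta_re (-15) = - sin_pi8" "zeta_re 27 = - cos_pi8" "zeta_im 27 = - sin_pi8" "zeta_re (-27) = - cos_pi8" "zeta_im (-27) = sin_pi8" "zeta_re 39 = sin_pi8"
  "zeta_re (-6) = sqrt 2 / 2" "zeta_im (-6) = - (sqrt 2 / 2)" "zeta_re (-8) = 1 / 2" "zeta_im (-8) = - (sqrt 3 / 2)"
  "zeta_re (-2) = zeta_re 2" "zeta_im (-2) = - zeta_im 2" "zeta_re (-10) = zeta_im 2" "zeta_im (-10) = - zeta_re 2"
  using zeta_re_im_shift(1,2)[of 3] zeta_re_im_shift(3,4)[of 3] zeta_re_im_shift(1,2)[of 9] zeta_re_im_shift(5)[of "- 9"] zeta_re_im_shift(1)[of 15]
    zeta_re_im_shift(5,6)[of 3] zeta_re_im_shift(1,2)[of 27] zeta_re_im_shift(5)[of 15] zeta_re_im_shift(1,2)[of 6] zeta_re_im_shift(1,2)[of 8]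
    zeta_re_im_shift(1,2)[of 2] zeta_re_im_shift(1,2)[of 10] zeta_re_im_shift(3,4)[of 2] zeta_re_im_basic
  by (simp_all add: cos_pi8_def sin_pi8_def)

lemma root2_table: "root2 0 = 1" "root2 1 = sqrt 2" "root2 2 = 2" "root2 3 = 2 * sqrt 2" "root2 4 = 4" "root2 5 = 4 * sqrt 2" "root2 6 = 8"
  "root2 (-1) = sqrt 2 / 2" "root2 (-2) = 1 / 2" "root2 (-3) = sqrt 2 / 4" "root2 (-5) = sqrt 2 / 8" "root2 (-6) = 1 / 8"
proof -
  have s: "sqrt 2 * (sqrt 2 * x) = 2 * x" for x :: real by (simp add: mult.assoc[symmetric])
  show p: "root2 0 = 1" "root2 1 = sqrt 2" "root2 2 = 2" "root2 3 = 2 * sqrt 2" "root2 4 = 4" "root2 5 = 4 * sqrt 2" "root2 6 = 8"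
    by (simp_all add: root2_def numeral_eq_Suc s)
  have i: "inverse (sqrt 2) = sqrt 2 / 2" by (simp add: field_simps)
  have m: "root2 (- n) = inverse (root2 n)" for n by (simp add: root2_def power_int_minus)
  show "root2 (-1) = sqrt 2 / 2" "root2 (-2) = 1 / 2" "root2 (-3) = sqrt 2 / 4" "root2 (-5) = sqrt 2 / 8" "root2 (-6) = 1 / 8"
    using m[of 1] m[of 2] m[of 3] m[of 5] m[of 6] p i by simp_all
qed

lemmas coefficient_tables = zeta_re_im_table zeta_re_im_basic root2_table

text \<open>All periods of the first pair of forms in terms of two of them. The triangle relations alone
  connect \<open>(3, -3)\<close> and \<open>(-3, 3)\<close> with their own orbit only; the Hecke operator at
  3 connects them with the orbit of \<open>(1, -1)\<close>.\<close>

lemma periods_by_hecke: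
  "period_re (-3) (-6) = 8 * sin_pi8 * period_re (-3) 3"
  "period_re 3 6 = sin_pi8 * period_re 3 (-3) / 8"
  "period_re 1 2 = cos_pi8 * period_re 1 (-1) / 2"
  "period_re (-1) (-2) = 2 * cos_pi8 * period_re (-1) 1"
  "period_re 1 (-1) = (sqrt 2 - 1) * (8 * sqrt 2 * period_re (-3) 3 - period_re 3 (-3)) / 6"
  "period_re (-1) 1 = (sqrt 2 - 1) * (2 * period_re (-3) 3 + sqrt 2 * period_re 3 (-3) / 4) / 3"
proof -
  define b1 b7 b3 b5 x y A1 A7 where "b1 = period_re 3 (-3)" and "b7 = period_re (-3) 3" and "b3 = period_re 1 (-1)" and "b5 = period_re (-1) 1"
    and "x = period_re 6 3" and "y = period_re (-6) (-3)" and "A1 = period_re (-3) (-6)" and "A7 = period_re 3 6"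
  note d = b1_def[symmetric] b7_def[symmetric] b3_def[symmetric] b5_def[symmetric] x_def[symmetric] y_def[symmetric] A1_def[symmetric] A7_def[symmetric]
  have 1: "A1 - cos_pi8 * b1 = 2 * sqrt 2 * x" "sin_pi8 * b1 = 8 * A7"
    using triangle_real[of 3 "-3"] by (simp_all add: cuspidal_def coefficient_tables d)
  have 2: "A7 + cos_pi8 * b7 = sqrt 2 / 4 * y" "sin_pi8 * b7 = A1 / 8"
    using triangle_real[of "-3" 3] by (simp_all add: cuspidal_def coefficient_tables d)
  have 3: "cos_pi8 * b3 = 2 * period_re 1 2" using triangle_real(2)[of 1 "-1"] by (simp add: cuspidal_def coefficient_tables d)
  have 4: "cos_pi8 * b5 = period_re (-1) (-2) / 2" using triangle_real(2)[of "-1" 1] by (simp add: cuspidal_def coefficient_tables d)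
  have cu: "cuspidal 3 (-3)" "cuspidal (-3) 3" by (simp_all add: cuspidal_def)
  have "-36 * b3 = - 6 * b1 + 6 * Re (zeta powi (-18) * thirds_period 3 (-3))"
    using hecke_period[of 1 "-1" "-36" 0 "-18"] hecke3_eq[of 1 "-1" "-36"] cu by (simp add: hecke_sign_def d)
  moreover have "Re (zeta powi (-18) * thirds_period 3 (-3)) = - (sin_pi8 * A1) - 2 * sqrt 2 * (3 * (sin_pi8 * x) - cos_pi8 * (2 * sqrt 2 * A7))"
    unfolding thirds_period_real[OF cu(1)] by (simp add: coefficient_tables d)
  ultimately have 5: "-36 * b3 = - 6 * b1 + 6 * (- (sin_pi8 * A1) - 2 * sqrt 2 * (3 * (sin_pi8 * x) - cos_pi8 * (2 * sqrt 2 * A7)))"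
    by (simp only:)
  have "9 * b5 = - 6 * b7 + 6 * Re (zeta powi 18 * thirds_period (-3) 3)"
    using hecke_period[of "-1" 1 9 3 18] hecke3_eq[of "-1" 1 9] cu by (simp add: hecke_sign_def d)
  moreover have "Re (zeta powi 18 * thirds_period (-3) 3) = sin_pi8 * A7 - sqrt 2 / 4 * (- (3 * (sin_pi8 * y)) - cos_pi8 * (sqrt 2 / 4 * A1))"
    unfolding thirds_period_real[OF cu(2)] by (simp add: coefficient_tables d)
  ultimately have 6: "9 * b5 = - 6 * b7 + 6 * (sin_pi8 * A7 - sqrt 2 / 4 * (- (3 * (sin_pi8 * y)) - cos_pi8 * (sqrt 2 / 4 * A1)))"
    by (simp only:)
  have A: "A1 = 8 * sin_pi8 * b7" "A7 = sin_pi8 * b1 / 8" using 1(2) 2(2) by simp_all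
  have r2: "sqrt 2 * sqrt 2 = (2::real)" by simp
  have S2: "sin_pi8 * sin_pi8 = (2 - sqrt 2) / 4" using pi8_values(4) by (simp add: power2_eq_square)
  have sq: "sqrt 2 * (sqrt 2 * z) = 2 * z" for z :: real by (simp add: mult.assoc[symmetric])
  \<comment> \<open>the auxiliary values \<open>x\<close>, \<open>y\<close> occur in exactly the combination that the triangle relations supply\<close>
  have B: "b3 = (sqrt 2 - 1) * (8 * sqrt 2 * b7 - b1) / 6"
  proof -
    have "-36 * b3 = - 6 * b1 + 6 * (- (sin_pi8 * A1) - 3 * sin_pi8 * (2 * sqrt 2 * x) + 8 * cos_pi8 * A7)"
      using 5 by (simp add: algebra_simps sq)
    also have "\<dots> = - 6 * b1 + 6 * (- 32 * (sin_pi8 * sin_pi8) * b7 + 4 * (sin_pi8 * cos_pi8) * b1)"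
      unfolding 1(1)[symmetric] A by (simp add: algebra_simps)
    finally have "-36 * b3 = - 6 * b1 + 6 * (- 8 * (2 - sqrt 2) * b7 + sqrt 2 * b1)" unfolding S2 pi8_values(5) by simp
    then have "6 * b3 = (sqrt 2 - 1) * (8 * sqrt 2 * b7 - b1)" by (simp add: algebra_simps sq)
    then show ?thesis by simp
  qed
  have C: "b5 = (sqrt 2 - 1) * (2 * b7 + sqrt 2 * b1 / 4) / 3"
  proof -
    have "9 * b5 = - 6 * b7 + 6 * (sin_pi8 * A7 + 3 * sin_pi8 * (sqrt 2 / 4 * y) + cos_pi8 * A1 / 8)"
      using 6 by (simp add: algebra_simps sq)
    also have "\<dots> = - 6 * b7 + 6 * ((sin_pi8 * sin_pi8) * b1 / 2 + 4 * (sin_pi8 * cos_pi8) * b7)"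
      unfolding 2(1)[symmetric] A by (simp add: algebra_simps)
    finally have "9 * b5 = - 6 * b7 + 6 * ((2 - sqrt 2) / 8 * b1 + sqrt 2 * b7)" unfolding S2 pi8_values(5) by simp
    then have "3 * b5 = (sqrt 2 - 1) * (2 * b7 + sqrt 2 * b1 / 4)" by (simp add: field_simps sq)
    then show ?thesis by simp
  qed
  show "period_re (-3) (-6) = 8 * sin_pi8 * period_re (-3) 3" "period_re 3 6 = sin_pi8 * period_re 3 (-3) / 8" "period_re 1 2 = cos_pi8 * period_re 1 (-1) / 2" "period_re (-1) (-2) = 2 * cos_pi8 * period_re (-1) 1"
    unfolding d using A 3 4 by simp_all
  show "period_re 1 (-1) = (sqrt 2 - 1) * (8 * sqrt 2 * period_re (-3) 3 - period_re 3 (-3)) / 6"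
    "period_re (-1) 1 = (sqrt 2 - 1) * (2 * period_re (-3) 3 + sqrt 2 * period_re 3 (-3) / 4) / 3"
    unfolding d by (rule B, rule C)
qed

text \<open>Four triangle relations together with the Landen relations for \<open>k = 1\<close> and \<open>k
  = -5\<close> express eight periods by two.\<close>

lemma periods_by_landen_8:
  "period_re (-5) (-4) = period_re 1 (-4) / 2 + sqrt 2 * period_re 5 4"
  "period_re (-1) 4 = sqrt 2 * period_re 1 (-4) / 16 + period_re 5 4 / 2"
  "cos_pi8 * period_re (-1) (-5) = 4 * period_re 5 4 + sqrt 2 * period_re 1 (-4) / 2"
  "period_re 5 1 = 2 * sqrt 2 * cos_pi8 * period_re 5 4"
  "period_re (-5) (-1) = sqrt 2 * cos_pi8 * period_re (-5) (-4)"
  "period_re 1 5 = sqrt 2 * sin_pi8 * period_re 1 (-4) / 8"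
proof -
  define P1 P2 P3 P4 where "P1 = period_re 1 (-4)" and "P2 = period_re (-5) (-4)" and "P3 = period_re 5 4" and "P4 = period_re (-1) 4"
  define Q1 Q2 Q3 Q4 where "Q1 = period_re (-1) (-5)" and "Q2 = period_re 5 1" and "Q3 = period_re (-5) (-1)" and "Q4 = period_re 1 5"
  note d = P1_def[symmetric] P2_def[symmetric] P3_def[symmetric] P4_def[symmetric] Q1_def[symmetric] Q2_def[symmetric] Q3_def[symmetric] Q4_def[symmetric]
  have r: "2 * period_re (-4) (-5) = P1 + 4 * P3" "2 * period_re 4 (-1) = P1 - 4 * P3"
    using period_landen[of 1] by (simp_all add: cuspidal_def d)
  have p: "2 * period_re (-4) 1 = P2 + 4 * P4" "2 * period_re 4 5 = P2 - 4 * P4"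
    using period_landen[of "-5"] by (simp_all add: cuspidal_def d)
  have 1: "sin_pi8 * period_re 4 (-1) + sin_pi8 * period_re (-4) (-5) = 4 * sqrt 2 * Q4" "cos_pi8 * period_re (-4) (-5) - cos_pi8 * period_re 4 (-1) = sqrt 2 * Q2"
    using triangle_real[of "-4" "-5"] by (simp_all add: cuspidal_def coefficient_tables d)
  have 2: "sin_pi8 * Q2 + sqrt 2 / 2 * P2 = 4 * P4" "sqrt 2 / 2 * P2 - cos_pi8 * Q2 = sqrt 2 / 2 * period_re 4 (-1)"
    using triangle_real[of "-5" "-4"] by (simp_all add: cuspidal_def coefficient_tables d)
  have 3: "cos_pi8 * Q1 - sqrt 2 / 2 * P1 = 4 * P3"
    using triangle_real(1)[of 1 "-4"] by (simp add: cuspidal_def coefficient_tables d)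
  have 4: "cos_pi8 * period_re 4 5 + cos_pi8 * period_re (-4) 1 = sqrt 2 / 2 * Q3"
    using triangle_real(1)[of "-4" 1] by (simp add: cuspidal_def coefficient_tables d)
  have sq: "sqrt 2 * (sqrt 2 * z) = 2 * z" for z :: real by (simp add: mult.assoc[symmetric])
  have Q4: "Q4 = sqrt 2 * sin_pi8 * P1 / 8"
  proof -
    have "2 * (4 * sqrt 2 * Q4) = sin_pi8 * (2 * period_re 4 (-1) + 2 * period_re (-4) (-5))" using 1(1) by (simp add: algebra_simps)
    also have "\<dots> = 2 * sin_pi8 * P1" unfolding r by (simp add: algebra_simps)
    finally have "4 * (sqrt 2 * Q4) = sin_pi8 * P1" by (simp add: mult.commute mult.left_commute)
    then have "sqrt 2 * (4 * (sqrt 2 * Q4)) = sqrt 2 * (sin_pi8 * P1)" by (simp only:)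
    then have "4 * (sqrt 2 * (sqrt 2 * Q4)) = sqrt 2 * sin_pi8 * P1" by (simp only: mult_ac)
    then show ?thesis unfolding sq by simp
  qed
  have Q2: "Q2 = 2 * sqrt 2 * cos_pi8 * P3"
  proof -
    have "2 * (sqrt 2 * Q2) = cos_pi8 * (2 * period_re (-4) (-5) - 2 * period_re 4 (-1))" using 1(2) by (simp add: algebra_simps)
    also have "\<dots> = 8 * cos_pi8 * P3" unfolding r by (simp add: algebra_simps)
    finally have "sqrt 2 * Q2 = 4 * (cos_pi8 * P3)" by (simp add: mult.commute mult.left_commute)
    then have "sqrt 2 * (sqrt 2 * Q2) = sqrt 2 * (4 * (cos_pi8 * P3))" by (simp only:)
    then show ?thesis unfolding sq by simp
  qed
  have P2: "P2 = P1 / 2 + sqrt 2 * P3"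
  proof -
    have "sqrt 2 * (sqrt 2 / 2 * P2 - cos_pi8 * Q2) = sqrt 2 * (sqrt 2 / 2 * period_re 4 (-1))" unfolding 2(2) ..
    then have "2 * P2 - 2 * (sqrt 2 * cos_pi8 * Q2) = 2 * period_re 4 (-1)" by (simp add: algebra_simps sq)
    moreover have "sqrt 2 * cos_pi8 * Q2 = 4 * cos_pi8^2 * P3" unfolding Q2 by (simp add: power2_eq_square sq algebra_simps)
    ultimately show ?thesis unfolding r pi8_values(3) by (simp add: algebra_simps)
  qed
  have P4: "P4 = sqrt 2 * P1 / 16 + P3 / 2"
  proof -
    have "sin_pi8 * Q2 = 2 * sqrt 2 * (sin_pi8 * cos_pi8) * P3" unfolding Q2 by simp
    also have "\<dots> = P3" unfolding pi8_values(5) by (simp add: sq algebra_simps)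
    finally have "4 * P4 = P3 + sqrt 2 / 2 * P2" using 2(1) by simp
    then show ?thesis unfolding P2 by (simp add: algebra_simps sq)
  qed
  have Q3: "Q3 = sqrt 2 * cos_pi8 * P2"
  proof -
    have "2 * (sqrt 2 / 2 * Q3) = cos_pi8 * (2 * period_re 4 5 + 2 * period_re (-4) 1)" using 4 by (simp add: algebra_simps)
    also have "\<dots> = 2 * cos_pi8 * P2" unfolding p by (simp add: algebra_simps)
    finally have "sqrt 2 * Q3 = 2 * cos_pi8 * P2" by (simp add: mult.commute mult.left_commute)
    then have "sqrt 2 * (sqrt 2 * Q3) = sqrt 2 * (2 * cos_pi8 * P2)" by (simp only:)
    then show ?thesis unfolding sq by simp
  qed
  show "period_re (-5) (-4) = period_re 1 (-4) / 2 + sqrt 2 * period_re 5 4" "period_re (-1) 4 = sqrt 2 * period_re 1 (-4) / 16 + period_re 5 4 / 2"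
    "cos_pi8 * period_re (-1) (-5) = 4 * period_re 5 4 + sqrt 2 * period_re 1 (-4) / 2" "period_re 5 1 = 2 * sqrt 2 * cos_pi8 * period_re 5 4"
    "period_re (-5) (-1) = sqrt 2 * cos_pi8 * period_re (-5) (-4)" "period_re 1 5 = sqrt 2 * sin_pi8 * period_re 1 (-4) / 8"
    unfolding d using P2 P4 3 Q2 Q3 Q4 by simp_all
qed

lemma pi12_values: "zeta_re 2 = (sqrt 6 + sqrt 2) / 4" "zeta_im 2 = (sqrt 6 - sqrt 2) / 4"
proof -
  have e: "pi * of_int 2 / 24 = pi / 3 - pi / 4" by simp
  have "sqrt 6 = sqrt 3 * sqrt 2" by (simp add: real_sqrt_mult[symmetric])
  then show "zeta_re 2 = (sqrt 6 + sqrt 2) / 4" "zeta_im 2 = (sqrt 6 - sqrt 2) / 4"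
    unfolding zeta_re_im e cos_diff sin_diff cos_60 sin_60 cos_45 sin_45 by (simp_all add: field_simps)
qed

text \<open>The same elimination with the Landen relations for \<open>k = 2\<close> and \<open>k =
  -6\<close>; the angle \<open>pi / 12\<close> takes the place of \<open>pi / 8\<close>.\<close>

lemma periods_by_landen_12:
  "period_re (-6) (-4) = period_re 2 (-4) / 2 + sqrt 3 * period_re 6 4"
  "period_re (-2) 4 = sqrt 3 * period_re 2 (-4) / 16 + period_re 6 4 / 2"
  "zeta_re 2 * period_re (-2) (-6) = 4 * period_re 6 4 + sqrt 3 * period_re 2 (-4) / 2"
  "period_re 6 2 = 2 * zeta_re 2 * period_re 6 4"
  "period_re (-6) (-2) = 2 * zeta_re 2 * period_re (-6) (-4)"
  "period_re 2 6 = zeta_im 2 * period_re 2 (-4) / 8"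
proof -
  define P1 P2 P3 P4 where "P1 = period_re 2 (-4)" and "P2 = period_re (-6) (-4)" and "P3 = period_re 6 4" and "P4 = period_re (-2) 4"
  define Q1 Q2 Q3 Q4 where "Q1 = period_re (-2) (-6)" and "Q2 = period_re 6 2" and "Q3 = period_re (-6) (-2)" and "Q4 = period_re 2 6"
  note d = P1_def[symmetric] P2_def[symmetric] P3_def[symmetric] P4_def[symmetric] Q1_def[symmetric] Q2_def[symmetric] Q3_def[symmetric] Q4_def[symmetric]
  have c2: "4 * (zeta_re 2)^2 = 2 + sqrt 3" using zeta_re_im_double(1)[of 2] zeta_re_im_basic(3) by simp
  have sc: "4 * (zeta_im 2 * zeta_re 2) = 1" using zeta_re_im_double(2)[of 2] zeta_re_im_basic(4) by simp
  have r: "2 * period_re (-4) (-6) = P1 + 4 * P3" "2 * period_re 4 (-2) = P1 - 4 * P3"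
    using period_landen[of 2] by (simp_all add: cuspidal_def d)
  have p: "2 * period_re (-4) 2 = P2 + 4 * P4" "2 * period_re 4 6 = P2 - 4 * P4"
    using period_landen[of "-6"] by (simp_all add: cuspidal_def d)
  have 1: "zeta_im 2 * period_re 4 (-2) + zeta_im 2 * period_re (-4) (-6) = 8 * Q4" "zeta_re 2 * period_re (-4) (-6) - zeta_re 2 * period_re 4 (-2) = 2 * Q2"
    using triangle_real[of "-4" "-6"] by (simp_all add: cuspidal_def coefficient_tables d)
  have 2: "zeta_im 2 * Q2 + sqrt 3 / 2 * P2 = 4 * P4" "P2 / 2 - zeta_re 2 * Q2 = period_re 4 (-2) / 2"
    using triangle_real[of "-6" "-4"] by (simp_all add: cuspidal_def coefficient_tables d)
  have 3: "zeta_re 2 * Q1 - sqrt 3 / 2 * P1 = 4 * P3"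
    using triangle_real(1)[of 2 "-4"] by (simp add: cuspidal_def coefficient_tables d)
  have 4: "zeta_re 2 * period_re 4 6 + zeta_re 2 * period_re (-4) 2 = Q3 / 2"
    using triangle_real(1)[of "-4" 2] by (simp add: cuspidal_def coefficient_tables d)
  have sq: "sqrt 3 * (sqrt 3 * z) = 3 * z" for z :: real by (simp add: mult.assoc[symmetric])
  have Q4: "Q4 = zeta_im 2 * P1 / 8"
  proof -
    have "2 * (8 * Q4) = zeta_im 2 * (2 * period_re 4 (-2) + 2 * period_re (-4) (-6))" using 1(1) by (simp add: algebra_simps)
    also have "\<dots> = 2 * zeta_im 2 * P1" unfolding r by (simp add: algebra_simps)
    finally show ?thesis by (simp add: mult_ac)
  qed
  have Q2: "Q2 = 2 * zeta_re 2 * P3"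
  proof -
    have "2 * (2 * Q2) = zeta_re 2 * (2 * period_re (-4) (-6) - 2 * period_re 4 (-2))" using 1(2) by (simp add: algebra_simps)
    also have "\<dots> = 8 * zeta_re 2 * P3" unfolding r by (simp add: algebra_simps)
    finally show ?thesis by simp
  qed
  have P2: "P2 = P1 / 2 + sqrt 3 * P3"
  proof -
    have "zeta_re 2 * Q2 * 2 = 4 * (zeta_re 2)^2 * P3" unfolding Q2 by (simp add: power2_eq_square)
    then have "P2 * 2 - 2 * (2 + sqrt 3) * P3 = 2 * period_re 4 (-2)" using 2(2) unfolding c2 by (simp add: field_simps)
    then show ?thesis unfolding r by (simp add: algebra_simps)
  qed
  have P4: "P4 = sqrt 3 * P1 / 16 + P3 / 2"
  proof -
    have "2 * (zeta_im 2 * Q2) = 4 * (zeta_im 2 * zeta_re 2) * P3" unfolding Q2 by simp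
    then have "4 * P4 = P3 / 2 + sqrt 3 / 2 * P2" using 2(1) unfolding sc by simp
    then show ?thesis unfolding P2 by (simp add: algebra_simps sq)
  qed
  have Q3: "Q3 = 2 * zeta_re 2 * P2"
  proof -
    have "Q3 = zeta_re 2 * (2 * period_re 4 6 + 2 * period_re (-4) 2)" using 4 by (simp add: algebra_simps)
    also have "\<dots> = 2 * zeta_re 2 * P2" unfolding p by (simp add: algebra_simps)
    finally show ?thesis .
  qed
  show "period_re (-6) (-4) = period_re 2 (-4) / 2 + sqrt 3 * period_re 6 4" "period_re (-2) 4 = sqrt 3 * period_re 2 (-4) / 16 + period_re 6 4 / 2"
    "zeta_re 2 * period_re (-2) (-6) = 4 * period_re 6 4 + sqrt 3 * period_re 2 (-4) / 2" "period_re 6 2 = 2 * zeta_re 2 * period_re 6 4"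
    "period_re (-6) (-2) = 2 * zeta_re 2 * period_re (-6) (-4)" "period_re 2 6 = zeta_im 2 * period_re 2 (-4) / 8"
    unfolding d using P2 P4 3 Q2 Q3 Q4 by simp_all
qed

section \<open>L-values as combinations of periods\<close>

lemma mellin_admissible_cong:
  assumes h: "mellin_admissible h" and e: "\<And>\<tau>. Im \<tau> > 0 \<Longrightarrow> f \<tau> = h \<tau>"
  shows "mellin_admissible f" "axis_integral f = axis_integral h"
proof -
  have Ie: "Im (\<i> * exp (complex_of_real u)) > 0" for u by (simp add: exp_of_real)
  show "mellin_admissible f" using h unfolding mellin_admissible_def by (simp add: e e[OF Ie] cong: conj_cong)
  show "axis_integral f = axis_integral h" unfolding axis_integral_def e[OF Ie] ..
qed

text \<open>The scaling by \<open>2 * b\<close> makes all exponents of the \<open>q\<close>-expansion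
  integral; \<open>j\<close> is the first of them.\<close>

lemma mellin_admissible_eta_quot_scaled:
  assumes cu: "cuspidal a c" and b: "b > 0" and j: "int b * (12 - a + 2 * c) = 24 * int j"
  shows "mellin_admissible (\<lambda>\<tau>. eta_quot a c (of_nat (2 * b) * \<tau>))"
  unfolding mellin_admissible_def
proof (intro conjI)
  have j0: "j > 0" using j cu b by (auto simp: cuspidal_def intro: Nat.gr0I)
  define g where "g = (\<lambda>q. q ^ j * phi_quot a c (q ^ b))"
  have "(\<lambda>q. phi_quot a c (q ^ b)) holomorphic_on ball 0 1"
    by (rule holomorphic_on_compose_gen[OF _ phi_quot_holomorphic, unfolded o_def])
       (use b in \<open>auto intro!: holomorphic_intros simp: norm_power power_less_one_iff\<close>)
  then have "g holomorphic_on ball 0 1" unfolding g_def by (intro holomorphic_intros)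
  moreover have "g 0 = 0" using j0 by (simp add: g_def)
  moreover have "eta_quot a c (of_nat (2 * b) * \<tau>) = g (exp (2 * pi * \<i> * \<tau>))" for \<tau>
  proof -
    have bj: "of_nat b * of_int (12 - a + 2 * c) = (24 * of_nat j :: complex)"
      using arg_cong[OF j, of "of_int :: int \<Rightarrow> complex"] by simp
    have "\<i> * (pi * (of_nat (2 * b) * \<tau>) * of_int (12 - a + 2 * c) / 24) = (of_nat b * of_int (12 - a + 2 * c)) * (2 * pi * \<i> * \<tau>) / 24"
      by (simp del: of_int_add of_int_diff of_int_mult)
    also have "\<dots> = of_nat j * (2 * pi * \<i> * \<tau>)" unfolding bj by simp
    finally have "\<i> * (pi * (of_nat (2 * b) * \<tau>) * of_int (12 - a + 2 * c) / 24) = of_nat j * (2 * pi * \<i> * \<tau>)" .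
    moreover have "\<i> * (pi * (of_nat (2 * b) * \<tau>)) = of_nat b * (2 * pi * \<i> * \<tau>)" by simp
    ultimately show ?thesis unfolding eta_quot_FF g_def by (simp only: exp_of_nat_mult)
  qed
  ultimately show "\<exists>g. g holomorphic_on ball 0 1 \<and> g 0 = 0 \<and> (\<forall>\<tau>. Im \<tau> > 0 \<longrightarrow> eta_quot a c (of_nat (2 * b) * \<tau>) = g (exp (2 * pi * \<i> * \<tau>)))"
    by blast
next
  define N where "N = real (2 * b)"
  have N: "N \<ge> 1" using b by (simp add: N_def)
  obtain B where B: "B > 0" "\<And>\<tau>. Im \<tau> > 0 \<Longrightarrow> Im \<tau> \<le> 1 \<Longrightarrow> norm (eta_quot a c \<tau>) \<le> B / (Im \<tau>)^2"
    using eta_quot_growth[OF cu] by blast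
  obtain C k where C: "C > 0" "k > 0" "\<And>\<tau>. Im \<tau> \<ge> 1/2 \<Longrightarrow> norm (eta_quot a c \<tau>) \<le> C * exp (- k * Im \<tau>)"
    using eta_quot_decay'[OF cu] by blast
  have "norm (eta_quot a c (of_nat (2 * b) * \<tau>)) \<le> max B C / (Im \<tau>)^2" if t: "0 < Im \<tau>" "Im \<tau> \<le> 1" for \<tau>
  proof (cases "N * Im \<tau> \<le> 1")
    case True
    have "norm (eta_quot a c (of_nat (2 * b) * \<tau>)) \<le> B / (N * Im \<tau>)^2" using B(2)[of "of_nat (2*b) * \<tau>"] True t b by (simp add: N_def)
    also have "\<dots> \<le> max B C / (Im \<tau>)^2" using N t B(1) by (intro frac_le power_mono) (auto intro: mult_right_mono[of 1 N, simplified])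
    finally show ?thesis .
  next
    case False
    have "norm (eta_quot a c (of_nat (2 * b) * \<tau>)) \<le> C * exp (- k * (N * Im \<tau>))" using C(3)[of "of_nat (2*b) * \<tau>"] False by (simp add: N_def)
    also have "\<dots> \<le> C * 1" using C N t by (intro mult_left_mono) auto
    also have "\<dots> \<le> max B C / 1" by simp
    also have "\<dots> \<le> max B C / (Im \<tau>)^2" using t C(1) by (intro divide_left_mono) (auto simp: power_le_one)
    finally show ?thesis .
  qed
  then show "\<exists>B. \<forall>\<tau>. 0 < Im \<tau> \<longrightarrow> Im \<tau> \<le> 1 \<longrightarrow> norm (eta_quot a c (of_nat (2 * b) * \<tau>)) \<le> B / (Im \<tau>)^2" by blast
next
  define t where "t = ln (real (2 * b))"
  have e: "of_nat (2 * b) * (\<i> * exp (of_real u)) = \<i> * exp (complex_of_real (t + u))" for u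
    using b by (simp add: t_def exp_add exp_of_real)
  have R: "rapid_decay (\<lambda>u. eta_quot a c (\<i> * exp (of_real u)))" by (rule eta_quot_rapid[OF cu])
  show "rapid_decay (\<lambda>u. eta_quot a c (of_nat (2 * b) * (\<i> * exp (of_real u))))"
    unfolding e rapid_decay_def
  proof (intro conjI allI)
    show "continuous_on UNIV (\<lambda>u. eta_quot a c (\<i> * exp (complex_of_real (t + u))))"
      by (rule continuous_on_compose2[of UNIV "\<lambda>u. eta_quot a c (\<i> * exp (complex_of_real u))" UNIV "\<lambda>u. t + u"])
         (use R in \<open>auto simp: rapid_decay_def intro!: continuous_intros\<close>)
    fix r :: real
    obtain C where C: "\<And>u. norm (eta_quot a c (\<i> * exp (complex_of_real u))) \<le> C * exp (- \<bar>r\<bar> * \<bar>u\<bar>)" using R by (auto simp: rapid_decay_def)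
    have C0: "C \<ge> 0" using C[of 0] norm_ge_zero[of "eta_quot a c (\<i> * exp (complex_of_real 0))"] by (simp del: norm_ge_zero)
    have "norm (eta_quot a c (\<i> * exp (complex_of_real (t + u)))) \<le> (C * exp (\<bar>r\<bar> * \<bar>t\<bar>)) * exp (- r * \<bar>u\<bar>)" for u
    proof -
      have "\<bar>r\<bar> * \<bar>u\<bar> \<le> \<bar>r\<bar> * (\<bar>t + u\<bar> + \<bar>t\<bar>)" by (intro mult_left_mono) auto
      moreover have "r * \<bar>u\<bar> \<le> \<bar>r\<bar> * \<bar>u\<bar>" by (intro mult_right_mono) auto
      ultimately have "- \<bar>r\<bar> * \<bar>t + u\<bar> \<le> \<bar>r\<bar> * \<bar>t\<bar> + - r * \<bar>u\<bar>" by (simp add: distrib_left)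
      then have "C * exp (- \<bar>r\<bar> * \<bar>t + u\<bar>) \<le> C * exp (\<bar>r\<bar> * \<bar>t\<bar> + - r * \<bar>u\<bar>)" using C0 by (intro mult_left_mono) auto
      then show ?thesis using C[of "t + u"] unfolding exp_add mult.assoc by (rule order_trans[rotated])
    qed
    then show "\<exists>C. \<forall>u. norm (eta_quot a c (\<i> * exp (complex_of_real (t + u)))) \<le> C * exp (- r * \<bar>u\<bar>)" by blast
  qed
qed

text \<open>The exponents of the three eta factors are integers that sum to 6, and a complex power of a
  nonzero number with integral exponent is the algebraic power.\<close>

lemma K2_axis_integral:
  assumes cu: "cuspidal a c" and b: "b > 0" and j: "int b * (12 - a + 2 * c) = 24 * int j"
    and l: "snd (quotient_of r) = int b" and a: "16 * s - 8 * r - 12 = of_int a" and c: "8 * r + 8 * s - 12 = of_int c"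
  shows "mellin_admissible (K2 r s)" "axis_integral (K2 r s) = of_real (period_re a c) / of_nat (2 * b)"
proof -
  have "K2 r s \<tau> = eta_quot a c (of_nat (2 * b) * \<tau>)" if t: "Im \<tau> > 0" for \<tau>
  proof -
    define \<sigma> where "\<sigma> = of_nat (2 * b) * \<tau>"
    have I: "Im \<sigma> > 0" using t b by (simp add: \<sigma>_def)
    have "24 * s - 30 = of_int (a + c - 6)" using a c by simp
    then have "K2_fun r s \<sigma> = dedekind_eta (\<sigma> / 2) powi a * dedekind_eta (2 * \<sigma>) powi c / dedekind_eta \<sigma> powi (a + c - 6)"
      unfolding K2_fun_def a c using I by (simp add: complex_powr_of_int eta_nonzero del: of_int_diff of_int_add)
    moreover have "dedekind_eta \<sigma> powi (6 - a - c) = inverse (dedekind_eta \<sigma> powi (a + c - 6))"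
      unfolding power_int_minus[symmetric] by (rule arg_cong[where f = "\<lambda>k. dedekind_eta \<sigma> powi k"]) simp
    ultimately have "K2_fun r s \<sigma> = eta_quot a c \<sigma>" by (simp add: eta_quot_def field_simps)
    then show ?thesis by (simp add: K2_def K2_level_def l \<sigma>_def)
  qed
  note e = this
  show "mellin_admissible (K2 r s)" by (rule mellin_admissible_cong[OF mellin_admissible_eta_quot_scaled[OF cu b j] e])
  have "axis_integral (K2 r s) = axis_integral (\<lambda>\<tau>. eta_quot a c (of_nat (2 * b) * \<tau>))" by (rule mellin_admissible_cong[OF mellin_admissible_eta_quot_scaled[OF cu b j] e])
  also have "\<dots> = period a c / of_nat (2 * b)"
    using axis_integral_scale(2)[of "real (2 * b)" "eta_quot a c"] period_integrable[OF cu] b by (simp add: period_def)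
  finally show "axis_integral (K2 r s) = of_real (period_re a c) / of_nat (2 * b)" by (simp add: period_lm)
qed

lemma L_function_four_terms:
  assumes "mellin_admissible h1" "mellin_admissible h2" "mellin_admissible h3" "mellin_admissible h4"
    and f: "f = (\<lambda>\<tau>. c1 * h1 \<tau> + c2 * h2 \<tau> + c3 * h3 \<tau> + c4 * h4 \<tau>)"
  shows "L_function f 1 = 2 * pi * (c1 * axis_integral h1 + c2 * axis_integral h2 + c3 * axis_integral h3 + c4 * axis_integral h4)"
proof -
  define k1 where "k1 = (\<lambda>\<tau>. c1 * h1 \<tau> + c2 * h2 \<tau>)"
  define k2 where "k2 = (\<lambda>\<tau>. 1 * k1 \<tau> + c3 * h3 \<tau>)"
  have f': "f = (\<lambda>\<tau>. 1 * k2 \<tau> + c4 * h4 \<tau>)" by (simp add: f k1_def k2_def)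
  have 1: "mellin_admissible k1" "axis_integral k1 = c1 * axis_integral h1 + c2 * axis_integral h2" unfolding k1_def using assms by (auto intro: mellin_admissible_linear axis_integral_linear)
  have 2: "mellin_admissible k2" "axis_integral k2 = 1 * axis_integral k1 + c3 * axis_integral h3" unfolding k2_def using mellin_admissible_linear[OF 1(1) assms(3), of 1 c3] axis_integral_linear[OF 1(1) assms(3), of 1 c3] by simp_all
  have 3: "mellin_admissible f" "axis_integral f = 1 * axis_integral k2 + c4 * axis_integral h4" unfolding f' using assms 2 by (blast intro: mellin_admissible_linear axis_integral_linear)+
  show ?thesis using L_function_value[OF 3(1)] 1 2 3 by simp
qed

lemma denominators: "snd (quotient_of (1/8)) = 8" "snd (quotient_of (3/8)) = 8" "snd (quotient_of (5/8)) = 8" "snd (quotient_of (7/8)) = 8"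
  "snd (quotient_of (1/12)) = 12" "snd (quotient_of (5/12)) = 12" "snd (quotient_of (7/12)) = 12" "snd (quotient_of (11/12)) = 12"
  by (simp_all add: rat_divide_code Rat.normalize_def Let_def gcd_non_0_int)

lemma L_f_1_8_5_8: "L_function f_1_8_5_8 1 = pi / 8 * (period_re (-3) (-6) - 2 * sqrt 3 * period_re (-1) (-2) - 4 * (\<i> * sqrt 3) * period_re 1 2 - 8 * \<i> * period_re 3 6)"
proof -
  note K = K2_axis_integral[of "-3" "-6" 8 1 "1/8" "5/8"] K2_axis_integral[of "-1" "-2" 8 3 "3/8" "7/8"] K2_axis_integral[of 1 2 8 5 "5/8" "9/8"] K2_axis_integral[of 3 6 8 7 "7/8" "11/8"]
  have G: "mellin_admissible (K2 (1/8) (5/8))" "mellin_admissible (K2 (3/8) (7/8))" "mellin_admissible (K2 (5/8) (9/8))" "mellin_admissible (K2 (7/8) (11/8))"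
    and P: "axis_integral (K2 (1/8) (5/8)) = of_real (period_re (-3) (-6)) / 16" "axis_integral (K2 (3/8) (7/8)) = of_real (period_re (-1) (-2)) / 16" "axis_integral (K2 (5/8) (9/8)) = of_real (period_re 1 2) / 16" "axis_integral (K2 (7/8) (11/8)) = of_real (period_re 3 6) / 16"
    using K by (simp_all add: denominators cuspidal_def)
  have f: "f_1_8_5_8 = (\<lambda>\<tau>. 1 * K2 (1/8) (5/8) \<tau> + (- (2 * sqrt 3)) * K2 (3/8) (7/8) \<tau> + (- (4 * (\<i> * sqrt 3))) * K2 (5/8) (9/8) \<tau> + (- (8 * \<i>)) * K2 (7/8) (11/8) \<tau>)"
    by (simp add: f_1_8_5_8_def fun_eq_iff)
  show ?thesis unfolding L_function_four_terms[OF G f] P by (simp add: field_simps)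
qed

lemma L_f_1_8_1: "L_function f_1_8_1 1 = pi / 8 * (period_re 3 (-3) - 2 * (\<i> * sqrt 3) * period_re 1 (-1) - 4 * sqrt 3 * period_re (-1) 1 + 8 * \<i> * period_re (-3) 3)"
proof -
  note K = K2_axis_integral[of 3 "-3" 8 1 "1/8" 1] K2_axis_integral[of 1 "-1" 8 3 "3/8" 1] K2_axis_integral[of "-1" 1 8 5 "5/8" 1] K2_axis_integral[of "-3" 3 8 7 "7/8" 1]
  have G: "mellin_admissible (K2 (1/8) 1)" "mellin_admissible (K2 (3/8) 1)" "mellin_admissible (K2 (5/8) 1)" "mellin_admissible (K2 (7/8) 1)"
    and P: "axis_integral (K2 (1/8) 1) = of_real (period_re 3 (-3)) / 16" "axis_integral (K2 (3/8) 1) = of_real (period_re 1 (-1)) / 16" "axis_integral (K2 (5/8) 1) = of_real (period_re (-1) 1) / 16" "axis_integral (K2 (7/8) 1) = of_real (period_re (-3) 3) / 16"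
    using K by (simp_all add: denominators cuspidal_def)
  have f: "f_1_8_1 = (\<lambda>\<tau>. 1 * K2 (1/8) 1 \<tau> + (- (2 * (\<i> * sqrt 3))) * K2 (3/8) 1 \<tau> + (- (4 * sqrt 3)) * K2 (5/8) 1 \<tau> + (8 * \<i>) * K2 (7/8) 1 \<tau>)"
    by (simp add: f_1_8_1_def fun_eq_iff)
  show ?thesis unfolding L_function_four_terms[OF G f] P by (simp add: field_simps)
qed

lemma L_f_1_8_7_8: "L_function f_1_8_7_8 1 = pi / 8 * (period_re 1 (-4) + 2 * sqrt 2 * period_re (-5) (-4) + 4 * \<i> * period_re 5 4 + 8 * (\<i> * sqrt 2) * period_re (-1) 4)"
proof -
  note K = K2_axis_integral[of 1 "-4" 8 1 "1/8" "7/8"] K2_axis_integral[of "-5" "-4" 8 3 "3/8" "5/8"] K2_axis_integral[of 5 4 8 5 "5/8" "11/8"] K2_axis_integral[of "-1" 4 8 7 "7/8" "9/8"]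
  have G: "mellin_admissible (K2 (1/8) (7/8))" "mellin_admissible (K2 (3/8) (5/8))" "mellin_admissible (K2 (5/8) (11/8))" "mellin_admissible (K2 (7/8) (9/8))"
    and P: "axis_integral (K2 (1/8) (7/8)) = of_real (period_re 1 (-4)) / 16" "axis_integral (K2 (3/8) (5/8)) = of_real (period_re (-5) (-4)) / 16" "axis_integral (K2 (5/8) (11/8)) = of_real (period_re 5 4) / 16" "axis_integral (K2 (7/8) (9/8)) = of_real (period_re (-1) 4) / 16"
    using K by (simp_all add: denominators cuspidal_def)
  have f: "f_1_8_7_8 = (\<lambda>\<tau>. 1 * K2 (1/8) (7/8) \<tau> + (2 * sqrt 2) * K2 (3/8) (5/8) \<tau> + (4 * \<i>) * K2 (5/8) (11/8) \<tau> + (8 * (\<i> * sqrt 2)) * K2 (7/8) (9/8) \<tau>)"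
    by (simp add: f_1_8_7_8_def fun_eq_iff)
  show ?thesis unfolding L_function_four_terms[OF G f] P by (simp add: field_simps)
qed

lemma L_f_1_8_3_4: "L_function f_1_8_3_4 1 = pi / 8 * (period_re (-1) (-5) + 2 * (\<i> * sqrt 2) * period_re 5 1 + 4 * period_re (-5) (-1) - 8 * (\<i> * sqrt 2) * period_re 1 5)"
proof -
  note K = K2_axis_integral[of "-1" "-5" 8 1 "1/8" "3/4"] K2_axis_integral[of 5 1 8 3 "3/8" "5/4"] K2_axis_integral[of "-5" "-1" 8 5 "5/8" "3/4"] K2_axis_integral[of 1 5 8 7 "7/8" "5/4"]
  have G: "mellin_admissible (K2 (1/8) (3/4))" "mellin_admissible (K2 (3/8) (5/4))" "mellin_admissible (K2 (5/8) (3/4))" "mellin_admissible (K2 (7/8) (5/4))"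
    and P: "axis_integral (K2 (1/8) (3/4)) = of_real (period_re (-1) (-5)) / 16" "axis_integral (K2 (3/8) (5/4)) = of_real (period_re 5 1) / 16" "axis_integral (K2 (5/8) (3/4)) = of_real (period_re (-5) (-1)) / 16" "axis_integral (K2 (7/8) (5/4)) = of_real (period_re 1 5) / 16"
    using K by (simp_all add: denominators cuspidal_def)
  have f: "f_1_8_3_4 = (\<lambda>\<tau>. 1 * K2 (1/8) (3/4) \<tau> + (2 * (\<i> * sqrt 2)) * K2 (3/8) (5/4) \<tau> + 4 * K2 (5/8) (3/4) \<tau> + (- (8 * (\<i> * sqrt 2))) * K2 (7/8) (5/4) \<tau>)"
    by (simp add: f_1_8_3_4_def fun_eq_iff)
  show ?thesis unfolding L_function_four_terms[OF G f] P by (simp add: field_simps)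
qed

lemma L_f_1_12_11_12: "L_function f_1_12_11_12 1 = pi / 12 * (period_re 2 (-4) - 4 * period_re (-6) (-4) - 4 * \<i> * period_re 6 4 + 16 * \<i> * period_re (-2) 4)"
proof -
  note K = K2_axis_integral[of 2 "-4" 12 1 "1/12" "11/12"] K2_axis_integral[of "-6" "-4" 12 5 "5/12" "7/12"] K2_axis_integral[of 6 4 12 7 "7/12" "17/12"] K2_axis_integral[of "-2" 4 12 11 "11/12" "13/12"]
  have G: "mellin_admissible (K2 (1/12) (11/12))" "mellin_admissible (K2 (5/12) (7/12))" "mellin_admissible (K2 (7/12) (17/12))" "mellin_admissible (K2 (11/12) (13/12))"
    and P: "axis_integral (K2 (1/12) (11/12)) = of_real (period_re 2 (-4)) / 24" "axis_integral (K2 (5/12) (7/12)) = of_real (period_re (-6) (-4)) / 24" "axis_integral (K2 (7/12) (17/12)) = of_real (period_re 6 4) / 24" "axis_integral (K2 (11/12) (13/12)) = of_real (period_re (-2) 4) / 24"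
    using K by (simp_all add: denominators cuspidal_def)
  have f: "f_1_12_11_12 = (\<lambda>\<tau>. 1 * K2 (1/12) (11/12) \<tau> + (- 4) * K2 (5/12) (7/12) \<tau> + (- (4 * \<i>)) * K2 (7/12) (17/12) \<tau> + (16 * \<i>) * K2 (11/12) (13/12) \<tau>)"
    by (simp add: f_1_12_11_12_def fun_eq_iff)
  show ?thesis unfolding L_function_four_terms[OF G f] P by (simp add: field_simps)
qed

lemma L_f_1_12_2_3: "L_function f_1_12_2_3 1 = pi / 12 * (period_re (-2) (-6) - 4 * period_re 6 2 + 4 * \<i> * period_re (-6) (-2) - 16 * \<i> * period_re 2 6)"
proof -
  note K = K2_axis_integral[of "-2" "-6" 12 1 "1/12" "2/3"] K2_axis_integral[of 6 2 12 5 "5/12" "4/3"] K2_axis_integral[of "-6" "-2" 12 7 "7/12" "2/3"] K2_axis_integral[of 2 6 12 11 "11/12" "4/3"]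
  have G: "mellin_admissible (K2 (1/12) (2/3))" "mellin_admissible (K2 (5/12) (4/3))" "mellin_admissible (K2 (7/12) (2/3))" "mellin_admissible (K2 (11/12) (4/3))"
    and P: "axis_integral (K2 (1/12) (2/3)) = of_real (period_re (-2) (-6)) / 24" "axis_integral (K2 (5/12) (4/3)) = of_real (period_re 6 2) / 24" "axis_integral (K2 (7/12) (2/3)) = of_real (period_re (-6) (-2)) / 24" "axis_integral (K2 (11/12) (4/3)) = of_real (period_re 2 6) / 24"
    using K by (simp_all add: denominators cuspidal_def)
  have f: "f_1_12_2_3 = (\<lambda>\<tau>. 1 * K2 (1/12) (2/3) \<tau> + (- 4) * K2 (5/12) (4/3) \<tau> + (4 * \<i>) * K2 (7/12) (2/3) \<tau> + (- (16 * \<i>)) * K2 (11/12) (4/3) \<tau>)"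
    by (simp add: f_1_12_2_3_def fun_eq_iff)
  show ?thesis unfolding L_function_four_terms[OF G f] P by (simp add: field_simps)
qed

section \<open>The three quotients of L-values\<close>

text \<open>After elimination both sides are linear in the two remaining periods, and comparing coefficients
  is arithmetic in the field generated by \<open>sqrt 2\<close>, \<open>sqrt 3\<close> and
  \<open>sin_pi8\<close>.\<close>

lemma L_quotient_5_8: "L_function f_1_8_5_8 1 = - (1/2) * root_unity 48 * L_function f_1_8_1 1"
proof -
  define p q where "p = (sqrt 3 * cos_pi8 + sin_pi8) / 2" and "q = (cos_pi8 - sqrt 3 * sin_pi8) / 2"
  have z: "root_unity 48 = Complex p q"
  proof -
    have "root_unity 48 = cis (pi / 6 - pi / 8)"
      by (simp add: root_unity_def cis_conv_exp)
    moreover have "cos_pi8 = cos (pi / 8)" "sin_pi8 = sin (pi / 8)" by (simp_all add: cos_pi8_def sin_pi8_def zeta_re_im)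
    moreover have "cis (pi / 6 - pi / 8) = Complex (cos (pi / 6) * cos (pi / 8) + sin (pi / 6) * sin (pi / 8)) (sin (pi / 6) * cos (pi / 8) - cos (pi / 6) * sin (pi / 8))"
      unfolding cos_diff[symmetric] sin_diff[symmetric] by (simp only: complex_eq_iff cis.sel complex.sel)
    ultimately show ?thesis by (simp add: p_def q_def cos_30 sin_30 field_simps)
  qed
  define b1 b7 where "b1 = period_re 3 (-3)" and "b7 = period_re (-3) 3"
  define r t where "r = sqrt (2::real)" and "t = sqrt (3::real)"
  have sqs: "r * r = 2" "t * t = 3" "r * (r * z) = 2 * z" "t * (t * z) = 3 * z" for z by (simp_all add: r_def t_def mult.assoc[symmetric])
  have C: "cos_pi8 = (1 + r) * sin_pi8" using pi8_values(6) by (simp add: r_def)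
  define X where "X = period_re (-3) (-6) - 2 * sqrt 3 * period_re (-1) (-2) - 4 * (\<i> * sqrt 3) * period_re 1 2 - 8 * \<i> * period_re 3 6"
  define Y where "Y = period_re 3 (-3) - 2 * (\<i> * sqrt 3) * period_re 1 (-1) - 4 * sqrt 3 * period_re (-1) 1 + 8 * \<i> * period_re (-3) 3"
  define b3 b5 where "b3 = (r - 1) * (8 * r * b7 - b1) / 6" and "b5 = (r - 1) * (2 * b7 + r * b1 / 4) / 3"
  have X: "X = Complex (8 * sin_pi8 * b7 - 4 * t * cos_pi8 * b5) (- (2 * t * cos_pi8 * b3 + sin_pi8 * b1))"
    unfolding X_def periods_by_hecke(1-4) unfolding periods_by_hecke by (simp add: complex_eq_iff b1_def b7_def b3_def b5_def r_def t_def)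
  have Y: "Y = Complex (b1 - 4 * t * b5) (8 * b7 - 2 * t * b3)"
    unfolding Y_def periods_by_hecke by (simp add: complex_eq_iff b1_def b7_def b3_def b5_def r_def t_def)
  have t2: "sqrt 3 = t" by (simp add: t_def)
  have re: "8 * sin_pi8 * b7 - 4 * t * cos_pi8 * b5 = - (1/2) * (p * (b1 - 4 * t * b5) - q * (8 * b7 - 2 * t * b3))"
    unfolding p_def q_def C t2 b3_def b5_def by (simp add: field_simps sqs)
  have im: "- (2 * t * cos_pi8 * b3 + sin_pi8 * b1) = - (1/2) * (p * (8 * b7 - 2 * t * b3) + q * (b1 - 4 * t * b5))"
    unfolding p_def q_def C t2 b3_def b5_def by (simp add: field_simps sqs)
  have "X = - (1/2) * root_unity 48 * Y"
    unfolding X Y z using re im by (simp add: complex_eq_iff)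
  then show ?thesis unfolding L_f_1_8_5_8 L_f_1_8_1 X_def[symmetric] Y_def[symmetric] by simp
qed

lemma L_quotient_2_3: "L_function f_1_12_2_3 1 = sqrt 3 * root_unity 8 ^ 7 * L_function f_1_12_11_12 1"
proof -
  define r t where "r = sqrt (2::real)" and "t = sqrt (3::real)"
  have sqs: "r * r = 2" "t * t = 3" "r * (r * z) = 2 * z" "t * (t * z) = 3 * z" for z by (simp_all add: r_def t_def mult.assoc[symmetric])
  have t2: "sqrt 3 = t" "sqrt 2 = r" by (simp_all add: t_def r_def)
  have cs: "zeta_re 2 = r * (t + 1) / 4" "zeta_im 2 = r * (t - 1) / 4"
    unfolding pi12_values by (simp_all add: r_def t_def algebra_simps real_sqrt_mult[symmetric])
  have z: "root_unity 8 ^ 7 = Complex (r / 2) (- (r / 2))"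
  proof -
    have "root_unity 8 ^ 7 = cis (2 * pi - pi / 4)"
      by (simp add: root_unity_def cis_conv_exp exp_of_nat_mult[symmetric]) (rule arg_cong[where f = exp], simp add: field_simps)
    moreover have "cos (2 * pi - pi / 4) = sqrt 2 / 2" "sin (2 * pi - pi / 4) = - (sqrt 2 / 2)"
      unfolding cos_diff sin_diff by (simp_all add: cos_45 sin_45)
    moreover have "cis \<theta> = Complex (cos \<theta>) (sin \<theta>)" for \<theta> by (simp add: complex_eq_iff)
    ultimately show ?thesis by (simp only: r_def)
  qed
  define P1 P3 where "P1 = period_re 2 (-4)" and "P3 = period_re 6 4"
  define Q1 where "Q1 = period_re (-2) (-6)"
  have Q1: "Q1 = r * (t - 1) * (4 * P3 + t * P1 / 2)"
  proof -
    have "r * (t - 1) * (zeta_re 2 * Q1) = (r * r) * (t * t - 1) / 4 * Q1" unfolding cs by (simp add: algebra_simps)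
    also have "\<dots> = Q1" unfolding sqs by simp
    finally have "r * (t - 1) * (zeta_re 2 * Q1) = Q1" .
    moreover have "zeta_re 2 * Q1 = 4 * P3 + t * P1 / 2" using periods_by_landen_12(3) by (simp add: Q1_def P3_def P1_def t_def)
    ultimately show ?thesis by simp
  qed
  define X where "X = period_re (-2) (-6) - 4 * period_re 6 2 + 4 * \<i> * period_re (-6) (-2) - 16 * \<i> * period_re 2 6"
  define Y where "Y = period_re 2 (-4) - 4 * period_re (-6) (-4) - 4 * \<i> * period_re 6 4 + 16 * \<i> * period_re (-2) 4"
  have X: "X = Complex (Q1 - 8 * zeta_re 2 * P3) (8 * zeta_re 2 * (P1 / 2 + t * P3) - 2 * zeta_im 2 * P1)"
    unfolding X_def periods_by_landen_12(4-6) unfolding periods_by_landen_12(1) by (simp add: complex_eq_iff P1_def P3_def Q1_def t_def)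
  have Y: "Y = Complex (- P1 - 4 * t * P3) (t * P1 + 4 * P3)"
    unfolding Y_def periods_by_landen_12(1,2) by (simp add: complex_eq_iff P1_def P3_def t_def)
  have re: "Q1 - 8 * zeta_re 2 * P3 = t * (r / 2 * (- P1 - 4 * t * P3) + r / 2 * (t * P1 + 4 * P3))"
    unfolding Q1 cs by (simp add: field_simps sqs)
  have im: "8 * zeta_re 2 * (P1 / 2 + t * P3) - 2 * zeta_im 2 * P1 = t * (r / 2 * (t * P1 + 4 * P3) - r / 2 * (- P1 - 4 * t * P3))"
    unfolding cs by (simp add: field_simps sqs)
  have "X = sqrt 3 * root_unity 8 ^ 7 * Y"
    unfolding X Y z t2 using re im by (simp add: complex_eq_iff algebra_simps)
  then show ?thesis unfolding L_f_1_12_2_3 L_f_1_12_11_12 X_def[symmetric] Y_def[symmetric] by simp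
qed

text \<open>Here the quotient is \<open>1 / cos_pi8 - 2 * \<i> * sin_pi8\<close>, whose square is the
  radicand and whose real part is positive.\<close>

lemma L_quotient_3_4: "L_function f_1_8_3_4 1 = csqrt (2 - sqrt 2 - 4 * \<i> * sqrt (3 - 2 * sqrt 2)) * L_function f_1_8_7_8 1"
proof -
  define r where "r = sqrt (2::real)"
  have rr: "r * r = 2" "r * (r * z) = 2 * z" for z by (simp_all add: r_def mult.assoc[symmetric])
  have sq: "sqrt 2 * (sqrt 2 * z) = 2 * z" for z :: real by (simp add: mult.assoc[symmetric])
  have C: "cos_pi8 = (1 + r) * sin_pi8" using pi8_values(6) by (simp add: r_def)
  have S2: "4 * sin_pi8 * sin_pi8 = 2 - r" using pi8_values(4) by (simp add: r_def power2_eq_square)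
  have S0: "sin_pi8 > 0" by (rule pi8_values)
  \<comment> \<open>\<open>D\<close> is the inverse of \<open>cos_pi8\<close>; the principal root turns out to be \<open>1 / cos_pi8 - 2 * \<i> * sin_pi8\<close>\<close>
  define D where "D = 2 * (2 - r) * cos_pi8"
  have "D * cos_pi8 = 2 * (2 - r) * cos_pi8^2" by (simp add: D_def power2_eq_square)
  then have DC: "D * cos_pi8 = 1" unfolding pi8_values(3) r_def by (simp add: algebra_simps)
  have w: "csqrt (2 - sqrt 2 - 4 * \<i> * sqrt (3 - 2 * sqrt 2)) = Complex D (- (2 * sin_pi8))"
  proof (rule csqrt_unique)
    have "sqrt (3 - 2 * sqrt 2) = r - 1"
      by (rule real_sqrt_unique) (auto simp: r_def power2_eq_square algebra_simps)
    moreover have "D * D - 4 * sin_pi8 * sin_pi8 = 2 - r"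
    proof -
      have "D * D = 2 * (2 - r) * (D * cos_pi8)" by (simp add: D_def)
      then show ?thesis unfolding DC S2 by simp
    qed
    moreover have "D * sin_pi8 = r - 1"
    proof -
      have "D * sin_pi8 = 2 * (2 - r) * (sin_pi8 * cos_pi8)" by (simp add: D_def)
      then show ?thesis unfolding pi8_values(5) r_def by (simp add: algebra_simps)
    qed
    ultimately show "(Complex D (- (2 * sin_pi8)))^2 = 2 - sqrt 2 - 4 * \<i> * sqrt (3 - 2 * sqrt 2)"
      by (simp add: complex_eq_iff power2_eq_square r_def)
    have "D > 0" using pi8_values(1) unfolding D_def r_def by (simp add: real_less_lsqrt)
    then show "0 < Re (Complex D (- (2 * sin_pi8))) \<or> Re (Complex D (- (2 * sin_pi8))) = 0 \<and> 0 \<le> Im (Complex D (- (2 * sin_pi8)))" by simp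
  qed
  define P1 P3 where "P1 = period_re 1 (-4)" and "P3 = period_re 5 4"
  define X where "X = period_re (-1) (-5) + 2 * (\<i> * sqrt 2) * period_re 5 1 + 4 * period_re (-5) (-1) - 8 * (\<i> * sqrt 2) * period_re 1 5"
  define Y where "Y = period_re 1 (-4) + 2 * sqrt 2 * period_re (-5) (-4) + 4 * \<i> * period_re 5 4 + 8 * (\<i> * sqrt 2) * period_re (-1) 4"
  have Q1: "period_re (-1) (-5) = D * (4 * P3 + r * P1 / 2)"
  proof -
    have "D * (cos_pi8 * period_re (-1) (-5)) = (D * cos_pi8) * period_re (-1) (-5)" by (simp only: mult.assoc)
    then show ?thesis unfolding DC periods_by_landen_8(3) by (simp add: P1_def P3_def r_def)
  qed
  have X: "X = Complex (D * (4 * P3 + r * P1 / 2) + 4 * (r * cos_pi8 * (P1 / 2 + r * P3))) (8 * cos_pi8 * P3 - 2 * sin_pi8 * P1)"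
    unfolding X_def Q1 periods_by_landen_8(4-6) unfolding periods_by_landen_8(1) by (simp add: complex_eq_iff P1_def P3_def r_def algebra_simps sq)
  have Y: "Y = Complex ((1 + r) * P1 + 4 * P3) (P1 + 4 * (1 + r) * P3)"
    unfolding Y_def periods_by_landen_8(1,2) by (simp add: complex_eq_iff P1_def P3_def r_def algebra_simps)
  have re: "D * (4 * P3 + r * P1 / 2) + 4 * (r * cos_pi8 * (P1 / 2 + r * P3)) = D * ((1 + r) * P1 + 4 * P3) + 2 * sin_pi8 * (P1 + 4 * (1 + r) * P3)"
    unfolding D_def C by (simp add: field_simps rr)
  have im: "8 * cos_pi8 * P3 - 2 * sin_pi8 * P1 = D * (P1 + 4 * (1 + r) * P3) - 2 * sin_pi8 * ((1 + r) * P1 + 4 * P3)"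
    unfolding D_def C by (simp add: field_simps rr)
  have "X = csqrt (2 - sqrt 2 - 4 * \<i> * sqrt (3 - 2 * sqrt 2)) * Y"
    unfolding w X Y using re im by (simp add: complex_eq_iff)
  then show ?thesis unfolding L_f_1_8_3_4 L_f_1_8_7_8 X_def[symmetric] Y_def[symmetric] by simp
qed

theorem theorem1p5:
  shows "L_function f_1_8_5_8 1 = - (1/2) * root_unity 48 * L_function f_1_8_1 1 \<and>
         L_function f_1_12_2_3 1 = sqrt 3 * root_unity 8 ^ 7 * L_function f_1_12_11_12 1 \<and>
         L_function f_1_8_3_4 1 =
           csqrt (2 - sqrt 2 - 4 * \<i> * sqrt (3 - 2 * sqrt 2)) * L_function f_1_8_7_8 1"
  using L_quotient_5_8 L_quotient_2_3 L_quotient_3_4 by blast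

end
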